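(* Let $W$ be a complex reflection group of type $G(de,e,r)$, $\rho$ a representation of $W$, and $\tau_{c,j}\in\mathbb{R}$ for all $c\in\mathcal{A}/W$ and $0\le j\le e_c-1$. Then the monodromy representation $R$ of the braid group $B$ of $W$ associated to $\rho$ and to the parameters $\tau_{c,j}$ is unitarizable for $h\in\mathrm{i}\mathbb{R}$ small enough.
   Context: $G(de,e,r)<\mathrm{GL}_r(\mathbb{C})$ is the group of monomial matrices whose nonzero entries are $de$-th roots of unity and have product a $d$-th root of unity. For a finite (pseudo-)reflection group $W<\mathrm{GL}(V)$, $\mathcal{A}$ is the set of reflecting hyperplanes, $X=V\setminus\bigcup\mathcal{A}$ and $B=\pi_1(X/W)$. For $H\in\mathcal{A}$ in the orbit $c\in\mathcal{A}/W$, $e_c$ is the order of the cyclic pointwise stabilizer of $H$ in $W$, $\zeta_c=\exp(2\mathrm{i}\pi/e_c)$ and $s_H$ is the generator of this stabilizer with $\det s_H=\zeta_c$. Given a finite-dimensional complex representation $\rho:W\to\mathrm{GL}(V_\rho)$ and parameters $\tau_{c,j}$, one sets for $H\in c$ $$\varphi(t_H)=\sum_{j=0}^{e_c-1}\tau_{c,j}\frac1{e_c}\sum_{k=0}^{e_c-1}\zeta_c^{-jk}\rho(s_H)^k\in\mathrm{End}(V_\rho).$$ For $h\in\mathbb{C}$, the integrable $W$-equivariant $1$-form $\omega=h\sum_{H\in\mathcal{A}}\varphi(t_H)\omega_H$ on $X$, $\omega_H=\frac{1}{2\mathrm{i}\pi}\,\mathrm{d}\alpha_H/\alpha_H$ ($\alpha_H\in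 V^*$ with kernel $H$), defines by monodromy a representation $R$ of $B$ on $V_\rho$, in which a braided reflection (meridian) $\sigma$ associated to $s_H$ satisfies $\prod_{j=0}^{e_c-1}(\sigma-q_{c,j}\zeta_c^j)=0$ with $q_{c,j}=\exp(-h\tau_{c,j}/e_c)$ (up to the sign convention for $h$). A representation is unitarizable if it preserves some positive definite hermitian form. *)

theory Defs
  imports "HOL-Analysis.Analysis" "HOL-Algebra.Generated_Groups"
begin

section \<open>Linear groups and representations\<close>

definition GL :: "('a::field ^ 'n ^ 'n) monoid" where
  "GL = \<lparr>carrier = {A. invertible A}, monoid.mult = (**), one = mat 1\<rparr>"

lemma group_GL: "group (GL :: ('a::field ^ 'n ^ 'n) monoid)"
proof (rule groupI)
  fix A :: "'a ^ 'n ^ 'n"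
  assume "A \<in> carrier GL"
  then obtain B where "A ** B = mat 1" "B ** A = mat 1"
    by (auto simp: GL_def invertible_def)
  then show "\<exists>B\<in>carrier GL. B \<otimes>\<^bsub>GL\<^esub> A = \<one>\<^bsub>GL\<^esub>"
    by (auto simp: GL_def invertible_def)
next
  fix A B :: "'a ^ 'n ^ 'n"
  assume "A \<in> carrier GL" "B \<in> carrier GL"
  then show "A \<otimes>\<^bsub>GL\<^esub> B \<in> carrier GL"
    by (auto simp: GL_def intro: invertible_mult)
next
  show "(\<one>\<^bsub>GL\<^esub> :: 'a ^ 'n ^ 'n) \<in> carrier GL"
    by (auto simp: GL_def invertible_def intro!: exI[of _ "mat 1"])
qed (auto simp: GL_def matrix_mul_assoc)

abbreviation linear_group :: "('a::field ^ 'n ^ 'n) set \<Rightarrow> ('a ^ 'n ^ 'n) monoid" where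
  "linear_group W \<equiv> GL\<lparr>carrier := W\<rparr>"

definition is_representation :: "('g, 'b) monoid_scheme \<Rightarrow> ('g \<Rightarrow> complex ^ 'm ^ 'm) \<Rightarrow> bool" where
  "is_representation G \<rho> \<longleftrightarrow> \<rho> \<in> hom G GL"

definition hermitian_form :: "(complex ^ 'm \<Rightarrow> complex ^ 'm \<Rightarrow> complex) \<Rightarrow> bool" where
  "hermitian_form f \<longleftrightarrow>
     (\<forall>u v w. f (u + v) w = f u w + f v w) \<and>
     (\<forall>a u v. f (a *s u) v = a * f u v) \<and>
     (\<forall>u v. f v u = cnj (f u v))"

text \<open>The values \<open>f v v\<close> of a hermitian form are real.\<close>

definition positive_definite :: "(complex ^ 'm \<Rightarrow> complex ^ 'm \<Rightarrow> complex) \<Rightarrow> bool" where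
  "positive_definite f \<longleftrightarrow> (\<forall>v. v \<noteq> 0 \<longrightarrow> Re (f v v) > 0)"

definition unitarizable :: "('g, 'b) monoid_scheme \<Rightarrow> ('g \<Rightarrow> complex ^ 'm ^ 'm) \<Rightarrow> bool" where
  "unitarizable G \<rho> \<longleftrightarrow> is_representation G \<rho> \<and>
     (\<exists>f. hermitian_form f \<and> positive_definite f \<and>
        (\<forall>g\<in>carrier G. \<forall>u v. f (\<rho> g *v u) (\<rho> g *v v) = f u v))"


section \<open>Reflection groups\<close>

text \<open>The row \<open>i\<close> of a monomial matrix has its nonzero entry \<open>z i\<close> in column \<open>p i\<close>.
  The rank \<open>r\<close> is the cardinality of the index type.\<close>

definition G_group :: "nat \<Rightarrow> nat \<Rightarrow> (complex ^ 'n ^ 'n) set" where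
  "G_group d e = {\<chi> i j. if j = p i then z i else 0 | p z.
     bij p \<and> (\<forall>i. z i ^ (d * e) = 1) \<and> (\<Prod>i\<in>UNIV. z i) ^ d = 1}"

definition fixed_space :: "complex ^ 'n ^ 'n \<Rightarrow> (complex ^ 'n) set" where
  "fixed_space w = {v. w *v v = v}"

definition reflection :: "complex ^ 'n ^ 'n \<Rightarrow> bool" where
  "reflection w \<longleftrightarrow> invertible w \<and> vec.dim (fixed_space w) + 1 = CARD('n)"

definition hyperplanes :: "(complex ^ 'n ^ 'n) set \<Rightarrow> (complex ^ 'n) set set" where
  "hyperplanes W = fixed_space ` {w \<in> W. reflection w}"

definition hyperplane_orbit ::
  "(complex ^ 'n ^ 'n) set \<Rightarrow> (complex ^ 'n) set \<Rightarrow> (complex ^ 'n) set set" where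
  "hyperplane_orbit W H = (\<lambda>w. (*v) w ` H) ` W"

definition pointwise_stabilizer ::
  "(complex ^ 'n ^ 'n) set \<Rightarrow> (complex ^ 'n) set \<Rightarrow> (complex ^ 'n ^ 'n) set" where
  "pointwise_stabilizer W H = {w \<in> W. \<forall>v\<in>H. w *v v = v}"

definition stab_order :: "(complex ^ 'n ^ 'n) set \<Rightarrow> (complex ^ 'n) set \<Rightarrow> nat" where
  "stab_order W H = card (pointwise_stabilizer W H)"

definition zeta :: "nat \<Rightarrow> complex" where
  "zeta n = exp (2 * \<i> * of_real pi / of_nat n)"

definition distinguished_reflection ::
  "(complex ^ 'n ^ 'n) set \<Rightarrow> (complex ^ 'n) set \<Rightarrow> complex ^ 'n ^ 'n" where
  "distinguished_reflection W H =
     (THE s. s \<in> pointwise_stabilizer W H \<and> generate GL {s} = pointwise_stabilizer W H \<and>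
        det s = zeta (stab_order W H))"

definition regular_points :: "(complex ^ 'n ^ 'n) set \<Rightarrow> (complex ^ 'n) set" where
  "regular_points W = UNIV - \<Union>(hyperplanes W)"


section \<open>The braid group\<close>

definition point_orbit :: "(complex ^ 'n ^ 'n) set \<Rightarrow> complex ^ 'n \<Rightarrow> (complex ^ 'n) set" where
  "point_orbit W x = (\<lambda>w. w *v x) ` W"

definition orbit_space :: "(complex ^ 'n ^ 'n) set \<Rightarrow> (complex ^ 'n) set topology" where
  "orbit_space W = topology (\<lambda>U. U \<subseteq> point_orbit W ` regular_points W \<and>
     openin (top_of_set (regular_points W)) {x \<in> regular_points W. point_orbit W x \<in> U})"

lemma openin_orbit_space:
  "openin (orbit_space W) U \<longleftrightarrow> U \<subseteq> point_orbit W ` regular_points W \<and>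
     openin (top_of_set (regular_points W)) {x \<in> regular_points W. point_orbit W x \<in> U}"
proof -
  let ?X = "regular_points W" and ?p = "point_orbit W"
  let ?L = "\<lambda>U. U \<subseteq> ?p ` ?X \<and> openin (top_of_set ?X) {x \<in> ?X. ?p x \<in> U}"
  have "?L (S \<inter> T)" if "?L S" "?L T" for S T
  proof -
    have "{x \<in> ?X. ?p x \<in> S \<inter> T} = {x \<in> ?X. ?p x \<in> S} \<inter> {x \<in> ?X. ?p x \<in> T}" by auto
    with that show ?thesis by (auto intro: openin_Int)
  qed
  moreover have "?L (\<Union>K)" if "\<forall>S\<in>K. ?L S" for K
  proof -
    have "{x \<in> ?X. ?p x \<in> \<Union>K} = \<Union>((\<lambda>S. {x \<in> ?X. ?p x \<in> S}) ` K)" by auto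
    with that show ?thesis by (auto intro!: openin_Union)
  qed
  ultimately have "istopology ?L"
    unfolding istopology_def by blast
  then show ?thesis
    unfolding orbit_space_def by (simp add: topology_inverse')
qed

lemma quotient_map_orbit_space:
  "quotient_map (top_of_set (regular_points W)) (orbit_space W) (point_orbit W)"
proof -
  have "openin (orbit_space W) (point_orbit W ` regular_points W)"
  proof -
    have "{x \<in> regular_points W. point_orbit W x \<in> point_orbit W ` regular_points W} =
        regular_points W" by auto
    then show ?thesis
      unfolding openin_orbit_space by (metis openin_subtopology_self subset_refl)
  qed
  then have "topspace (orbit_space W) = point_orbit W ` regular_points W"
    by (metis openin_orbit_space openin_subset openin_topspace subset_antisym)
  then show ?thesis
    by (auto simp: quotient_map_def openin_orbit_space)
qed

definition loops :: "'a topology \<Rightarrow> 'a \<Rightarrow> (real \<Rightarrow> 'a) set" where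
  "loops T b = {p. pathin T p \<and> p 0 = b \<and> p 1 = b}"

definition loop_homotopic ::
  "'a topology \<Rightarrow> 'a \<Rightarrow> (real \<Rightarrow> 'a) \<Rightarrow> (real \<Rightarrow> 'a) \<Rightarrow> bool" where
  "loop_homotopic T b = homotopic_with (\<lambda>p. p 0 = b \<and> p 1 = b) (top_of_set {0..1}) T"

text \<open>The library's \<open>(+++)\<close>, which requires a topological space type.\<close>

definition loop_concat :: "(real \<Rightarrow> 'a) \<Rightarrow> (real \<Rightarrow> 'a) \<Rightarrow> real \<Rightarrow> 'a" where
  "loop_concat p q = (\<lambda>t. if t \<le> 1/2 then p (2 * t) else q (2 * t - 1))"

definition fundamental_group :: "'a topology \<Rightarrow> 'a \<Rightarrow> (real \<Rightarrow> 'a) set monoid" where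
  "fundamental_group T b =
     \<lparr>carrier = loops T b // {(p, q). loop_homotopic T b p q},
      monoid.mult = (\<lambda>A B. {r. \<exists>p\<in>A. \<exists>q\<in>B. loop_homotopic T b (loop_concat p q) r}),
      one = {r. loop_homotopic T b (\<lambda>_. b) r}\<rparr>"

definition braid_group ::
  "(complex ^ 'n ^ 'n) set \<Rightarrow> complex ^ 'n \<Rightarrow> (real \<Rightarrow> (complex ^ 'n) set) set monoid" where
  "braid_group W x0 = fundamental_group (orbit_space W) (point_orbit W x0)"


section \<open>The one-form and its monodromy\<close>

text \<open>Complex scalars act on matrices through scalar matrices, \<open>mat c ** A\<close>.\<close>

definition phi_t ::
  "(complex ^ 'n ^ 'n) set \<Rightarrow> (complex ^ 'n ^ 'n \<Rightarrow> complex ^ 'm ^ 'm) \<Rightarrow>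
   ((complex ^ 'n) set set \<Rightarrow> nat \<Rightarrow> complex) \<Rightarrow> (complex ^ 'n) set \<Rightarrow> complex ^ 'm ^ 'm" where
  "phi_t W \<rho> \<tau> H =
     (let c = hyperplane_orbit W H; n = stab_order W H; s = distinguished_reflection W H
      in \<Sum>j<n. mat (\<tau> c j * (1 / of_nat n)) **
           (\<Sum>k<n. mat (inverse (zeta n) ^ (j * k)) ** (\<rho> s [^]\<^bsub>GL\<^esub> k)))"

definition hyperplane_form :: "(complex ^ 'n) set \<Rightarrow> complex ^ 'n \<Rightarrow> complex" where
  "hyperplane_form H = (SOME \<alpha>. Vector_Spaces.linear (*s) (*) \<alpha> \<and> {v. \<alpha> v = 0} = H)"

text \<open>A one-form takes a point and a tangent vector; \<open>d\<alpha>\<close> is \<open>\<alpha>\<close> at every point.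
  The following does not depend on the choice of \<open>\<alpha>\<close>, which is unique up to a nonzero scalar.\<close>

definition log_form :: "(complex ^ 'n) set \<Rightarrow> complex ^ 'n \<Rightarrow> complex ^ 'n \<Rightarrow> complex" where
  "log_form H x v = 1 / (2 * \<i> * of_real pi) * (hyperplane_form H v / hyperplane_form H x)"

definition omega ::
  "(complex ^ 'n ^ 'n) set \<Rightarrow> (complex ^ 'n ^ 'n \<Rightarrow> complex ^ 'm ^ 'm) \<Rightarrow>
   ((complex ^ 'n) set set \<Rightarrow> nat \<Rightarrow> complex) \<Rightarrow> complex \<Rightarrow>
   complex ^ 'n \<Rightarrow> complex ^ 'n \<Rightarrow> complex ^ 'm ^ 'm" where
  "omega W \<rho> \<tau> h x v =
     mat h ** (\<Sum>H\<in>hyperplanes W. mat (log_form H x v) ** phi_t W \<rho> \<tau> H)"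

text \<open>\<open>S\<close> is a solution of \<open>dS = \<omega> S\<close> on the open set \<open>U\<close> of regular points.\<close>

definition flat_on ::
  "(complex ^ 'n ^ 'n) set \<Rightarrow> (complex ^ 'n ^ 'n \<Rightarrow> complex ^ 'm ^ 'm) \<Rightarrow>
   ((complex ^ 'n) set set \<Rightarrow> nat \<Rightarrow> complex) \<Rightarrow> complex \<Rightarrow>
   (complex ^ 'n) set \<Rightarrow> (complex ^ 'n \<Rightarrow> complex ^ 'm ^ 'm) \<Rightarrow> bool" where
  "flat_on W \<rho> \<tau> h U S \<longleftrightarrow> open U \<and> U \<subseteq> regular_points W \<and>
     (\<forall>y\<in>U. (S has_derivative (\<lambda>v. omega W \<rho> \<tau> h y v ** S y)) (at y))"

text \<open>\<open>F t\<close> is the value at \<open>g t\<close> of a solution continued analytically along the path \<open>g\<close>.\<close>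

definition flat_along ::
  "(complex ^ 'n ^ 'n) set \<Rightarrow> (complex ^ 'n ^ 'n \<Rightarrow> complex ^ 'm ^ 'm) \<Rightarrow>
   ((complex ^ 'n) set set \<Rightarrow> nat \<Rightarrow> complex) \<Rightarrow> complex \<Rightarrow>
   (real \<Rightarrow> complex ^ 'n) \<Rightarrow> (real \<Rightarrow> complex ^ 'm ^ 'm) \<Rightarrow> bool" where
  "flat_along W \<rho> \<tau> h g F \<longleftrightarrow>
     (\<forall>t\<in>{0..1}. \<exists>U S. flat_on W \<rho> \<tau> h U S \<and>
        (\<exists>\<delta>>0. \<forall>s\<in>{0..1}. \<bar>s - t\<bar> < \<delta> \<longrightarrow> g s \<in> U \<and> F s = S (g s)))"

definition transport ::
  "(complex ^ 'n ^ 'n) set \<Rightarrow> (complex ^ 'n ^ 'n \<Rightarrow> complex ^ 'm ^ 'm) \<Rightarrow>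
   ((complex ^ 'n) set set \<Rightarrow> nat \<Rightarrow> complex) \<Rightarrow> complex \<Rightarrow>
   (real \<Rightarrow> complex ^ 'n) \<Rightarrow> complex ^ 'm ^ 'm" where
  "transport W \<rho> \<tau> h g = (THE M. \<exists>F. flat_along W \<rho> \<tau> h g F \<and> F 0 = mat 1 \<and> F 1 = M)"

definition lifts_to ::
  "(complex ^ 'n ^ 'n) set \<Rightarrow> complex ^ 'n \<Rightarrow> (real \<Rightarrow> (complex ^ 'n) set) \<Rightarrow>
   (real \<Rightarrow> complex ^ 'n) \<Rightarrow> complex ^ 'n ^ 'n \<Rightarrow> bool" where
  "lifts_to W x0 \<gamma> g w \<longleftrightarrow> path g \<and> path_image g \<subseteq> regular_points W \<and> pathstart g = x0 \<and>
     (\<forall>t\<in>{0..1}. point_orbit W (g t) = \<gamma> t) \<and> w \<in> W \<and> pathfinish g = w *v x0"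

text \<open>The flat bundle on the orbit space is the quotient of the trivial one by
  \<open>(x, v) \<sim> (w x, \<rho>(w) v)\<close>. For a loop whose lift \<open>g\<close> runs from \<open>x0\<close> to \<open>w x0\<close>, parallel
  transport in the fibre at \<open>x0\<close> is \<open>\<rho>(w)\<^sup>-\<^sup>1 P\<close> with \<open>P\<close> the transport along \<open>g\<close>. Since
  \<open>loop_concat p q\<close> runs through \<open>p\<close> first, this is an anti-homomorphism, and the monodromy
  representation is its inverse \<open>P\<^sup>-\<^sup>1 \<rho>(w)\<close>. For a meridian around \<open>H\<close> lifting to a path
  from \<open>x0\<close> to \<open>s_H x0\<close> close to \<open>H\<close>, it is conjugate to
  \<open>exp (- h \<phi>(t_H) / e_c) \<rho>(s_H)\<close>, with eigenvalues among the \<open>exp (- h \<tau>_cj / e_c) \<zeta>_c^j\<close>.\<close>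

definition monodromy ::
  "(complex ^ 'n ^ 'n) set \<Rightarrow> (complex ^ 'n ^ 'n \<Rightarrow> complex ^ 'm ^ 'm) \<Rightarrow>
   ((complex ^ 'n) set set \<Rightarrow> nat \<Rightarrow> complex) \<Rightarrow> complex \<Rightarrow> complex ^ 'n \<Rightarrow>
   (real \<Rightarrow> (complex ^ 'n) set) set \<Rightarrow> complex ^ 'm ^ 'm" where
  "monodromy W \<rho> \<tau> h x0 b =
     (THE M. \<exists>\<gamma>\<in>b. \<exists>g w. lifts_to W x0 \<gamma> g w \<and>
        M = matrix_inv (transport W \<rho> \<tau> h g) ** \<rho> w)"

end

theory Submission
  imports Defs
begin

text \<open>For imaginary \<open>h\<close> and real \<open>\<tau>\<close> the braided reflections have eigenvalues of modulus one, and at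
  \<open>h = 0\<close> the monodromy is the representation \<open>\<rho>\<close> of the finite group \<open>W\<close>, which preserves a
  positive definite form. It suffices that this form is a limit of forms invariant under the
  monodromy as \<open>h \<rightarrow> 0\<close>. The invariance equations \<open>D(h) M = 0\<close> are finitely many, since the braid
  group is finitely generated, and the kernel of \<open>D(0)\<close> persists if every limit of values
  \<open>D(h\<^sub>n) M\<^sub>n\<close> lies in the range of \<open>D(0)\<close>. Such a limit is a cocycle of the braid group in the
  space of forms. Near a hyperplane of order \<open>e\<close> the monodromy of the meridian is conjugate, by a matrix
  close to the identity, to \<open>exp (- h \<phi> / e) \<rho>(s)\<close>, which is unitary on each eigenspace of
  \<open>\<rho>(s)\<close>; hence the cocycle vanishes on the \<open>e\<close>-th power of the meridian, that is, on small circles around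
  the hyperplanes. These generate the pure braid group normally: a cocycle on it that vanishes on
  small circles is trivial, as one sees by contracting loops linearly to a generic point and
  cutting the cone into cells. The cocycle therefore factors through \<open>W\<close>, and averaging over
  \<open>W\<close> makes it a coboundary.\<close>

section \<open>Complex matrices\<close>

text \<open>Kernels can jump: the space of forms invariant at h = 0 may be larger than at every
  nearby h. The obstruction to following a form is not a derivative in h. It is a limit of defects
  \<open>act (\<gamma> (hk k)) (xk k) - xk k\<close> in which the matrices \<open>xk k\<close> may
  be unbounded, being minimisers divided by the least size of the defect. Local facts must therefore
  hold exactly at each small h, not only to first order: the meridian is conjugated to its model by
  a matrix tending to 1, after which unimodular eigenvalues make the defect vanish identically on
  each eigenspace. Parameters at which unitarizability fails are collected in a sequence tending to
  0, so only sequences have to be treated. Transports are handled as functions of h along one fixed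
  path, so that a statement about a path serves all h at once. The group enters through finiteness,
  invariance of the standard norm and freeness on regular points. The matrices of forms need not be
  hermitian along the way; symmetry is restored at the end by adding the adjoint.\<close>

definition mcnj :: "complex ^ 'n ^ 'm \<Rightarrow> complex ^ 'n ^ 'm" where
  "mcnj A = (\<chi> i j. cnj (A $ i $ j))"

lemma mcnj_nth [simp]: "mcnj A $ i $ j = cnj (A $ i $ j)"
  by (simp add: mcnj_def)

lemma mcnj_mult: "mcnj (A ** B) = mcnj A ** mcnj B"
  by (simp add: vec_eq_iff matrix_matrix_mult_def)

lemma mat_mult_nth [simp]: "(mat c ** A) $ i $ j = c * A $ i $ j"
proof -
  have "(mat c ** A) $ i $ j = (\<Sum>k\<in>UNIV. (if i = k then c else 0) * A $ k $ j)"
    by (simp add: matrix_matrix_mult_def mat_def)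
  also have "\<dots> = (\<Sum>k\<in>UNIV. if i = k then c * A $ k $ j else 0)"
    by (intro sum.cong) auto
  finally show ?thesis by simp
qed

lemma mult_mat_nth [simp]: "((A :: 'a::comm_semiring_1 ^ 'n ^ 'm) ** mat c) $ i $ j = c * A $ i $ j"
proof -
  have "(A ** mat c) $ i $ j = (\<Sum>k\<in>UNIV. A $ i $ k * (if k = j then c else 0))"
    by (simp add: matrix_matrix_mult_def mat_def)
  also have "\<dots> = (\<Sum>k\<in>UNIV. if k = j then c * A $ i $ k else 0)"
    by (intro sum.cong) (auto simp: mult.commute)
  finally show ?thesis by simp
qed

lemma mat_commute: "(A :: 'a::comm_semiring_1 ^ 'n ^ 'n) ** mat c = mat c ** A"
  by (simp add: vec_eq_iff)

lemma mat_left_commute: "(A :: 'a::comm_semiring_1 ^ 'n ^ 'n) ** (mat c ** B) = mat c ** (A ** B)"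
  by (simp add: matrix_mul_assoc mat_commute)

lemma mat_mat_mult: "mat a ** (mat b ** A) = mat (a * b) ** (A :: 'a::comm_semiring_1 ^ 'n ^ 'm)"
  by (simp add: vec_eq_iff mult.assoc)

lemma mat_add_mult: "mat (a + b) ** A = mat a ** A + mat b ** (A :: 'a::comm_semiring_1 ^ 'n ^ 'm)"
  by (simp add: vec_eq_iff distrib_right)

lemma matrix_add_rdistrib: "(A + B) ** C = A ** C + B ** (C :: 'a::comm_semiring_1 ^ 'n ^ 'm)"
  by (simp add: vec_eq_iff matrix_matrix_mult_def sum.distrib distrib_right)

lemma matrix_mult_sum_left: "(\<Sum>i\<in>I. f i) ** (A :: 'a::comm_semiring_1 ^ 'n ^ 'm) = (\<Sum>i\<in>I. f i ** A)"
  by (induction I rule: infinite_finite_induct) (auto simp: matrix_add_rdistrib)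

lemma matrix_mult_sum_right: "(A :: 'a::comm_semiring_1 ^ 'n ^ 'm) ** (\<Sum>i\<in>I. f i) = (\<Sum>i\<in>I. A ** f i)"
  by (induction I rule: infinite_finite_induct) (auto simp: matrix_add_ldistrib)

lemma matrix_mult_minus_left: "(- A) ** (B :: 'a::comm_ring_1 ^ 'n ^ 'm) = - (A ** B)"
  by (simp add: vec_eq_iff matrix_matrix_mult_def sum_negf)

lemma matrix_mult_minus_right: "A ** (- B) = - (A ** (B :: 'a::comm_ring_1 ^ 'n ^ 'm))"
  by (simp add: vec_eq_iff matrix_matrix_mult_def sum_negf)

lemma matrix_mult_diff_left: "(A - B) ** C = A ** C - B ** (C :: 'a::comm_ring_1 ^ 'n ^ 'm)"
  by (simp add: vec_eq_iff matrix_matrix_mult_def sum_subtractf left_diff_distrib)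

lemma matrix_mult_diff_right: "A ** (B - C) = A ** B - A ** (C :: 'a::comm_ring_1 ^ 'n ^ 'm)"
  by (simp add: vec_eq_iff matrix_matrix_mult_def sum_subtractf right_diff_distrib)

lemma matrix_mult_scaleR_left: "(r *\<^sub>R A) ** B = r *\<^sub>R (A ** (B :: complex ^ 'n ^ 'm))"
  by (simp add: vec_eq_iff matrix_matrix_mult_def scaleR_sum_right)

lemma matrix_mult_scaleR_right: "A ** (r *\<^sub>R B) = r *\<^sub>R (A ** (B :: complex ^ 'n ^ 'm))"
  by (simp add: vec_eq_iff matrix_matrix_mult_def scaleR_sum_right)

lemma norm_matrix_square: "(norm (A :: complex ^ 'n ^ 'm))\<^sup>2 = (\<Sum>i\<in>UNIV. \<Sum>j\<in>UNIV. (cmod (A $ i $ j))\<^sup>2)"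
  by (simp add: norm_vec_def L2_set_def sum_nonneg)

text \<open>The norm of the nested vector type is the Frobenius norm, and Cauchy-Schwarz for each
  entry makes it submultiplicative. The identity does not have norm 1, hence the factors
  \<open>norm (mat 1)\<close> in later bounds.\<close>

lemma norm_matrix_mult_le: "norm (A ** B) \<le> norm A * norm (B :: complex ^ 'n ^ 'm)"
proof -
  have row: "(cmod ((A ** B) $ i $ j))\<^sup>2 \<le> (\<Sum>k\<in>UNIV. (cmod (A $ i $ k))\<^sup>2) * (\<Sum>k\<in>UNIV. (cmod (B $ k $ j))\<^sup>2)" for i j
  proof -
    have "cmod ((A ** B) $ i $ j) \<le> (\<Sum>k\<in>UNIV. cmod (A $ i $ k) * cmod (B $ k $ j))"
      by (simp add: matrix_matrix_mult_def) (metis (mono_tags, lifting) norm_mult norm_sum sum.cong)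
    also have "\<dots> \<le> L2_set (\<lambda>k. cmod (A $ i $ k)) UNIV * L2_set (\<lambda>k. cmod (B $ k $ j)) UNIV"
      using L2_set_mult_ineq[of "\<lambda>k. cmod (A $ i $ k)" "\<lambda>k. cmod (B $ k $ j)" UNIV] by simp
    finally have "(cmod ((A ** B) $ i $ j))\<^sup>2 \<le>
        (L2_set (\<lambda>k. cmod (A $ i $ k)) UNIV * L2_set (\<lambda>k. cmod (B $ k $ j)) UNIV)\<^sup>2"
      by (rule power_mono) simp
    then show ?thesis by (simp add: power_mult_distrib L2_set_def sum_nonneg)
  qed
  have "(norm (A ** B))\<^sup>2 \<le> (\<Sum>i\<in>UNIV. \<Sum>j\<in>UNIV. (\<Sum>k\<in>UNIV. (cmod (A $ i $ k))\<^sup>2) * (\<Sum>k\<in>UNIV. (cmod (B $ k $ j))\<^sup>2))"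
    unfolding norm_matrix_square by (intro sum_mono row)
  also have "\<dots> = (norm A)\<^sup>2 * (\<Sum>j\<in>UNIV. \<Sum>k\<in>UNIV. (cmod (B $ k $ j))\<^sup>2)"
    unfolding norm_matrix_square by (simp add: sum_product)
  also have "(\<Sum>j\<in>UNIV. \<Sum>k\<in>UNIV. (cmod (B $ k $ j))\<^sup>2) = (norm B)\<^sup>2"
    unfolding norm_matrix_square by (rule sum.swap)
  finally have "(norm (A ** B))\<^sup>2 \<le> (norm A * norm B)\<^sup>2"
    by (simp add: power_mult_distrib)
  then show ?thesis by (rule power2_le_imp_le) simp
qed

lemma norm_mat_mult: "norm (mat c ** A) = cmod c * norm (A :: complex ^ 'n ^ 'm)"
proof -
  have "(norm (mat c ** A))\<^sup>2 = (cmod c * norm A)\<^sup>2"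
    by (simp add: norm_matrix_square norm_mult power_mult_distrib sum_distrib_left)
  then show ?thesis by (rule power2_eq_imp_eq) simp_all
qed

lemma norm_transpose: "norm (transpose A) = norm (A :: complex ^ 'n ^ 'm)"
proof -
  have "(norm (transpose A))\<^sup>2 = (norm A)\<^sup>2"
    unfolding norm_matrix_square transpose_def by (simp, rule sum.swap)
  then show ?thesis by (rule power2_eq_imp_eq) simp_all
qed

lemma norm_mcnj: "norm (mcnj A) = norm A"
proof -
  have "(norm (mcnj A))\<^sup>2 = (norm A)\<^sup>2"
    unfolding norm_matrix_square by simp
  then show ?thesis by (rule power2_eq_imp_eq) simp_all
qed

lemma bounded_bilinear_matrix_mult: "bounded_bilinear ((**) :: complex ^ 'k ^ 'm \<Rightarrow> complex ^ 'n ^ 'k \<Rightarrow> _)"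
  by standard (auto simp: matrix_add_ldistrib matrix_add_rdistrib matrix_mult_scaleR_left
      matrix_mult_scaleR_right norm_matrix_mult_le intro!: exI[of _ 1])

lemmas tendsto_matrix_mult [tendsto_intros] = bounded_bilinear.tendsto[OF bounded_bilinear_matrix_mult]
lemmas continuous_on_matrix_mult [continuous_intros] = bounded_bilinear.continuous_on[OF bounded_bilinear_matrix_mult]
lemmas has_derivative_matrix_mult = bounded_bilinear.FDERIV[OF bounded_bilinear_matrix_mult]

lemma bounded_linear_mat_mult: "bounded_linear (\<lambda>c. mat c ** (A :: complex ^ 'n ^ 'm))"
proof (rule bounded_linear_intro[of _ "norm A"])
  show "mat (x + y) ** A = mat x ** A + mat y ** A" for x y by (simp add: mat_add_mult)
  show "mat (r *\<^sub>R x) ** A = r *\<^sub>R (mat x ** A)" for r x by (simp add: vec_eq_iff)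
  show "norm (mat x ** A) \<le> norm x * norm A" for x by (simp add: norm_mat_mult)
qed

lemmas continuous_on_mat_mult [continuous_intros] = bounded_linear.continuous_on[OF bounded_linear_mat_mult]
lemmas has_derivative_mat_mult = bounded_linear.has_derivative[OF bounded_linear_mat_mult]

lemma bounded_linear_transpose: "bounded_linear (transpose :: complex ^ 'n ^ 'm \<Rightarrow> _)"
  by (rule bounded_linear_intro[of _ 1]) (auto simp: transpose_def vec_eq_iff norm_transpose[unfolded transpose_def])

lemma bounded_linear_mcnj: "bounded_linear (mcnj :: complex ^ 'n ^ 'm \<Rightarrow> _)"
  by (rule bounded_linear_intro[of _ 1]) (auto simp: vec_eq_iff norm_mcnj)

lemmas tendsto_transpose [tendsto_intros] = bounded_linear.tendsto[OF bounded_linear_transpose]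
lemmas tendsto_mcnj [tendsto_intros] = bounded_linear.tendsto[OF bounded_linear_mcnj]

lemma matrix_inv_unique:
  assumes "A ** B = mat 1" "B ** A = (mat 1 :: complex ^ 'n ^ 'n)"
  shows "matrix_inv A = B"
proof -
  have "invertible A" using assms by (auto simp: invertible_def)
  then have "A ** matrix_inv A = mat 1 \<and> matrix_inv A ** A = mat 1"
    unfolding matrix_inv_def invertible_def by (rule someI_ex)
  then have "matrix_inv A ** A = mat 1" ..
  then have "matrix_inv A ** A ** B = B" by simp
  then show ?thesis by (metis assms(1) matrix_mul_assoc matrix_mul_rid)
qed

text \<open>The hermitian forms on column vectors are encoded by their Gram matrices, so that
  \<open>act g M\<close> is the pullback of the form \<open>M\<close> along \<open>g\<close>.\<close>

definition act :: "complex ^ 'm ^ 'm \<Rightarrow> complex ^ 'm ^ 'm \<Rightarrow> complex ^ 'm ^ 'm" where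
  "act g M = transpose g ** M ** mcnj g"

text \<open>Pulling back reverses products, so this is a right action. In the cocycle rule it is
  therefore the value of the first factor that gets transported.\<close>

lemma act_mult: "act (g ** g') M = act g' (act g M)"
  by (simp add: act_def matrix_transpose_mul mcnj_mult matrix_mul_assoc)

lemma act_one [simp]: "act (mat 1) M = M"
proof -
  have "mcnj (mat 1 :: complex ^ 'm ^ 'm) = mat 1" by (simp add: vec_eq_iff mat_def)
  then show ?thesis unfolding act_def by (metis matrix_mul_lid matrix_mul_rid transpose_mat)
qed

lemma bounded_linear_act: "bounded_linear (act g)"
  unfolding act_def
  by (intro bounded_linear_compose[OF bounded_bilinear.bounded_linear_left[OF bounded_bilinear_matrix_mult]]
      bounded_bilinear.bounded_linear_right[OF bounded_bilinear_matrix_mult])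

lemma linear_act: "linear (act g)"
  by (rule bounded_linear.linear[OF bounded_linear_act])

lemma tendsto_act [tendsto_intros]:
  assumes "(g \<longlongrightarrow> g0) F" "(M \<longlongrightarrow> M0) F"
  shows "((\<lambda>x. act (g x) (M x)) \<longlongrightarrow> act g0 M0) F"
  unfolding act_def by (intro tendsto_intros assms)

section \<open>Persistence of common kernels\<close>

text \<open>Suppose the part of \<open>v0\<close> orthogonal to the kernel of \<open>D n\<close>
  does not tend to 0. Then the least size \<open>l\<close> of the values on unit vectors orthogonal
  to that kernel tends to 0 along a subsequence. Minimisers divided by \<open>l\<close> have bounded
  values, and by \<open>exact\<close> a limit of these is attained by some \<open>u\<close>.
  Correcting the minimisers by \<open>l\<close> times \<open>u\<close> keeps them nearly of unit
  length but makes their values small compared with \<open>l\<close>, against minimality. The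
  divided minimisers are unbounded, so \<open>exact\<close> has to allow every sequence
  \<open>x\<close>.\<close>

lemma kernels_persist:
  fixes D :: "nat \<Rightarrow> 'i \<Rightarrow> 'v::euclidean_space \<Rightarrow> 'v" and D0 :: "'i \<Rightarrow> 'v \<Rightarrow> 'v"
  assumes fin: "finite I"
    and lin: "\<And>n i. linear (D n i)"
    and conv: "\<And>i v. i \<in> I \<Longrightarrow> (\<lambda>n. D n i v) \<longlonglongrightarrow> D0 i v"
    and exact: "\<And>r x c. strict_mono (r :: nat \<Rightarrow> nat) \<Longrightarrow>
      (\<And>i. i \<in> I \<Longrightarrow> (\<lambda>n. D (r n) i (x n)) \<longlonglongrightarrow> c i) \<Longrightarrow> \<exists>u. \<forall>i\<in>I. c i = D0 i u"
    and v0: "\<And>i. i \<in> I \<Longrightarrow> D0 i v0 = 0"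
  shows "\<exists>f. (\<forall>n. \<forall>i\<in>I. D n i (f n) = 0) \<and> f \<longlonglongrightarrow> v0"
proof -
  define F where "F n = {v. \<forall>i\<in>I. D n i v = 0}" for n
  define G where "G n = orthogonal_comp (F n)" for n
  have subF: "subspace (F n)" for n
    unfolding F_def subspace_def using lin
    by (auto simp: linear_0 linear_add linear_cmul)
  have subG: "subspace (G n)" for n
    unfolding G_def by (rule subspace_orthogonal_comp)
  have FG: "v = 0" if "v \<in> F n" "v \<in> G n" for v n
    using that unfolding G_def orthogonal_comp_def by (auto simp: orthogonal_def)
  have dec: "\<exists>y z. v = y + z \<and> y \<in> F n \<and> z \<in> G n" for v n
  proof -
    obtain y z where "y \<in> span (F n)" and z: "\<And>w. w \<in> span (F n) \<Longrightarrow> orthogonal z w" and "v = y + z"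
      using orthogonal_subspace_decomp_exists[of "F n" v] by metis
    moreover have "span (F n) = F n" using subF[of n] by (simp add: span_eq_iff)
    ultimately have "y \<in> F n" "z \<in> G n"
      by (auto simp: G_def orthogonal_comp_def orthogonal_commute)
    with \<open>v = y + z\<close> show ?thesis by blast
  qed
  from dec have "\<forall>n v. \<exists>y z. v = y + z \<and> y \<in> F n \<and> z \<in> G n" by blast
  then obtain f g where fg: "\<And>n v. v = f n v + g n v" "\<And>n v. f n v \<in> F n" "\<And>n v. g n v \<in> G n"
    by metis
  have norm_g: "norm (g n v) \<le> norm v" for n v
  proof -
    have "orthogonal (f n v) (g n v)"
      using fg(2,3)[of n v] by (auto simp: G_def orthogonal_comp_def)
    then have "(norm v)\<^sup>2 = (norm (f n v))\<^sup>2 + (norm (g n v))\<^sup>2"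
      using norm_add_Pythagorean fg(1)[of v n] by metis
    then show ?thesis by (intro power2_le_imp_le[OF _ norm_ge_zero]) simp
  qed
  define N where "N n v = (\<Sum>i\<in>I. norm (D n i v))" for n v
  have N_cmul: "N n (a *\<^sub>R v) = \<bar>a\<bar> * N n v" for n a v
    by (simp add: N_def linear_cmul[OF lin] sum_distrib_left)
  have N_g: "N n (g n v) = N n v" for n v
  proof -
    have "D n i (g n v) = D n i v" if "i \<in> I" for i
      using linear_add[OF lin, of n i "f n v" "g n v"] fg(1)[of v n] fg(2)[of n v] that by (auto simp: F_def)
    then show ?thesis by (simp add: N_def)
  qed
  have N_pos: "N n v > 0" if "v \<in> G n" "v \<noteq> 0" for n v
  proof (rule ccontr)
    assume "\<not> N n v > 0"
    moreover have "N n v \<ge> 0" by (simp add: N_def sum_nonneg)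
    ultimately have "N n v = 0" by linarith
    then have "v \<in> F n" using fin by (auto simp: N_def F_def sum_nonneg_eq_0_iff)
    with FG that show False by blast
  qed
  have "(\<lambda>n. g n v0) \<longlonglongrightarrow> 0"
  proof (rule ccontr)
    assume "\<not> ?thesis"
    then obtain \<eta> where \<eta>: "\<eta> > 0" "\<exists>\<^sub>F n in sequentially. norm (g n v0) \<ge> \<eta>"
      by (auto simp: tendsto_iff not_eventually not_less)
    then obtain r0 :: "nat \<Rightarrow> nat" where r0: "strict_mono r0" "\<And>n. norm (g (r0 n) v0) \<ge> \<eta>"
      using infinite_enumerate[of "{n. norm (g n v0) \<ge> \<eta>}"]
      by (auto simp: frequently_sequentially infinite_nat_iff_unbounded_le)
    have "\<exists>v. v \<in> G (r0 n) \<and> norm v = 1 \<and> (\<forall>w. w \<in> G (r0 n) \<and> norm w = 1 \<longrightarrow> N (r0 n) v \<le> N (r0 n) w)" for n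
    proof -
      have "compact (G (r0 n) \<inter> sphere 0 1)"
        by (intro closed_Int_compact closed_subspace subG) simp
      moreover have "(1 / norm (g (r0 n) v0)) *\<^sub>R g (r0 n) v0 \<in> G (r0 n) \<inter> sphere 0 1"
        using r0(2)[of n] \<eta>(1) subG[of "r0 n"] fg(3)[of "r0 n" v0] by (auto simp: subspace_def)
      moreover have "continuous_on (G (r0 n) \<inter> sphere 0 1) (N (r0 n))"
        unfolding N_def using lin by (intro continuous_intros linear_continuous_on)
          (simp add: linear_conv_bounded_linear)
      ultimately obtain v where "v \<in> G (r0 n) \<inter> sphere 0 1"
          "\<forall>w\<in>G (r0 n) \<inter> sphere 0 1. N (r0 n) v \<le> N (r0 n) w"
        using continuous_attains_inf[of "G (r0 n) \<inter> sphere 0 1" "N (r0 n)"] by blast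
      then show ?thesis by auto
    qed
    then obtain v where v: "\<And>n. v n \<in> G (r0 n)" "\<And>n. norm (v n) = 1"
      "\<And>n w. w \<in> G (r0 n) \<Longrightarrow> norm w = 1 \<Longrightarrow> N (r0 n) (v n) \<le> N (r0 n) w"
      by metis
    define l where "l n = N (r0 n) (v n)" for n
    have l_pos: "l n > 0" for n unfolding l_def using N_pos v(1,2)[of n] by force
    have l_min: "l n * norm w \<le> N (r0 n) w" if "w \<in> G (r0 n)" for w n
    proof (cases "w = 0")
      case False
      have "l n \<le> N (r0 n) ((1 / norm w) *\<^sub>R w)"
        unfolding l_def using subG[of "r0 n"] that False by (intro v(3)) (auto simp: subspace_def)
      then show ?thesis using False by (simp add: N_cmul field_simps)
    qed (simp add: N_def sum_nonneg)
    have Nv0: "(\<lambda>n. N (r0 n) v0) \<longlonglongrightarrow> 0"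
    proof -
      have "(\<lambda>n. N n v0) \<longlonglongrightarrow> (\<Sum>i\<in>I. norm (D0 i v0))"
        unfolding N_def by (intro tendsto_intros conv)
      then show ?thesis using v0 r0(1) by (auto dest: LIMSEQ_subseq_LIMSEQ simp: o_def)
    qed
    have l0: "l \<longlonglongrightarrow> 0"
    proof (rule tendsto_sandwich[OF _ _ tendsto_const])
      show "\<forall>\<^sub>F n in sequentially. 0 \<le> l n" using l_pos by (simp add: less_imp_le)
      have "l n \<le> N (r0 n) v0 / \<eta>" for n
      proof -
        have "l n * \<eta> \<le> l n * norm (g (r0 n) v0)" using r0(2)[of n] l_pos[of n] by simp
        also have "\<dots> \<le> N (r0 n) v0" using l_min[OF fg(3)] N_g by metis
        finally show ?thesis using \<eta>(1) by (simp add: field_simps)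
      qed
      then show "\<forall>\<^sub>F n in sequentially. l n \<le> N (r0 n) v0 / \<eta>" by simp
      show "(\<lambda>n. N (r0 n) v0 / \<eta>) \<longlonglongrightarrow> 0" using tendsto_divide[OF Nv0 tendsto_const, of \<eta>] \<eta>(1) by simp
    qed
    \<comment> \<open>Division by \<open>l\<close> normalises the values: each of the finitely many
      has norm at most 1, so a common subsequence converges.\<close>
    define c where "c n i = D (r0 n) i (v n /\<^sub>R l n)" for n i
    have c_bound: "norm (c n i) \<le> 1" if "i \<in> I" for n i
    proof -
      have "norm (D (r0 n) i (v n)) \<le> l n"
        unfolding l_def N_def using that fin by (intro member_le_sum) auto
      then show ?thesis using l_pos[of n] by (simp add: c_def linear_cmul[OF lin] field_simps)
    qed
    have "\<exists>s ci. strict_mono (s :: nat \<Rightarrow> nat) \<and> (\<forall>i\<in>J. (\<lambda>n. c (s n) i) \<longlonglongrightarrow> ci i)" if "J \<subseteq> I" for J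
      using finite_subset[OF that fin] that
    proof (induction J rule: finite_induct)
      case empty
      then show ?case by (auto intro!: exI[of _ id] strict_mono_id)
    next
      case (insert j J)
      then obtain s ci where s: "strict_mono (s :: nat \<Rightarrow> nat)" "\<forall>i\<in>J. (\<lambda>n. c (s n) i) \<longlonglongrightarrow> ci i" by auto
      have "bounded (range (\<lambda>n. c (s n) j))"
        using c_bound insert.prems by (auto simp: bounded_iff)
      then obtain q t where t: "strict_mono (t :: nat \<Rightarrow> nat)" "((\<lambda>n. c (s n) j) \<circ> t) \<longlonglongrightarrow> q"
        using bounded_imp_convergent_subsequence by blast
      have "(\<lambda>n. c ((s \<circ> t) n) i) \<longlonglongrightarrow> (ci(j := q)) i" if "i \<in> insert j J" for i
        using that t s insert.hyps LIMSEQ_subseq_LIMSEQ[of "\<lambda>n. c (s n) i" "ci i" t] by (auto simp: o_def)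
      then show ?case using strict_mono_o[OF s(1) t(1)] by blast
    qed
    then obtain s ci where s: "strict_mono (s :: nat \<Rightarrow> nat)" "\<And>i. i \<in> I \<Longrightarrow> (\<lambda>n. c (s n) i) \<longlonglongrightarrow> ci i"
      by blast
    obtain u where u: "\<And>i. i \<in> I \<Longrightarrow> ci i = D0 i u"
      using exact[OF strict_mono_o[OF r0(1) s(1)], of "\<lambda>n. v (s n) /\<^sub>R l (s n)" ci] s(2)
      by (auto simp: c_def o_def)
    \<comment> \<open>Subtracting the component of \<open>u\<close> orthogonal to the kernel leaves
      \<open>w\<close> inside \<open>G\<close>. The length changes by at most
      \<open>l * norm u\<close>, while the value becomes \<open>l\<close> times something tending to
      0.\<close>
    define w where "w n = v (s n) - l (s n) *\<^sub>R g (r0 (s n)) u" for n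
    have Gw: "w n \<in> G (r0 (s n))" for n
      unfolding w_def using subG v(1) fg(3) by (intro subspace_diff subspace_scale) auto
    have Nw: "N (r0 (s n)) (w n) = l (s n) * (\<Sum>i\<in>I. norm (c (s n) i - D (r0 (s n)) i u))" for n
    proof -
      have "norm (D (r0 (s n)) i (w n)) = l (s n) * norm (c (s n) i - D (r0 (s n)) i u)" if i: "i \<in> I" for i
      proof -
        have "D (r0 (s n)) i (g (r0 (s n)) u) = D (r0 (s n)) i u"
          using linear_add[OF lin, of "r0 (s n)" i "f (r0 (s n)) u" "g (r0 (s n)) u"] fg(1)[of u "r0 (s n)"] fg(2)[of "r0 (s n)" u] i
          by (auto simp: F_def)
        then have "D (r0 (s n)) i (w n) = l (s n) *\<^sub>R (c (s n) i - D (r0 (s n)) i u)"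
          using l_pos[of "s n"] unfolding w_def c_def
          by (simp add: linear_diff[OF lin] linear_cmul[OF lin] scaleR_diff_right)
        then show ?thesis using l_pos[of "s n"] by simp
      qed
      then show ?thesis by (simp add: N_def sum_distrib_left)
    qed
    have "norm (w n) \<le> (\<Sum>i\<in>I. norm (c (s n) i - D (r0 (s n)) i u))" for n
    proof -
      have "l (s n) * norm (w n) \<le> l (s n) * (\<Sum>i\<in>I. norm (c (s n) i - D (r0 (s n)) i u))"
        using l_min[OF Gw, of n] Nw by metis
      then show ?thesis using l_pos[of "s n"] by simp
    qed
    moreover have "1 - l (s n) * norm u \<le> norm (w n)" for n
    proof -
      have "norm (v (s n)) \<le> norm (w n) + norm (l (s n) *\<^sub>R g (r0 (s n)) u)"
        unfolding w_def by (metis norm_triangle_sub add.commute)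
      moreover have "norm (l (s n) *\<^sub>R g (r0 (s n)) u) \<le> l (s n) * norm u"
        using norm_g[of "r0 (s n)" u] l_pos[of "s n"] by simp
      ultimately show ?thesis using v(2)[of "s n"] by simp
    qed
    ultimately have le: "1 - l (s n) * norm u \<le> (\<Sum>i\<in>I. norm (c (s n) i - D (r0 (s n)) i u))" for n
      using order_trans by blast
    have "(\<lambda>n. 1 - l (s n) * norm u) \<longlonglongrightarrow> 1 - 0 * norm u"
      using LIMSEQ_subseq_LIMSEQ[OF l0 s(1)] by (intro tendsto_intros) (simp add: o_def)
    moreover have "(\<lambda>n. \<Sum>i\<in>I. norm (c (s n) i - D (r0 (s n)) i u)) \<longlonglongrightarrow> (\<Sum>i\<in>I. norm (ci i - D0 i u))"
      using s(2) LIMSEQ_subseq_LIMSEQ[OF conv strict_mono_o[OF r0(1) s(1)]]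
      by (intro tendsto_intros) (auto simp: o_def)
    ultimately have "1 \<le> (\<Sum>i\<in>I. norm (ci i - D0 i u))"
      using le by (intro tendsto_le[OF sequentially_bot]) auto
    then show False using u by simp
  qed
  then have "(\<lambda>n. v0 - g n v0) \<longlonglongrightarrow> v0 - 0" by (intro tendsto_intros)
  moreover have "(\<lambda>n. v0 - g n v0) = (\<lambda>n. f n v0)" using fg(1) by (metis add_diff_cancel_right')
  ultimately have "(\<lambda>n. f n v0) \<longlonglongrightarrow> v0" by simp
  moreover have "\<forall>n. \<forall>i\<in>I. D n i (f n v0) = 0" using fg(2) by (auto simp: F_def)
  ultimately show ?thesis by (intro exI[of _ "\<lambda>n. f n v0"]) simp
qed

section \<open>Flat connections\<close>

lemma linear_Basis_expansion:
  fixes f :: "'a::euclidean_space \<Rightarrow> 'b::real_vector"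
  assumes "linear f"
  shows "f v = (\<Sum>b\<in>Basis. (v \<bullet> b) *\<^sub>R f b)"
proof -
  have "f v = f (\<Sum>b\<in>Basis. (v \<bullet> b) *\<^sub>R b)" by (simp add: euclidean_representation)
  then show ?thesis by (simp add: linear_sum[OF assms] linear_cmul[OF assms])
qed

text \<open>The Poincare lemma: \<open>F\<close> integrates the form along the segment from
  \<open>p\<close>. Under the integral sign its derivative is the t-derivative of
  \<open>t *\<^sub>R \<eta> (q x t) u\<close>, because closedness exchanges the two arguments of
  \<open>\<eta>'\<close>; the integral then telescopes to the value at t = 1.\<close>

lemma closed_form_exact_convex:
  fixes \<eta> :: "'a::euclidean_space \<Rightarrow> 'a \<Rightarrow> 'b::euclidean_space"
  assumes K: "open K" "convex K" "p \<in> K"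
    and lin: "\<And>x. x \<in> K \<Longrightarrow> linear (\<eta> x)"
    and der: "\<And>x v. x \<in> K \<Longrightarrow> ((\<lambda>x. \<eta> x v) has_derivative (\<lambda>u. \<eta>' x u v)) (at x)"
    and sym: "\<And>x u v. x \<in> K \<Longrightarrow> \<eta>' x u v = \<eta>' x v u"
    and cont: "\<And>u v. continuous_on K (\<lambda>x. \<eta>' x u v)"
  shows "\<exists>F. F p = 0 \<and> (\<forall>x\<in>K. (F has_derivative \<eta> x) (at x))"
proof -
  define q where "q x t = p + t *\<^sub>R (x - p)" for x and t :: real
  have q_in: "q x t \<in> K" if "x \<in> K" "t \<in> {0..1}" for x t
  proof -
    have "q x t = (1 - t) *\<^sub>R p + t *\<^sub>R x" by (simp add: q_def algebra_simps)
    then show ?thesis using K that by (simp add: convexD)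
  qed
  have lin'1: "linear (\<lambda>u. \<eta>' x u v)" if "x \<in> K" for x v
    using der[OF that] has_derivative_bounded_linear bounded_linear.linear by blast
  have lin'2: "linear (\<eta>' x u)" if "x \<in> K" for x u
  proof -
    have "\<eta>' x u = (\<lambda>v. \<eta>' x v u)" using sym[OF that] by blast
    then show ?thesis using lin'1[OF that, of u] by simp
  qed
  have exp1: "\<eta> x v = (\<Sum>b\<in>Basis. (v \<bullet> b) *\<^sub>R \<eta> x b)" if "x \<in> K" for x v
    by (rule linear_Basis_expansion[OF lin[OF that]])
  have exp2: "\<eta>' x u v = (\<Sum>b\<in>Basis. (v \<bullet> b) *\<^sub>R \<eta>' x u b)" if "x \<in> K" for x u v
    by (rule linear_Basis_expansion[OF lin'2[OF that]])
  have cont0: "continuous_on K (\<lambda>x. \<eta> x v)" for v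
    by (intro continuous_at_imp_continuous_on ballI has_derivative_continuous[OF der])
  have cq: "continuous_on (K \<times> {0..1}) (\<lambda>z. q (fst z) (snd z))"
    unfolding q_def by (intro continuous_intros)
  have c1: "continuous_on (K \<times> {0..1}) (\<lambda>z. \<eta> (q (fst z) (snd z)) v)" for v
    by (rule continuous_on_compose2[OF cont0 cq]) (auto intro: q_in)
  have c2: "continuous_on (K \<times> {0..1}) (\<lambda>z. \<eta>' (q (fst z) (snd z)) u v)" for u v
    by (rule continuous_on_compose2[OF cont cq]) (auto intro: q_in)
  define G where "G x t = \<eta> (q x t) (x - p)" for x t
  define G' where "G' x t u = t *\<^sub>R \<eta>' (q x t) u (x - p) + \<eta> (q x t) u" for x t u
  have derq: "((\<lambda>x. q x t) has_derivative (\<lambda>u. t *\<^sub>R u)) (at x)" for x t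
    unfolding q_def by (auto intro!: derivative_eq_intros)
  have derG: "((\<lambda>x. G x t) has_derivative G' x t) (at x)" if x: "x \<in> K" and t: "t \<in> {0..1}" for x t
  proof -
    have d: "((\<lambda>x. \<eta> (q x t) b) has_derivative (\<lambda>u. \<eta>' (q x t) (t *\<^sub>R u) b)) (at x)" for b
      by (rule has_derivative_compose[OF derq der[OF q_in[OF x t]]])
    have 1: "((\<lambda>x. \<Sum>b\<in>Basis. ((x - p) \<bullet> b) *\<^sub>R \<eta> (q x t) b) has_derivative
      (\<lambda>u. \<Sum>b\<in>Basis. ((x - p) \<bullet> b) *\<^sub>R \<eta>' (q x t) (t *\<^sub>R u) b + (u \<bullet> b) *\<^sub>R \<eta> (q x t) b)) (at x)"
      by (rule has_derivative_sum) (auto intro!: derivative_eq_intros d)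
    have 2: "(\<lambda>u. \<Sum>b\<in>Basis. ((x - p) \<bullet> b) *\<^sub>R \<eta>' (q x t) (t *\<^sub>R u) b + (u \<bullet> b) *\<^sub>R \<eta> (q x t) b) = G' x t"
    proof
      fix u
      have "(\<Sum>b\<in>Basis. ((x - p) \<bullet> b) *\<^sub>R \<eta>' (q x t) (t *\<^sub>R u) b + (u \<bullet> b) *\<^sub>R \<eta> (q x t) b)
          = \<eta>' (q x t) (t *\<^sub>R u) (x - p) + \<eta> (q x t) u"
        using exp1[OF q_in[OF x t], of u] exp2[OF q_in[OF x t], of "t *\<^sub>R u" "x - p"] by (simp add: sum.distrib)
      then show "(\<Sum>b\<in>Basis. ((x - p) \<bullet> b) *\<^sub>R \<eta>' (q x t) (t *\<^sub>R u) b + (u \<bullet> b) *\<^sub>R \<eta> (q x t) b) = G' x t u"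
        by (simp add: G'_def linear_cmul[OF lin'1[OF q_in[OF x t]]])
    qed
    show ?thesis
    proof (rule has_derivative_transform_within_open[OF 1[unfolded 2] K(1) x])
      show "(\<Sum>b\<in>Basis. ((y - p) \<bullet> b) *\<^sub>R \<eta> (q y t) b) = G y t" if "y \<in> K" for y
        unfolding G_def using exp1[OF q_in[OF that t], of "y - p"] by simp
    qed
  qed
  have blG: "bounded_linear (G' x t)" if "x \<in> K" "t \<in> {0..1}" for x t
    using derG[OF that] by (rule has_derivative_bounded_linear)
  have contG: "continuous_on (K \<times> {0..1}) (\<lambda>z. G' (fst z) (snd z) u)" for u
  proof -
    have "continuous_on (K \<times> {0..1}) (\<lambda>z. snd z *\<^sub>R (\<Sum>b\<in>Basis. ((fst z - p) \<bullet> b) *\<^sub>R \<eta>' (q (fst z) (snd z)) u b)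
        + \<eta> (q (fst z) (snd z)) u)"
      by (intro continuous_intros c1 c2)
    then show ?thesis
      by (rule continuous_on_eq) (use exp2[OF q_in] in \<open>auto simp: G'_def simp flip: exp2\<close>)
  qed
  \<comment> \<open>Differentiation under the integral requires the derivative as a jointly
    continuous map into bounded linear functions; in finite dimension this is checked on basis
    vectors.\<close>
  define B where "B x t = Blinfun (G' x t)" for x t
  have B: "blinfun_apply (B x t) = G' x t" if "x \<in> K" "t \<in> {0..1}" for x t
    unfolding B_def by (rule bounded_linear_Blinfun_apply[OF blG[OF that]])
  have contB: "continuous_on (K \<times> cbox 0 1) (\<lambda>(x, t). B x t)"
  proof (rule continuous_on_blinfun_componentwise)
    fix i :: 'a
    show "continuous_on (K \<times> cbox 0 1) (\<lambda>z. blinfun_apply (case z of (x, t) \<Rightarrow> B x t) i)"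
      using contG[of i] unfolding cbox_interval by (rule continuous_on_eq) (auto simp: B)
  qed
  have Gint: "G x integrable_on cbox 0 1" if x: "x \<in> K" for x
  proof (rule integrable_continuous)
    have "continuous_on (cbox 0 1) (\<lambda>t. \<Sum>b\<in>Basis. ((x - p) \<bullet> b) *\<^sub>R \<eta> (q x t) b)"
    proof (intro continuous_intros continuous_on_compose2[OF cont0])
      show "continuous_on (cbox 0 1) (q x)" unfolding q_def by (intro continuous_intros)
      show "q x ` cbox 0 1 \<subseteq> K" using q_in[OF x] by auto
    qed
    then show "continuous_on (cbox 0 1) (G x)"
      by (rule continuous_on_eq) (use exp1[OF q_in[OF x]] in \<open>auto simp: G_def simp flip: exp1\<close>)
  qed
  define F where "F x = integral (cbox 0 1) (G x)" for x
  have "(F has_derivative \<eta> x) (at x)" if x: "x \<in> K" for x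
  proof -
    have 1: "(F has_derivative blinfun_apply (integral (cbox 0 1) (B x))) (at x within K)"
      unfolding F_def
      by (rule leibniz_rule[OF _ Gint contB x K(2)])
        (auto simp: B intro: has_derivative_at_withinI[OF derG])
    have "blinfun_apply (integral (cbox 0 1) (B x)) u = \<eta> x u" for u
    proof -
      have cB: "continuous_on (cbox 0 1) (B x)"
      proof -
        have "continuous_on (cbox 0 1) (\<lambda>t. (\<lambda>(x, t). B x t) (x, t))"
          by (rule continuous_on_compose2[OF contB]) (auto intro!: continuous_intros simp: x)
        then show ?thesis by simp
      qed
      have "blinfun_apply (integral (cbox 0 1) (B x)) u = integral (cbox 0 1) (\<lambda>t. blinfun_apply (B x t) u)"
        using integral_linear[OF integrable_continuous[OF cB] blinfun.bounded_linear_left, of u] by (simp add: o_def)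
      also have "\<dots> = integral {0..1} (\<lambda>t. G' x t u)"
        by (auto intro!: Henstock_Kurzweil_Integration.integral_cong simp: B x)
      also have "\<dots> = 1 *\<^sub>R \<eta> (q x 1) u - 0 *\<^sub>R \<eta> (q x 0) u"
      proof (rule integral_unique, rule fundamental_theorem_of_calculus)
        fix t :: real assume t: "t \<in> {0..1}"
        have dq: "(q x has_derivative (\<lambda>s. s *\<^sub>R (x - p))) (at t)"
          unfolding q_def by (auto intro!: derivative_eq_intros)
        have "((\<lambda>t. \<eta> (q x t) u) has_derivative (\<lambda>s. \<eta>' (q x t) (s *\<^sub>R (x - p)) u)) (at t)"
          by (rule has_derivative_compose[OF dq der[OF q_in[OF x t]]])
        then have "((\<lambda>t. t *\<^sub>R \<eta> (q x t) u) has_derivative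
            (\<lambda>s. t *\<^sub>R \<eta>' (q x t) (s *\<^sub>R (x - p)) u + s *\<^sub>R \<eta> (q x t) u)) (at t)"
          by (intro has_derivative_scaleR has_derivative_ident)
        \<comment> \<open>Closedness enters here: the derivative along the ray in direction
          \<open>x - p\<close> becomes the derivative in direction \<open>u\<close>.\<close>
        moreover have "(\<lambda>s. t *\<^sub>R \<eta>' (q x t) (s *\<^sub>R (x - p)) u + s *\<^sub>R \<eta> (q x t) u) = (\<lambda>s. s *\<^sub>R G' x t u)"
          using sym[OF q_in[OF x t], of u "x - p"]
          by (auto simp: G'_def linear_cmul[OF lin'1[OF q_in[OF x t]]] scaleR_add_right)
        ultimately show "((\<lambda>t. t *\<^sub>R \<eta> (q x t) u) has_vector_derivative G' x t u) (at t within {0..1})"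
          by (simp add: has_vector_derivative_def has_derivative_at_withinI)
      qed simp
      finally show ?thesis by (simp add: q_def)
    qed
    then have "blinfun_apply (integral (cbox 0 1) (B x)) = \<eta> x" by blast
    then show ?thesis using 1 at_within_open[OF x K(1)] by simp
  qed
  moreover have "F p = 0"
  proof -
    have "G p t = 0" if "t \<in> {0..1}" for t
      using linear_0[OF lin[OF q_in[OF K(3) that]]] by (simp add: G_def)
    then have "(G p has_integral 0) (cbox 0 1)" by (intro has_integral_is_0) simp
    then show ?thesis by (simp add: F_def integral_unique)
  qed
  ultimately show ?thesis by blast
qed

text \<open>Flatness, d om = om \<and> om, is imposed as two separate conditions, closedness and
  commuting values. With a parameter h in front of the form the first is linear and the second
  quadratic in h, so flatness for all h amounts to both. \<open>om' x u v\<close> is the derivative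
  of \<open>om x v\<close> in direction \<open>u\<close>.\<close>

locale flat_form =
  fixes X :: "'a::euclidean_space set"
    and om :: "'a \<Rightarrow> 'a \<Rightarrow> complex ^ 'm ^ 'm"
    and om' :: "'a \<Rightarrow> 'a \<Rightarrow> 'a \<Rightarrow> complex ^ 'm ^ 'm"
  assumes open_X: "open X"
    and lin_om: "x \<in> X \<Longrightarrow> linear (om x)"
    and der_om: "x \<in> X \<Longrightarrow> ((\<lambda>x. om x v) has_derivative (\<lambda>u. om' x u v)) (at x)"
    and closed_om: "x \<in> X \<Longrightarrow> om' x u v = om' x v u"
    and cont_om': "continuous_on X (\<lambda>x. om' x u v)"
    and comm_om: "x \<in> X \<Longrightarrow> om x u ** om x v = om x v ** om x u"
begin

definition cvx :: "'a set \<Rightarrow> bool" where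
  "cvx K \<longleftrightarrow> open K \<and> convex K \<and> K \<subseteq> X"

definition sol :: "'a set \<Rightarrow> ('a \<Rightarrow> complex ^ 'm ^ 'm) \<Rightarrow> bool" where
  "sol K S \<longleftrightarrow> (\<forall>x\<in>K. (S has_derivative (\<lambda>v. om x v ** S x)) (at x))"

lemma cvx_Int: "cvx K \<Longrightarrow> cvx K' \<Longrightarrow> cvx (K \<inter> K')"
  by (auto simp: cvx_def convex_Int)

lemma cvx_seg: "cvx K \<Longrightarrow> p \<in> K \<Longrightarrow> x \<in> K \<Longrightarrow> t \<in> {0..1} \<Longrightarrow> p + t *\<^sub>R (x - p) \<in> K"
  using convexD[of K p x "1 - t" t] by (auto simp: cvx_def algebra_simps)

text \<open>Chen's iterated integrals. The form \<open>om ** S n\<close> is closed: one half of its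
  derivative is symmetric since \<open>om\<close> is closed, the other half is
  \<open>om x v ** om x u ** S (n - 1) x\<close>, symmetric since the values commute.\<close>

lemma iterated_integrals:
  assumes K: "cvx K" and p: "p \<in> K"
  shows "\<exists>S. S 0 = (\<lambda>_. mat 1) \<and> (\<forall>n. S (Suc n) p = 0 \<and>
    (\<forall>x\<in>K. (S (Suc n) has_derivative (\<lambda>v. om x v ** S n x)) (at x)))"
proof -
  define prim where "prim S F \<longleftrightarrow> F p = 0 \<and> (\<forall>x\<in>K. (F has_derivative (\<lambda>v. om x v ** S x)) (at x))"
    for S F :: "'a \<Rightarrow> complex ^ 'm ^ 'm"
  define S where "S = rec_nat (\<lambda>_. mat 1 :: complex ^ 'm ^ 'm) (\<lambda>_ S. SOME F. prim S F)"
  define S' where "S' n x v = (case n of 0 \<Rightarrow> 0 | Suc k \<Rightarrow> om x v ** S k x)" for n x v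
  have S0: "S 0 = (\<lambda>_. mat 1)" and SS: "S (Suc n) = (SOME F. prim (S n) F)" for n
    by (simp_all add: S_def)
  have KX: "K \<subseteq> X" using K by (simp add: cvx_def)
  have ex: "\<exists>F. prim (S n) F" if d: "\<forall>x\<in>K. (S n has_derivative S' n x) (at x)"
    and c: "\<forall>v. continuous_on K (\<lambda>x. S' n x v)" and sy: "\<forall>x\<in>K. \<forall>u v. om x v ** S' n x u = om x u ** S' n x v" for n
    unfolding prim_def
  proof (rule closed_form_exact_convex)
    show "open K" "convex K" "p \<in> K" using K p by (auto simp: cvx_def)
    show "linear (\<lambda>v. om x v ** S n x)" if "x \<in> K" for x
    proof -
      have "linear (om x)" using lin_om KX that by blast
      then show ?thesis
        by (intro linearI) (simp_all add: linear_add linear_cmul matrix_add_rdistrib matrix_mult_scaleR_left)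
    qed
    show "((\<lambda>x. om x v ** S n x) has_derivative (\<lambda>u. om x v ** S' n x u + om' x u v ** S n x)) (at x)" if "x \<in> K" for x v
      using KX that d by (intro has_derivative_matrix_mult der_om) auto
    show "om x v ** S' n x u + om' x u v ** S n x = om x u ** S' n x v + om' x v u ** S n x" if "x \<in> K" for x u v
    proof -
      have "om' x u v = om' x v u" using closed_om that KX by blast
      moreover have "om x v ** S' n x u = om x u ** S' n x v" using sy that by blast
      ultimately show ?thesis by simp
    qed
    show "continuous_on K (\<lambda>x. om x v ** S' n x u + om' x u v ** S n x)" for u v
    proof (intro continuous_intros)
      show "continuous_on K (\<lambda>x. om x v)"
        using KX by (intro continuous_at_imp_continuous_on ballI has_derivative_continuous[OF der_om]) auto
      show "continuous_on K (\<lambda>x. om' x u v)" by (rule continuous_on_subset[OF cont_om' KX])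
      show "continuous_on K (\<lambda>x. S' n x u)" using c by blast
      show "continuous_on K (S n)"
        using d by (intro continuous_at_imp_continuous_on ballI) (auto dest: has_derivative_continuous)
    qed
  qed
  have ind: "(\<forall>x\<in>K. (S n has_derivative S' n x) (at x)) \<and> (\<forall>v. continuous_on K (\<lambda>x. S' n x v)) \<and>
      (\<forall>x\<in>K. \<forall>u v. om x v ** S' n x u = om x u ** S' n x v)" for n
  proof (induction n)
    case 0
    have "S' 0 = (\<lambda>x v. 0)" by (simp add: S'_def fun_eq_iff)
    then show ?case by (simp add: S0)
  next
    case (Suc n)
    then have "prim (S n) (S (Suc n))" unfolding SS using ex by (metis someI_ex)
    moreover have "S' (Suc n) x = (\<lambda>v. om x v ** S n x)" for x by (simp add: S'_def fun_eq_iff)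
    ultimately have d: "\<forall>x\<in>K. (S (Suc n) has_derivative S' (Suc n) x) (at x)" by (simp add: prim_def)
    have "continuous_on K (\<lambda>x. S' (Suc n) x v)" for v
    proof -
      have "continuous_on K (\<lambda>x. om x v)"
        using KX by (intro continuous_at_imp_continuous_on ballI has_derivative_continuous[OF der_om]) auto
      moreover have "continuous_on K (S n)"
        using Suc by (intro continuous_at_imp_continuous_on ballI) (auto dest: has_derivative_continuous)
      ultimately show ?thesis unfolding S'_def by (auto intro: continuous_intros)
    qed
    moreover have "om x v ** S' (Suc n) x u = om x u ** S' (Suc n) x v" if "x \<in> K" for x u v
      using comm_om[of x v u] that KX by (auto simp: S'_def matrix_mul_assoc)
    ultimately show ?case using d by blast
  qed
  have "prim (S n) (S (Suc n))" for n
    unfolding SS using ex[of n] ind[of n] by (metis someI_ex)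
  then show ?thesis using S0 by (auto simp: prim_def)
qed

text \<open>Along the segment the derivative of \<open>S (Suc n)\<close> is at most \<open>L\<close>
  times the bound for \<open>S n\<close>, and integrating \<open>t ^ n\<close> supplies the next
  factorial.\<close>

lemma iterated_integral_bound:
  assumes K: "cvx K" and p: "p \<in> K" and y: "y \<in> K" and L: "L \<ge> 0"
    and S0: "S 0 = (\<lambda>_. mat 1)" and Sp: "\<And>n. S (Suc n) p = 0"
    and Sd: "\<And>n x. x \<in> K \<Longrightarrow> (S (Suc n) has_derivative (\<lambda>v. om x v ** S n x)) (at x)"
    and bd: "\<And>t. t \<in> {0..1} \<Longrightarrow> norm (om (p + t *\<^sub>R (y - p)) (y - p)) \<le> L"
  shows "t \<in> {0..1} \<Longrightarrow>
    norm (S n (p + t *\<^sub>R (y - p))) \<le> norm (mat 1 :: complex ^ 'm ^ 'm) * (L ^ n * t ^ n / fact n)"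
proof (induction n arbitrary: t)
  case 0
  then show ?case by (simp add: S0)
next
  case (Suc n)
  let ?c = "norm (mat 1 :: complex ^ 'm ^ 'm)"
  let ?q = "\<lambda>t. p + t *\<^sub>R (y - p)"
  show ?case
  proof (cases "t = 0")
    case True then show ?thesis by (simp add: Sp)
  next
    case False
    then have t: "0 < t" "t \<le> 1" using Suc.prems by auto
    have d: "((\<lambda>t. S (Suc n) (?q t)) has_vector_derivative (om (?q s) (y - p) ** S n (?q s))) (at s)"
      if s: "s \<in> {0..1}" for s
    proof -
      have dq: "(?q has_derivative (\<lambda>r. r *\<^sub>R (y - p))) (at s)" by (auto intro!: derivative_eq_intros)
      have "?q s \<in> K" using cvx_seg[OF K p y s] .
      note has_derivative_compose[OF dq Sd[OF this, of n]]
      moreover have "linear (om (?q s))" using lin_om \<open>?q s \<in> K\<close> K by (auto simp: cvx_def)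
      ultimately show ?thesis by (simp add: has_vector_derivative_def linear_cmul matrix_mult_scaleR_left)
    qed
    have "norm (S (Suc n) (?q t) - S (Suc n) (?q 0)) \<le> ?c * (L ^ Suc n * t ^ Suc n / fact (Suc n)) - ?c * (L ^ Suc n * 0 ^ Suc n / fact (Suc n))"
    proof (rule differentiable_bound_general[OF t(1)])
      show "continuous_on {0..t} (\<lambda>t. ?c * (L ^ Suc n * t ^ Suc n / fact (Suc n)))" by (intro continuous_intros) simp
      show "continuous_on {0..t} (\<lambda>t. S (Suc n) (?q t))"
        using t by (intro continuous_at_imp_continuous_on ballI has_vector_derivative_continuous[OF d]) auto
      show "((\<lambda>t. S (Suc n) (?q t)) has_vector_derivative (om (?q s) (y - p) ** S n (?q s))) (at s)" if "0 < s" "s < t" for s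
        using that t by (intro d) auto
      show "((\<lambda>t. ?c * (L ^ Suc n * t ^ Suc n / fact (Suc n))) has_vector_derivative ?c * (L ^ Suc n * s ^ n / fact n)) (at s)"
        if "0 < s" "s < t" for s
      proof -
        have "((\<lambda>t. ?c * (L ^ Suc n * t ^ Suc n / fact (Suc n))) has_real_derivative ?c * (L ^ Suc n * (real (Suc n) * s ^ (Suc n - Suc 0)) / fact (Suc n))) (at s)"
          by (intro DERIV_cmult DERIV_cdivide DERIV_pow)
        then have "((\<lambda>t. ?c * (L ^ Suc n * t ^ Suc n / fact (Suc n))) has_real_derivative ?c * (L ^ Suc n * (real (Suc n) * s ^ n) / fact (Suc n))) (at s)"
          by simp
        moreover have "?c * (L ^ Suc n * (real (Suc n) * s ^ n) / fact (Suc n)) = ?c * (L ^ Suc n * s ^ n / fact n)"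
          by (simp add: field_simps del: of_nat_Suc)
        ultimately show ?thesis by (simp only: has_real_derivative_iff_has_vector_derivative)
      qed
      show "norm (om (?q s) (y - p) ** S n (?q s)) \<le> ?c * (L ^ Suc n * s ^ n / fact n)" if "0 < s" "s < t" for s
      proof -
        have s: "s \<in> {0..1}" using that t by auto
        have "norm (om (?q s) (y - p) ** S n (?q s)) \<le> norm (om (?q s) (y - p)) * norm (S n (?q s))"
          by (rule norm_matrix_mult_le)
        also have "\<dots> \<le> L * (?c * (L ^ n * s ^ n / fact n))"
          using bd[OF s] Suc.IH[OF s] L by (intro mult_mono) auto
        finally show ?thesis by (simp add: mult_ac)
      qed
    qed
    then show ?thesis by (simp add: Sp)
  qed
qed

text \<open>The fundamental solution is the sum of the iterated integrals. The estimate is the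
  exponential series without its constant term; it is what forces transports to the identity when
  the form is multiplied by a small h.\<close>

lemma frame_exists:
  assumes K: "cvx K" and p: "p \<in> K"
  shows "\<exists>S. S p = mat 1 \<and> sol K S \<and> (\<forall>y\<in>K. \<forall>L\<ge>0.
    (\<forall>t\<in>{0..1}. norm (om (p + t *\<^sub>R (y - p)) (y - p)) \<le> L) \<longrightarrow>
    norm (S y - mat 1) \<le> norm (mat 1 :: complex ^ 'm ^ 'm) * (exp L - 1))"
proof -
  let ?c = "norm (mat 1 :: complex ^ 'm ^ 'm)"
  obtain f where f0: "f 0 = (\<lambda>_. mat 1)" and fp: "\<And>n. f (Suc n) p = 0"
    and fd: "\<And>n x. x \<in> K \<Longrightarrow> (f (Suc n) has_derivative (\<lambda>v. om x v ** f n x)) (at x)"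
    using iterated_integrals[OF K p] by blast
  note bound = iterated_integral_bound[OF K p _ _ f0 fp fd]
  define f' where "f' n x v = (case n of 0 \<Rightarrow> 0 | Suc k \<Rightarrow> om x v ** f k x)" for n x v
  have fd': "(f n has_derivative f' n x) (at x)" if "x \<in> K" for n x
  proof (cases n)
    case 0
    have "f' 0 x = (\<lambda>v. 0)" by (simp add: f'_def fun_eq_iff)
    then show ?thesis by (simp add: 0 f0)
  next
    case (Suc k)
    moreover have "f' (Suc k) x = (\<lambda>v. om x v ** f k x)" by (simp add: f'_def fun_eq_iff)
    ultimately show ?thesis using fd[OF that, of k] by simp
  qed
  define S where "S x = (\<Sum>n. f n x)" for x
  have bd1: "norm (f n y) \<le> ?c * (L ^ n / fact n)" if "y \<in> K" "L \<ge> 0"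
    "\<And>t. t \<in> {0..1} \<Longrightarrow> norm (om (p + t *\<^sub>R (y - p)) (y - p)) \<le> L" for y L n
    using bound[of y L 1 n] that by simp
  have KX: "K \<subseteq> X" and oK: "open K" using K by (auto simp: cvx_def)
  have sol_local: "(\<lambda>n. f n x) sums S x \<and> (S has_derivative (\<lambda>v. om x v ** S x)) (at x)" if x: "x \<in> K" for x
  proof -
    obtain r where r: "r > 0" "cball x r \<subseteq> K" using oK x open_contains_cball by blast
    \<comment> \<open>The cone from \<open>p\<close> over a small closed ball around
      \<open>x\<close> is compact, so \<open>om\<close> is bounded on it. This gives one convergent
      majorant for the whole ball, as termwise differentiation needs.\<close>
    define C where "C = (\<lambda>(y, t). p + t *\<^sub>R (y - p)) ` (cball x r \<times> {0..1::real})"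
    have "compact C" unfolding C_def
      by (intro compact_continuous_image compact_Times compact_cball compact_Icc)
        (auto intro!: continuous_intros simp: case_prod_unfold)
    have CK: "C \<subseteq> K" unfolding C_def using cvx_seg[OF K p] r(2) by auto
    have ball_C: "y \<in> C" if "y \<in> cball x r" for y
      unfolding C_def using that by (auto intro!: image_eqI[of _ _ "(y, 1)"])
    have "\<exists>b\<ge>0. \<forall>z\<in>C. \<forall>v. norm (om z v) \<le> b * norm v"
    proof -
      have "\<forall>i\<in>Basis. \<exists>b. \<forall>z\<in>C. norm (om z i) \<le> b"
      proof
        fix i :: 'a
        have "continuous_on C (\<lambda>z. om z i)"
          using KX CK by (intro continuous_at_imp_continuous_on ballI has_derivative_continuous[OF der_om]) auto
        then have "bounded ((\<lambda>z. om z i) ` C)" using \<open>compact C\<close> compact_continuous_image compact_imp_bounded by blast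
        then show "\<exists>b. \<forall>z\<in>C. norm (om z i) \<le> b" by (auto simp: bounded_iff)
      qed
      then obtain b where b: "\<And>i z. i \<in> Basis \<Longrightarrow> z \<in> C \<Longrightarrow> norm (om z i) \<le> b i" by metis
      have "norm (om z v) \<le> (\<Sum>i\<in>Basis. \<bar>b i\<bar>) * norm v" if z: "z \<in> C" for z v
      proof -
        have l: "linear (om z)" using lin_om z CK KX by blast
        have "om z v = (\<Sum>i\<in>Basis. (v \<bullet> i) *\<^sub>R om z i)"
          by (rule linear_Basis_expansion[OF l])
        also have "norm \<dots> \<le> (\<Sum>i\<in>Basis. norm v * \<bar>b i\<bar>)"
        proof (rule sum_norm_le)
          fix i :: 'a assume "i \<in> Basis"
          then show "norm ((v \<bullet> i) *\<^sub>R om z i) \<le> norm v * \<bar>b i\<bar>"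
            using Basis_le_norm[of i v] b[of i z] z by (auto intro!: mult_mono)
        qed
        finally show ?thesis by (simp add: sum_distrib_left mult.commute)
      qed
      then show ?thesis by (intro exI[of _ "\<Sum>i\<in>Basis. \<bar>b i\<bar>"]) (auto simp: sum_nonneg)
    qed
    then obtain b where b: "b \<ge> 0" "\<And>z v. z \<in> C \<Longrightarrow> norm (om z v) \<le> b * norm v" by blast
    define L where "L = b * (norm (x - p) + r)"
    have L0: "L \<ge> 0" using b r by (simp add: L_def)
    have fb: "norm (f n y) \<le> ?c * (L ^ n / fact n)" if y: "y \<in> cball x r" for y n
    proof (rule bd1[OF _ L0])
      show "y \<in> K" using y r by blast
      fix t :: real assume "t \<in> {0..1}"
      then have "p + t *\<^sub>R (y - p) \<in> C" using y unfolding C_def by auto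
      then have "norm (om (p + t *\<^sub>R (y - p)) (y - p)) \<le> b * norm (y - p)" by (rule b(2))
      moreover have "norm (y - p) \<le> norm (x - p) + r"
        using y norm_triangle_ineq[of "x - p" "y - x"] by (simp add: dist_norm norm_minus_commute)
      ultimately show "norm (om (p + t *\<^sub>R (y - p)) (y - p)) \<le> L"
        unfolding L_def using b(1) by (meson mult_left_mono order_trans)
    qed
    have sumexp: "summable (\<lambda>n. ?c * (L ^ n / fact n))"
      using summable_exp[of L] by (intro summable_mult) (simp add: field_simps)
    have fsum: "(\<lambda>n. f n y) sums S y" if "y \<in> cball x r" for y
      unfolding S_def by (intro summable_sums summable_comparison_test'[OF sumexp, of 0]) (use fb that in auto)
    have ex: "\<exists>g. \<forall>y\<in>ball x r. (\<lambda>n. f n y) sums g y \<and> (g has_derivative (\<lambda>v. om y v ** S y)) (at y within ball x r)"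
    proof (rule has_derivative_series)
      show "convex (ball x r)" by simp
      show "(f n has_derivative f' n y) (at y within ball x r)" if "y \<in> ball x r" for n y
      proof (rule has_derivative_at_withinI[OF fd'])
        show "y \<in> K" using that r(2) by (meson ball_subset_cball subsetD)
      qed
      show "x \<in> ball x r" using r by simp
      show "(\<lambda>n. f n x) sums S x" using fsum[of x] r by simp
      fix e :: real assume e: "e > 0"
      let ?tail = "\<lambda>n. \<Sum>k. ?c * (L ^ (k + n) / fact (k + n))"
      have "?tail \<longlonglongrightarrow> 0" using suminf_exist_split2[OF sumexp] .
      then have "(\<lambda>n. b * ?tail n) \<longlonglongrightarrow> b * 0" by (intro tendsto_intros)
      then have "\<forall>\<^sub>F n in sequentially. b * ?tail n < e" using e by (simp add: order_tendstoD)
      then obtain n0 where n0: "\<And>n. n \<ge> n0 \<Longrightarrow> b * ?tail n < e" by (auto simp: eventually_sequentially)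
      have "norm (sum (\<lambda>i. f' i y h) {..<n} - om y h ** S y) \<le> e * norm h" if n: "n \<ge> Suc n0" and y: "y \<in> ball x r" for n y h
      proof -
        \<comment> \<open>The index drops by one: the derivative of a partial sum with
          \<open>Suc m\<close> terms is \<open>om\<close> applied to the partial sum with
          \<open>m\<close> terms, so the error is governed by the tail from \<open>m\<close>
          on.\<close>
        obtain m where m: "n = Suc m" "m \<ge> n0" using n by (cases n) auto
        have yc: "y \<in> cball x r" using y by simp
        have "sum (\<lambda>i. f' i y h) {..<n} = om y h ** (\<Sum>i<m. f i y)"
          unfolding m(1) by (simp add: sum.lessThan_Suc_shift f'_def matrix_mult_sum_right del: sum.lessThan_Suc)
        then have "sum (\<lambda>i. f' i y h) {..<n} - om y h ** S y = - (om y h ** (S y - (\<Sum>i<m. f i y)))"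
          by (simp add: matrix_mult_diff_right)
        also have "norm \<dots> \<le> norm (om y h) * norm (S y - (\<Sum>i<m. f i y))"
          by (simp add: norm_matrix_mult_le)
        also have "S y - (\<Sum>i<m. f i y) = (\<Sum>k. f (k + m) y)"
          using suminf_split_initial_segment[OF sums_summable[OF fsum[OF yc]], of m] by (simp add: S_def)
        also have "norm (\<Sum>k. f (k + m) y) \<le> ?tail m"
          by (intro norm_suminf_le summable_ignore_initial_segment[OF sumexp]) (rule fb[OF yc])
        also have "norm (om y h) * ?tail m \<le> (b * norm h) * ?tail m"
        proof (intro mult_right_mono b(2) ball_C yc)
          show "0 \<le> ?tail m"
            by (rule suminf_nonneg[OF summable_ignore_initial_segment[OF sumexp]]) (use L0 in simp)
        qed
        also have "\<dots> = (b * ?tail m) * norm h" by simp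
        also have "\<dots> \<le> e * norm h" using n0[OF m(2)] by (intro mult_right_mono) auto
        finally show ?thesis by (simp add: mult_left_mono)
      qed
      then show "\<forall>\<^sub>F n in sequentially. \<forall>y\<in>ball x r. \<forall>h. norm (sum (\<lambda>i. f' i y h) {..<n} - om y h ** S y) \<le> e * norm h"
        unfolding eventually_sequentially by blast
    qed
    then obtain g where g: "\<And>y. y \<in> ball x r \<Longrightarrow> (\<lambda>n. f n y) sums g y"
      "\<And>y. y \<in> ball x r \<Longrightarrow> (g has_derivative (\<lambda>v. om y v ** S y)) (at y within ball x r)" by blast
    have gS: "g y = S y" if "y \<in> ball x r" for y by (rule sums_unique2[OF g(1)[OF that] fsum]) (use that in auto)
    have "(g has_derivative (\<lambda>v. om x v ** S x)) (at x)"
      using g(2)[of x] at_within_open[of x "ball x r"] r(1) by simp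
    then have "(S has_derivative (\<lambda>v. om x v ** S x)) (at x)"
      using r(1) gS by (auto elim!: has_derivative_transform_within_open[OF _ open_ball, of _ _ x UNIV x r])
    then show ?thesis using fsum[of x] r(1) by simp
  qed
  have "S p = mat 1"
  proof -
    have "(\<lambda>n. f n p) = (\<lambda>n. if n = 0 then mat 1 else 0)"
    proof
      show "f n p = (if n = 0 then mat 1 else 0)" for n by (cases n) (auto simp: f0 fp)
    qed
    then have "(\<lambda>n. f n p) sums mat 1" using sums_single[of 0 "\<lambda>_. mat 1 :: complex ^ 'm ^ 'm"] by simp
    then show ?thesis using sums_unique2 conjunct1[OF sol_local[OF p]] by metis
  qed
  moreover have "norm (S y - mat 1) \<le> ?c * (exp L - 1)" if y: "y \<in> K" and L: "L \<ge> 0"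
    "\<forall>t\<in>{0..1}. norm (om (p + t *\<^sub>R (y - p)) (y - p)) \<le> L" for y L
  proof -
    have e: "(\<lambda>n. ?c * (L ^ n / fact n)) sums (?c * exp L)"
      using exp_converges[of L] by (intro sums_mult) (simp add: divide_inverse mult.commute)
    have "(\<lambda>n. f (Suc n) y) sums (S y - f 0 y)" using sol_local[OF y] by (subst sums_Suc_iff) simp
    moreover have "(\<lambda>n. ?c * (L ^ Suc n / fact (Suc n))) sums (?c * exp L - ?c)"
      using e by (subst sums_Suc_iff) simp
    moreover have "norm (f (Suc n) y) \<le> ?c * (L ^ Suc n / fact (Suc n))" for n
      using bd1[of y L "Suc n"] y L by blast
    ultimately have "norm (S y - f 0 y) \<le> ?c * exp L - ?c"
      by (metis (no_types, lifting) norm_suminf_le sums_iff)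
    then show ?thesis by (simp add: f0 right_diff_distrib)
  qed
  ultimately show ?thesis using sol_local by (auto simp: sol_def)
qed

end

text \<open>The dual connection. The transpose \<open>Z\<close> of its frame satisfies dZ = - Z om
  and therefore inverts the frame of \<open>om\<close>.\<close>

lemma (in flat_form) flat_form_dual: "flat_form X (\<lambda>x v. - transpose (om x v)) (\<lambda>x u v. - transpose (om' x u v))"
proof (rule flat_form.intro)
  show "open X" by (rule open_X)
  show "linear (\<lambda>v. - transpose (om x v))" if "x \<in> X" for x
    using linear_compose_neg[OF linear_compose[OF lin_om[OF that] bounded_linear.linear[OF bounded_linear_transpose]]]
    by (simp add: o_def)
  show "((\<lambda>x. - transpose (om x v)) has_derivative (\<lambda>u. - transpose (om' x u v))) (at x)" if "x \<in> X" for x v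
    by (intro has_derivative_minus bounded_linear.has_derivative[OF bounded_linear_transpose] der_om that)
  show "- transpose (om' x u v) = - transpose (om' x v u)" if "x \<in> X" for x u v
    using closed_om[OF that, of u v] by simp
  show "continuous_on X (\<lambda>x. - transpose (om' x u v))" for u v
    by (intro continuous_intros bounded_linear.continuous_on[OF bounded_linear_transpose] cont_om')
  show "- transpose (om x u) ** - transpose (om x v) = - transpose (om x v) ** - transpose (om x u)" if "x \<in> X" for x u v
    using arg_cong[OF comm_om[OF that, of u v], of transpose]
    by (simp add: matrix_mult_minus_left matrix_mult_minus_right matrix_transpose_mul)
qed

section \<open>Uniqueness of solutions and transport inside convex sets\<close>

context flat_form
begin

text \<open>With \<open>Z\<close> the transposed dual frame, \<open>Z x ** U x\<close> has zero
  derivative for every solution \<open>U\<close>, hence is constant on the convex set. Taking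
  \<open>U = S\<close> shows that \<open>Z\<close> inverts \<open>S\<close>.\<close>

lemma sol_determined:
  assumes K: "cvx K" and p: "p \<in> K" and S: "S p = mat 1" "sol K S"
  shows "\<exists>Z. (\<forall>x\<in>K. Z x ** S x = mat 1 \<and> S x ** Z x = mat 1) \<and>
    (\<forall>U. sol K U \<longrightarrow> (\<forall>x\<in>K. U x = S x ** U p))"
proof -
  interpret dual: flat_form X "\<lambda>x v. - transpose (om x v)" "\<lambda>x u v. - transpose (om' x u v)"
    by (rule flat_form_dual)
  have "dual.cvx K" using K by (simp add: cvx_def dual.cvx_def)
  then obtain Y where Y: "Y p = mat 1" "dual.sol K Y" using dual.frame_exists p by blast
  define Z where "Z x = transpose (Y x)" for x
  have Zd: "(Z has_derivative (\<lambda>v. - (Z x ** om x v))) (at x)" if "x \<in> K" for x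
  proof -
    have "(Z has_derivative (\<lambda>v. transpose (- transpose (om x v) ** Y x))) (at x)"
      unfolding Z_def using Y(2) that
      by (intro bounded_linear.has_derivative[OF bounded_linear_transpose]) (auto simp: dual.sol_def)
    moreover have "transpose (- transpose (om x v) ** Y x) = - (Z x ** om x v)" for v
    proof -
      have "transpose (- transpose (om x v) ** Y x) = - transpose (transpose (om x v) ** Y x)"
        by (simp add: matrix_mult_minus_left) (simp add: transpose_def vec_eq_iff)
      then show ?thesis by (simp add: matrix_transpose_mul Z_def)
    qed
    ultimately show ?thesis by simp
  qed
  have Zp: "Z p = mat 1" by (simp add: Z_def Y(1))
  have const: "Z x ** U x = U p" if U: "sol K U" and x: "x \<in> K" for U x
  proof -
    have "((\<lambda>x. Z x ** U x) has_derivative (\<lambda>v. 0)) (at y within K)" if y: "y \<in> K" for y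
    proof -
      have "((\<lambda>x. Z x ** U x) has_derivative (\<lambda>v. Z y ** (om y v ** U y) + - (Z y ** om y v) ** U y)) (at y)"
        using U y by (intro has_derivative_matrix_mult Zd) (auto simp: sol_def)
      then show ?thesis by (simp add: matrix_mult_minus_left matrix_mul_assoc has_derivative_at_withinI)
    qed
    then have "Z x ** U x = Z p ** U p"
      using has_derivative_zero_unique[of K "\<lambda>x. Z x ** U x" x p] K x p by (auto simp: cvx_def)
    then show ?thesis by (simp add: Zp)
  qed
  have ZS: "Z x ** S x = mat 1" if "x \<in> K" for x using const[OF S(2) that] S(1) by simp
  then have SZ: "S x ** Z x = mat 1" if "x \<in> K" for x using that matrix_left_right_inverse by blast
  have "U x = S x ** U p" if "sol K U" "x \<in> K" for U x
  proof -
    have "S x ** U p = (S x ** Z x) ** U x" using const[OF that] by (simp add: matrix_mul_assoc[symmetric])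
    then show ?thesis using SZ[OF that(2)] by simp
  qed
  then show ?thesis using ZS SZ by blast
qed

text \<open>A description without naming the convex set is legitimate: two admissible sets intersect
  in an admissible set that still contains both points, and solutions agree there.\<close>

definition T :: "'a \<Rightarrow> 'a \<Rightarrow> complex ^ 'm ^ 'm" where
  "T p x = (THE M. \<exists>K S. cvx K \<and> p \<in> K \<and> x \<in> K \<and> S p = mat 1 \<and> sol K S \<and> M = S x)"

lemma sol_mono: "sol K S \<Longrightarrow> K' \<subseteq> K \<Longrightarrow> sol K' S"
  by (auto simp: sol_def)

lemma T_eq:
  assumes K: "cvx K" and p: "p \<in> K" and x: "x \<in> K" and S: "S p = mat 1" "sol K S"
  shows "T p x = S x"
  unfolding T_def
proof (rule the_equality)
  show "\<exists>K S'. cvx K \<and> p \<in> K \<and> x \<in> K \<and> S' p = mat 1 \<and> sol K S' \<and> S x = S' x" using assms by blast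
  fix M assume "\<exists>K S'. cvx K \<and> p \<in> K \<and> x \<in> K \<and> S' p = mat 1 \<and> sol K S' \<and> M = S' x"
  then obtain K' S' where *: "cvx K'" "p \<in> K'" "x \<in> K'" "S' p = mat 1" "sol K' S'" "M = S' x" by blast
  have "cvx (K \<inter> K')" using K *(1) by (rule cvx_Int)
  moreover have "sol (K \<inter> K') S" "sol (K \<inter> K') S'" using S(2) *(5) by (auto intro: sol_mono)
  ultimately have "S' x = S x ** S' p" using sol_determined[of "K \<inter> K'" p S] S p x * by blast
  then show "M = S x" using * by simp
qed

lemma T_frame:
  assumes K: "cvx K" and p: "p \<in> K"
  shows "sol K (T p)"
proof -
  obtain S where S: "S p = mat 1" "sol K S" using frame_exists[OF assms] by blast
  have TS: "T p x = S x" if "x \<in> K" for x by (rule T_eq[OF K p that S])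
  show ?thesis unfolding sol_def
  proof
    fix x assume x: "x \<in> K"
    have "(S has_derivative (\<lambda>v. om x v ** S x)) (at x)" using S(2) x by (simp add: sol_def)
    then show "(T p has_derivative (\<lambda>v. om x v ** T p x)) (at x)"
      unfolding TS[OF x]
      by (rule has_derivative_transform_within_open[OF _ _ x]) (use K TS in \<open>auto simp: cvx_def\<close>)
  qed
qed

lemma T_refl: "p \<in> X \<Longrightarrow> T p p = mat 1"
proof -
  assume "p \<in> X"
  then obtain r where "r > 0" "ball p r \<subseteq> X" using open_X open_contains_ball by blast
  then have K: "cvx (ball p r)" "p \<in> ball p r" by (auto simp: cvx_def)
  obtain S where S: "S p = mat 1" "sol (ball p r) S" using frame_exists[OF K] by blast
  show ?thesis using T_eq[OF K(1) K(2) K(2) S] S by simp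
qed

lemma sol_T:
  assumes K: "cvx K" "p \<in> K" "x \<in> K" and U: "sol K U"
  shows "U x = T p x ** U p"
  using sol_determined[OF K(1,2) T_refl T_frame[OF K(1,2)]] K U by (auto simp: cvx_def)

lemma T_trans: "cvx K \<Longrightarrow> p \<in> K \<Longrightarrow> q \<in> K \<Longrightarrow> x \<in> K \<Longrightarrow> T q x ** T p q = T p x"
  using sol_T[of K q x "T p"] T_frame by simp

lemma T_inverse: "cvx K \<Longrightarrow> p \<in> K \<Longrightarrow> q \<in> K \<Longrightarrow> T q p ** T p q = mat 1"
  using T_trans[of K p q p] T_refl[of p] by (auto simp: cvx_def)

lemma T_bound:
  assumes K: "cvx K" "p \<in> K" "x \<in> K" and L: "L \<ge> 0"
    and bd: "\<And>t. t \<in> {0..1} \<Longrightarrow> norm (om (p + t *\<^sub>R (x - p)) (x - p)) \<le> L"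
  shows "norm (T p x - mat 1) \<le> norm (mat 1 :: complex ^ 'm ^ 'm) * (exp L - 1)"
proof -
  obtain S where S: "S p = mat 1" "sol K S" "\<forall>y\<in>K. \<forall>L\<ge>0.
    (\<forall>t\<in>{0..1}. norm (om (p + t *\<^sub>R (y - p)) (y - p)) \<le> L) \<longrightarrow>
    norm (S y - mat 1) \<le> norm (mat 1 :: complex ^ 'm ^ 'm) * (exp L - 1)"
    using frame_exists[OF K(1,2)] by blast
  show ?thesis using T_eq[OF K S(1,2)] S(3) K(3) L bd by simp
qed

end

section \<open>Logarithmic connections of hyperplane arrangements\<close>

definition linear_form :: "(complex ^ 'n \<Rightarrow> complex) \<Rightarrow> bool" where
  "linear_form f \<longleftrightarrow> Vector_Spaces.linear (*s) (*) f"

lemma linear_form_iff: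
  "linear_form f \<longleftrightarrow> (\<forall>u v. f (u + v) = f u + f v) \<and> (\<forall>c v. f (c *s v) = c * f v)"
proof -
  have "module ((*) :: complex \<Rightarrow> complex \<Rightarrow> complex)" by unfold_locales (simp_all add: algebra_simps)
  moreover have "vector_space ((*) :: complex \<Rightarrow> complex \<Rightarrow> complex)" by unfold_locales (simp_all add: algebra_simps)
  moreover have "module ((*s) :: complex \<Rightarrow> complex ^ 'n \<Rightarrow> _)" by unfold_locales
  moreover have "vector_space ((*s) :: complex \<Rightarrow> complex ^ 'n \<Rightarrow> _)" by unfold_locales
  ultimately show ?thesis
    unfolding linear_form_def Vector_Spaces.linear_def module_hom_def module_hom_axioms_def by blast
qed

lemma linear_form_add: "linear_form f \<Longrightarrow> f (u + v) = f u + f v"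
  and linear_form_scale: "linear_form f \<Longrightarrow> f (c *s v) = c * f v"
  by (auto simp: linear_form_iff)

lemma scaleR_eq_smult: "r *\<^sub>R (v :: complex ^ 'n) = complex_of_real r *s v"
  by (simp add: vec_eq_iff) (simp add: scaleR_conv_of_real)

lemma linear_form_scaleR: "linear_form f \<Longrightarrow> f (r *\<^sub>R v) = complex_of_real r * f v"
  by (simp add: scaleR_eq_smult linear_form_scale)

lemma linear_form_diff: "linear_form f \<Longrightarrow> f (u - v) = f u - f v"
  using linear_form_add[of f "u - v" v] by simp

lemma linear_form_0: "linear_form f \<Longrightarrow> f 0 = 0"
  using linear_form_diff[of f 0 0] by simp

lemma linear_form_linear: "linear_form f \<Longrightarrow> linear f"
  by (rule linearI) (simp_all add: linear_form_add linear_form_scaleR scaleR_conv_of_real[where 'a = complex])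

lemma linear_form_bounded_linear: "linear_form f \<Longrightarrow> bounded_linear f"
  using linear_form_linear linear_conv_bounded_linear by blast

lemma linear_form_kernel_subset:
  assumes f: "linear_form f" and g: "linear_form g" and sub: "\<And>v. f v = 0 \<Longrightarrow> g v = 0" and e: "f e = 1"
  shows "g v = f v * g e"
proof -
  have "f (v - f v *s e) = 0" by (simp add: linear_form_diff[OF f] linear_form_scale[OF f] e)
  then have "g (v - f v *s e) = 0" by (rule sub)
  then show ?thesis by (simp add: linear_form_diff[OF g] linear_form_scale[OF g])
qed

locale arrangement =
  fixes \<A> :: "(complex ^ 'n) set set" and \<alpha> :: "(complex ^ 'n) set \<Rightarrow> complex ^ 'n \<Rightarrow> complex"
  assumes finite_A: "finite \<A>"
    and form: "H \<in> \<A> \<Longrightarrow> linear_form (\<alpha> H)"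
    and kernel: "H \<in> \<A> \<Longrightarrow> {v. \<alpha> H v = 0} = H"
    and proper: "H \<in> \<A> \<Longrightarrow> H \<noteq> UNIV"
begin

lemma kernel_iff: "H \<in> \<A> \<Longrightarrow> v \<in> H \<longleftrightarrow> \<alpha> H v = 0"
  using kernel by auto

definition X :: "(complex ^ 'n) set" where
  "X = UNIV - \<Union>\<A>"

lemma X_iff: "x \<in> X \<longleftrightarrow> (\<forall>H\<in>\<A>. \<alpha> H x \<noteq> 0)"
  unfolding X_def using kernel_iff by auto

lemma cont_form: "H \<in> \<A> \<Longrightarrow> continuous_on S (\<alpha> H)"
  using linear_form_bounded_linear[OF form] linear_continuous_on by blast

lemma open_X: "open X"
proof -
  have "closed H" if "H \<in> \<A>" for H
    using continuous_closed_preimage_constant[OF cont_form[OF that] closed_UNIV, of 0] kernel[OF that] by simp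
  then show ?thesis unfolding X_def using finite_A by (intro open_Diff closed_Union) auto
qed

lemma unit_vector: "H \<in> \<A> \<Longrightarrow> \<exists>e. \<alpha> H e = 1"
proof -
  assume H: "H \<in> \<A>"
  then obtain v where "\<alpha> H v \<noteq> 0" using proper kernel_iff by blast
  then have "\<alpha> H (inverse (\<alpha> H v) *s v) = 1" by (simp add: linear_form_scale[OF form[OF H]])
  then show ?thesis by blast
qed

lemma not_subset: "H \<in> \<A> \<Longrightarrow> K \<in> \<A> \<Longrightarrow> H \<noteq> K \<Longrightarrow> \<exists>v. \<alpha> H v = 0 \<and> \<alpha> K v = 1"
proof -
  assume *: "H \<in> \<A>" "K \<in> \<A>" "H \<noteq> K"
  obtain e where e: "\<alpha> H e = 1" using unit_vector *(1) by blast
  have "\<exists>v. \<alpha> H v = 0 \<and> \<alpha> K v \<noteq> 0"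
  proof (rule ccontr)
    assume "\<not> ?thesis"
    then have **: "\<alpha> K v = \<alpha> H v * \<alpha> K e" for v
      using linear_form_kernel_subset[OF form form _ e] * by blast
    obtain f where "\<alpha> K f = 1" using unit_vector *(2) by blast
    then have "\<alpha> K e \<noteq> 0" using **[of f] by auto
    then have "\<alpha> K v = 0 \<longleftrightarrow> \<alpha> H v = 0" for v using **[of v] by simp
    then have "H = K" using * kernel_iff by blast
    with * show False by simp
  qed
  then obtain v where v: "\<alpha> H v = 0" "\<alpha> K v \<noteq> 0" by blast
  then have "\<alpha> H (inverse (\<alpha> K v) *s v) = 0 \<and> \<alpha> K (inverse (\<alpha> K v) *s v) = 1"
    using * by (simp add: linear_form_scale[OF form])
  then show ?thesis by blast
qed

lemma pencil:
  assumes H: "H \<in> \<A>" "K \<in> \<A>" "H \<noteq> K" and L: "L \<in> \<A>" "H \<inter> K \<subseteq> L"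
  shows "\<exists>c d. \<forall>v. \<alpha> L v = c * \<alpha> H v + d * \<alpha> K v"
proof -
  obtain f where f: "\<alpha> H f = 0" "\<alpha> K f = 1" using not_subset H by blast
  obtain e where e: "\<alpha> K e = 0" "\<alpha> H e = 1" using not_subset H by metis
  note fH = form[OF H(1)] and fK = form[OF H(2)] and fL = form[OF L(1)]
  have "\<alpha> L v = \<alpha> L e * \<alpha> H v + \<alpha> L f * \<alpha> K v" for v
  proof -
    let ?w = "v - \<alpha> H v *s e - \<alpha> K v *s f"
    have "\<alpha> H ?w = 0" "\<alpha> K ?w = 0"
      by (simp_all add: linear_form_diff[OF fH] linear_form_scale[OF fH] linear_form_diff[OF fK] linear_form_scale[OF fK] e f)
    then have "?w \<in> L" using L(2) kernel_iff H by auto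
    then have "\<alpha> L ?w = 0" using kernel_iff L(1) by blast
    then show ?thesis by (simp add: linear_form_diff[OF fL] linear_form_scale[OF fL] diff_eq_eq add.commute mult.commute)
  qed
  then show ?thesis by blast
qed

text \<open>The forms of \<open>H\<close> and \<open>K\<close> are combinations of those of
  \<open>H1\<close> and \<open>H2\<close>; as \<open>H \<noteq> K\<close> the determinant of the
  coefficients is nonzero, so the two pairs have the same common zeros.\<close>

lemma pencil_Int:
  assumes "H \<in> \<A>" "K \<in> \<A>" "H1 \<in> \<A>" "H2 \<in> \<A>" "H1 \<noteq> H2" "H \<noteq> K"
    and sub: "H1 \<inter> H2 \<subseteq> H" "H1 \<inter> H2 \<subseteq> K"
  shows "H \<inter> K = H1 \<inter> H2"
proof
  show "H1 \<inter> H2 \<subseteq> H \<inter> K" using sub by blast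
  obtain c d where cd: "\<And>v. \<alpha> H v = c * \<alpha> H1 v + d * \<alpha> H2 v"
    using pencil[OF assms(3,4,5) assms(1) sub(1)] by blast
  obtain c' d' where cd': "\<And>v. \<alpha> K v = c' * \<alpha> H1 v + d' * \<alpha> H2 v"
    using pencil[OF assms(3,4,5) assms(2) sub(2)] by blast
  obtain f where f: "\<alpha> H f = 0" "\<alpha> K f = 1" using not_subset assms by blast
  obtain e where e: "\<alpha> K e = 0" "\<alpha> H e = 1" using not_subset assms by metis
  have det: "c * d' - d * c' \<noteq> 0"
  proof
    assume *: "c * d' - d * c' = 0"
    have "c' * \<alpha> H v = c * \<alpha> K v" "d' * \<alpha> H v = d * \<alpha> K v" for v
      using * unfolding cd cd' by algebra+
    from this[of e] this[of f] have "c' = 0" "d' = 0" using e f by auto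
    then show False using cd'[of f] f by simp
  qed
  show "H \<inter> K \<subseteq> H1 \<inter> H2"
  proof
    fix v assume "v \<in> H \<inter> K"
    then have "c * \<alpha> H1 v + d * \<alpha> H2 v = 0" "c' * \<alpha> H1 v + d' * \<alpha> H2 v = 0"
      using kernel_iff assms cd cd' by auto
    then have "(c * d' - d * c') * \<alpha> H1 v = 0" "(c * d' - d * c') * \<alpha> H2 v = 0" by algebra+
    then show "v \<in> H1 \<inter> H2" using det kernel_iff assms by auto
  qed
qed

definition lform :: "((complex ^ 'n) set \<Rightarrow> complex ^ 'm ^ 'm) \<Rightarrow> complex ^ 'n \<Rightarrow> complex ^ 'n \<Rightarrow> complex ^ 'm ^ 'm" where
  "lform A x v = (\<Sum>H\<in>\<A>. mat (\<alpha> H v / \<alpha> H x) ** A H)"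

definition lform' :: "((complex ^ 'n) set \<Rightarrow> complex ^ 'm ^ 'm) \<Rightarrow> complex ^ 'n \<Rightarrow> complex ^ 'n \<Rightarrow> complex ^ 'n \<Rightarrow> complex ^ 'm ^ 'm" where
  "lform' A x u v = (\<Sum>H\<in>\<A>. mat (- (\<alpha> H u * \<alpha> H v) / (\<alpha> H x)\<^sup>2) ** A H)"

text \<open>Arnold's relation for the logarithmic forms of a pencil. All forms in the pencil depend
  on the two coordinates given by \<open>H1\<close> and \<open>H2\<close>, so each wedge product is
  a multiple of the same determinant, and the multiples satisfy a partial fraction identity.\<close>

lemma arnold:
  assumes "H1 \<in> \<A>" "H2 \<in> \<A>" "H1 \<noteq> H2" "H \<in> \<A>" "K \<in> \<A>" "H1 \<inter> H2 \<subseteq> H" "H1 \<inter> H2 \<subseteq> K" "x \<in> X"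
  defines "\<kappa> \<equiv> \<lambda>u v H K. \<alpha> H u / \<alpha> H x * (\<alpha> K v / \<alpha> K x) - \<alpha> H v / \<alpha> H x * (\<alpha> K u / \<alpha> K x)"
  shows "\<kappa> u v H K = \<kappa> u v H1 K - \<kappa> u v H1 H"
proof -
  obtain c d where cd: "\<And>v. \<alpha> H v = c * \<alpha> H1 v + d * \<alpha> H2 v"
    using pencil[OF assms(1-3) assms(4) assms(6)] by blast
  obtain c' d' where cd': "\<And>v. \<alpha> K v = c' * \<alpha> H1 v + d' * \<alpha> H2 v"
    using pencil[OF assms(1-3) assms(5) assms(7)] by blast
  let ?D = "\<alpha> H1 u * \<alpha> H2 v - \<alpha> H1 v * \<alpha> H2 u"
  have nz: "\<alpha> H x \<noteq> 0" "\<alpha> K x \<noteq> 0" "\<alpha> H1 x \<noteq> 0" using assms X_iff by auto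
  have 1: "\<kappa> u v P Q = (\<alpha> P u * \<alpha> Q v - \<alpha> P v * \<alpha> Q u) / (\<alpha> P x * \<alpha> Q x)" for P Q
    unfolding \<kappa>_def by (simp add: diff_divide_distrib)
  have "\<kappa> u v H K = ?D * (c * d' - d * c') / (\<alpha> H x * \<alpha> K x)"
    unfolding 1 by (rule arg_cong2[of _ _ _ _ "(/)"]) (simp_all add: cd cd' algebra_simps)
  moreover have "\<kappa> u v H1 K = ?D * d' / (\<alpha> H1 x * \<alpha> K x)"
    unfolding 1 by (rule arg_cong2[of _ _ _ _ "(/)"]) (simp_all add: cd cd' algebra_simps)
  moreover have "\<kappa> u v H1 H = ?D * d / (\<alpha> H1 x * \<alpha> H x)"
    unfolding 1 by (rule arg_cong2[of _ _ _ _ "(/)"]) (simp_all add: cd cd' algebra_simps)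
  moreover have "?D * d' / (\<alpha> H1 x * \<alpha> K x) - ?D * d / (\<alpha> H1 x * \<alpha> H x) = ?D * (d' * \<alpha> H x - d * \<alpha> K x) / (\<alpha> H1 x * \<alpha> H x * \<alpha> K x)"
    using nz by (simp add: field_simps)
  moreover have "d' * \<alpha> H x - d * \<alpha> K x = (c * d' - d * c') * \<alpha> H1 x"
    by (simp add: cd cd' algebra_simps)
  ultimately show ?thesis using nz by simp
qed

text \<open>The infinitesimal braid relations: for every flat of codimension two, the residue of
  each hyperplane through it commutes with the sum of all residues through it. The flat is given as
  an intersection \<open>H1 \<inter> H2\<close>.\<close>

definition holonomy :: "((complex ^ 'n) set \<Rightarrow> complex ^ 'm ^ 'm) \<Rightarrow> bool" where
  "holonomy A \<longleftrightarrow> (\<forall>H1\<in>\<A>. \<forall>H2\<in>\<A>. \<forall>H\<in>\<A>. H1 \<noteq> H2 \<longrightarrow> H1 \<inter> H2 \<subseteq> H \<longrightarrow>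
     A H ** (\<Sum>K\<in>{K\<in>\<A>. H1 \<inter> H2 \<subseteq> K}. A K) = (\<Sum>K\<in>{K\<in>\<A>. H1 \<inter> H2 \<subseteq> K}. A K) ** A H)"

text \<open>The commutator is a sum over ordered pairs of distinct hyperplanes. Grouping pairs by
  their intersection and rewriting each group by Arnold's relation leaves only products with the sum
  \<open>\<Phi>\<close> of the group, and these cancel because \<open>\<Phi>\<close> commutes with
  each residue.\<close>

lemma lform_commute:
  fixes A :: "(complex ^ 'n) set \<Rightarrow> complex ^ 'm ^ 'm"
  assumes hol: "holonomy A" and x: "x \<in> X"
  shows "lform A x u ** lform A x v = lform A x v ** lform A x u"
proof -
  define \<kappa> where "\<kappa> H K = \<alpha> H u / \<alpha> H x * (\<alpha> K v / \<alpha> K x) - \<alpha> H v / \<alpha> H x * (\<alpha> K u / \<alpha> K x)" for H K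
  define f where "f = (\<lambda>(H, K). mat (\<kappa> H K) ** (A H ** A K))"
  define D where "D = {(H, K). H \<in> \<A> \<and> K \<in> \<A> \<and> H \<noteq> K}"
  define g where "g = (\<lambda>(H :: (complex ^ 'n) set, K). H \<inter> K)"
  have prod: "lform A x a ** lform A x b = (\<Sum>(H, K)\<in>\<A> \<times> \<A>. mat (\<alpha> H a / \<alpha> H x * (\<alpha> K b / \<alpha> K x)) ** (A H ** A K))" for a b
  proof -
    have "(mat c ** A H) ** (mat d ** A K) = mat (c * d) ** (A H ** A K)" for c d H K
      by (metis mat_left_commute mat_mat_mult matrix_mul_assoc)
    then show ?thesis unfolding lform_def matrix_mult_sum_left matrix_mult_sum_right
      by (subst sum.swap) (simp add: sum.cartesian_product)
  qed
  have "lform A x u ** lform A x v - lform A x v ** lform A x u = (\<Sum>p\<in>\<A> \<times> \<A>. f p)"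
  proof -
    have "mat a ** B - mat b ** B = mat (a - b) ** B" for a b and B :: "complex ^ 'm ^ 'm"
      by (simp add: vec_eq_iff left_diff_distrib)
    then show ?thesis
      unfolding prod sum_subtractf[symmetric] by (intro sum.cong refl) (simp add: f_def \<kappa>_def case_prod_unfold)
  qed
  also have "\<dots> = (\<Sum>p\<in>D. f p)"
    by (rule sum.mono_neutral_right) (auto simp: D_def f_def \<kappa>_def finite_A)
  also have "\<dots> = (\<Sum>L\<in>g ` D. \<Sum>p\<in>{p \<in> D. g p = L}. f p)"
  proof -
    have "finite D" by (rule finite_subset[of _ "\<A> \<times> \<A>"]) (auto simp: D_def finite_A)
    then show ?thesis by (intro sum.group[symmetric]) auto
  qed
  also have "\<dots> = 0"
  proof (rule sum.neutral, safe)
    fix H1 H2 assume D: "(H1, H2) \<in> D"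
    then have H12: "H1 \<in> \<A>" "H2 \<in> \<A>" "H1 \<noteq> H2" by (auto simp: D_def)
    define N where "N = {H \<in> \<A>. H1 \<inter> H2 \<subseteq> H}"
    have fN: "finite N" by (simp add: N_def finite_A)
    define \<Phi> where "\<Phi> = sum A N"
    have comm: "A H ** \<Phi> = \<Phi> ** A H" if "H \<in> N" for H
      using hol H12 that unfolding holonomy_def N_def \<Phi>_def by blast
    \<comment> \<open>Distinct members of the pencil all have the same intersection, so a group
      consists of the off-diagonal pairs of \<open>N\<close>; the diagonal can be added since
      \<open>\<kappa>\<close> vanishes on it.\<close>
    have "(\<Sum>p\<in>{p \<in> D. g p = g (H1, H2)}. f p) = (\<Sum>p\<in>N \<times> N. f p)"
    proof (rule sum.mono_neutral_left)
      show "finite (N \<times> N)" using fN by simp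
      show "{p \<in> D. g p = g (H1, H2)} \<subseteq> N \<times> N" by (auto simp: D_def g_def N_def)
      show "\<forall>p\<in>N \<times> N - {p \<in> D. g p = g (H1, H2)}. f p = 0"
      proof
        fix p assume p: "p \<in> N \<times> N - {p \<in> D. g p = g (H1, H2)}"
        obtain H K where HK: "p = (H, K)" by (cases p)
        then have "H = K" using p pencil_Int[of H K H1 H2] H12 unfolding N_def D_def g_def by auto
        then show "f p = 0" by (simp add: f_def \<kappa>_def HK)
      qed
    qed
    also have "\<dots> = (\<Sum>H\<in>N. \<Sum>K\<in>N. mat (\<kappa> H1 K - \<kappa> H1 H) ** (A H ** A K))"
    proof -
      have "(\<Sum>p\<in>N \<times> N. f p) = (\<Sum>H\<in>N. \<Sum>K\<in>N. f (H, K))" by (simp add: sum.cartesian_product)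
      also have "f (H, K) = mat (\<kappa> H1 K - \<kappa> H1 H) ** (A H ** A K)" if "H \<in> N" "K \<in> N" for H K
        using arnold[OF H12 _ _ _ _ x, of H K u v] that by (simp add: f_def \<kappa>_def N_def)
      then have "(\<Sum>H\<in>N. \<Sum>K\<in>N. f (H, K)) = (\<Sum>H\<in>N. \<Sum>K\<in>N. mat (\<kappa> H1 K - \<kappa> H1 H) ** (A H ** A K))"
        by (intro sum.cong refl)
      finally show ?thesis .
    qed
    also have "\<dots> = (\<Sum>H\<in>N. \<Sum>K\<in>N. mat (\<kappa> H1 K) ** (A H ** A K)) - (\<Sum>H\<in>N. \<Sum>K\<in>N. mat (\<kappa> H1 H) ** (A H ** A K))"
      unfolding sum_subtractf[symmetric] by (intro sum.cong refl) (simp add: vec_eq_iff left_diff_distrib)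
    also have "(\<Sum>H\<in>N. \<Sum>K\<in>N. mat (\<kappa> H1 K) ** (A H ** A K)) = (\<Sum>K\<in>N. mat (\<kappa> H1 K) ** (\<Phi> ** A K))"
      by (subst sum.swap) (simp add: \<Phi>_def matrix_mult_sum_left matrix_mult_sum_right)
    also have "(\<Sum>H\<in>N. \<Sum>K\<in>N. mat (\<kappa> H1 H) ** (A H ** A K)) = (\<Sum>H\<in>N. mat (\<kappa> H1 H) ** (A H ** \<Phi>))"
      by (simp add: \<Phi>_def matrix_mult_sum_right)
    also have "\<dots> = (\<Sum>K\<in>N. mat (\<kappa> H1 K) ** (\<Phi> ** A K))"
      using comm by (intro sum.cong) auto
    finally show "(\<Sum>p\<in>{p \<in> D. g p = g (H1, H2)}. f p) = 0" by simp
  qed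
  finally show ?thesis by simp
qed

lemma flat_lform:
  assumes hol: "holonomy A"
  shows "flat_form X (lform A) (lform' A)"
proof (rule flat_form.intro)
  show "open X" by (rule open_X)
  show "linear (lform A x)" if "x \<in> X" for x
  proof (rule linearI)
    show "lform A x (u + v) = lform A x u + lform A x v" for u v
      unfolding lform_def sum.distrib[symmetric]
      by (intro sum.cong refl) (simp add: linear_form_add[OF form] add_divide_distrib mat_add_mult)
    show "lform A x (r *\<^sub>R v) = r *\<^sub>R lform A x v" for r v
      unfolding lform_def scaleR_sum_right
      by (intro sum.cong refl) (simp add: linear_form_scaleR[OF form] vec_eq_iff scaleR_conv_of_real[where 'a = complex])
  qed
  show "((\<lambda>x. lform A x v) has_derivative (\<lambda>u. lform' A x u v)) (at x)" if x: "x \<in> X" for x v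
    unfolding lform_def lform'_def
  proof (rule has_derivative_sum)
    fix H assume H: "H \<in> \<A>"
    have "((\<lambda>y. \<alpha> H v / \<alpha> H y) has_derivative (\<lambda>u. - (\<alpha> H u * \<alpha> H v) / (\<alpha> H x)\<^sup>2)) (at x)"
    proof -
      have "((\<lambda>z. \<alpha> H v / z) has_field_derivative - \<alpha> H v / (\<alpha> H x)\<^sup>2) (at (\<alpha> H x))"
        using x H X_iff by (auto intro!: derivative_eq_intros simp: power2_eq_square)
      then have "((\<lambda>z. \<alpha> H v / z) has_derivative (\<lambda>u. - \<alpha> H v / (\<alpha> H x)\<^sup>2 * u)) (at (\<alpha> H x))"
        unfolding has_field_derivative_def .
      from has_derivative_compose[OF bounded_linear_imp_has_derivative[OF linear_form_bounded_linear[OF form[OF H]]] this]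
      show ?thesis by (simp add: mult.commute)
    qed
    then show "((\<lambda>x. mat (\<alpha> H v / \<alpha> H x) ** A H) has_derivative (\<lambda>u. mat (- (\<alpha> H u * \<alpha> H v) / (\<alpha> H x)\<^sup>2) ** A H)) (at x)"
      by (rule has_derivative_mat_mult)
  qed
  show "lform' A x u v = lform' A x v u" for x u v
    unfolding lform'_def by (simp add: mult.commute)
  show "continuous_on X (\<lambda>x. lform' A x u v)" for u v
    unfolding lform'_def using X_iff
    by (intro continuous_intros) (auto intro: cont_form)
  show "lform A x u ** lform A x v = lform A x v ** lform A x u" if "x \<in> X" for x u v
    by (rule lform_commute[OF hol that])
qed

lemma holonomy_scale:
  fixes A :: "(complex ^ 'n) set \<Rightarrow> complex ^ 'm ^ 'm"
  assumes "holonomy A"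
  shows "holonomy (\<lambda>H. mat h ** A H)"
proof -
  have 1: "(mat h ** B) ** (\<Sum>K\<in>N. mat h ** A K) = mat (h * h) ** (B ** sum A N)" for N and B :: "complex ^ 'm ^ 'm"
  proof -
    have "(mat h ** B) ** (\<Sum>K\<in>N. mat h ** A K) = mat h ** (B ** (mat h ** sum A N))"
      by (simp add: matrix_mult_sum_right matrix_mul_assoc)
    then show ?thesis by (simp only: mat_left_commute[of B h] mat_mat_mult)
  qed
  have 2: "(\<Sum>K\<in>N. mat h ** A K) ** (mat h ** B) = mat (h * h) ** (sum A N ** B)" for N and B :: "complex ^ 'm ^ 'm"
  proof -
    have "(\<Sum>K\<in>N. mat h ** A K) ** (mat h ** B) = mat h ** (sum A N ** (mat h ** B))"
      by (simp add: matrix_mult_sum_right matrix_mult_sum_left matrix_mul_assoc)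
    then show ?thesis by (simp only: mat_left_commute[of "sum A N" h] mat_mat_mult)
  qed
  show ?thesis unfolding holonomy_def 1 2 using assms[unfolded holonomy_def] by simp
qed

end

section \<open>Parallel transport along paths\<close>

locale log_connection = arrangement \<A> \<alpha>
  for \<A> :: "(complex ^ 'n) set set" and \<alpha> :: "(complex ^ 'n) set \<Rightarrow> complex ^ 'n \<Rightarrow> complex" +
  fixes A :: "(complex ^ 'n) set \<Rightarrow> complex ^ 'm ^ 'm"
  assumes hol: "holonomy A"
begin

definition om :: "complex \<Rightarrow> complex ^ 'n \<Rightarrow> complex ^ 'n \<Rightarrow> complex ^ 'm ^ 'm" where
  "om h x v = mat h ** lform A x v"

lemma om_lform: "om h = lform (\<lambda>H. mat h ** A H)"
  by (intro ext) (simp add: om_def lform_def matrix_mult_sum_right mat_mat_mult mult.commute)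

lemma flat_om: "flat_form X (om h) (lform' (\<lambda>H. mat h ** A H))"
  unfolding om_lform by (rule flat_lform[OF holonomy_scale[OF hol]])

definition cvx :: "(complex ^ 'n) set \<Rightarrow> bool" where
  "cvx K \<longleftrightarrow> open K \<and> convex K \<and> K \<subseteq> X"

definition T :: "complex \<Rightarrow> complex ^ 'n \<Rightarrow> complex ^ 'n \<Rightarrow> complex ^ 'm ^ 'm" where
  "T h = flat_form.T X (om h)"

definition sol :: "complex \<Rightarrow> (complex ^ 'n) set \<Rightarrow> (complex ^ 'n \<Rightarrow> complex ^ 'm ^ 'm) \<Rightarrow> bool" where
  "sol h K S \<longleftrightarrow> (\<forall>x\<in>K. (S has_derivative (\<lambda>v. om h x v ** S x)) (at x))"

lemma cvx_eq: "cvx = flat_form.cvx X"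
  using flat_form.cvx_def[OF flat_om] by (auto simp: cvx_def fun_eq_iff)

lemma sol_eq: "sol h = flat_form.sol (om h)"
  using flat_form.sol_def[OF flat_om, of h] by (auto simp: sol_def fun_eq_iff)

lemma cvx_D: "cvx K \<Longrightarrow> open K" "cvx K \<Longrightarrow> convex K" "cvx K \<Longrightarrow> K \<subseteq> X" "cvx K \<Longrightarrow> x \<in> K \<Longrightarrow> x \<in> X"
  by (auto simp: cvx_def)

lemma cvx_ball: "ball x r \<subseteq> X \<Longrightarrow> cvx (ball x r)"
  by (simp add: cvx_def)

lemma ball_in_X: "x \<in> X \<Longrightarrow> \<exists>r>0. ball x r \<subseteq> X"
  using open_X open_contains_ball by blast

lemmas T_refl = flat_form.T_refl[OF flat_om, folded T_def]
lemmas T_trans = flat_form.T_trans[OF flat_om, folded T_def cvx_eq]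
lemmas T_inverse = flat_form.T_inverse[OF flat_om, folded T_def cvx_eq]
lemmas T_sol = flat_form.T_frame[OF flat_om, folded T_def cvx_eq sol_eq]
lemmas sol_T = flat_form.sol_T[OF flat_om, folded T_def cvx_eq sol_eq]
lemmas T_bound = flat_form.T_bound[OF flat_om, folded T_def cvx_eq]

lemma sol_mult_right: "sol h K S \<Longrightarrow> sol h K (\<lambda>x. S x ** B)"
  unfolding sol_def
proof
  fix x assume "\<forall>x\<in>K. (S has_derivative (\<lambda>v. om h x v ** S x)) (at x)" "x \<in> K"
  then have "(S has_derivative (\<lambda>v. om h x v ** S x)) (at x)" by blast
  from bounded_linear.has_derivative[OF bounded_bilinear.bounded_linear_left[OF bounded_bilinear_matrix_mult] this, of B]
  show "((\<lambda>x. S x ** B) has_derivative (\<lambda>v. om h x v ** (S x ** B))) (at x)"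
    by (simp only: matrix_mul_assoc)
qed

text \<open>The form is h times a fixed one, bounded along the segment; hence a single
  \<open>L\<close> serves every h.\<close>

lemma T_near_one:
  assumes K: "cvx K" "p \<in> K" "x \<in> K"
  shows "\<exists>L\<ge>0. \<forall>h. norm (T h p x - mat 1) \<le> norm (mat 1 :: complex ^ 'm ^ 'm) * (exp (cmod h * L) - 1)"
proof -
  have seg: "p + t *\<^sub>R (x - p) \<in> K" if "t \<in> {0..1}" for t
    by (rule flat_form.cvx_seg[OF flat_om K[unfolded cvx_eq] that])
  have "continuous_on {0..1} (\<lambda>t. lform A (p + t *\<^sub>R (x - p)) (x - p))"
  proof (rule continuous_on_compose2[of X "\<lambda>y. lform A y (x - p)"])
    show "continuous_on X (\<lambda>y. lform A y (x - p))"
      unfolding lform_def using X_iff by (intro continuous_intros cont_form) auto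
    show "(\<lambda>t. p + t *\<^sub>R (x - p)) ` {0..1} \<subseteq> X" using seg cvx_D[OF K(1)] by auto
  qed (intro continuous_intros)
  then have "bounded ((\<lambda>t. lform A (p + t *\<^sub>R (x - p)) (x - p)) ` {0..1})"
    by (intro compact_imp_bounded compact_continuous_image) auto
  then obtain L where L: "\<And>t. t \<in> {0..1} \<Longrightarrow> norm (lform A (p + t *\<^sub>R (x - p)) (x - p)) \<le> L"
    unfolding bounded_iff by blast
  have "L \<ge> 0" using L[of 0] norm_ge_zero order_trans by (metis atLeastAtMost_iff order_refl zero_le_one)
  moreover have "norm (T h p x - mat 1) \<le> norm (mat 1 :: complex ^ 'm ^ 'm) * (exp (cmod h * L) - 1)" for h
    by (rule T_bound[OF K]) (use L \<open>L \<ge> 0\<close> in \<open>auto simp: om_def norm_mat_mult intro!: mult_left_mono\<close>)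
  ultimately show ?thesis by blast
qed

lemma T_tendsto:
  assumes K: "cvx K" "p \<in> K" "x \<in> K" and h: "(h \<longlongrightarrow> 0) F"
  shows "((\<lambda>n. T (h n) p x) \<longlongrightarrow> mat 1) F"
proof -
  obtain L where L: "\<And>h. norm (T h p x - mat 1) \<le> norm (mat 1 :: complex ^ 'm ^ 'm) * (exp (cmod h * L) - 1)"
    using T_near_one[OF K] by blast
  have "((\<lambda>n. norm (mat 1 :: complex ^ 'm ^ 'm) * (exp (cmod (h n) * L) - 1)) \<longlongrightarrow> norm (mat 1 :: complex ^ 'm ^ 'm) * (exp (cmod 0 * L) - 1)) F"
    by (intro tendsto_intros h)
  then have "((\<lambda>n. norm (mat 1 :: complex ^ 'm ^ 'm) * (exp (cmod (h n) * L) - 1)) \<longlongrightarrow> 0) F" by simp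
  then have "((\<lambda>n. T (h n) p x - mat 1) \<longlongrightarrow> 0) F"
    by (rule Lim_null_comparison[rotated]) (simp add: L)
  then show ?thesis by (simp add: LIM_zero_iff)
qed

lemma T_zero: "cvx K \<Longrightarrow> p \<in> K \<Longrightarrow> x \<in> K \<Longrightarrow> T 0 p x = mat 1"
  using T_near_one[of K p x] by (auto dest: spec[of _ 0])

text \<open>\<open>reach x y P\<close>: for every \<open>h\<close>, \<open>P h\<close> is the parallel transport along one and the same
  polygonal path from \<open>x\<close> to \<open>y\<close>.\<close>

inductive reach :: "complex ^ 'n \<Rightarrow> complex ^ 'n \<Rightarrow> (complex \<Rightarrow> complex ^ 'm ^ 'm) \<Rightarrow> bool" where
  reach_refl: "x \<in> X \<Longrightarrow> reach x x (\<lambda>h. mat 1)"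
| reach_step: "reach x y P \<Longrightarrow> cvx K \<Longrightarrow> y \<in> K \<Longrightarrow> z \<in> K \<Longrightarrow> reach x z (\<lambda>h. T h y z ** P h)"

lemma reach_in_X: "reach x y P \<Longrightarrow> x \<in> X \<and> y \<in> X"
  by (induction rule: reach.induct) (auto dest: cvx_D)

lemma reach_T: "cvx K \<Longrightarrow> x \<in> K \<Longrightarrow> y \<in> K \<Longrightarrow> reach x y (\<lambda>h. T h x y)"
  using reach_step[OF reach_refl, of x K y] by (auto dest: cvx_D)

lemma reach_trans:
  assumes "reach x y P" "reach y z Q" shows "reach x z (\<lambda>h. Q h ** P h)"
  using assms(2,1)
proof (induction arbitrary: P rule: reach.induct)
  case (reach_refl x')
  then show ?case by simp
next
  case (reach_step x' y Q K z)
  then show ?case using reach.reach_step[OF reach_step.IH[OF reach_step.prems] reach_step.hyps(2-4)]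
    by (simp add: matrix_mul_assoc)
qed

lemma reach_inverse:
  "reach x y P \<Longrightarrow> \<exists>Q. reach y x Q \<and> (\<forall>h. Q h ** P h = mat 1 \<and> P h ** Q h = mat 1)"
proof (induction rule: reach.induct)
  case (reach_refl x)
  then show ?case using reach.reach_refl by (intro exI[of _ "\<lambda>h. mat 1"]) auto
next
  case (reach_step x y P K z)
  then obtain Q where Q: "reach y x Q" "\<And>h. Q h ** P h = mat 1" "\<And>h. P h ** Q h = mat 1" by blast
  have "reach z x (\<lambda>h. Q h ** T h z y)"
    by (rule reach_trans[OF reach_T[OF reach_step.hyps(2,4,3)] Q(1)])
  moreover have 1: "(Q h ** T h z y) ** (T h y z ** P h) = mat 1" for h
  proof -
    have "(Q h ** T h z y) ** (T h y z ** P h) = Q h ** (T h z y ** T h y z) ** P h"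
      by (simp add: matrix_mul_assoc)
    then show ?thesis using T_inverse[OF reach_step.hyps(2,3,4)] Q(2) by simp
  qed
  moreover have "(T h y z ** P h) ** (Q h ** T h z y) = mat 1" for h
    using 1 matrix_left_right_inverse by blast
  ultimately show ?case by (intro exI[of _ "\<lambda>h. Q h ** T h z y"]) simp
qed

lemma reach_tendsto: "reach x y P \<Longrightarrow> (h \<longlongrightarrow> 0) F \<Longrightarrow> ((\<lambda>n. P (h n)) \<longlongrightarrow> mat 1) F"
proof (induction rule: reach.induct)
  case (reach_step x y P K z)
  have "((\<lambda>n. T (h n) y z ** P (h n)) \<longlongrightarrow> mat 1 ** mat 1) F"
    using reach_step by (intro tendsto_intros T_tendsto) auto
  then show ?case by simp
qed simp

lemma reach_zero: "reach x y P \<Longrightarrow> P 0 = mat 1"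
  by (induction rule: reach.induct) (auto simp: T_zero)

text \<open>Paths are only continuous, so a parallel section along \<open>g\<close> cannot be
  defined by a differential equation in t. It is compared with the transport \<open>T\<close> near
  each parameter instead.\<close>

definition tr_on :: "complex \<Rightarrow> (real \<Rightarrow> complex ^ 'n) \<Rightarrow> real \<Rightarrow> real \<Rightarrow> (real \<Rightarrow> complex ^ 'm ^ 'm) \<Rightarrow> bool" where
  "tr_on h g a b G \<longleftrightarrow> (\<forall>t\<in>{a..b}. \<exists>\<delta>>0. \<forall>s\<in>{a..b}. \<bar>s - t\<bar> < \<delta> \<longrightarrow>
     (\<exists>K. cvx K \<and> g t \<in> K \<and> g s \<in> K) \<and> G s = T h (g t) (g s) ** G t)"

lemma tr_on_cong: "(\<And>t. t \<in> {a..b} \<Longrightarrow> g t = g' t) \<Longrightarrow> tr_on h g a b G \<longleftrightarrow> tr_on h g' a b G"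
  unfolding tr_on_def by (intro ball_cong refl) (metis (no_types, lifting))

lemma tr_on_right: "tr_on h g a b G \<Longrightarrow> tr_on h g a b (\<lambda>t. G t ** B)"
  unfolding tr_on_def by (simp add: matrix_mul_assoc) metis

lemma tr_on_cat:
  assumes 1: "tr_on h g a b G1" and 2: "tr_on h g b c G2" and eq: "G1 b = G2 b" and ab: "a \<le> b" "b \<le> c"
  shows "tr_on h g a c (\<lambda>t. if t \<le> b then G1 t else G2 t)"
  unfolding tr_on_def
proof
  fix t assume t: "t \<in> {a..c}"
  let ?G = "\<lambda>t. if t \<le> b then G1 t else G2 t"
  let ?P = "\<lambda>G s. (\<exists>K. cvx K \<and> g t \<in> K \<and> g s \<in> K) \<and> G s = T h (g t) (g s) ** G t"
  consider "t < b" | "t = b" | "t > b" by linarith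
  then show "\<exists>\<delta>>0. \<forall>s\<in>{a..c}. \<bar>s - t\<bar> < \<delta> \<longrightarrow> ?P ?G s"
  proof cases
    case c1: 1
    with t have "t \<in> {a..b}" by auto
    then obtain \<delta> where \<delta>: "\<delta> > 0" "\<And>s. s \<in> {a..b} \<Longrightarrow> \<bar>s - t\<bar> < \<delta> \<Longrightarrow> ?P G1 s"
      using 1 unfolding tr_on_def by blast
    then show ?thesis using c1 by (intro exI[of _ "min \<delta> (b - t)"]) auto
  next
    case c2: 2
    with t ab have tb: "t \<in> {a..b}" "t \<in> {b..c}" by auto
    then obtain \<delta> where \<delta>: "\<delta> > 0" "\<And>s. s \<in> {a..b} \<Longrightarrow> \<bar>s - t\<bar> < \<delta> \<Longrightarrow> ?P G1 s"
      using 1 unfolding tr_on_def by blast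
    obtain \<delta>' where \<delta>': "\<delta>' > 0" "\<And>s. s \<in> {b..c} \<Longrightarrow> \<bar>s - t\<bar> < \<delta>' \<Longrightarrow> ?P G2 s"
      using 2 tb(2) unfolding tr_on_def by blast
    have "?P ?G s" if s: "s \<in> {a..c}" "\<bar>s - t\<bar> < min \<delta> \<delta>'" for s
      using \<delta>(2)[of s] \<delta>'(2)[of s] s c2 eq by (cases "s \<le> b") auto
    then show ?thesis using \<delta>(1) \<delta>'(1) by (intro exI[of _ "min \<delta> \<delta>'"]) simp
  next
    case c3: 3
    with t have "t \<in> {b..c}" by auto
    then obtain \<delta> where \<delta>: "\<delta> > 0" "\<And>s. s \<in> {b..c} \<Longrightarrow> \<bar>s - t\<bar> < \<delta> \<Longrightarrow> ?P G2 s"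
      using 2 unfolding tr_on_def by blast
    then show ?thesis using c3 by (intro exI[of _ "min \<delta> (t - b)"]) auto
  qed
qed

text \<open>Around each parameter x agreement at s is carried back to x by the inverse transport and
  from there on to t. Bisection extends this to the whole interval.\<close>

lemma tr_on_unique:
  assumes 1: "tr_on h g a b G1" and 2: "tr_on h g a b G2" and eq: "G1 a = G2 a" and ab: "a \<le> b"
  shows "G1 b = G2 b"
proof -
  have "a \<le> b" by fact
  then have "a \<le> a \<and> b \<le> b \<and> G1 a = G2 a \<longrightarrow> G1 b = G2 b"
  proof (induction rule: Bolzano[where P = "\<lambda>s t. a \<le> s \<and> t \<le> b \<and> G1 s = G2 s \<longrightarrow> G1 t = G2 t"])
    case (trans x y z)
    then show ?case by auto
  next
    case (local x)
    then have x: "x \<in> {a..b}" by auto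
    obtain \<delta> where \<delta>: "\<delta> > 0" "\<And>s. s \<in> {a..b} \<Longrightarrow> \<bar>s - x\<bar> < \<delta> \<Longrightarrow>
      (\<exists>K. cvx K \<and> g x \<in> K \<and> g s \<in> K) \<and> G1 s = T h (g x) (g s) ** G1 x"
      using 1 x unfolding tr_on_def by blast
    obtain \<delta>' where \<delta>': "\<delta>' > 0" "\<And>s. s \<in> {a..b} \<Longrightarrow> \<bar>s - x\<bar> < \<delta>' \<Longrightarrow> G2 s = T h (g x) (g s) ** G2 x"
      using 2 x unfolding tr_on_def by blast
    have "G1 t = G2 t" if *: "s \<le> x" "x \<le> t" "t - s < min \<delta> \<delta>'" "a \<le> s" "t \<le> b" "G1 s = G2 s" for s t
    proof -
      have s: "s \<in> {a..b}" "\<bar>s - x\<bar> < \<delta>" "\<bar>s - x\<bar> < \<delta>'" "t \<in> {a..b}" "\<bar>t - x\<bar> < \<delta>" "\<bar>t - x\<bar> < \<delta>'"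
        using * by auto
      obtain K where K: "cvx K" "g x \<in> K" "g s \<in> K" using \<delta>(2)[OF s(1,2)] by blast
      have "T h (g s) (g x) ** (T h (g x) (g s) ** G1 x) = T h (g s) (g x) ** (T h (g x) (g s) ** G2 x)"
        using *(6) \<delta>(2)[OF s(1,2)] \<delta>'(2)[OF s(1,3)] by simp
      then have "G1 x = G2 x" using T_inverse[OF K, of h] by (simp add: matrix_mul_assoc)
      then show ?thesis using \<delta>(2)[OF s(4,5)] \<delta>'(2)[OF s(4,6)] by simp
    qed
    then show ?case using \<delta>(1) \<delta>'(1) by (intro exI[of _ "min \<delta> \<delta>'"]) auto
  qed
  then show ?thesis using eq by simp
qed

lemma tr_on_reparam:
  assumes "tr_on h g (c * a + d) (c * b + d) G" "c > 0"
  shows "tr_on h (\<lambda>t. g (c * t + d)) a b (\<lambda>t. G (c * t + d))"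
  unfolding tr_on_def
proof
  fix t assume t: "t \<in> {a..b}"
  then have "c * t + d \<in> {c * a + d..c * b + d}" using assms(2) by auto
  then obtain \<delta> where \<delta>: "\<delta> > 0" "\<And>s. s \<in> {c * a + d..c * b + d} \<Longrightarrow> \<bar>s - (c * t + d)\<bar> < \<delta> \<Longrightarrow>
      (\<exists>K. cvx K \<and> g (c * t + d) \<in> K \<and> g s \<in> K) \<and> G s = T h (g (c * t + d)) (g s) ** G (c * t + d)"
    using assms(1) unfolding tr_on_def by blast
  have "\<bar>(c * s + d) - (c * t + d)\<bar> < \<delta>" if "\<bar>s - t\<bar> < \<delta> / c" for s
  proof -
    have "\<bar>(c * s + d) - (c * t + d)\<bar> = c * \<bar>s - t\<bar>" using assms(2) by (simp add: abs_mult right_diff_distrib[symmetric])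
    then show ?thesis using that assms(2) by (simp add: field_simps)
  qed
  then show "\<exists>\<delta>>0. \<forall>s\<in>{a..b}. \<bar>s - t\<bar> < \<delta> \<longrightarrow>
     (\<exists>K. cvx K \<and> g (c * t + d) \<in> K \<and> g (c * s + d) \<in> K) \<and> G (c * s + d) = T h (g (c * t + d)) (g (c * s + d)) ** G (c * t + d)"
    using \<delta> assms(2) by (intro exI[of _ "\<delta> / c"]) auto
qed

text \<open>Subdivision into parts lying in balls inside \<open>X\<close> depends on the path alone,
  so the family \<open>P\<close> is found simultaneously for all h.\<close>

lemma tr_on_exists:
  assumes g: "continuous_on {0..1} g" "g ` {0..1} \<subseteq> X"
  shows "\<exists>P. reach (g 0) (g 1) P \<and> (\<forall>h. \<exists>G. tr_on h g 0 1 G \<and> G 0 = mat 1 \<and> G 1 = P h)"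
proof -
  define Q where "Q a b \<longleftrightarrow> (0 \<le> a \<and> b \<le> 1 \<and> a \<le> b \<longrightarrow>
    (\<exists>P. reach (g a) (g b) P \<and> (\<forall>h. \<exists>G. tr_on h g a b G \<and> G a = mat 1 \<and> G b = P h)))" for a b
  have "(0::real) \<le> 1" by simp
  then have "Q 0 1"
  proof (induction rule: Bolzano)
    case (trans a b c)
    show ?case unfolding Q_def
    proof
      assume *: "0 \<le> a \<and> c \<le> 1 \<and> a \<le> c"
      obtain P where P: "reach (g a) (g b) P" "\<And>h. \<exists>G. tr_on h g a b G \<and> G a = mat 1 \<and> G b = P h"
        using trans * unfolding Q_def by auto
      obtain P' where P': "reach (g b) (g c) P'" "\<And>h. \<exists>G. tr_on h g b c G \<and> G b = mat 1 \<and> G c = P' h"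
        using trans * unfolding Q_def by auto
      have "\<exists>G. tr_on h g a c G \<and> G a = mat 1 \<and> G c = P' h ** P h" for h
      proof -
        obtain G where G: "tr_on h g a b G" "G a = mat 1" "G b = P h" using P(2) by blast
        obtain G' where G': "tr_on h g b c G'" "G' b = mat 1" "G' c = P' h" using P'(2) by blast
        have "tr_on h g a c (\<lambda>t. if t \<le> b then G t else G' t ** P h)"
          using tr_on_cat[OF G(1) tr_on_right[OF G'(1), of "P h"]] G G' trans by simp
        moreover have "(if c \<le> b then G c else G' c ** P h) = P' h ** P h"
        proof (cases "c = b")
          case True
          then have "P' h = mat 1" using G' by simp
          then show ?thesis using True G by simp
        qed (use trans G' in auto)
        ultimately show ?thesis using trans G by (intro exI[of _ "\<lambda>t. if t \<le> b then G t else G' t ** P h"]) auto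
      qed
      then show "\<exists>P. reach (g a) (g c) P \<and> (\<forall>h. \<exists>G. tr_on h g a c G \<and> G a = mat 1 \<and> G c = P h)"
        using reach_trans[OF P(1) P'(1)] by blast
    qed
  next
    case (local x)
    then have "g x \<in> X" using g(2) by auto
    then obtain r where r: "r > 0" "ball (g x) r \<subseteq> X" using ball_in_X by blast
    obtain d where d: "d > 0" "\<And>y. y \<in> {0..1} \<Longrightarrow> dist y x < d \<Longrightarrow> dist (g y) (g x) < r"
      using g(1) local r(1) unfolding continuous_on_iff by (metis atLeastAtMost_iff)
    have "Q a b" if ab: "a \<le> x" "x \<le> b" "b - a < d" for a b
      unfolding Q_def
    proof
      assume *: "0 \<le> a \<and> b \<le> 1 \<and> a \<le> b"
      have in_K: "g t \<in> ball (g x) r" if "t \<in> {a..b}" for t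
        using d(2)[of t] that ab * by (auto simp: dist_commute dist_real_def)
      have K: "cvx (ball (g x) r)" by (rule cvx_ball[OF r(2)])
      have "tr_on h g a b (\<lambda>t. T h (g a) (g t))" for h
        unfolding tr_on_def
      proof (intro ballI exI[of _ "1::real"] conjI impI)
        fix t s assume "t \<in> {a..b}" "s \<in> {a..b}"
        then show "T h (g a) (g s) = T h (g t) (g s) ** T h (g a) (g t)"
          using T_trans[OF K, of "g a" "g t" "g s" h] in_K * by auto
        show "\<exists>K. cvx K \<and> g t \<in> K \<and> g s \<in> K" using K in_K \<open>t \<in> {a..b}\<close> \<open>s \<in> {a..b}\<close> by blast
      qed simp
      moreover have "reach (g a) (g b) (\<lambda>h. T h (g a) (g b))"
        using * in_K by (intro reach_T[OF K]) auto
      moreover have "T h (g a) (g a) = mat 1" for h using g(2) * by (intro T_refl) auto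
      ultimately show "\<exists>P. reach (g a) (g b) P \<and> (\<forall>h. \<exists>G. tr_on h g a b G \<and> G a = mat 1 \<and> G b = P h)"
        by (intro exI[of _ "\<lambda>h. T h (g a) (g b)"]) blast
    qed
    then show ?case using d(1) by blast
  qed
  then show ?thesis by (simp add: Q_def)
qed

text \<open>For close parameters the four points of the two paths lie in one ball inside
  \<open>X\<close>; the half radius in the hypothesis leaves room for the motion of
  \<open>g\<close>. Both routes through that ball give the same transport.\<close>

lemma tr_on_perturb:
  assumes G: "tr_on h g 0 1 G" and g: "continuous_on {0..1} g" and g': "continuous_on {0..1} g'"
    and r: "\<And>t. t \<in> {0..1} \<Longrightarrow> ball (g t) r \<subseteq> X" "\<And>t. t \<in> {0..1} \<Longrightarrow> dist (g t) (g' t) < r / 2"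
  shows "tr_on h g' 0 1 (\<lambda>t. T h (g t) (g' t) ** G t)"
  unfolding tr_on_def
proof
  fix t :: real assume t: "t \<in> {0..1}"
  have r0: "r > 0" using r(2)[OF t] zero_le_dist[of "g t" "g' t"] by linarith
  obtain d where d: "d > 0" "\<And>s. s \<in> {0..1} \<Longrightarrow> dist s t < d \<Longrightarrow> dist (g s) (g t) < r / 2"
    using g t r0 unfolding continuous_on_iff by (metis half_gt_zero)
  obtain \<delta> where \<delta>: "\<delta> > 0" "\<And>s. s \<in> {0..1} \<Longrightarrow> \<bar>s - t\<bar> < \<delta> \<Longrightarrow> G s = T h (g t) (g s) ** G t"
    using G t unfolding tr_on_def by blast
  let ?K = "ball (g t) r"
  have K: "cvx ?K" by (rule cvx_ball[OF r(1)[OF t]])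
  have "(\<exists>K. cvx K \<and> g' t \<in> K \<and> g' s \<in> K) \<and>
      T h (g s) (g' s) ** G s = T h (g' t) (g' s) ** (T h (g t) (g' t) ** G t)"
    if s: "s \<in> {0..1}" "\<bar>s - t\<bar> < min d \<delta>" for s
  proof -
    have gs: "g s \<in> ?K" and "dist (g s) (g t) < r / 2" using d(2)[of s] s r0 by (auto simp: dist_real_def dist_commute)
    then have g's: "g' s \<in> ?K" using r(2)[OF s(1)] dist_triangle_half_r[of "g s" "g t" r "g' s"] by simp
    have g't: "g' t \<in> ?K" using r(2)[OF t] r0 by simp
    have gt: "g t \<in> ?K" using r0 by simp
    have "T h (g s) (g' s) ** G s = T h (g s) (g' s) ** T h (g t) (g s) ** G t"
      using \<delta>(2)[of s] s by (simp add: matrix_mul_assoc)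
    also have "T h (g s) (g' s) ** T h (g t) (g s) = T h (g' t) (g' s) ** T h (g t) (g' t)"
      using T_trans[OF K gt gs g's] T_trans[OF K gt g't g's] by simp
    finally show ?thesis using K g't g's by (auto simp: matrix_mul_assoc)
  qed
  then show "\<exists>\<delta>>0. \<forall>s\<in>{0..1}. \<bar>s - t\<bar> < \<delta> \<longrightarrow> (\<exists>K. cvx K \<and> g' t \<in> K \<and> g' s \<in> K) \<and>
      T h (g s) (g' s) ** G s = T h (g' t) (g' s) ** (T h (g t) (g' t) ** G t)"
    using d(1) \<delta>(1) by (intro exI[of _ "min d \<delta>"]) auto
qed

definition trans_is :: "complex \<Rightarrow> (real \<Rightarrow> complex ^ 'n) \<Rightarrow> complex ^ 'm ^ 'm \<Rightarrow> bool" where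
  "trans_is h g M \<longleftrightarrow> (\<exists>G. tr_on h g 0 1 G \<and> G 0 = mat 1 \<and> G 1 = M)"

lemma trans_is_unique: "trans_is h g M \<Longrightarrow> trans_is h g M' \<Longrightarrow> M = M'"
  unfolding trans_is_def using tr_on_unique[of h g 0 1] by (metis zero_le_one)

text \<open>By uniform continuity nearby slices of the homotopy are perturbations of each other,
  within a radius valid on its compact image. The endpoints stay fixed, so the correcting transports
  at both ends are the identity.\<close>

lemma trans_is_homotopic:
  assumes hom: "homotopic_paths X g0 g1" and M: "trans_is h g0 M"
  shows "trans_is h g1 M"
proof -
  obtain k :: "real \<times> real \<Rightarrow> complex ^ 'n"
    where k: "continuous_on ({0..1} \<times> {0..1}) k" "k ` ({0..1} \<times> {0..1}) \<subseteq> X"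
      "\<And>x. k (0, x) = g0 x" "\<And>x. k (1, x) = g1 x"
      "\<And>t. t \<in> {0..1} \<Longrightarrow> k (t, 0) = g0 0" "\<And>t. t \<in> {0..1} \<Longrightarrow> k (t, 1) = g0 1"
    using hom by (auto simp: homotopic_paths_def homotopic_with_def pathstart_def pathfinish_def image_subset_iff_funcset)
  have comp: "compact ({0..1} \<times> {0..1} :: (real \<times> real) set)" by (intro compact_Times) auto
  obtain r where r: "r > 0" "(\<Union>x\<in>k ` ({0..1} \<times> {0..1}). ball x r) \<subseteq> X"
    using compact_subset_open_imp_ball_epsilon_subset[OF compact_continuous_image[OF k(1) comp] open_X k(2)] by blast
  have "uniformly_continuous_on ({0..1} \<times> {0..1}) k" by (rule compact_uniformly_continuous[OF k(1) comp])
  then obtain d where d: "d > 0" "\<And>x y. x \<in> {0..1} \<times> {0..1} \<Longrightarrow> y \<in> {0..1} \<times> {0..1} \<Longrightarrow> dist y x < d \<Longrightarrow> dist (k y) (k x) < r / 2"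
    using r(1) unfolding uniformly_continuous_on_def by (metis half_gt_zero)
  have ck: "continuous_on {0..1} (\<lambda>t. k (a, t))" if "a \<in> {0..1}" for a
    by (rule continuous_on_compose2[OF k(1)]) (use that in \<open>auto intro!: continuous_intros\<close>)
  define Q where "Q a b \<longleftrightarrow> (0 \<le> a \<and> b \<le> 1 \<and> a \<le> b \<longrightarrow> trans_is h (\<lambda>t. k (a, t)) M \<longrightarrow> trans_is h (\<lambda>t. k (b, t)) M)" for a b
  have "(0::real) \<le> 1" by simp
  then have "Q 0 1"
  proof (induction rule: Bolzano)
    case (trans a b c)
    then show ?case by (auto simp: Q_def)
  next
    case (local x)
    have "Q a b" if ab: "a \<le> x" "x \<le> b" "b - a < d" for a b
      unfolding Q_def
    proof (intro impI)
      assume *: "0 \<le> a \<and> b \<le> 1 \<and> a \<le> b" and "trans_is h (\<lambda>t. k (a, t)) M"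
      then obtain G where G: "tr_on h (\<lambda>t. k (a, t)) 0 1 G" "G 0 = mat 1" "G 1 = M" by (auto simp: trans_is_def)
      have "tr_on h (\<lambda>t. k (b, t)) 0 1 (\<lambda>t. T h (k (a, t)) (k (b, t)) ** G t)"
      proof (rule tr_on_perturb[OF G(1)])
        show "continuous_on {0..1} (\<lambda>t. k (a, t))" "continuous_on {0..1} (\<lambda>t. k (b, t))" using * by (auto intro: ck)
        show "ball (k (a, t)) r \<subseteq> X" if "t \<in> {0..1}" for t
          using r(2) that * by (auto simp: UN_subset_iff)
        show "dist (k (a, t)) (k (b, t)) < r / 2" if "t \<in> {0..1}" for t
          using * ab that by (intro d(2)) (auto simp: dist_Pair_Pair dist_real_def)
      qed
      moreover have "T h (k (a, 0)) (k (b, 0)) = mat 1" "T h (k (a, 1)) (k (b, 1)) = mat 1"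
      proof -
        have "k (0, 0) \<in> X" "k (0, 1) \<in> X" using k(2) by auto
        then have "g0 0 \<in> X" "g0 1 \<in> X" by (simp_all add: k(3))
        then show "T h (k (a, 0)) (k (b, 0)) = mat 1" "T h (k (a, 1)) (k (b, 1)) = mat 1"
          using k(5,6) * T_refl by auto
      qed
      ultimately show "trans_is h (\<lambda>t. k (b, t)) M"
        unfolding trans_is_def using G by (intro exI[of _ "\<lambda>t. T h (k (a, t)) (k (b, t)) ** G t"]) auto
    qed
    then show ?case using d(1) by blast
  qed
  then show ?thesis using M k(3,4) by (simp add: Q_def)
qed

lemma trans_is_join:
  assumes 1: "trans_is h g1 M1" and 2: "trans_is h g2 M2" and eq: "g1 1 = g2 0"
  shows "trans_is h (g1 +++ g2) (M2 ** M1)"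
proof -
  obtain G1 where G1: "tr_on h g1 0 1 G1" "G1 0 = mat 1" "G1 1 = M1" using 1 by (auto simp: trans_is_def)
  obtain G2 where G2: "tr_on h g2 0 1 G2" "G2 0 = mat 1" "G2 1 = M2" using 2 by (auto simp: trans_is_def)
  have "tr_on h (\<lambda>t. g1 (2 * t + 0)) 0 (1/2) (\<lambda>t. G1 (2 * t + 0))"
    by (rule tr_on_reparam) (simp_all add: G1)
  then have a: "tr_on h (g1 +++ g2) 0 (1/2) (\<lambda>t. G1 (2 * t))"
    by (subst tr_on_cong[of _ _ _ "\<lambda>t. g1 (2 * t)"]) (auto simp: joinpaths_def)
  have "tr_on h (\<lambda>t. g2 (2 * t + (-1))) (1/2) 1 (\<lambda>t. G2 (2 * t + (-1)))"
    by (rule tr_on_reparam) (simp_all add: G2)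
  then have b: "tr_on h (g1 +++ g2) (1/2) 1 (\<lambda>t. G2 (2 * t - 1))"
  proof (subst tr_on_cong[of _ _ _ "\<lambda>t. g2 (2 * t - 1)"])
    show "(g1 +++ g2) t = g2 (2 * t - 1)" if "t \<in> {1/2..1}" for t
    proof (cases "t = 1/2")
      case True
      show ?thesis using eq unfolding True by (simp add: joinpaths_def)
    qed (use that in \<open>auto simp: joinpaths_def\<close>)
  qed simp
  have "tr_on h (g1 +++ g2) 0 1 (\<lambda>t. if t \<le> 1/2 then G1 (2 * t) else G2 (2 * t - 1) ** M1)"
    by (rule tr_on_cat[OF a tr_on_right[OF b, of M1]]) (simp_all add: G1 G2)
  then show ?thesis unfolding trans_is_def
    by (intro exI[of _ "\<lambda>t. if t \<le> 1/2 then G1 (2 * t) else G2 (2 * t - 1) ** M1"]) (simp add: G1 G2)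
qed

text \<open>The restatement of \<open>flat_along\<close> for \<open>om\<close>; the open sets in it
  need not be convex.\<close>

definition along :: "complex \<Rightarrow> (real \<Rightarrow> complex ^ 'n) \<Rightarrow> (real \<Rightarrow> complex ^ 'm ^ 'm) \<Rightarrow> bool" where
  "along h g F \<longleftrightarrow> (\<forall>t\<in>{0..1}. \<exists>U S. (open U \<and> U \<subseteq> X \<and> sol h U S) \<and>
        (\<exists>\<delta>>0. \<forall>s\<in>{0..1}. \<bar>s - t\<bar> < \<delta> \<longrightarrow> g s \<in> U \<and> F s = S (g s)))"

lemma along_iff:
  assumes g: "continuous_on {0..1} g" "g ` {0..1} \<subseteq> X"
  shows "along h g F \<longleftrightarrow> tr_on h g 0 1 F"
proof
  assume F: "along h g F"
  show "tr_on h g 0 1 F"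
    unfolding tr_on_def
  proof
    fix t :: real assume t: "t \<in> {0..1}"
    then obtain U S \<delta> where U: "open U" "U \<subseteq> X" "sol h U S" "\<delta> > 0"
      "\<And>s. s \<in> {0..1} \<Longrightarrow> \<bar>s - t\<bar> < \<delta> \<Longrightarrow> g s \<in> U \<and> F s = S (g s)"
      using F unfolding along_def by metis
    have gt: "g t \<in> U" "F t = S (g t)" using U(4) U(5)[OF t] by auto
    then obtain r where r: "r > 0" "ball (g t) r \<subseteq> U" using U(1) open_contains_ball by blast
    have K: "cvx (ball (g t) r)" using r U by (intro cvx_ball) auto
    have S: "sol h (ball (g t) r) S" using U(3) r(2) by (auto simp: sol_def)
    obtain d where d: "d > 0" "\<And>s. s \<in> {0..1} \<Longrightarrow> dist s t < d \<Longrightarrow> dist (g s) (g t) < r"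
      using g(1) t r(1) unfolding continuous_on_iff by metis
    have "(\<exists>K. cvx K \<and> g t \<in> K \<and> g s \<in> K) \<and> F s = T h (g t) (g s) ** F t"
      if s: "s \<in> {0..1}" "\<bar>s - t\<bar> < min d \<delta>" for s
    proof -
      have "g s \<in> ball (g t) r" using d(2)[of s] s by (auto simp: dist_real_def dist_commute)
      then show ?thesis using sol_T[OF K _ _ S, of "g t" "g s"] U(5)[of s] s gt r(1) K by auto
    qed
    then show "\<exists>\<delta>>0. \<forall>s\<in>{0..1}. \<bar>s - t\<bar> < \<delta> \<longrightarrow> (\<exists>K. cvx K \<and> g t \<in> K \<and> g s \<in> K) \<and> F s = T h (g t) (g s) ** F t"
      using d(1) U(4) by (intro exI[of _ "min d \<delta>"]) auto
  qed
next
  assume F: "tr_on h g 0 1 F"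
  show "along h g F"
    unfolding along_def
  proof
    fix t :: real assume t: "t \<in> {0..1}"
    then have "g t \<in> X" using g(2) by auto
    then obtain r where r: "r > 0" "ball (g t) r \<subseteq> X" using ball_in_X by blast
    have K: "cvx (ball (g t) r)" by (rule cvx_ball[OF r(2)])
    obtain d where d: "d > 0" "\<And>s. s \<in> {0..1} \<Longrightarrow> dist s t < d \<Longrightarrow> dist (g s) (g t) < r"
      using g(1) t r(1) unfolding continuous_on_iff by metis
    obtain \<delta> where \<delta>: "\<delta> > 0" "\<And>s. s \<in> {0..1} \<Longrightarrow> \<bar>s - t\<bar> < \<delta> \<Longrightarrow> F s = T h (g t) (g s) ** F t"
      using F t unfolding tr_on_def by blast
    have S: "sol h (ball (g t) r) (\<lambda>y. T h (g t) y ** F t)"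
      using T_sol[OF K] r(1) by (intro sol_mult_right) auto
    have "\<forall>s\<in>{0..1}. \<bar>s - t\<bar> < min d \<delta> \<longrightarrow> g s \<in> ball (g t) r \<and> F s = T h (g t) (g s) ** F t"
      using d(2) \<delta>(2) by (auto simp: dist_real_def dist_commute)
    then show "\<exists>U S. (open U \<and> U \<subseteq> X \<and> sol h U S) \<and>
        (\<exists>\<delta>>0. \<forall>s\<in>{0..1}. \<bar>s - t\<bar> < \<delta> \<longrightarrow> g s \<in> U \<and> F s = S (g s))"
      using S r(2) d(1) \<delta>(1)
      by (intro exI[of _ "ball (g t) r"] exI[of _ "\<lambda>y. T h (g t) y ** F t"] conjI exI[of _ "min d \<delta>"]) auto
  qed
qed

end

section \<open>General position and finite generation\<close>

lemma matrix_vector_scaleR: "(M :: complex ^ 'n ^ 'k) *v (r *\<^sub>R v) = r *\<^sub>R (M *v v)"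
  by (simp add: scaleR_eq_smult vector_scalar_commute)

lemma linear_matrix_vector: "linear ((*v) (M :: complex ^ 'n ^ 'k))"
  by (rule linearI) (simp_all add: matrix_vector_right_distrib matrix_vector_scaleR)

lemma bounded_linear_matrix_vector: "bounded_linear ((*v) (M :: complex ^ 'n ^ 'k))"
  using linear_matrix_vector linear_conv_bounded_linear by blast

text \<open>Proper real subspaces are null sets. The subspaces used later are only
  real-linear.\<close>

lemma generic_point:
  fixes \<S> :: "'a::euclidean_space set set"
  assumes "finite \<S>" "\<And>S. S \<in> \<S> \<Longrightarrow> subspace S \<and> S \<noteq> UNIV"
  shows "\<exists>x. \<forall>S\<in>\<S>. x \<notin> S"
proof -
  have "negligible S" if "S \<in> \<S>" for S
  proof (rule negligible_lowdim)
    have "dim S \<noteq> DIM('a)" using assms(2)[OF that] subspace_dim_equal[of S UNIV] by auto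
    then show "dim S < DIM('a)" using dim_subset_UNIV[of S] by linarith
  qed
  then have "negligible (\<Union>\<S>)" using assms(1) by (intro negligible_Union) auto
  then have "\<Union>\<S> \<noteq> UNIV" using non_negligible_UNIV by metis
  then show ?thesis by blast
qed

section \<open>Segments in general position\<close>

context log_connection
begin

lemma cvx_neighbourhood:
  assumes C: "compact C" "convex C" "C \<subseteq> X"
  shows "\<exists>K. cvx K \<and> C \<subseteq> K"
proof -
  obtain r where r: "r > 0" "(\<Union>x\<in>C. ball x r) \<subseteq> X"
    using compact_subset_open_imp_ball_epsilon_subset[OF C(1) open_X C(3)] by blast
  have eq: "(\<Union>x\<in>C. ball x r) = (\<Union>x\<in>C. \<Union>y\<in>ball 0 r. {x + y})"
  proof (intro equalityI subsetI)
    fix z assume "z \<in> (\<Union>x\<in>C. ball x r)"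
    then obtain x where "x \<in> C" "dist x z < r" by auto
    then show "z \<in> (\<Union>x\<in>C. \<Union>y\<in>ball 0 r. {x + y})"
      by (intro UN_I[of x] UN_I[of "z - x"]) (auto simp: dist_norm norm_minus_commute)
  next
    fix z assume "z \<in> (\<Union>x\<in>C. \<Union>y\<in>ball 0 r. {x + y})"
    then obtain x y where "z = x + y" "x \<in> C" "norm y < r" by auto
    then show "z \<in> (\<Union>x\<in>C. ball x r)" by (intro UN_I[of x]) (auto simp: dist_norm)
  qed
  have "convex (\<Union>x\<in>C. ball x r)" unfolding eq by (intro convex_sums C(2)) simp
  then have "cvx (\<Union>x\<in>C. ball x r)" using r by (auto simp: cvx_def)
  moreover have "C \<subseteq> (\<Union>x\<in>C. ball x r)" using r(1) by auto
  ultimately show ?thesis by blast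
qed

lemma segment_neighbourhood: "closed_segment x y \<subseteq> X \<Longrightarrow> \<exists>K. cvx K \<and> x \<in> K \<and> y \<in> K"
  using cvx_neighbourhood[of "closed_segment x y"] by auto

text \<open>A segment from \<open>p\<close> to \<open>x\<close> can meet the kernel of
  \<open>\<alpha> H\<close> only if the ratio is a negative real. Excluding all real ratios instead
  of the negative ones gives a real subspace, to which general position applies.\<close>

definition wall :: "complex ^ 'n \<Rightarrow> (complex ^ 'n) set \<Rightarrow> (complex ^ 'n) set" where
  "wall p H = {x. Im (\<alpha> H x / \<alpha> H p) = 0}"

lemma wall_subspace:
  assumes "H \<in> \<A>" "p \<in> X" shows "subspace (wall p H) \<and> wall p H \<noteq> UNIV"
proof
  note f = form[OF assms(1)]
  show "subspace (wall p H)"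
    unfolding wall_def subspace_def
    by (auto simp: linear_form_0[OF f] linear_form_add[OF f] linear_form_scaleR[OF f] add_divide_distrib
        simp flip: times_divide_eq_right)
  have "\<alpha> H p \<noteq> 0" using assms X_iff by blast
  then have "Im (\<alpha> H (\<i> *s p) / \<alpha> H p) \<noteq> 0" by (simp add: linear_form_scale[OF f])
  then show "wall p H \<noteq> UNIV" unfolding wall_def by blast
qed

lemma segment_off_walls:
  assumes p: "p \<in> X" and x: "\<And>H. H \<in> \<A> \<Longrightarrow> x \<notin> wall p H"
  shows "closed_segment p x \<subseteq> X"
proof
  fix y assume "y \<in> closed_segment p x"
  then obtain t where t: "0 \<le> t" "t \<le> 1" "y = (1 - t) *\<^sub>R p + t *\<^sub>R x" by (auto simp: in_segment)
  show "y \<in> X"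
    unfolding X_iff
  proof
    fix H assume H: "H \<in> \<A>"
    note f = form[OF H]
    have nz: "\<alpha> H p \<noteq> 0" using H p X_iff by blast
    have "\<alpha> H y / \<alpha> H p = complex_of_real (1 - t) + complex_of_real t * (\<alpha> H x / \<alpha> H p)"
      using nz unfolding t(3) by (simp add: linear_form_add[OF f] linear_form_scaleR[OF f] add_divide_distrib)
    moreover have "\<dots> \<noteq> 0"
    proof
      assume *: "complex_of_real (1 - t) + complex_of_real t * (\<alpha> H x / \<alpha> H p) = 0"
      have "Im (complex_of_real (1 - t) + complex_of_real t * w) = t * Im w" for w by simp
      from this[of "\<alpha> H x / \<alpha> H p"] have "t * Im (\<alpha> H x / \<alpha> H p) = 0"
        unfolding * by simp
      then have "t = 0" using x[OF H] by (auto simp: wall_def)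
      then show False using * by simp
    qed
    ultimately show "\<alpha> H y \<noteq> 0" by auto
  qed
qed

text \<open>A generic point sees both \<open>x\<close> and \<open>y\<close> along segments inside
  \<open>X\<close>.\<close>

lemma reach_exists:
  assumes "x \<in> X" "y \<in> X" shows "\<exists>P. reach x y P"
proof -
  have "\<exists>z. \<forall>S\<in>wall x ` \<A> \<union> wall y ` \<A>. z \<notin> S"
  proof (rule generic_point)
    show "finite (wall x ` \<A> \<union> wall y ` \<A>)" using finite_A by simp
    fix S assume "S \<in> wall x ` \<A> \<union> wall y ` \<A>"
    then show "subspace S \<and> S \<noteq> UNIV" using wall_subspace assms by fast
  qed
  then obtain z where zz: "\<forall>S\<in>wall x ` \<A> \<union> wall y ` \<A>. z \<notin> S" ..
  have z: "z \<notin> wall x H" "z \<notin> wall y H" if "H \<in> \<A>" for H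
    using zz that by simp_all
  obtain K where K: "cvx K" "x \<in> K" "z \<in> K"
    using segment_neighbourhood[OF segment_off_walls[OF assms(1) z(1)]] by blast
  obtain K' where K': "cvx K'" "y \<in> K'" "z \<in> K'"
    using segment_neighbourhood[OF segment_off_walls[OF assms(2) z(2)]] by blast
  show ?thesis using reach_step[OF reach_T[OF K] K'(1,3,2)] by blast
qed

text \<open>Finitely many convex pieces covering \<open>X\<close>: on each piece, the values of every \<open>\<alpha> H\<close> are
  confined to an open half plane.\<close>

definition units :: "complex set" where
  "units = {1, -1, \<i>, -\<i>}"

definition piece :: "((complex ^ 'n) set \<Rightarrow> complex) \<Rightarrow> (complex ^ 'n) set" where
  "piece s = {x. \<forall>H\<in>\<A>. Re (s H * \<alpha> H x) > 0}"

lemma piece_cvx: "cvx (piece s)"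
  unfolding cvx_def
proof (intro conjI)
  have eq: "piece s = (\<Inter>H\<in>\<A>. {x. Re (s H * \<alpha> H x) > 0})" by (auto simp: piece_def)
  have lin: "linear (\<lambda>x. Re (s H * \<alpha> H x))" if "H \<in> \<A>" for H
    by (rule linearI) (simp_all add: linear_form_add[OF form[OF that]] linear_form_scaleR[OF form[OF that]] algebra_simps)
  show "open (piece s)"
    unfolding eq using finite_A
  proof (rule open_INT, intro ballI)
    fix H assume H: "H \<in> \<A>"
    have "continuous_on UNIV (\<lambda>x. Re (s H * \<alpha> H x))"
      using lin[OF H] linear_conv_bounded_linear linear_continuous_on by blast
    then show "open {x. Re (s H * \<alpha> H x) > 0}" by (intro open_Collect_less) auto
  qed
  show "convex (piece s)"
    unfolding eq
  proof (rule convex_INT)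
    fix H assume H: "H \<in> \<A>"
    have "{x. Re (s H * \<alpha> H x) > 0} = (\<lambda>x. Re (s H * \<alpha> H x)) -` {0<..}" by auto
    then show "convex {x. Re (s H * \<alpha> H x) > 0}" using convex_linear_vimage[OF lin[OF H], of "{0<..}"] by simp
  qed
  show "piece s \<subseteq> X" unfolding X_iff piece_def subset_iff by auto
qed

text \<open>One of the four units turns a given nonzero complex number into the open right half
  plane.\<close>

lemma piece_cover:
  assumes "x \<in> X" shows "\<exists>s\<in>PiE \<A> (\<lambda>_. units). x \<in> piece s"
proof -
  have "\<exists>u\<in>units. Re (u * z) > 0" if "z \<noteq> 0" for z :: complex
  proof -
    have "Re z \<noteq> 0 \<or> Im z \<noteq> 0" using that by (simp add: complex_eq_iff)
    then show ?thesis unfolding units_def by (auto simp: linorder_neq_iff)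
  qed
  then have "\<forall>H\<in>\<A>. \<exists>u. u \<in> units \<and> Re (u * \<alpha> H x) > 0" using assms X_iff by blast
  then obtain s where s: "\<And>H. H \<in> \<A> \<Longrightarrow> s H \<in> units \<and> Re (s H * \<alpha> H x) > 0" by metis
  then have "restrict s \<A> \<in> PiE \<A> (\<lambda>_. units)" "x \<in> piece (restrict s \<A>)" by (auto simp: piece_def)
  then show ?thesis by blast
qed

text \<open>Only products are formed; the generators below are loops along edges taken in both
  directions.\<close>

inductive_set words :: "(complex \<Rightarrow> complex ^ 'm ^ 'm) set \<Rightarrow> (complex \<Rightarrow> complex ^ 'm ^ 'm) set"
  for G where
  words_Nil: "(\<lambda>h. mat 1) \<in> words G"
| words_snoc: "\<gamma> \<in> words G \<Longrightarrow> g \<in> G \<Longrightarrow> (\<lambda>h. \<gamma> h ** g h) \<in> words G"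

lemma reach_matrix_inv:
  assumes "reach x y P"
  shows "matrix_inv (P h) ** P h = mat 1" "P h ** matrix_inv (P h) = mat 1"
    and "reach y x (\<lambda>h. matrix_inv (P h))"
proof -
  obtain Q where Q: "reach y x Q" "\<And>h. Q h ** P h = mat 1" "\<And>h. P h ** Q h = mat 1"
    using reach_inverse[OF assms] by blast
  then have "matrix_inv (P h) = Q h" for h by (intro matrix_inv_unique) auto
  then show "matrix_inv (P h) ** P h = mat 1" "P h ** matrix_inv (P h) = mat 1" "reach y x (\<lambda>h. matrix_inv (P h))"
    using Q by auto
qed

text \<open>Choose a point in each nonempty intersection of two pieces and a path to it from
  \<open>x0\<close>. The generators run from \<open>x0\<close> to one chosen point, inside a piece
  to another, and back. A path is rewritten piece by piece, each change of piece contributing one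
  generator on the right; this is why the conclusion is about the inverse of
  \<open>P\<close>.\<close>

lemma pure_loops_finitely_generated:
  assumes x0: "x0 \<in> X"
  shows "\<exists>G. finite G \<and> G \<subseteq> {P. reach x0 x0 P} \<and>
    (\<forall>P. reach x0 x0 P \<longrightarrow> (\<lambda>h. matrix_inv (P h)) \<in> words G)"
proof -
  define I where "I = PiE \<A> (\<lambda>_. units)"
  have finI: "finite I" unfolding I_def by (intro finite_PiE finite_A) (simp add: units_def)
  define pt where "pt s t = (SOME x. x \<in> piece s \<inter> piece t)" for s t
  have pt: "pt s t \<in> piece s \<inter> piece t" if "x \<in> piece s \<inter> piece t" for s t x
    unfolding pt_def using that by (rule someI)
  define S where "S = insert x0 {pt s t | s t. s \<in> I \<and> t \<in> I \<and> piece s \<inter> piece t \<noteq> {}}"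
  have "finite ((\<lambda>(s, t). pt s t) ` (I \<times> I))" using finI by blast
  then have finS: "finite S" unfolding S_def
    by (rule_tac finite.insertI) (erule finite_subset[rotated], auto)
  have SX: "p \<in> X" if "p \<in> S" for p
    using that x0 pt cvx_D(3)[OF piece_cvx] unfolding S_def by blast
  have "\<forall>p\<in>S. \<exists>P. reach x0 p P" using reach_exists x0 SX by blast
  then obtain a' where a': "\<And>p. p \<in> S \<Longrightarrow> reach x0 p (a' p)" by metis
  \<comment> \<open>The chosen path to \<open>x0\<close> must be trivial, so that the final instance
    \<open>p = x0\<close> yields the loop itself.\<close>
  define a where "a = a'(x0 := (\<lambda>h. mat 1))"
  have a: "reach x0 p (a p)" if "p \<in> S" for p using a' that reach_refl[OF x0] by (auto simp: a_def)
  define gen where "gen p q = (\<lambda>h. matrix_inv (a q h) ** (T h p q ** a p h))" for p q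
  define G where "G = {gen p q | p q. p \<in> S \<and> q \<in> S \<and> (\<exists>s\<in>I. p \<in> piece s \<and> q \<in> piece s)}"
  have "finite ((\<lambda>(p, q). gen p q) ` (S \<times> S))" using finS by blast
  then have finG: "finite G" unfolding G_def by (rule finite_subset[rotated]) auto
  have Gloops: "G \<subseteq> {P. reach x0 x0 P}"
  proof
    fix g assume "g \<in> G"
    then obtain p q s where *: "g = gen p q" "p \<in> S" "q \<in> S" "p \<in> piece s" "q \<in> piece s" unfolding G_def by blast
    show "g \<in> {P. reach x0 x0 P}"
      unfolding *(1) gen_def
      using reach_trans[OF reach_step[OF a[OF *(2)] piece_cvx *(4,5)] reach_matrix_inv(3)[OF a[OF *(3)]]] by simp
  qed
  \<comment> \<open>The invariant of the rewriting: going out to any chosen point sharing a piece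
    with \<open>y\<close>, over to \<open>y\<close>, and back along \<open>P\<close> is a word in
    the generators.\<close>
  define C where "C y P \<longleftrightarrow> (\<forall>s\<in>I. \<forall>p\<in>S. y \<in> piece s \<and> p \<in> piece s \<longrightarrow>
    (\<lambda>h. matrix_inv (P h) ** (T h p y ** a p h)) \<in> words G)" for y P
  \<comment> \<open>The detour is through the chosen point \<open>q\<close> of the intersection of
    the old piece \<open>t\<close> with the new piece \<open>s\<close>: the part up to
    \<open>q\<close> is covered by the invariant, the part from \<open>p\<close> to \<open>q\<close>
    is a generator.\<close>
  have step1: "C z (\<lambda>h. T h y z ** P h)" if C: "C y P" and yz: "y \<in> piece t" "z \<in> piece t" "t \<in> I" and P: "reach x0 y P" for y z P t
    unfolding C_def
  proof (intro ballI impI)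
    fix s p assume s: "s \<in> I" and p: "p \<in> S" and zp: "z \<in> piece s \<and> p \<in> piece s"
    define q where "q = pt s t"
    have q: "q \<in> S" "q \<in> piece s" "q \<in> piece t"
      unfolding q_def S_def using pt[of z s t] zp yz s by auto
    have w: "(\<lambda>h. matrix_inv (P h) ** (T h q y ** a q h)) \<in> words G"
      using C yz q unfolding C_def by blast
    have g: "gen p q \<in> G" using p q zp s unfolding G_def by blast
    have "matrix_inv (T h y z ** P h) ** (T h p z ** a p h) =
        (matrix_inv (P h) ** (T h q y ** a q h)) ** gen p q h" for h
    proof -
      have "matrix_inv (T h y z ** P h) = matrix_inv (P h) ** T h z y"
      proof (rule matrix_inv_unique)
        have "matrix_inv (P h) ** T h z y ** (T h y z ** P h) = matrix_inv (P h) ** (T h z y ** T h y z) ** P h"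
          by (simp add: matrix_mul_assoc)
        then show *: "matrix_inv (P h) ** T h z y ** (T h y z ** P h) = mat 1"
          using T_inverse[OF piece_cvx yz(1,2)] reach_matrix_inv(1)[OF P] by simp
        then show "T h y z ** P h ** (matrix_inv (P h) ** T h z y) = mat 1"
          using matrix_left_right_inverse by blast
      qed
      then have "matrix_inv (T h y z ** P h) ** (T h p z ** a p h) = matrix_inv (P h) ** ((T h z y ** T h p z) ** a p h)"
        by (simp add: matrix_mul_assoc)
      also have "T h z y ** T h p z = T h q y ** T h p q"
      proof -
        have "T h q z ** T h p q = T h p z" using T_trans[OF piece_cvx, of p s q z h] zp q by simp
        then have "T h z y ** T h p z = (T h z y ** T h q z) ** T h p q" by (simp flip: matrix_mul_assoc)
        then show ?thesis using T_trans[OF piece_cvx q(3) yz(2) yz(1), of h] by simp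
      qed
      also have "matrix_inv (P h) ** ((T h q y ** T h p q) ** a p h) =
          matrix_inv (P h) ** (T h q y ** (a q h ** matrix_inv (a q h)) ** T h p q ** a p h)"
        using reach_matrix_inv(2)[OF a[OF q(1)]] by simp
      finally show ?thesis unfolding gen_def by (simp add: matrix_mul_assoc)
    qed
    then show "(\<lambda>h. matrix_inv (T h y z ** P h) ** (T h p z ** a p h)) \<in> words G"
      using words_snoc[OF w g] by simp
  qed
  have step: "C z (\<lambda>h. T h y z ** P h)" if C: "C y P" and K: "cvx K" "y \<in> K" "z \<in> K" and P: "reach x0 y P" for y z P K
  proof -
    \<comment> \<open>The convex set \<open>K\<close> need not lie in one piece. Bisection cuts the
      segment from \<open>y\<close> to \<open>z\<close> into parts each contained in a single
      piece.\<close>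
    define g where "g t = y + t *\<^sub>R (z - y)" for t :: real
    have gK: "g t \<in> K" if "t \<in> {0..1}" for t
      unfolding g_def by (rule flat_form.cvx_seg[OF flat_om K[unfolded cvx_eq] that])
    define Q where "Q u v \<longleftrightarrow> (0 \<le> u \<and> u \<le> v \<and> v \<le> 1 \<longrightarrow> (\<forall>P. reach x0 (g u) P \<longrightarrow> C (g u) P \<longrightarrow>
      C (g v) (\<lambda>h. T h (g u) (g v) ** P h)))" for u v
    have "(0::real) \<le> 1" by simp
    then have "Q 0 1"
    proof (induction rule: Bolzano)
      case (trans u v w)
      show ?case unfolding Q_def
      proof (intro impI allI)
        fix P assume *: "0 \<le> u \<and> u \<le> w \<and> w \<le> 1" "reach x0 (g u) P" "C (g u) P"
        have le: "0 \<le> u \<and> u \<le> v \<and> v \<le> 1" "0 \<le> v \<and> v \<le> w \<and> w \<le> 1" using *(1) trans(3,4) by linarith+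
        have gs: "g u \<in> K" "g v \<in> K" "g w \<in> K" using le by (auto intro: gK)
        have 1: "C (g v) (\<lambda>h. T h (g u) (g v) ** P h)"
          by (rule trans(1)[unfolded Q_def, rule_format, OF le(1) *(2,3)])
        have 2: "reach x0 (g v) (\<lambda>h. T h (g u) (g v) ** P h)" by (rule reach_step[OF *(2) K(1) gs(1,2)])
        have "C (g w) (\<lambda>h. T h (g v) (g w) ** (T h (g u) (g v) ** P h))"
          by (rule trans(2)[unfolded Q_def, rule_format, OF le(2) 2 1])
        then show "C (g w) (\<lambda>h. T h (g u) (g w) ** P h)"
          using T_trans[OF K(1) gs] by (simp add: matrix_mul_assoc)
      qed
    next
      case (local x)
      then have "g x \<in> X" using gK cvx_D(4)[OF K(1)] by auto
      then obtain s where s: "s \<in> I" "g x \<in> piece s" using piece_cover unfolding I_def by blast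
      obtain e where e: "e > 0" "ball (g x) e \<subseteq> piece s"
        using cvx_D(1)[OF piece_cvx] s(2) open_contains_ball by blast
      have "continuous (at x) g" unfolding g_def by (intro continuous_intros)
      then obtain d where d: "d > 0" "\<And>t. dist t x < d \<Longrightarrow> dist (g t) (g x) < e"
        using e(1) unfolding continuous_at_eps_delta by blast
      have d2: "g t \<in> piece s" if "dist t x < d" for t
        using d(2)[OF that] e(2) by (auto simp: dist_commute)
      have "Q u v" if uv: "u \<le> x" "x \<le> v" "v - u < d" for u v
        unfolding Q_def
      proof (intro impI allI)
        fix P assume "reach x0 (g u) P" "C (g u) P"
        moreover have "g u \<in> piece s" "g v \<in> piece s" using uv by (auto intro!: d2 simp: dist_real_def)
        ultimately show "C (g v) (\<lambda>h. T h (g u) (g v) ** P h)" using step1 s(1) by blast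
      qed
      then show ?case using d(1) by blast
    qed
    then have "\<forall>P. reach x0 (g 0) P \<longrightarrow> C (g 0) P \<longrightarrow> C (g 1) (\<lambda>h. T h (g 0) (g 1) ** P h)"
      unfolding Q_def by simp
    moreover have "g 0 = y" "g 1 = z" by (simp_all add: g_def)
    ultimately show ?thesis using C P by metis
  qed
  have C: "C y P" if "reach x y P" "x = x0" for x y P
    using that
  proof (induction rule: reach.induct)
    case (reach_refl x)
    show ?case unfolding C_def
    proof (intro ballI impI)
      fix s p assume "s \<in> I" "p \<in> S" "x \<in> piece s \<and> p \<in> piece s"
      then have "gen p x0 \<in> G" using reach_refl unfolding G_def S_def by blast
      moreover have "matrix_inv (mat 1 :: complex ^ 'm ^ 'm) = mat 1" by (rule matrix_inv_unique) simp_all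
      then have "gen p x0 = (\<lambda>h. matrix_inv (mat 1) ** (T h p x ** a p h))"
        using reach_refl by (simp add: gen_def a_def)
      ultimately show "(\<lambda>h. matrix_inv (mat 1) ** (T h p x ** a p h)) \<in> words G"
        using words_snoc[OF words_Nil, of "gen p x0" G] by simp
    qed
  next
    case (reach_step x y P K z)
    then show ?case using step by blast
  qed
  have "(\<lambda>h. matrix_inv (P h)) \<in> words G" if P: "reach x0 x0 P" for P
  proof -
    obtain s where s: "s \<in> I" "x0 \<in> piece s" using piece_cover x0 unfolding I_def by blast
    have "x0 \<in> S" by (simp add: S_def)
    then have "(\<lambda>h. matrix_inv (P h) ** (T h x0 x0 ** a x0 h)) \<in> words G"
      using C[OF P refl] s unfolding C_def by blast
    then show ?thesis using T_refl[OF x0] by (simp add: a_def)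
  qed
  then show ?thesis using finG Gloops by blast
qed

end

section \<open>Equivariance and monodromies of loops in the orbit space\<close>

locale equivariant_connection = log_connection \<A> \<alpha> A
  for \<A> :: "(complex ^ 'n) set set" and \<alpha> :: "(complex ^ 'n) set \<Rightarrow> complex ^ 'n \<Rightarrow> complex"
    and A :: "(complex ^ 'n) set \<Rightarrow> complex ^ 'm ^ 'm" +
  fixes W :: "(complex ^ 'n ^ 'n) set" and \<rho> :: "complex ^ 'n ^ 'n \<Rightarrow> complex ^ 'm ^ 'm"
  assumes finite_W: "finite W"
    and one_W: "mat 1 \<in> W"
    and mult_W: "w \<in> W \<Longrightarrow> w' \<in> W \<Longrightarrow> w ** w' \<in> W"
    and inv_W: "w \<in> W \<Longrightarrow> \<exists>w'\<in>W. w' ** w = mat 1 \<and> w ** w' = mat 1"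
    and isometric_W: "w \<in> W \<Longrightarrow> norm (w *v v) = norm v"
    and free_W: "w \<in> W \<Longrightarrow> x \<in> X \<Longrightarrow> w *v x = x \<Longrightarrow> w = mat 1"
    and perm_W: "w \<in> W \<Longrightarrow> H \<in> \<A> \<Longrightarrow> (*v) w ` H \<in> \<A>"
    and rho_one: "\<rho> (mat 1) = mat 1"
    and rho_mult: "w \<in> W \<Longrightarrow> w' \<in> W \<Longrightarrow> \<rho> (w ** w') = \<rho> w ** \<rho> w'"
    and equiv_A: "w \<in> W \<Longrightarrow> H \<in> \<A> \<Longrightarrow> A ((*v) w ` H) ** \<rho> w = \<rho> w ** A H"
begin

definition winv :: "complex ^ 'n ^ 'n \<Rightarrow> complex ^ 'n ^ 'n" where
  "winv w = (SOME w'. w' \<in> W \<and> w' ** w = mat 1 \<and> w ** w' = mat 1)"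

lemma winv: "w \<in> W \<Longrightarrow> winv w \<in> W \<and> winv w ** w = mat 1 \<and> w ** winv w = mat 1"
  unfolding winv_def using inv_W by (intro someI_ex[of "\<lambda>w'. w' \<in> W \<and> w' ** w = mat 1 \<and> w ** w' = mat 1"]) blast

lemma winv_vec: "w \<in> W \<Longrightarrow> winv w *v (w *v x) = x" "w \<in> W \<Longrightarrow> w *v (winv w *v x) = x"
  using winv[of w] by (simp_all add: matrix_vector_mul_assoc)

lemma rho_winv: "w \<in> W \<Longrightarrow> \<rho> (winv w) ** \<rho> w = mat 1" "w \<in> W \<Longrightarrow> \<rho> w ** \<rho> (winv w) = mat 1"
  using winv[of w] rho_mult rho_one by metis+

lemma image_winv: "w \<in> W \<Longrightarrow> (*v) w ` K = {y. winv w *v y \<in> K}"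
proof (intro equalityI subsetI CollectI)
  assume w: "w \<in> W"
  show "winv w *v y \<in> K" if "y \<in> (*v) w ` K" for y using that winv_vec(1)[OF w] by auto
  show "y \<in> (*v) w ` K" if "y \<in> {y. winv w *v y \<in> K}" for y
    using that winv_vec(2)[OF w, of y] by (intro image_eqI[of _ _ "winv w *v y"]) auto
qed

lemma W_preserves_X: "w \<in> W \<Longrightarrow> w *v x \<in> X \<longleftrightarrow> x \<in> X"
proof -
  have *: "w *v x \<in> X" if w: "w \<in> W" and x: "x \<in> X" for w x
  proof (rule ccontr)
    assume "w *v x \<notin> X"
    then obtain H where H: "H \<in> \<A>" "w *v x \<in> H" unfolding X_def by blast
    then have "winv w *v (w *v x) \<in> (*v) (winv w) ` H" by blast
    then have "x \<in> (*v) (winv w) ` H" using winv_vec w by simp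
    then show False using perm_W[of "winv w" H] winv[OF w] H(1) x unfolding X_def by blast
  qed
  assume "w \<in> W"
  then show ?thesis using *[of w x] *[of "winv w" "w *v x"] winv winv_vec by auto
qed

lemma cvx_image:
  assumes w: "w \<in> W" and K: "cvx K" shows "cvx ((*v) w ` K)"
  unfolding cvx_def
proof (intro conjI)
  have "open ((*v) (winv w) -` K)"
    using cvx_D(1)[OF K] bounded_linear_matrix_vector linear_continuous_on by (intro open_vimage) auto
  then show "open ((*v) w ` K)" using image_winv[OF w] by (simp add: vimage_def)
  show "convex ((*v) w ` K)" by (intro convex_linear_image linear_matrix_vector cvx_D(2)[OF K])
  show "(*v) w ` K \<subseteq> X" using W_preserves_X[OF w] cvx_D(3)[OF K] by auto
qed

lemma form_image:
  assumes w: "w \<in> W" and H: "H \<in> \<A>"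
  shows "\<exists>c. c \<noteq> 0 \<and> (\<forall>v. \<alpha> ((*v) w ` H) (w *v v) = c * \<alpha> H v)"
proof -
  let ?H = "(*v) w ` H"
  have H': "?H \<in> \<A>" by (rule perm_W[OF w H])
  obtain e where e: "\<alpha> H e = 1" using unit_vector H by blast
  have lf: "linear_form (\<lambda>v. \<alpha> ?H (w *v v))"
    unfolding linear_form_iff
    by (simp add: matrix_vector_right_distrib linear_form_add[OF form[OF H']] vector_scalar_commute linear_form_scale[OF form[OF H']])
  have f1: "\<alpha> ?H (w *v v) = \<alpha> H v * \<alpha> ?H (w *v e)" for v
  proof (rule linear_form_kernel_subset[OF form[OF H] lf _ e])
    fix v assume "\<alpha> H v = 0"
    then have "w *v v \<in> ?H" using kernel_iff[OF H] by blast
    then show "\<alpha> ?H (w *v v) = 0" using kernel_iff[OF H'] by blast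
  qed
  have "\<alpha> ?H (w *v e) \<noteq> 0"
  proof
    assume "\<alpha> ?H (w *v e) = 0"
    then have "w *v e \<in> ?H" using kernel_iff[OF H'] by blast
    then have "winv w *v (w *v e) \<in> H" using image_winv[OF w, of H] by blast
    then show False using winv_vec[OF w] kernel_iff[OF H] e by simp
  qed
  moreover have "\<alpha> ?H (w *v v) = \<alpha> ?H (w *v e) * \<alpha> H v" for v
    by (rule trans[OF f1 mult.commute])
  ultimately show ?thesis by blast
qed

lemma lform_equivariant:
  assumes w: "w \<in> W"
  shows "lform A (w *v x) (w *v v) ** \<rho> w = \<rho> w ** lform A x v"
proof -
  let ?i = "\<lambda>H. (*v) w ` H"
  have inj: "inj_on ?i \<A>"
  proof (rule inj_onI)
    fix H K assume "?i H = ?i K"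
    then have "(*v) (winv w) ` ?i H = (*v) (winv w) ` ?i K" by simp
    then show "H = K" using winv_vec(1)[OF w] by (simp add: image_image)
  qed
  have surj: "?i ` \<A> = \<A>"
  proof (rule card_subset_eq[OF finite_A])
    show "?i ` \<A> \<subseteq> \<A>" using perm_W[OF w] by blast
    show "card (?i ` \<A>) = card \<A>" by (rule card_image[OF inj])
  qed
  have "lform A (w *v x) (w *v v) ** \<rho> w = (\<Sum>H\<in>?i ` \<A>. (mat (\<alpha> H (w *v v) / \<alpha> H (w *v x)) ** A H) ** \<rho> w)"
    unfolding surj by (simp add: lform_def matrix_mult_sum_left)
  also have "\<dots> = (\<Sum>H\<in>\<A>. (mat (\<alpha> (?i H) (w *v v) / \<alpha> (?i H) (w *v x)) ** A (?i H)) ** \<rho> w)"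
    by (subst sum.reindex[OF inj]) simp
  also have "\<dots> = (\<Sum>H\<in>\<A>. \<rho> w ** (mat (\<alpha> H v / \<alpha> H x) ** A H))"
  proof (rule sum.cong[OF refl])
    fix H assume H: "H \<in> \<A>"
    \<comment> \<open>The linear form of the image hyperplane matches the old one only up to a
      scalar, which cancels in the logarithmic form.\<close>
    obtain c where c: "c \<noteq> 0" "\<And>v. \<alpha> (?i H) (w *v v) = c * \<alpha> H v" using form_image[OF w H] by blast
    show "(mat (\<alpha> (?i H) (w *v v) / \<alpha> (?i H) (w *v x)) ** A (?i H)) ** \<rho> w = \<rho> w ** (mat (\<alpha> H v / \<alpha> H x) ** A H)"
      using c(1) equiv_A[OF w H] by (simp add: c(2) mat_left_commute flip: matrix_mul_assoc)
  qed
  finally show ?thesis by (simp add: lform_def matrix_mult_sum_right)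
qed

lemma om_equivariant: "w \<in> W \<Longrightarrow> om h (w *v x) (w *v v) ** \<rho> w = \<rho> w ** om h x v"
  unfolding om_def by (simp only: mat_left_commute lform_equivariant flip: matrix_mul_assoc)

text \<open>Composing the transport at the translated points with \<open>\<rho> (winv w)\<close>
  gives a solution of the original equation on \<open>K\<close>, determined by its value at
  \<open>p\<close>.\<close>

lemma T_equivariant:
  assumes w: "w \<in> W" and K: "cvx K" "p \<in> K" "x \<in> K"
  shows "T h (w *v p) (w *v x) = \<rho> w ** T h p x ** \<rho> (winv w)"
proof -
  note wK = cvx_image[OF w K(1)]
  let ?S = "\<lambda>y. \<rho> (winv w) ** T h (w *v p) (w *v y)"
  have "sol h K ?S"
    unfolding sol_def
  proof
    fix y assume y: "y \<in> K"
    have "(T h (w *v p) has_derivative (\<lambda>v. om h (w *v y) v ** T h (w *v p) (w *v y))) (at (w *v y))"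
      using T_sol[OF wK, of "w *v p" h] K y by (auto simp: sol_def)
    from has_derivative_compose[OF bounded_linear_imp_has_derivative[OF bounded_linear_matrix_vector] this]
    have "((\<lambda>y. T h (w *v p) (w *v y)) has_derivative (\<lambda>v. om h (w *v y) (w *v v) ** T h (w *v p) (w *v y))) (at y)" .
    from bounded_linear.has_derivative[OF bounded_bilinear.bounded_linear_right[OF bounded_bilinear_matrix_mult] this, of "\<rho> (winv w)"]
    have "(?S has_derivative (\<lambda>v. \<rho> (winv w) ** (om h (w *v y) (w *v v) ** T h (w *v p) (w *v y)))) (at y)" .
    moreover have "\<rho> (winv w) ** (om h (w *v y) (w *v v) ** B) = om h y v ** (\<rho> (winv w) ** B)"
      for v and B :: "complex ^ 'm ^ 'm"
    proof -
      have "om h (w *v y) (w *v v) = om h (w *v y) (w *v v) ** \<rho> w ** \<rho> (winv w)"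
        using rho_winv(2)[OF w] by (simp flip: matrix_mul_assoc)
      also have "\<dots> = \<rho> w ** om h y v ** \<rho> (winv w)" using om_equivariant[OF w] by simp
      finally have "\<rho> (winv w) ** (om h (w *v y) (w *v v) ** B) = (\<rho> (winv w) ** \<rho> w) ** om h y v ** (\<rho> (winv w) ** B)"
        by (simp add: matrix_mul_assoc)
      then show ?thesis using rho_winv(1)[OF w] by simp
    qed
    ultimately show "(?S has_derivative (\<lambda>v. om h y v ** ?S y)) (at y)" by simp
  qed
  from sol_T[OF K this] have "\<rho> (winv w) ** T h (w *v p) (w *v x) = T h p x ** (\<rho> (winv w) ** T h (w *v p) (w *v p))" .
  also have "T h (w *v p) (w *v p) = mat 1"
    using T_refl W_preserves_X[OF w] cvx_D(4)[OF K(1,2)] by blast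
  finally have "\<rho> w ** (\<rho> (winv w) ** T h (w *v p) (w *v x)) = \<rho> w ** (T h p x ** \<rho> (winv w))" by simp
  then show ?thesis using rho_winv(2)[OF w] by (simp add: matrix_mul_assoc)
qed

lemma reach_equivariant:
  assumes w: "w \<in> W" and P: "reach x y P"
  shows "reach (w *v x) (w *v y) (\<lambda>h. \<rho> w ** P h ** \<rho> (winv w))"
  using P
proof (induction rule: reach.induct)
  case (reach_refl x)
  then show ?case using reach.reach_refl W_preserves_X[OF w] rho_winv(2)[OF w] by simp
next
  case (reach_step x y P K z)
  have "reach (w *v x) (w *v z) (\<lambda>h. T h (w *v y) (w *v z) ** (\<rho> w ** P h ** \<rho> (winv w)))"
    using reach_step by (intro reach.reach_step[OF reach_step.IH cvx_image[OF w reach_step.hyps(2)]]) auto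
  moreover have "T h (w *v y) (w *v z) ** (\<rho> w ** P h ** \<rho> (winv w)) = \<rho> w ** (T h y z ** P h) ** \<rho> (winv w)" for h
  proof -
    have "T h (w *v y) (w *v z) ** (\<rho> w ** P h ** \<rho> (winv w)) = \<rho> w ** T h y z ** (\<rho> (winv w) ** \<rho> w) ** P h ** \<rho> (winv w)"
      unfolding T_equivariant[OF w reach_step.hyps(2-4)] by (simp add: matrix_mul_assoc)
    then show ?thesis using rho_winv(1)[OF w] by (simp add: matrix_mul_assoc)
  qed
  ultimately show ?case by simp
qed

lemma trans_is_equivariant:
  assumes w: "w \<in> W" and M: "trans_is h g M"
  shows "trans_is h (\<lambda>t. w *v g t) (\<rho> w ** M ** \<rho> (winv w))"
proof -
  obtain G where G: "tr_on h g 0 1 G" "G 0 = mat 1" "G 1 = M" using M by (auto simp: trans_is_def)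
  have "tr_on h (\<lambda>t. w *v g t) 0 1 (\<lambda>t. \<rho> w ** G t ** \<rho> (winv w))"
    unfolding tr_on_def
  proof
    fix t :: real assume "t \<in> {0..1}"
    then obtain \<delta> where \<delta>: "\<delta> > 0" "\<And>s. s \<in> {0..1} \<Longrightarrow> \<bar>s - t\<bar> < \<delta> \<Longrightarrow>
        (\<exists>K. cvx K \<and> g t \<in> K \<and> g s \<in> K) \<and> G s = T h (g t) (g s) ** G t"
      using G(1) unfolding tr_on_def by blast
    have "(\<exists>K. cvx K \<and> w *v g t \<in> K \<and> w *v g s \<in> K) \<and>
        \<rho> w ** G s ** \<rho> (winv w) = T h (w *v g t) (w *v g s) ** (\<rho> w ** G t ** \<rho> (winv w))"
      if s: "s \<in> {0..1}" "\<bar>s - t\<bar> < \<delta>" for s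
    proof -
      obtain K where K: "cvx K" "g t \<in> K" "g s \<in> K" and Gs: "G s = T h (g t) (g s) ** G t"
        using \<delta>(2)[OF s] by blast
      have "T h (w *v g t) (w *v g s) ** (\<rho> w ** G t ** \<rho> (winv w)) =
          \<rho> w ** T h (g t) (g s) ** (\<rho> (winv w) ** \<rho> w) ** G t ** \<rho> (winv w)"
        unfolding T_equivariant[OF w K] by (simp add: matrix_mul_assoc)
      also have "\<dots> = \<rho> w ** G s ** \<rho> (winv w)"
        using rho_winv(1)[OF w] by (simp add: Gs matrix_mul_assoc)
      finally show ?thesis using cvx_image[OF w K(1)] K(2,3) by auto
    qed
    then show "\<exists>\<delta>>0. \<forall>s\<in>{0..1}. \<bar>s - t\<bar> < \<delta> \<longrightarrow> (\<exists>K. cvx K \<and> w *v g t \<in> K \<and> w *v g s \<in> K) \<and>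
        \<rho> w ** G s ** \<rho> (winv w) = T h (w *v g t) (w *v g s) ** (\<rho> w ** G t ** \<rho> (winv w))"
      using \<delta>(1) by blast
  qed
  then show ?thesis unfolding trans_is_def using G rho_winv(2)[OF w]
    by (intro exI[of _ "\<lambda>t. \<rho> w ** G t ** \<rho> (winv w)"]) simp
qed

text \<open>\<open>mon x0 w \<gamma>\<close>: the family \<open>\<gamma>\<close> consists of the monodromies of one loop in the orbit space
  whose lift runs from \<open>x0\<close> to \<open>w x0\<close>.\<close>

definition mon :: "complex ^ 'n \<Rightarrow> complex ^ 'n ^ 'n \<Rightarrow> (complex \<Rightarrow> complex ^ 'm ^ 'm) \<Rightarrow> bool" where
  "mon x0 w \<gamma> \<longleftrightarrow> w \<in> W \<and> (\<exists>P. reach x0 (w *v x0) P \<and> \<gamma> = (\<lambda>h. matrix_inv (P h) ** \<rho> w))"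

lemma mon_pure: "reach x0 x0 P \<Longrightarrow> mon x0 (mat 1) (\<lambda>h. matrix_inv (P h))"
  unfolding mon_def using one_W rho_one by (intro conjI exI[of _ P]) simp_all

lemma mon_pureD: "mon x0 (mat 1) \<gamma> \<Longrightarrow> \<exists>P. reach x0 x0 P \<and> \<gamma> = (\<lambda>h. matrix_inv (P h))"
  unfolding mon_def using rho_one by simp

lemma mon_at_zero: "mon x0 w \<gamma> \<Longrightarrow> \<gamma> 0 = \<rho> w"
proof -
  assume "mon x0 w \<gamma>"
  then obtain P where "reach x0 (w *v x0) P" "\<gamma> = (\<lambda>h. matrix_inv (P h) ** \<rho> w)" by (auto simp: mon_def)
  moreover have "matrix_inv (mat 1 :: complex ^ 'm ^ 'm) = mat 1" by (rule matrix_inv_unique) simp_all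
  ultimately show ?thesis using reach_zero[of x0 "w *v x0" P] by simp
qed

lemma mon_tendsto:
  assumes "mon x0 w \<gamma>" "(h \<longlongrightarrow> 0) F" shows "((\<lambda>n. \<gamma> (h n)) \<longlongrightarrow> \<rho> w) F"
proof -
  obtain P where P: "reach x0 (w *v x0) P" "\<gamma> = (\<lambda>h. matrix_inv (P h) ** \<rho> w)" using assms(1) by (auto simp: mon_def)
  have "((\<lambda>n. matrix_inv (P (h n)) ** \<rho> w) \<longlongrightarrow> mat 1 ** \<rho> w) F"
    by (intro tendsto_intros reach_tendsto[OF reach_matrix_inv(3)[OF P(1)] assms(2)])
  then show ?thesis by (simp add: P(2))
qed

text \<open>The second path is translated by \<open>w\<close> before it is appended, which
  conjugates its transport by \<open>\<rho> w\<close>. Passing to inverses reverses the order of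
  composition once more, so the monodromies multiply in the order of the loops.\<close>

lemma twisted_product:
  assumes w: "w \<in> W" "w' \<in> W" and P: "reach x0 (w *v x0) P" and Q: "reach x0 (w' *v x0) Q"
  shows "matrix_inv (\<rho> w ** Q h ** \<rho> (winv w) ** P h) ** \<rho> (w ** w') =
    (matrix_inv (P h) ** \<rho> w) ** (matrix_inv (Q h) ** \<rho> w')"
proof -
  have "matrix_inv (\<rho> w ** Q h ** \<rho> (winv w) ** P h) = matrix_inv (P h) ** \<rho> w ** matrix_inv (Q h) ** \<rho> (winv w)" (is "_ = ?R")
  proof (rule matrix_inv_unique)
    have "?R ** (\<rho> w ** Q h ** \<rho> (winv w) ** P h) =
        matrix_inv (P h) ** \<rho> w ** matrix_inv (Q h) ** (\<rho> (winv w) ** \<rho> w) ** Q h ** \<rho> (winv w) ** P h"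
      by (simp add: matrix_mul_assoc)
    also have "\<dots> = matrix_inv (P h) ** \<rho> w ** (matrix_inv (Q h) ** Q h) ** \<rho> (winv w) ** P h"
      using rho_winv(1)[OF w(1)] by (simp add: matrix_mul_assoc)
    also have "\<dots> = matrix_inv (P h) ** (\<rho> w ** \<rho> (winv w)) ** P h"
      using reach_matrix_inv(1)[OF Q] by (simp add: matrix_mul_assoc)
    finally show *: "?R ** (\<rho> w ** Q h ** \<rho> (winv w) ** P h) = mat 1"
      using rho_winv(2)[OF w(1)] reach_matrix_inv(1)[OF P] by simp
    then show "(\<rho> w ** Q h ** \<rho> (winv w) ** P h) ** ?R = mat 1" using matrix_left_right_inverse by blast
  qed
  then have "matrix_inv (\<rho> w ** Q h ** \<rho> (winv w) ** P h) ** \<rho> (w ** w') =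
      matrix_inv (P h) ** \<rho> w ** matrix_inv (Q h) ** (\<rho> (winv w) ** \<rho> w) ** \<rho> w'"
    using rho_mult[OF w] by (simp add: matrix_mul_assoc)
  then show ?thesis using rho_winv(1)[OF w(1)] by (simp add: matrix_mul_assoc)
qed

lemma mon_mult:
  assumes 1: "mon x0 w \<gamma>" and 2: "mon x0 w' \<gamma>'"
  shows "mon x0 (w ** w') (\<lambda>h. \<gamma> h ** \<gamma>' h)"
proof -
  obtain P where P: "w \<in> W" "reach x0 (w *v x0) P" "\<gamma> = (\<lambda>h. matrix_inv (P h) ** \<rho> w)" using 1 by (auto simp: mon_def)
  obtain Q where Q: "w' \<in> W" "reach x0 (w' *v x0) Q" "\<gamma>' = (\<lambda>h. matrix_inv (Q h) ** \<rho> w')" using 2 by (auto simp: mon_def)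
  have "reach (w *v x0) (w *v (w' *v x0)) (\<lambda>h. \<rho> w ** Q h ** \<rho> (winv w))"
    by (rule reach_equivariant[OF P(1) Q(2)])
  from reach_trans[OF P(2) this]
  have R: "reach x0 ((w ** w') *v x0) (\<lambda>h. \<rho> w ** Q h ** \<rho> (winv w) ** P h)"
    by (simp add: matrix_vector_mul_assoc)
  have "matrix_inv (\<rho> w ** Q h ** \<rho> (winv w) ** P h) ** \<rho> (w ** w') = \<gamma> h ** \<gamma>' h" for h
    unfolding P(3) Q(3) by (rule twisted_product[OF P(1) Q(1) P(2) Q(2)])
  then show ?thesis unfolding mon_def using R mult_W[OF P(1) Q(1)]
    by (intro conjI exI[of _ "\<lambda>h. \<rho> w ** Q h ** \<rho> (winv w) ** P h"]) auto
qed

lemma mon_inverse: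
  assumes "mon x0 w \<gamma>"
  shows "\<exists>\<gamma>'. mon x0 (winv w) \<gamma>' \<and> (\<forall>h. \<gamma>' h ** \<gamma> h = mat 1 \<and> \<gamma> h ** \<gamma>' h = mat 1)"
proof -
  obtain P where P: "w \<in> W" "reach x0 (w *v x0) P" "\<gamma> = (\<lambda>h. matrix_inv (P h) ** \<rho> w)" using assms by (auto simp: mon_def)
  have w': "winv w \<in> W" using winv[OF P(1)] by simp
  have ww: "winv (winv w) = w"
  proof -
    have "winv (winv w) = winv (winv w) ** (winv w ** w)" using winv[OF P(1)] by simp
    also have "\<dots> = (winv (winv w) ** winv w) ** w" by (simp add: matrix_mul_assoc)
    finally show ?thesis using winv[OF w'] by simp
  qed
  have "reach (winv w *v (w *v x0)) (winv w *v x0) (\<lambda>h. \<rho> (winv w) ** matrix_inv (P h) ** \<rho> (winv (winv w)))"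
    by (rule reach_equivariant[OF w' reach_matrix_inv(3)[OF P(2)]])
  then have R: "reach x0 (winv w *v x0) (\<lambda>h. \<rho> (winv w) ** matrix_inv (P h) ** \<rho> w)"
    by (simp add: winv_vec[OF P(1)] ww)
  let ?\<gamma> = "\<lambda>h. matrix_inv (\<rho> (winv w) ** matrix_inv (P h) ** \<rho> w) ** \<rho> (winv w)"
  have 1: "?\<gamma> h ** \<gamma> h = mat 1" for h
  proof -
    have "?\<gamma> h ** \<gamma> h = matrix_inv (\<rho> (winv w) ** matrix_inv (P h) ** \<rho> w) ** (\<rho> (winv w) ** matrix_inv (P h) ** \<rho> w)"
      by (simp add: P(3) matrix_mul_assoc)
    then show ?thesis using reach_matrix_inv(1)[OF R, of h] by simp
  qed
  have "mon x0 (winv w) ?\<gamma>"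
    unfolding mon_def using w' R by (intro conjI exI[of _ "\<lambda>h. \<rho> (winv w) ** matrix_inv (P h) ** \<rho> w"]) auto
  then show ?thesis using 1 matrix_left_right_inverse by blast
qed

lemma mon_exists: "x0 \<in> X \<Longrightarrow> w \<in> W \<Longrightarrow> \<exists>\<gamma>. mon x0 w \<gamma>"
  unfolding mon_def using reach_exists[of x0 "w *v x0"] W_preserves_X by blast

text \<open>The pure loops have finite index: one monodromy \<open>D w\<close> for each element of
  the finite group is adjoined, and dividing by it leaves a pure loop.\<close>

lemma monodromies_finitely_generated:
  assumes x0: "x0 \<in> X"
  shows "\<exists>G. finite G \<and> (\<forall>g\<in>G. \<exists>w. mon x0 w g) \<and> (\<forall>w \<gamma>. mon x0 w \<gamma> \<longrightarrow> \<gamma> \<in> words G)"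
proof -
  obtain G where G: "finite G" "G \<subseteq> {P. reach x0 x0 P}" "\<And>P. reach x0 x0 P \<Longrightarrow> (\<lambda>h. matrix_inv (P h)) \<in> words G"
    using pure_loops_finitely_generated[OF x0] by blast
  obtain D where D: "\<And>w. w \<in> W \<Longrightarrow> mon x0 w (D w)" using mon_exists[OF x0] by metis
  have inv_inv: "matrix_inv (matrix_inv (P h)) = P h" if "reach x0 x0 P" for P h
    using reach_matrix_inv(1,2)[OF that] by (intro matrix_inv_unique) auto
  have "\<exists>w. mon x0 w g" if "g \<in> G \<union> D ` W" for g
  proof -
    have "mon x0 (mat 1) g" if "g \<in> G"
    proof -
      have g: "reach x0 x0 g" using that G(2) by blast
      have "mon x0 (mat 1) (\<lambda>h. matrix_inv (matrix_inv (g h)))"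
        by (rule mon_pure[OF reach_matrix_inv(3)[OF g]])
      then show ?thesis using inv_inv[OF g] by simp
    qed
    then show ?thesis using that D by blast
  qed
  moreover have "\<gamma> \<in> words (G \<union> D ` W)" if \<gamma>: "mon x0 w \<gamma>" for w \<gamma>
  proof -
    have w: "w \<in> W" using \<gamma> by (simp add: mon_def)
    obtain E where E: "mon x0 (winv w) E" "\<And>h. E h ** D w h = mat 1" "\<And>h. D w h ** E h = mat 1"
      using mon_inverse[OF D[OF w]] by blast
    have "mon x0 (mat 1) (\<lambda>h. \<gamma> h ** E h)" using mon_mult[OF \<gamma> E(1)] winv[OF w] by simp
    then obtain P where P: "reach x0 x0 P" "(\<lambda>h. \<gamma> h ** E h) = (\<lambda>h. matrix_inv (P h))"
      using mon_pureD by blast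
    have 1: "(\<lambda>h. \<gamma> h ** E h) \<in> words G" unfolding P(2) by (rule G(3)[OF P(1)])
    have "words G \<subseteq> words (G \<union> D ` W)"
    proof
      fix g assume "g \<in> words G" then show "g \<in> words (G \<union> D ` W)"
        by (induction rule: words.induct) (auto intro: words.intros)
    qed
    with 1 have "(\<lambda>h. \<gamma> h ** E h) \<in> words (G \<union> D ` W)" by blast
    from words_snoc[OF this, of "D w"] have "(\<lambda>h. (\<gamma> h ** E h) ** D w h) \<in> words (G \<union> D ` W)" using w by blast
    then show ?thesis using E(2) by (simp flip: matrix_mul_assoc)
  qed
  moreover have "finite (G \<union> D ` W)" using G(1) finite_W by simp
  ultimately show ?thesis by blast
qed

end

section \<open>Additive cocycles without residues\<close>

context arrangement
begin

text \<open>Points whose image under the two forms lies in the real span of the images of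
  \<open>y\<close> and \<open>z\<close>, a span of dimension at most 2 in a space of real dimension
  4. Away from it, a triangle with apex \<open>p\<close> and base from \<open>y\<close> to
  \<open>z\<close> misses \<open>H \<inter> K\<close>.\<close>

definition thin :: "complex ^ 'n \<Rightarrow> complex ^ 'n \<Rightarrow> (complex ^ 'n) set \<Rightarrow> (complex ^ 'n) set \<Rightarrow> (complex ^ 'n) set" where
  "thin y z H K = {x. \<exists>a b. \<alpha> H x = complex_of_real a * \<alpha> H y + complex_of_real b * \<alpha> H z \<and>
     \<alpha> K x = complex_of_real a * \<alpha> K y + complex_of_real b * \<alpha> K z}"

lemma thin_subspace:
  assumes H: "H \<in> \<A>" "K \<in> \<A>" "H \<noteq> K" shows "subspace (thin y z H K) \<and> thin y z H K \<noteq> UNIV"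
proof
  note fH = form[OF H(1)] and fK = form[OF H(2)]
  show "subspace (thin y z H K)"
    unfolding subspace_def
  proof (intro conjI ballI allI)
    show "0 \<in> thin y z H K"
      unfolding thin_def by (intro CollectI exI[of _ 0]) (simp add: linear_form_0[OF fH] linear_form_0[OF fK])
    fix u v assume "u \<in> thin y z H K" "v \<in> thin y z H K"
    then obtain a b a' b' where
      "\<alpha> H u = complex_of_real a * \<alpha> H y + complex_of_real b * \<alpha> H z"
      "\<alpha> K u = complex_of_real a * \<alpha> K y + complex_of_real b * \<alpha> K z"
      "\<alpha> H v = complex_of_real a' * \<alpha> H y + complex_of_real b' * \<alpha> H z"
      "\<alpha> K v = complex_of_real a' * \<alpha> K y + complex_of_real b' * \<alpha> K z"
      unfolding thin_def by blast
    then show "u + v \<in> thin y z H K"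
      unfolding thin_def
      by (intro CollectI exI[of _ "a + a'"] exI[of _ "b + b'"])
        (simp add: linear_form_add[OF fH] linear_form_add[OF fK] algebra_simps)
  next
    fix c u assume "u \<in> thin y z H K"
    then obtain a b where
      "\<alpha> H u = complex_of_real a * \<alpha> H y + complex_of_real b * \<alpha> H z"
      "\<alpha> K u = complex_of_real a * \<alpha> K y + complex_of_real b * \<alpha> K z"
      unfolding thin_def by blast
    then show "c *\<^sub>R u \<in> thin y z H K"
      unfolding thin_def
      by (intro CollectI exI[of _ "c * a"] exI[of _ "c * b"])
        (simp add: linear_form_scaleR[OF fH] linear_form_scaleR[OF fK] algebra_simps)
  qed
  show "thin y z H K \<noteq> UNIV"
  proof
    assume all: "thin y z H K = UNIV"
    let ?P = "(\<alpha> H y, \<alpha> K y)" and ?Q = "(\<alpha> H z, \<alpha> K z)"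
    have "dim (span {?P, ?Q}) \<le> card {?P, ?Q}" by (simp only: dim_span) (rule dim_le_card', simp)
    also have "\<dots> \<le> 2" by (simp add: card_insert_if)
    finally have "dim (span {?P, ?Q}) < DIM(complex \<times> complex)" by simp
    then have "span {?P, ?Q} \<noteq> UNIV" by (metis dim_UNIV less_irrefl)
    then obtain p q where pq: "(p, q) \<notin> span {?P, ?Q}" by auto
    obtain f where f: "\<alpha> H f = 0" "\<alpha> K f = 1" using not_subset H by blast
    obtain e where e: "\<alpha> K e = 0" "\<alpha> H e = 1" using not_subset H by metis
    let ?x = "p *s e + q *s f"
    have x: "\<alpha> H ?x = p" "\<alpha> K ?x = q"
      by (simp_all add: linear_form_add[OF fH] linear_form_add[OF fK] linear_form_scale[OF fH] linear_form_scale[OF fK] e f)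
    obtain a b where ab: "p = complex_of_real a * \<alpha> H y + complex_of_real b * \<alpha> H z"
      "q = complex_of_real a * \<alpha> K y + complex_of_real b * \<alpha> K z"
    proof -
      have "?x \<in> thin y z H K" using all by simp
      then obtain a b where "\<alpha> H ?x = complex_of_real a * \<alpha> H y + complex_of_real b * \<alpha> H z"
        "\<alpha> K ?x = complex_of_real a * \<alpha> K y + complex_of_real b * \<alpha> K z" unfolding thin_def by blast
      then show ?thesis using that unfolding x by blast
    qed
    have "(p, q) = a *\<^sub>R ?P + b *\<^sub>R ?Q" unfolding ab by (simp add: scaleR_conv_of_real)
    also have "\<dots> \<in> span {?P, ?Q}" by (intro span_add span_scale span_base) auto
    finally show False using pq by simp
  qed
qed

end

text \<open>The values of \<open>c\<close> matter only for pairs in a common convex set. Near a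
  point on a single hyperplane, vanishing on one small square around the hyperplane suffices:
  additivity in convex sets transfers it to every other loop there.\<close>

locale local_cocycle = log_connection \<A> \<alpha> A
  for \<A> :: "(complex ^ 'n) set set" and \<alpha> and A :: "(complex ^ 'n) set \<Rightarrow> complex ^ 'm ^ 'm" +
  fixes c :: "complex ^ 'n \<Rightarrow> complex ^ 'n \<Rightarrow> 'v::real_vector"
  assumes c_add: "cvx K \<Longrightarrow> x \<in> K \<Longrightarrow> y \<in> K \<Longrightarrow> z \<in> K \<Longrightarrow> c x y + c y z = c x z"
    and c_circle: "H \<in> \<A> \<Longrightarrow> q \<in> H \<Longrightarrow> (\<And>K. K \<in> \<A> \<Longrightarrow> q \<in> K \<Longrightarrow> K = H) \<Longrightarrow> \<delta> > 0 \<Longrightarrow>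
      \<exists>v. norm v < \<delta> \<and> Im (\<alpha> H v) = 0 \<and> Re (\<alpha> H v) > 0 \<and>
        c (q + v) (q + \<i> *s v) + c (q + \<i> *s v) (q - v) + c (q - v) (q - \<i> *s v) + c (q - \<i> *s v) (q + v) = 0"
begin

lemma c_refl: "x \<in> X \<Longrightarrow> c x x = 0"
  using ball_in_X[of x] cvx_ball c_add[of _ x x x] by (metis add_cancel_left_left centre_in_ball)

lemma c_minus: "cvx K \<Longrightarrow> x \<in> K \<Longrightarrow> y \<in> K \<Longrightarrow> c y x = - c x y"
  using c_add[of K x y x] c_refl[of x] by (auto dest: cvx_D simp: eq_neg_iff_add_eq_0 add.commute)

lemma local_primitive_extends:
  assumes K: "cvx K" "x \<in> K" "y \<in> K"
    and loc: "\<And>p. p \<in> closed_segment x y \<Longrightarrow> \<exists>V. open V \<and> p \<in> V \<and> (\<forall>a\<in>V. \<forall>b\<in>V. c a b = u b - u a)"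
  shows "c x y = u y - u x"
proof -
  define g where "g t = x + t *\<^sub>R (y - x)" for t :: real
  have gK: "g t \<in> K" if "t \<in> {0..1}" for t
    unfolding g_def by (rule flat_form.cvx_seg[OF flat_om K[unfolded cvx_eq] that])
  define Q where "Q a b \<longleftrightarrow> (0 \<le> a \<and> b \<le> 1 \<longrightarrow> c (g a) (g b) = u (g b) - u (g a))" for a b
  have "(0::real) \<le> 1" by simp
  then have "Q 0 1"
  proof (induction rule: Bolzano)
    case (trans s t r)
    show ?case unfolding Q_def
    proof
      assume *: "0 \<le> s \<and> r \<le> 1"
      then have "c (g s) (g r) = c (g s) (g t) + c (g t) (g r)"
        using trans(3,4) gK by (intro c_add[OF K(1), symmetric]) auto
      moreover have "c (g s) (g t) = u (g t) - u (g s)" "c (g t) (g r) = u (g r) - u (g t)"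
        using trans * unfolding Q_def by auto
      ultimately show "c (g s) (g r) = u (g r) - u (g s)" by simp
    qed
  next
    case (local t)
    have "g t = (1 - t) *\<^sub>R x + t *\<^sub>R y" by (simp add: g_def algebra_simps)
    then have "g t \<in> closed_segment x y" unfolding in_segment using local by blast
    from loc[OF this] obtain V where V: "open V" "g t \<in> V" "\<forall>a\<in>V. \<forall>b\<in>V. c a b = u b - u a"
      by (elim exE conjE)
    obtain e where e: "e > 0" "ball (g t) e \<subseteq> V" using V(1,2) open_contains_ball by blast
    have "continuous (at t) g" unfolding g_def by (intro continuous_intros)
    then obtain d where d: "d > 0" "\<And>s. dist s t < d \<Longrightarrow> dist (g s) (g t) < e"
      using e(1) unfolding continuous_at_eps_delta by blast
    have gV: "g s \<in> V" if "dist s t < d" for s using d(2)[OF that] e(2) by (auto simp: dist_commute)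
    have "Q a b" if "a \<le> t \<and> t \<le> b \<and> b - a < d" for a b
      unfolding Q_def using that by (intro impI V(3)[rule_format] gV) (auto simp: dist_real_def)
    then show ?case using d(1) by blast
  qed
  then show ?thesis by (simp add: g_def Q_def)
qed

text \<open>Off the hyperplanes \<open>c q\<close> itself is a primitive on a ball. Near a point of
  just one \<open>H\<close> the ball without \<open>H\<close> is covered by four overlapping convex
  half-balls, each with its own primitive; they can be adjusted to agree on overlaps exactly because
  the square around \<open>H\<close> has total 0.\<close>

lemma local_primitive:
  assumes q: "\<And>H K. H \<in> \<A> \<Longrightarrow> K \<in> \<A> \<Longrightarrow> q \<in> H \<Longrightarrow> q \<in> K \<Longrightarrow> H = K"
  shows "\<exists>r>0. \<exists>u. \<forall>x\<in>ball q r. \<forall>y\<in>ball q r. closed_segment x y \<subseteq> X \<longrightarrow> c x y = u y - u x"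
proof (cases "q \<in> X")
  case True
  then obtain r where r: "r > 0" "ball q r \<subseteq> X" using ball_in_X by blast
  have "c x y = c q y - c q x" if "x \<in> ball q r" "y \<in> ball q r" for x y
    using c_add[OF cvx_ball[OF r(2)], of q x y] that r(1) by (auto simp: algebra_simps)
  then show ?thesis using r(1) by blast
next
  case False
  then obtain H where H: "H \<in> \<A>" "q \<in> H" unfolding X_def by blast
  have only: "K = H" if "K \<in> \<A>" "q \<in> K" for K using q that H by blast
  note f = form[OF H(1)]
  have aq: "\<alpha> H q = 0" using H kernel_iff by blast
  have "closed K" if "K \<in> \<A>" for K
    using continuous_closed_preimage_constant[OF cont_form[OF that] closed_UNIV, of 0] kernel[OF that] by simp
  then have "open (- \<Union>(\<A> - {H}))" using finite_A by (intro open_Compl closed_Union) auto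
  moreover have "q \<in> - \<Union>(\<A> - {H})" using only by blast
  ultimately obtain r where r: "r > 0" "ball q r \<subseteq> - \<Union>(\<A> - {H})" using open_contains_ball by blast
  have inX: "x \<in> X \<longleftrightarrow> \<alpha> H x \<noteq> 0" if "x \<in> ball q r" for x
  proof -
    have "x \<notin> K" if "K \<in> \<A>" "K \<noteq> H" for K
      using r(2) \<open>x \<in> ball q r\<close> that by blast
    then have "x \<in> X \<longleftrightarrow> x \<notin> H" unfolding X_def using H(1) by blast
    then show ?thesis using kernel_iff[OF H(1)] by simp
  qed
  define B where "B a b = ball q r \<inter> {x. a * Re (\<alpha> H x) + b * Im (\<alpha> H x) > 0}" for a b :: real
  have Bcvx: "cvx (B a b)" for a b
    unfolding cvx_def
  proof (intro conjI)
    have lin: "linear (\<lambda>x. a * Re (\<alpha> H x) + b * Im (\<alpha> H x))"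
      by (rule linearI) (simp_all add: linear_form_add[OF f] linear_form_scaleR[OF f] algebra_simps)
    then have co: "continuous_on UNIV (\<lambda>x. a * Re (\<alpha> H x) + b * Im (\<alpha> H x))"
      using linear_conv_bounded_linear linear_continuous_on by blast
    show "open (B a b)" unfolding B_def by (intro open_Int open_ball open_Collect_less co) auto
    have "convex ((\<lambda>x. a * Re (\<alpha> H x) + b * Im (\<alpha> H x)) -` {0<..})"
      by (rule convex_linear_vimage[OF lin]) simp
    moreover have "(\<lambda>x. a * Re (\<alpha> H x) + b * Im (\<alpha> H x)) -` {0<..} = {x. a * Re (\<alpha> H x) + b * Im (\<alpha> H x) > 0}" by auto
    ultimately show "convex (B a b)" unfolding B_def by (intro convex_Int) auto
    show "B a b \<subseteq> X" unfolding B_def using inX by auto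
  qed
  obtain v where v: "norm v < r" "Im (\<alpha> H v) = 0" "Re (\<alpha> H v) > 0"
    "c (q + v) (q + \<i> *s v) + c (q + \<i> *s v) (q - v) + c (q - v) (q - \<i> *s v) + c (q - \<i> *s v) (q + v) = 0"
    using c_circle[OF H only r(1)] by blast
  have niv: "norm (\<i> *s v) = norm v" by (simp add: norm_vec_def norm_mult)
  \<comment> \<open>The four corners of the square lie on the positive and negative real and
    imaginary axes of \<open>\<alpha> H\<close>, so consecutive corners share one of the half-balls
    \<open>B\<close>.\<close>
  define p where "p = (\<lambda>n::nat. if n = 0 then q + v else if n = 1 then q + \<i> *s v else if n = 2 then q - v else q - \<i> *s v)"
  have pB: "p 0 \<in> B 1 1" "p 1 \<in> B 1 1" "p 1 \<in> B (-1) 1" "p 2 \<in> B (-1) 1" "p 2 \<in> B (-1) (-1)" "p 3 \<in> B (-1) (-1)"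
    "p 3 \<in> B 1 (-1)" "p 0 \<in> B 1 (-1)"
    using v(1-3) niv unfolding p_def B_def
    by (auto simp: dist_norm linear_form_add[OF f] linear_form_diff[OF f] linear_form_scale[OF f] aq)
  have sum: "c (p 0) (p 1) + c (p 1) (p 2) + c (p 2) (p 3) + c (p 3) (p 0) = 0"
    using v(4) by (simp add: p_def)
  \<comment> \<open>Sums of \<open>c\<close> along the square up to each corner; \<open>u\<close>
    continues from the corner of the first half-ball that contains the point.\<close>
  define C where "C = (\<lambda>n::nat. if n = 0 then 0 else if n = 1 then c (p 0) (p 1)
     else if n = 2 then c (p 0) (p 1) + c (p 1) (p 2) else c (p 0) (p 1) + c (p 1) (p 2) + c (p 2) (p 3))"
  define k where "k x = (if x \<in> B 1 1 then 0 else if x \<in> B (-1) 1 then 1 else if x \<in> B (-1) (-1) then 2 else (3::nat))" for x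
  define u where "u x = C (k x) + c (p (k x)) x" for x
  note add = c_add[OF Bcvx]
  have u0: "u x = c (p 0) x" if "x \<in> B 1 1" for x using that by (simp add: u_def k_def C_def)
  have u1: "u x = C 1 + c (p 1) x" if "x \<in> B (-1) 1" for x
    using that u0[of x] add[of "p 0" 1 1 "p 1" x] pB by (cases "x \<in> B 1 1") (auto simp: u_def k_def C_def)
  have u2: "u x = C 2 + c (p 2) x" if "x \<in> B (-1) (-1)" for x
  proof (cases "x \<in> B (-1) 1")
    case True
    then show ?thesis using u1[OF True] add[of "p 1" "-1" 1 "p 2" x] pB by (simp add: C_def)
  next
    case False
    moreover have "x \<notin> B 1 1" using that by (auto simp: B_def)
    ultimately show ?thesis using that by (simp add: u_def k_def)
  qed
  \<comment> \<open>The critical overlap is that of the last half-ball with the first: there the two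
    descriptions of \<open>u\<close> differ by the total around the square.\<close>
  have u3: "u x = C 3 + c (p 3) x" if x: "x \<in> B 1 (-1)" for x
  proof -
    consider "x \<in> B 1 1" | "x \<notin> B 1 1" "x \<in> B (-1) (-1)" | "x \<notin> B 1 1" "x \<notin> B (-1) (-1)" by blast
    then show ?thesis
    proof cases
      case 1
      have "C 3 + c (p 3) x = C 3 + (c (p 3) (p 0) + c (p 0) x)"
        using add[of "p 3" 1 "-1" "p 0" x] pB x by simp
      also have "\<dots> = (c (p 0) (p 1) + c (p 1) (p 2) + c (p 2) (p 3) + c (p 3) (p 0)) + c (p 0) x" by (simp add: C_def)
      finally show ?thesis using u0[OF 1] sum by simp
    next
      case 2
      then show ?thesis using u2[OF 2(2)] add[of "p 2" "-1" "-1" "p 3" x] pB by (simp add: C_def)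
    next
      case 3
      moreover have "x \<notin> B (-1) 1" using x by (auto simp: B_def)
      ultimately show ?thesis by (simp add: u_def k_def)
    qed
  qed
  have diff: "c a b = u b - u a" if ab: "a \<in> V" "b \<in> V" and V: "V = B 1 1 \<or> V = B (-1) 1 \<or> V = B (-1) (-1) \<or> V = B 1 (-1)" for a b V
    using V
  proof (elim disjE)
    assume "V = B 1 1"
    then show ?thesis using u0[of a] u0[of b] add[of "p 0" 1 1 a b] ab pB by (simp add: algebra_simps)
  next
    assume "V = B (-1) 1"
    then show ?thesis using u1[of a] u1[of b] add[of "p 1" "-1" 1 a b] ab pB by (simp add: algebra_simps)
  next
    assume "V = B (-1) (-1)"
    then show ?thesis using u2[of a] u2[of b] add[of "p 2" "-1" "-1" a b] ab pB by (simp add: algebra_simps)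
  next
    assume "V = B 1 (-1)"
    then show ?thesis using u3[of a] u3[of b] add[of "p 3" 1 "-1" a b] ab pB by (simp add: algebra_simps)
  qed
  have "c x y = u y - u x" if xy: "x \<in> ball q r" "y \<in> ball q r" and seg: "closed_segment x y \<subseteq> X" for x y
  proof -
    obtain K where K: "cvx K" "x \<in> K" "y \<in> K" using segment_neighbourhood[OF seg] by blast
    show ?thesis
    proof (rule local_primitive_extends[OF K])
      fix p assume p: "p \<in> closed_segment x y"
      have "p \<in> ball q r" using p closed_segment_subset[OF xy convex_ball] by blast
      moreover have "\<alpha> H p \<noteq> 0" using p seg inX calculation by blast
      then have "Re (\<alpha> H p) \<noteq> 0 \<or> Im (\<alpha> H p) \<noteq> 0" by (simp add: complex_eq_iff)
      ultimately have "p \<in> B 1 1 \<or> p \<in> B (-1) 1 \<or> p \<in> B (-1) (-1) \<or> p \<in> B 1 (-1)"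
        unfolding B_def by auto
      then obtain V where V: "V = B 1 1 \<or> V = B (-1) 1 \<or> V = B (-1) (-1) \<or> V = B 1 (-1)" "p \<in> V" by blast
      have "open V" using V(1) cvx_D(1)[OF Bcvx] by metis
      then show "\<exists>V. open V \<and> p \<in> V \<and> (\<forall>a\<in>V. \<forall>b\<in>V. c a b = u b - u a)"
        by (intro exI[of _ V] conjI ballI V(2) diff[OF _ _ V(1)])
    qed
  qed
  then show ?thesis using r(1) by blast
qed

lemma good_point_near:
  assumes "finite B" "0 \<le> t" "t \<le> 1" "d > (0::real)"
  shows "\<exists>s. s \<in> {0..1} - B \<and> \<bar>s - t\<bar> < d"
proof -
  have "infinite {max 0 (t - d / 2)..min 1 (t + d / 2)}" using assms by (intro infinite_Icc) auto
  then obtain s where "s \<in> {max 0 (t - d / 2)..min 1 (t + d / 2)} - B"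
    using assms(1) by (metis Diff_infinite_finite finite.emptyI ex_in_conv)
  then show ?thesis using assms by (intro exI[of _ s]) auto
qed

end

section \<open>Contraction of closed chains to a generic point\<close>

context local_cocycle
begin

text \<open>The triangle with vertices \<open>p\<close>, \<open>y\<close>, \<open>z\<close> is parametrised by \<open>g s t = p + t (y + s (z - y) - p)\<close>.
  For \<open>p\<close> in general position it meets the hyperplanes in finitely many points, each on a
  single hyperplane, so it can be dissected by lines \<open>s = const\<close> and \<open>t = const\<close> inside \<open>X\<close> into
  cells on which \<open>c\<close> has a primitive.\<close>

lemma triangle:
  assumes K: "cvx K" "y \<in> K" "z \<in> K"
    and py: "\<And>H. H \<in> \<A> \<Longrightarrow> p \<notin> wall y H" and pz: "\<And>H. H \<in> \<A> \<Longrightarrow> p \<notin> wall z H"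
    and pyz: "\<And>H L. H \<in> \<A> \<Longrightarrow> L \<in> \<A> \<Longrightarrow> H \<noteq> L \<Longrightarrow> p \<notin> thin y z H L"
  shows "c y z + c z p = c y p"
proof -
  define g where "g s t = p + t *\<^sub>R ((y + s *\<^sub>R (z - y)) - p)" for s t :: real
  have yz: "y \<in> X" "z \<in> X" using K cvx_D by auto
  have pX: "p \<in> X" unfolding X_iff
  proof
    fix H assume "H \<in> \<A>" then show "\<alpha> H p \<noteq> 0" using py unfolding wall_def by force
  qed
  have edge: "y + s *\<^sub>R (z - y) \<in> X" if "s \<in> {0..1}" for s
    using flat_form.cvx_seg[OF flat_om K[unfolded cvx_eq] that] K(1) cvx_D(3) by blast
  have ag: "\<alpha> H (g s t) = complex_of_real (1 - t) * \<alpha> H p +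
      complex_of_real t * (complex_of_real (1 - s) * \<alpha> H y + complex_of_real s * \<alpha> H z)" if "H \<in> \<A>" for H s t
    unfolding g_def
    by (simp add: linear_form_add[OF form[OF that]] linear_form_diff[OF form[OF that]] linear_form_scaleR[OF form[OF that]] algebra_simps)
  \<comment> \<open>At a common point of two hyperplanes, division by \<open>1 - t\<close> writes
    both forms at \<open>p\<close> as the same real combination of their values at \<open>y\<close>
    and \<open>z\<close>, so \<open>p\<close> would be in \<open>thin y z H L\<close>.\<close>
  have one_H: "H = L" if HL: "H \<in> \<A>" "L \<in> \<A>" "g s t \<in> H" "g s t \<in> L" and st: "s \<in> {0..1}" "t \<in> {0..1}" for H L s t
  proof (rule ccontr)
    assume "H \<noteq> L"
    have "t \<noteq> 1"
    proof
      assume "t = 1"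
      then have "g s t = y + s *\<^sub>R (z - y)" by (simp add: g_def)
      then show False using edge[OF st(1)] HL unfolding X_def by auto
    qed
    have "\<alpha> M p = complex_of_real (- t * (1 - s) / (1 - t)) * \<alpha> M y + complex_of_real (- t * s / (1 - t)) * \<alpha> M z"
      if M: "M \<in> \<A>" "g s t \<in> M" for M
    proof -
      have z: "complex_of_real (1 - t) * \<alpha> M p +
        complex_of_real t * (complex_of_real (1 - s) * \<alpha> M y + complex_of_real s * \<alpha> M z) = 0"
        using kernel_iff[OF M(1)] M(2) ag[OF M(1)] by metis
      have nz: "complex_of_real (1 - t) \<noteq> 0" using \<open>t \<noteq> 1\<close> by simp
      have "\<alpha> M p = - (complex_of_real t * (complex_of_real (1 - s) * \<alpha> M y + complex_of_real s * \<alpha> M z)) / complex_of_real (1 - t)"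
      proof -
        have "\<alpha> M p * complex_of_real (1 - t) = - (complex_of_real t * (complex_of_real (1 - s) * \<alpha> M y + complex_of_real s * \<alpha> M z))"
          using z by (simp add: eq_neg_iff_add_eq_0 mult.commute del: of_real_diff)
        then show ?thesis by (simp only: nonzero_eq_divide_eq[OF nz])
      qed
      also have "\<dots> = complex_of_real (- t * (1 - s) / (1 - t)) * \<alpha> M y + complex_of_real (- t * s / (1 - t)) * \<alpha> M z"
        using nz by (simp add: field_simps del: of_real_diff) (simp add: algebra_simps)
      finally show ?thesis .
    qed
    then have "p \<in> thin y z H L" unfolding thin_def using HL by blast
    then show False using pyz HL(1,2) \<open>H \<noteq> L\<close> by blast
  qed
  define Z where "Z H = {(s, t). s \<in> {0..1} \<and> t \<in> {0..1} \<and> \<alpha> H (g s t) = 0}" for H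
  \<comment> \<open>There is at most one zero. After division by \<open>\<alpha> H p\<close> the
    imaginary part gives an affine equation for s, nondegenerate because \<open>p\<close> avoids the
    walls; the equation itself then fixes t.\<close>
  have finZ: "finite (Z H)" if H: "H \<in> \<A>" for H
  proof -
    define a b where "a = \<alpha> H y / \<alpha> H p" and "b = \<alpha> H z / \<alpha> H p"
    have nz: "\<alpha> H p \<noteq> 0" "\<alpha> H y \<noteq> 0" "\<alpha> H z \<noteq> 0" using pX yz H X_iff by auto
    have Imnz: "Im (inverse x) = 0 \<longleftrightarrow> Im x = 0" for x :: complex
      by (simp add: inverse_complex.sel) (auto simp: complex_eq_iff)
    have ia: "Im a \<noteq> 0" "Im b \<noteq> 0"
      using py[OF H] pz[OF H] Imnz[of a] Imnz[of b] unfolding wall_def a_def b_def by (auto simp: inverse_eq_divide)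
    have sol: "(1 - s) * Im a + s * Im b = 0 \<and>
        complex_of_real t * (1 - (complex_of_real (1 - s) * a + complex_of_real s * b)) = 1" if "(s, t) \<in> Z H" for s t
    proof -
      have "complex_of_real (1 - t) * \<alpha> H p +
        complex_of_real t * (complex_of_real (1 - s) * \<alpha> H y + complex_of_real s * \<alpha> H z) = 0"
        using that ag[OF H] unfolding Z_def by auto
      then have "(complex_of_real (1 - t) * \<alpha> H p +
        complex_of_real t * (complex_of_real (1 - s) * \<alpha> H y + complex_of_real s * \<alpha> H z)) / \<alpha> H p = 0" by simp
      then have eq: "complex_of_real (1 - t) + complex_of_real t * (complex_of_real (1 - s) * a + complex_of_real s * b) = 0"
      proof -
        have "complex_of_real (1 - t) + complex_of_real t * (complex_of_real (1 - s) * a + complex_of_real s * b) =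
            (complex_of_real (1 - t) * \<alpha> H p +
              complex_of_real t * (complex_of_real (1 - s) * \<alpha> H y + complex_of_real s * \<alpha> H z)) / \<alpha> H p"
          using nz(1) unfolding a_def b_def by (simp add: field_simps del: of_real_diff)
        with \<open>_ / \<alpha> H p = 0\<close> show ?thesis by simp
      qed
      then have "Im (complex_of_real (1 - t) + complex_of_real t * (complex_of_real (1 - s) * a + complex_of_real s * b)) = 0" by simp
      then have "t * ((1 - s) * Im a + s * Im b) = 0" by simp
      moreover have "t \<noteq> 0" using eq by auto
      moreover have "complex_of_real t * (1 - (complex_of_real (1 - s) * a + complex_of_real s * b)) = 1"
        using eq by (simp add: algebra_simps)
      ultimately show ?thesis by simp
    qed
    have "x = x'" if x: "x \<in> Z H" and x': "x' \<in> Z H" for x x'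
    proof -
      obtain s t where st: "x = (s, t)" by (cases x)
      obtain s' t' where st': "x' = (s', t')" by (cases x')
      note 1 = sol[OF x[unfolded st]] and 2 = sol[OF x'[unfolded st']]
      have "Im a \<noteq> Im b" using 1 ia by (auto simp: algebra_simps)
      moreover have "(s - s') * (Im b - Im a) = 0" using 1 2 by (simp add: algebra_simps)
      ultimately have ss: "s = s'" by simp
      define w where "w = 1 - (complex_of_real (1 - s) * a + complex_of_real s * b)"
      have "complex_of_real t * w = 1" "complex_of_real t' * w = 1" using 1 2 ss by (simp_all add: w_def)
      then have "complex_of_real t = complex_of_real t'" by (metis mult_cancel_right mult_zero_right zero_neq_one)
      then show ?thesis using ss st st' by simp
    qed
    then show ?thesis by (metis finite.simps finite_subset infinite_imp_nonempty subsetI insertI1 ex_in_conv insertE singletonI)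
  qed
  define Sb where "Sb = (\<Union>H\<in>\<A>. fst ` Z H)"
  define Tb where "Tb = (\<Union>H\<in>\<A>. snd ` Z H)"
  have finb: "finite Sb" "finite Tb" unfolding Sb_def Tb_def using finite_A finZ by auto
  define SG where "SG = {0..1} - Sb"
  define TG where "TG = {0..1} - Tb"
  have gX: "g s t \<in> X" if "s \<in> {0..1}" "t \<in> {0..1}" "s \<in> SG \<or> t \<in> TG" for s t
    unfolding X_iff
  proof (intro ballI notI)
    fix H assume "H \<in> \<A>" "\<alpha> H (g s t) = 0"
    then have "H \<in> \<A>" "(s, t) \<in> Z H" using that by (auto simp: Z_def)
    then have "s \<in> Sb" "t \<in> Tb" unfolding Sb_def Tb_def by force+
    then show False using that(3) by (auto simp: SG_def TG_def)
  qed
  have hor_seg: "closed_segment (g s0 t) (g s1 t) = (\<lambda>s. g s t) ` closed_segment s0 s1" for s0 s1 t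
  proof -
    have "(1 - r) *\<^sub>R g s0 t + r *\<^sub>R g s1 t = g ((1 - r) *\<^sub>R s0 + r *\<^sub>R s1) t" for r
      unfolding g_def by (simp add: algebra_simps)
    then show ?thesis unfolding closed_segment_def by (auto simp: image_iff)
  qed
  have ver_seg: "closed_segment (g s t0) (g s t1) = (\<lambda>t. g s t) ` closed_segment t0 t1" for s t0 t1
  proof -
    have "(1 - r) *\<^sub>R g s t0 + r *\<^sub>R g s t1 = g s ((1 - r) *\<^sub>R t0 + r *\<^sub>R t1)" for r
      unfolding g_def by (simp add: algebra_simps)
    then show ?thesis unfolding closed_segment_def by (auto simp: image_iff)
  qed
  have cs: "closed_segment a b \<subseteq> {0..1}" if "a \<in> {0..1}" "b \<in> {0..1}" for a b :: real
    by (rule closed_segment_subset[OF that]) simp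
  have hor_X: "closed_segment (g s0 t) (g s1 t) \<subseteq> X" if "s0 \<in> {0..1}" "s1 \<in> {0..1}" "t \<in> TG" for s0 s1 t
    unfolding hor_seg using gX[of _ t] cs[OF that(1,2)] that(3) by (auto simp: TG_def subset_iff)
  have ver_X: "closed_segment (g s t0) (g s t1) \<subseteq> X" if "t0 \<in> {0..1}" "t1 \<in> {0..1}" "s \<in> SG" for s t0 t1
    unfolding ver_seg using gX[of s] cs[OF that(1,2)] that(3) by (auto simp: SG_def subset_iff)
  have c_hor: "c (g s0 t) (g s1 t) + c (g s1 t) (g s2 t) = c (g s0 t) (g s2 t)"
    if s: "s0 \<in> {0..1}" "s1 \<in> {0..1}" "s2 \<in> {0..1}" "t \<in> TG" for s0 s1 s2 t
  proof -
    have "closed_segment (g 0 t) (g 1 t) \<subseteq> X" using hor_X s(4) by simp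
    then obtain M where M: "cvx M" "closed_segment (g 0 t) (g 1 t) \<subseteq> M" using cvx_neighbourhood[of "closed_segment (g 0 t) (g 1 t)"] by auto
    have "g s t \<in> M" if "s \<in> {0..1}" for s
      using M(2) that unfolding hor_seg by (auto simp: closed_segment_eq_real_ivl)
    then show ?thesis using c_add[OF M(1)] s by blast
  qed
  have c_ver: "c (g s t0) (g s t1) + c (g s t1) (g s t2) = c (g s t0) (g s t2)"
    if s: "t0 \<in> {0..1}" "t1 \<in> {0..1}" "t2 \<in> {0..1}" "s \<in> SG" for s t0 t1 t2
  proof -
    have "closed_segment (g s 0) (g s 1) \<subseteq> X" using ver_X s(4) by simp
    then obtain M where M: "cvx M" "closed_segment (g s 0) (g s 1) \<subseteq> M" using cvx_neighbourhood[of "closed_segment (g s 0) (g s 1)"] by auto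
    have "g s t \<in> M" if "t \<in> {0..1}" for t
      using M(2) that unfolding ver_seg by (auto simp: closed_segment_eq_real_ivl)
    then show ?thesis using c_add[OF M(1)] s by blast
  qed
  \<comment> \<open>The sum of \<open>c\<close> around the boundary of a rectangle of parameters
    with sides on good lines. It is additive under both kinds of subdivision.\<close>
  define J where "J s s' t t' = c (g s t) (g s' t) + c (g s' t) (g s' t') - c (g s t') (g s' t') - c (g s t) (g s t')" for s s' t t'
  have Js: "J s s' t t' + J s' s'' t t' = J s s'' t t'" if "s \<in> SG" "s' \<in> SG" "s'' \<in> SG" "t \<in> TG" "t' \<in> TG" for s s' s'' t t'
    using c_hor[of s s' s'' t] c_hor[of s s' s'' t'] that unfolding J_def SG_def
    by (simp add: algebra_simps)
  have Jt: "J s s' t t' + J s s' t' t'' = J s s' t t''" if "t \<in> TG" "t' \<in> TG" "t'' \<in> TG" "s \<in> SG" "s' \<in> SG" for s s' t t' t''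
    using c_ver[of t t' t'' s] c_ver[of t t' t'' s'] that unfolding J_def TG_def
    by (simp add: algebra_simps)
  have contg: "continuous_on UNIV (\<lambda>x. g (fst x) (snd x))" unfolding g_def by (intro continuous_intros)
  have J_local: "\<exists>\<delta>>0. \<forall>s\<in>SG. \<forall>s'\<in>SG. \<forall>t\<in>TG. \<forall>t'\<in>TG. \<bar>s - s0\<bar> < \<delta> \<longrightarrow> \<bar>s' - s0\<bar> < \<delta> \<longrightarrow> \<bar>t - t0\<bar> < \<delta> \<longrightarrow> \<bar>t' - t0\<bar> < \<delta> \<longrightarrow> J s s' t t' = 0"
    if st: "s0 \<in> {0..1}" "t0 \<in> {0..1}" for s0 t0
  proof -
    obtain r u where r: "r > 0" and u: "\<And>x y. x \<in> ball (g s0 t0) r \<Longrightarrow> y \<in> ball (g s0 t0) r \<Longrightarrow> closed_segment x y \<subseteq> X \<Longrightarrow> c x y = u y - u x"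
      using local_primitive[of "g s0 t0"] one_H[OF _ _ _ _ st] by metis
    obtain d where d: "d > 0" "\<And>x. dist x (s0, t0) < d \<Longrightarrow> dist (g (fst x) (snd x)) (g s0 t0) < r"
      using contg r unfolding continuous_on_iff by (metis UNIV_I fst_conv snd_conv)
    have near: "g s t \<in> ball (g s0 t0) r" if "\<bar>s - s0\<bar> < d / 2" "\<bar>t - t0\<bar> < d / 2" for s t
    proof -
      have "dist (s, t) (s0, t0) \<le> dist s s0 + dist t t0" by (simp add: dist_Pair_Pair sqrt_sum_squares_le_sum)
      then have "dist (s, t) (s0, t0) < d" using that by (simp add: dist_real_def)
      then show ?thesis using d(2)[of "(s, t)"] by (simp add: dist_commute)
    qed
    have "J s s' t t' = 0" if "s \<in> SG" "s' \<in> SG" "t \<in> TG" "t' \<in> TG" "\<bar>s - s0\<bar> < d / 2" "\<bar>s' - s0\<bar> < d / 2" "\<bar>t - t0\<bar> < d / 2" "\<bar>t' - t0\<bar> < d / 2" for s s' t t'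
    proof -
      have sg: "s \<in> {0..1}" "s' \<in> {0..1}" "t \<in> {0..1}" "t' \<in> {0..1}" using that by (auto simp: SG_def TG_def)
      have "c (g s t) (g s' t) = u (g s' t) - u (g s t)" using that sg by (intro u near hor_X) auto
      moreover have "c (g s' t) (g s' t') = u (g s' t') - u (g s' t)" using that sg by (intro u near ver_X) auto
      moreover have "c (g s t') (g s' t') = u (g s' t') - u (g s t')" using that sg by (intro u near hor_X) auto
      moreover have "c (g s t) (g s t') = u (g s t') - u (g s t)" using that sg by (intro u near ver_X) auto
      ultimately show ?thesis unfolding J_def by simp
    qed
    then show ?thesis using d(1) by (intro exI[of _ "d / 2"]) auto
  qed
  have J_col: "\<exists>\<delta>>0. \<forall>s\<in>SG. \<forall>s'\<in>SG. \<forall>t\<in>TG. \<forall>t'\<in>TG. \<bar>s - s0\<bar> < \<delta> \<longrightarrow> \<bar>s' - s0\<bar> < \<delta> \<longrightarrow> \<bar>t - 0\<bar> < \<delta> \<longrightarrow> \<bar>t' - 1\<bar> < \<delta> \<longrightarrow> J s s' t t' = 0"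
    if s0: "s0 \<in> {0..1}" for s0
  proof -
    \<comment> \<open>A cut prescribed by the bisection may be a bad parameter. Hence
      \<open>Q\<close> speaks of all good parameters near the two ends, and a good value near the
      cut serves as common edge of the two rectangles.\<close>
    define Q where "Q a b \<longleftrightarrow> (0 \<le> a \<and> b \<le> 1 \<longrightarrow> (\<exists>\<delta>>0. \<forall>s\<in>SG. \<forall>s'\<in>SG. \<forall>t\<in>TG. \<forall>t'\<in>TG. \<bar>s - s0\<bar> < \<delta> \<longrightarrow> \<bar>s' - s0\<bar> < \<delta> \<longrightarrow> \<bar>t - a\<bar> < \<delta> \<longrightarrow> \<bar>t' - b\<bar> < \<delta> \<longrightarrow> J s s' t t' = 0))" for a b
    have "(0::real) \<le> 1" by simp
    then have "Q 0 1"
    proof (induction rule: Bolzano)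
      case (trans a b c')
      show ?case unfolding Q_def
      proof
        assume *: "0 \<le> a \<and> c' \<le> 1"
        have le: "0 \<le> a \<and> b \<le> 1" "0 \<le> b \<and> c' \<le> 1" using * trans(3,4) by auto
        obtain \<delta>1 where \<delta>1: "\<delta>1 > 0" "\<And>s s' t t'. s \<in> SG \<Longrightarrow> s' \<in> SG \<Longrightarrow> t \<in> TG \<Longrightarrow> t' \<in> TG \<Longrightarrow> \<bar>s - s0\<bar> < \<delta>1 \<Longrightarrow> \<bar>s' - s0\<bar> < \<delta>1 \<Longrightarrow> \<bar>t - a\<bar> < \<delta>1 \<Longrightarrow> \<bar>t' - b\<bar> < \<delta>1 \<Longrightarrow> J s s' t t' = 0"
          using trans(1)[unfolded Q_def, THEN mp, OF le(1)] by blast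
        obtain \<delta>2 where \<delta>2: "\<delta>2 > 0" "\<And>s s' t t'. s \<in> SG \<Longrightarrow> s' \<in> SG \<Longrightarrow> t \<in> TG \<Longrightarrow> t' \<in> TG \<Longrightarrow> \<bar>s - s0\<bar> < \<delta>2 \<Longrightarrow> \<bar>s' - s0\<bar> < \<delta>2 \<Longrightarrow> \<bar>t - b\<bar> < \<delta>2 \<Longrightarrow> \<bar>t' - c'\<bar> < \<delta>2 \<Longrightarrow> J s s' t t' = 0"
          using trans(2)[unfolded Q_def, THEN mp, OF le(2)] by blast
        obtain m where m: "m \<in> TG" "\<bar>m - b\<bar> < min \<delta>1 \<delta>2"
          using good_point_near[OF finb(2), of b "min \<delta>1 \<delta>2"] trans(3,4) * \<delta>1(1) \<delta>2(1) unfolding TG_def by auto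
        have "J s s' t t' = 0" if "s \<in> SG" "s' \<in> SG" "t \<in> TG" "t' \<in> TG" "\<bar>s - s0\<bar> < min \<delta>1 \<delta>2" "\<bar>s' - s0\<bar> < min \<delta>1 \<delta>2" "\<bar>t - a\<bar> < min \<delta>1 \<delta>2" "\<bar>t' - c'\<bar> < min \<delta>1 \<delta>2" for s s' t t'
          using \<delta>1(2)[of s s' t m] \<delta>2(2)[of s s' m t'] Jt[of t m t' s s'] m that by simp
        then show "\<exists>\<delta>>0. \<forall>s\<in>SG. \<forall>s'\<in>SG. \<forall>t\<in>TG. \<forall>t'\<in>TG. \<bar>s - s0\<bar> < \<delta> \<longrightarrow> \<bar>s' - s0\<bar> < \<delta> \<longrightarrow> \<bar>t - a\<bar> < \<delta> \<longrightarrow> \<bar>t' - c'\<bar> < \<delta> \<longrightarrow> J s s' t t' = 0"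
          using \<delta>1(1) \<delta>2(1) by (intro exI[of _ "min \<delta>1 \<delta>2"]) auto
      qed
    next
      case (local t0)
      then obtain \<delta> where \<delta>: "\<delta> > 0" "\<And>s s' t t'. s \<in> SG \<Longrightarrow> s' \<in> SG \<Longrightarrow> t \<in> TG \<Longrightarrow> t' \<in> TG \<Longrightarrow> \<bar>s - s0\<bar> < \<delta> \<Longrightarrow> \<bar>s' - s0\<bar> < \<delta> \<Longrightarrow> \<bar>t - t0\<bar> < \<delta> \<Longrightarrow> \<bar>t' - t0\<bar> < \<delta> \<Longrightarrow> J s s' t t' = 0"
        using J_local[OF s0, of t0] by fastforce
      have "Q a b" if ab: "a \<le> t0 \<and> t0 \<le> b \<and> b - a < \<delta> / 2" for a b
      proof -
        have "J s s' t t' = 0" if "s \<in> SG" "s' \<in> SG" "t \<in> TG" "t' \<in> TG" "\<bar>s - s0\<bar> < \<delta> / 2" "\<bar>s' - s0\<bar> < \<delta> / 2" "\<bar>t - a\<bar> < \<delta> / 2" "\<bar>t' - b\<bar> < \<delta> / 2" for s s' t t'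
          using that ab \<delta>(1) by (intro \<delta>(2)) (auto simp: abs_if split: if_splits)
        then show ?thesis unfolding Q_def using \<delta>(1) by (intro impI exI[of _ "\<delta> / 2"]) auto
      qed
      then show ?case using \<delta>(1) by (intro exI[of _ "\<delta> / 2"]) auto
    qed
    then show ?thesis by (simp add: Q_def)
  qed
  have seg_py: "closed_segment p y \<subseteq> X" "closed_segment p z \<subseteq> X"
    using segment_off_walls[OF yz(1) py] segment_off_walls[OF yz(2) pz] by (simp_all add: closed_segment_commute)
  have g0: "g s 0 = p" "g 0 1 = y" "g 1 1 = z" "g s 1 = y + s *\<^sub>R (z - y)" for s by (simp_all add: g_def)
  have T01: "0 \<in> TG" "1 \<in> TG"
  proof -
    have "\<alpha> H (g s t) \<noteq> 0" if "t = 0 \<or> t = 1" "H \<in> \<A>" "s \<in> {0..1}" for s t H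
      using that g0(1,4) pX edge X_iff by metis
    then show "0 \<in> TG" "1 \<in> TG" unfolding TG_def Tb_def Z_def by fastforce+
  qed
  \<comment> \<open>The sides s = 0 and s = 1 are the segments from \<open>p\<close> to
    \<open>y\<close> and \<open>z\<close>, which lie in \<open>X\<close> because \<open>p\<close> is
    off the walls.\<close>
  have S01: "0 \<in> SG" "1 \<in> SG"
  proof -
    have "g 0 t \<in> closed_segment p y" "g 1 t \<in> closed_segment p z" if "t \<in> {0..1}" for t
      using that unfolding g_def in_segment by (auto intro!: exI[of _ t] simp: algebra_simps)
    then have "\<alpha> H (g s t) \<noteq> 0" if "s = 0 \<or> s = 1" "H \<in> \<A>" "t \<in> {0..1}" for s t H
      using that seg_py X_iff by blast
    then show "0 \<in> SG" "1 \<in> SG" unfolding SG_def Sb_def Z_def by fastforce+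
  qed
  \<comment> \<open>The columns over small intervals of s, already known to give 0, are assembled by
    a second bisection with the same tolerance at the ends.\<close>
  define Q where "Q a b \<longleftrightarrow> (0 \<le> a \<and> b \<le> 1 \<longrightarrow> (\<exists>\<delta>>0. \<forall>s\<in>SG. \<forall>s'\<in>SG. \<bar>s - a\<bar> < \<delta> \<longrightarrow> \<bar>s' - b\<bar> < \<delta> \<longrightarrow> J s s' 0 1 = 0))" for a b
  have "(0::real) \<le> 1" by simp
  then have "Q 0 1"
  proof (induction rule: Bolzano)
    case (trans a b c')
    show ?case unfolding Q_def
    proof
      assume *: "0 \<le> a \<and> c' \<le> 1"
      have le: "0 \<le> a \<and> b \<le> 1" "0 \<le> b \<and> c' \<le> 1" using * trans(3,4) by auto
      obtain \<delta>1 where \<delta>1: "\<delta>1 > 0" "\<And>s s'. s \<in> SG \<Longrightarrow> s' \<in> SG \<Longrightarrow> \<bar>s - a\<bar> < \<delta>1 \<Longrightarrow> \<bar>s' - b\<bar> < \<delta>1 \<Longrightarrow> J s s' 0 1 = 0"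
        using trans(1)[unfolded Q_def, THEN mp, OF le(1)] by blast
      obtain \<delta>2 where \<delta>2: "\<delta>2 > 0" "\<And>s s'. s \<in> SG \<Longrightarrow> s' \<in> SG \<Longrightarrow> \<bar>s - b\<bar> < \<delta>2 \<Longrightarrow> \<bar>s' - c'\<bar> < \<delta>2 \<Longrightarrow> J s s' 0 1 = 0"
        using trans(2)[unfolded Q_def, THEN mp, OF le(2)] by blast
      obtain m where m: "m \<in> SG" "\<bar>m - b\<bar> < min \<delta>1 \<delta>2"
        using good_point_near[OF finb(1), of b "min \<delta>1 \<delta>2"] trans(3,4) * \<delta>1(1) \<delta>2(1) unfolding SG_def by auto
      have "J s s' 0 1 = 0" if "s \<in> SG" "s' \<in> SG" "\<bar>s - a\<bar> < min \<delta>1 \<delta>2" "\<bar>s' - c'\<bar> < min \<delta>1 \<delta>2" for s s'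
        using \<delta>1(2)[of s m] \<delta>2(2)[of m s'] Js[of s m s' 0 1] m that T01 by simp
      then show "\<exists>\<delta>>0. \<forall>s\<in>SG. \<forall>s'\<in>SG. \<bar>s - a\<bar> < \<delta> \<longrightarrow> \<bar>s' - c'\<bar> < \<delta> \<longrightarrow> J s s' 0 1 = 0"
        using \<delta>1(1) \<delta>2(1) by (intro exI[of _ "min \<delta>1 \<delta>2"]) auto
    qed
  next
    case (local s0)
    then obtain \<delta> where \<delta>: "\<delta> > 0" "\<And>s s' t t'. s \<in> SG \<Longrightarrow> s' \<in> SG \<Longrightarrow> t \<in> TG \<Longrightarrow> t' \<in> TG \<Longrightarrow> \<bar>s - s0\<bar> < \<delta> \<Longrightarrow> \<bar>s' - s0\<bar> < \<delta> \<Longrightarrow> \<bar>t - 0\<bar> < \<delta> \<Longrightarrow> \<bar>t' - 1\<bar> < \<delta> \<Longrightarrow> J s s' t t' = 0"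
      using J_col[of s0] by fastforce
    have "Q a b" if ab: "a \<le> s0 \<and> s0 \<le> b \<and> b - a < \<delta> / 2" for a b
    proof -
      have "J s s' 0 1 = 0" if "s \<in> SG" "s' \<in> SG" "\<bar>s - a\<bar> < \<delta> / 2" "\<bar>s' - b\<bar> < \<delta> / 2" for s s'
        using that ab \<delta>(1) T01 by (intro \<delta>(2)) (auto simp: abs_if split: if_splits)
      then show ?thesis unfolding Q_def using \<delta>(1) by (intro impI exI[of _ "\<delta> / 2"]) auto
    qed
    then show ?case using \<delta>(1) by (intro exI[of _ "\<delta> / 2"]) auto
  qed
  then obtain \<delta> where "\<delta> > 0" "\<forall>s\<in>SG. \<forall>s'\<in>SG. \<bar>s - 0\<bar> < \<delta> \<longrightarrow> \<bar>s' - 1\<bar> < \<delta> \<longrightarrow> J s s' 0 1 = 0" unfolding Q_def by auto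
  \<comment> \<open>The side t = 0 collapses to the apex and contributes \<open>c p p\<close>, so
    the boundary of the whole parameter square is the boundary of the triangle.\<close>
  then have "J 0 1 0 1 = 0" using S01 by simp
  then have 1: "c p z = c y z + c p y"
    using c_refl[OF pX] unfolding J_def g0 by (simp add: algebra_simps)
  obtain K1 where "cvx K1" "p \<in> K1" "y \<in> K1" using segment_neighbourhood[OF seg_py(1)] by blast
  then have 2: "c y p = - c p y" by (rule c_minus)
  obtain K2 where "cvx K2" "p \<in> K2" "z \<in> K2" using segment_neighbourhood[OF seg_py(2)] by blast
  then have 3: "c z p = - c p z" by (rule c_minus)
  show ?thesis using 1 2 3 by simp
qed

inductive chain :: "complex ^ 'n \<Rightarrow> complex ^ 'n \<Rightarrow> 'v \<Rightarrow> bool" where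
  chain_refl: "x \<in> X \<Longrightarrow> chain x x 0"
| chain_step: "chain x y s \<Longrightarrow> cvx K \<Longrightarrow> y \<in> K \<Longrightarrow> z \<in> K \<Longrightarrow> chain x z (s + c y z)"

text \<open>Coning from \<open>p\<close> replaces each step by the difference of two edges to
  \<open>p\<close>, and the sum telescopes. Each step excludes finitely many more proper subspaces
  for \<open>p\<close>. For a closed chain the two remaining terms coincide.\<close>

lemma chain_cone:
  "chain x y s \<Longrightarrow> \<exists>\<S>. finite \<S> \<and> (\<forall>S\<in>\<S>. subspace S \<and> S \<noteq> UNIV) \<and> (\<forall>p. (\<forall>S\<in>\<S>. p \<notin> S) \<longrightarrow> s = c x p - c y p)"
proof (induction rule: chain.induct)
  case (chain_refl x)
  then show ?case by (intro exI[of _ "{}"]) auto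
next
  case (chain_step x y s K z)
  then obtain \<S> where \<S>: "finite \<S>" "\<forall>S\<in>\<S>. subspace S \<and> S \<noteq> UNIV" "\<And>p. (\<forall>S\<in>\<S>. p \<notin> S) \<Longrightarrow> s = c x p - c y p" by blast
  have yz: "y \<in> X" "z \<in> X" using chain_step cvx_D by auto
  let ?N = "(\<lambda>(H, L). thin y z H L) ` {(H, L). H \<in> \<A> \<and> L \<in> \<A> \<and> H \<noteq> L}"
  have "finite {(H, L). H \<in> \<A> \<and> L \<in> \<A> \<and> H \<noteq> L}" by (rule finite_subset[of _ "\<A> \<times> \<A>"]) (auto simp: finite_A)
  then have fin: "finite (\<S> \<union> wall y ` \<A> \<union> wall z ` \<A> \<union> ?N)" using \<S>(1) finite_A by simp
  have sub: "subspace S \<and> S \<noteq> UNIV" if "S \<in> \<S> \<union> wall y ` \<A> \<union> wall z ` \<A> \<union> ?N" for S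
    using that
  proof (elim UnE)
    assume "S \<in> ?N" then show ?thesis using thin_subspace by auto
  next
    assume "S \<in> wall y ` \<A>" then show ?thesis using wall_subspace[OF _ yz(1)] by fast
  next
    assume "S \<in> wall z ` \<A>" then show ?thesis using wall_subspace[OF _ yz(2)] by fast
  qed (use \<S>(2) in blast)
  have val: "s + c y z = c x p - c z p" if p: "\<forall>S\<in>\<S> \<union> wall y ` \<A> \<union> wall z ` \<A> \<union> ?N. p \<notin> S" for p
  proof -
    have "c y z + c z p = c y p"
      by (rule triangle[OF chain_step.hyps(2-4)]) (use p in blast)+
    moreover have "s = c x p - c y p" using p by (intro \<S>(3)) blast
    ultimately show ?thesis by (simp add: algebra_simps)
  qed
  show ?case
    by (rule exI[of _ "\<S> \<union> wall y ` \<A> \<union> wall z ` \<A> \<union> ?N"], intro conjI ballI allI impI)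
      (fact fin, (rule sub[THEN conjunct1] sub[THEN conjunct2], assumption)+, rule val)
qed

lemma closed_chain_zero: "chain x x s \<Longrightarrow> s = 0"
proof -
  assume "chain x x s"
  from chain_cone[OF this] obtain \<S> where \<S>: "finite \<S>" "\<forall>S\<in>\<S>. subspace S \<and> S \<noteq> UNIV"
    and val: "\<forall>p. (\<forall>S\<in>\<S>. p \<notin> S) \<longrightarrow> s = c x p - c x p"
    by (elim exE conjE)
  obtain p where "\<forall>S\<in>\<S>. p \<notin> S" using generic_point[of \<S>] \<S> by metis
  with val have "s = c x p - c x p" by metis
  then show "s = 0" by simp
qed

end

section \<open>Local monodromy around a hyperplane\<close>

text \<open>The partial products are bounded by the exponential of the sum of the norms; their
  increments are then dominated by a geometric series, which gives convergence and the distance from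
  the identity.\<close>

lemma infinite_matrix_product:
  fixes G d :: "nat \<Rightarrow> complex ^ 'm ^ 'm"
  assumes G0: "G 0 = mat 1" and GS: "\<And>i. G (Suc i) = G i ** (mat 1 + d i)"
    and d: "\<And>i. norm (d i) \<le> \<eta> * q ^ i" and q: "0 \<le> q" "q < 1" and \<eta>: "0 \<le> \<eta>"
  shows "\<exists>L. G \<longlonglongrightarrow> L \<and> norm (L - mat 1) \<le> norm (mat 1 :: complex ^ 'm ^ 'm) * exp (\<eta> / (1 - q)) * (\<eta> / (1 - q))"
proof -
  let ?c = "norm (mat 1 :: complex ^ 'm ^ 'm)"
  have geo: "(\<lambda>i. \<eta> * q ^ i) sums (\<eta> / (1 - q))"
    using sums_mult[OF geometric_sums[of q], of \<eta>] q by simp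
  have part: "(\<Sum>j<i. \<eta> * q ^ j) \<le> \<eta> / (1 - q)" for i
    using sum_le_suminf[OF sums_summable[OF geo], of "{..<i}"] sums_unique[OF geo] q \<eta> by simp
  have Gb: "norm (G i) \<le> ?c * exp (\<Sum>j<i. \<eta> * q ^ j)" for i
  proof (induction i)
    case (Suc i)
    have "norm (G (Suc i)) = norm (G i + G i ** d i)" by (simp add: GS matrix_add_ldistrib)
    also have "\<dots> \<le> norm (G i) + norm (G i) * (\<eta> * q ^ i)"
      using norm_triangle_ineq[of "G i" "G i ** d i"] norm_matrix_mult_le[of "G i" "d i"] mult_left_mono[OF d[of i] norm_ge_zero[of "G i"]]
      by linarith
    also have "\<dots> = norm (G i) * (1 + \<eta> * q ^ i)" by (simp add: algebra_simps)
    also have "\<dots> \<le> (?c * exp (\<Sum>j<i. \<eta> * q ^ j)) * exp (\<eta> * q ^ i)"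
      using Suc q \<eta> exp_ge_add_one_self[of "\<eta> * q ^ i"] by (intro mult_mono) auto
    finally show ?case by (simp add: exp_add mult.assoc)
  qed (simp add: G0)
  have Gb': "norm (G i) \<le> ?c * exp (\<eta> / (1 - q))" for i
    by (rule order_trans[OF Gb]) (simp add: mult_left_mono part)
  have inc: "norm (G (Suc i) - G i) \<le> ?c * exp (\<eta> / (1 - q)) * (\<eta> * q ^ i)" for i
  proof -
    have "norm (G (Suc i) - G i) = norm (G i ** d i)" by (simp add: GS matrix_add_ldistrib)
    also have "\<dots> \<le> norm (G i) * norm (d i)" by (rule norm_matrix_mult_le)
    also have "\<dots> \<le> (?c * exp (\<eta> / (1 - q))) * (\<eta> * q ^ i)"
      using Gb' d by (intro mult_mono) auto
    finally show ?thesis .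
  qed
  have s2: "(\<lambda>i. ?c * exp (\<eta> / (1 - q)) * (\<eta> * q ^ i)) sums (?c * exp (\<eta> / (1 - q)) * (\<eta> / (1 - q)))"
    by (rule sums_mult[OF geo])
  have "summable (\<lambda>i. G (Suc i) - G i)"
    by (rule summable_comparison_test'[OF sums_summable[OF s2], of 0]) (rule inc)
  then have "(\<lambda>i. G (Suc i) - G i) sums (\<Sum>i. G (Suc i) - G i)" by (rule summable_sums)
  then have "(\<lambda>n. G n - G 0) \<longlonglongrightarrow> (\<Sum>i. G (Suc i) - G i)"
    by (simp add: sums_def sum_lessThan_telescope)
  then have "(\<lambda>n. (G n - G 0) + G 0) \<longlonglongrightarrow> (\<Sum>i. G (Suc i) - G i) + G 0" by (intro tendsto_intros)
  then have "G \<longlonglongrightarrow> (\<Sum>i. G (Suc i) - G i) + mat 1" by (simp add: G0)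
  moreover have "norm (\<Sum>i. G (Suc i) - G i) \<le> ?c * exp (\<eta> / (1 - q)) * (\<eta> / (1 - q))"
    using norm_suminf_le[OF inc sums_summable[OF s2]] sums_unique[OF s2] by simp
  ultimately show ?thesis by (intro exI[of _ "(\<Sum>i. G (Suc i) - G i) + mat 1"]) simp
qed

lemma norm_matrix_mult_diff:
  fixes a b :: "complex ^ 'm ^ 'm"
  assumes "norm (a' - a) \<le> x" "norm (b' - b) \<le> y" "norm a \<le> M" "norm b' \<le> M"
  shows "norm (a' ** b' - a ** b) \<le> M * x + M * y"
proof -
  have "a' ** b' - a ** b = (a' - a) ** b' + a ** (b' - b)"
    by (simp add: matrix_mult_diff_left matrix_mult_diff_right)
  then have "norm (a' ** b' - a ** b) \<le> norm (a' - a) * norm b' + norm a * norm (b' - b)"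
    by (metis add_mono norm_matrix_mult_le norm_triangle_le)
  also have "\<dots> \<le> x * M + M * y"
    using assms order_trans[OF norm_ge_zero assms(1)] order_trans[OF norm_ge_zero assms(3)]
    by (intro add_mono mult_mono) auto
  finally show ?thesis by (simp add: mult.commute)
qed

text \<open>\<open>q\<close> lies on \<open>H\<close> and on no other hyperplane, and
  \<open>n\<close> is a transverse eigenvector of \<open>s\<close>. Thus \<open>s\<close> rotates
  the line through \<open>q\<close> in direction \<open>n\<close> by \<open>zeta e\<close>. The
  matrices \<open>E j\<close> are the eigenprojections of \<open>\<rho> s\<close>, and
  \<open>A H\<close> is a combination of the same projections.\<close>

locale meridian = equivariant_connection \<A> \<alpha> A W \<rho>
  for \<A> :: "(complex ^ 'n) set set" and \<alpha> and A :: "(complex ^ 'n) set \<Rightarrow> complex ^ 'm ^ 'm" and W \<rho> +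
  fixes H :: "(complex ^ 'n) set" and q n :: "complex ^ 'n" and s :: "complex ^ 'n ^ 'n" and e :: nat
    and E :: "nat \<Rightarrow> complex ^ 'm ^ 'm" and \<tau> :: "nat \<Rightarrow> real"
  assumes H: "H \<in> \<A>" and qH: "q \<in> H" and only: "\<And>K. K \<in> \<A> \<Longrightarrow> q \<in> K \<Longrightarrow> K = H"
    and s: "s \<in> W" and e2: "e \<ge> 2" and sq: "s *v q = q" and sn: "s *v n = zeta e *s n" and an: "\<alpha> H n = 1"
    and E_mult: "\<And>i j. i < e \<Longrightarrow> j < e \<Longrightarrow> E i ** E j = (if i = j then E i else 0)"
    and E_sum: "(\<Sum>j<e. E j) = mat 1"
    and rho_s: "\<rho> s = (\<Sum>j<e. mat (zeta e ^ j) ** E j)"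
    and A_H: "A H = (\<Sum>j<e. mat (complex_of_real (\<tau> j) / (2 * of_real pi * \<i>)) ** E j)"
begin

definition diag :: "(nat \<Rightarrow> complex) \<Rightarrow> complex ^ 'm ^ 'm" where
  "diag x = (\<Sum>j<e. mat (x j) ** E j)"

lemma diag_E: "j < e \<Longrightarrow> diag x ** E j = mat (x j) ** E j"
proof -
  assume j: "j < e"
  have "diag x ** E j = (\<Sum>i<e. if i = j then mat (x j) ** E j else 0)"
    unfolding diag_def matrix_mult_sum_left
    by (intro sum.cong refl) (use j E_mult in \<open>auto simp flip: matrix_mul_assoc\<close>)
  then show ?thesis using j by simp
qed

lemma diag_mult: "diag x ** diag y = diag (\<lambda>j. x j * y j)"
proof -
  have "diag x ** diag y = (\<Sum>j<e. mat (y j) ** (diag x ** E j))"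
    unfolding diag_def[of y] by (simp add: matrix_mult_sum_right mat_left_commute)
  also have "\<dots> = (\<Sum>j<e. mat (x j * y j) ** E j)"
    by (intro sum.cong refl) (simp add: diag_E mat_mat_mult mult.commute)
  finally show ?thesis by (simp add: diag_def)
qed

lemma diag_one: "diag (\<lambda>_. 1) = mat 1"
  by (simp add: diag_def E_sum)

text \<open>The eigenprojections need not be orthogonal, so a bound on the eigenvalues bounds the
  norm only up to this constant.\<close>

definition CE :: real where "CE = (\<Sum>j<e. norm (E j))"

lemma CE_nonneg: "CE \<ge> 0"
  by (simp add: CE_def sum_nonneg)

lemma norm_diag: "(\<And>j. j < e \<Longrightarrow> cmod (x j) \<le> b) \<Longrightarrow> norm (diag x) \<le> b * CE"
  unfolding diag_def CE_def sum_distrib_left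
  by (rule sum_norm_le) (simp add: norm_mat_mult mult_right_mono)

definition a :: "nat \<Rightarrow> complex" where
  "a j = complex_of_real (\<tau> j) / (2 * of_real pi * \<i>)"

definition amax :: real where "amax = (\<Sum>j<e. cmod (a j))"

lemma amax: "j < e \<Longrightarrow> cmod (a j) \<le> amax" "amax \<ge> 0"
  unfolding amax_def by (rule member_le_sum) (auto simp: sum_nonneg)

lemma A_H_diag: "A H = diag a"
  by (simp add: A_H diag_def a_def)

text \<open>The exponential of \<open>h x A H\<close>; for \<open>x = Ln \<kappa>\<close> it is the
  power of \<open>\<kappa>\<close> with exponent \<open>h A H\<close>.\<close>

definition Pw :: "complex \<Rightarrow> complex \<Rightarrow> complex ^ 'm ^ 'm" where
  "Pw h x = diag (\<lambda>j. exp (h * a j * x))"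

lemma Pw_add: "Pw h x ** Pw h y = Pw h (x + y)"
  by (simp add: Pw_def diag_mult exp_add[symmetric] distrib_left)

lemma Pw_0: "Pw h 0 = mat 1"
  by (simp add: Pw_def diag_one)

lemma Pw_inverse: "Pw h x ** Pw h (- x) = mat 1" "Pw h (- x) ** Pw h x = mat 1"
  by (simp_all add: Pw_add Pw_0)

lemma Pw_bound: "norm (Pw h x) \<le> exp (cmod h * amax * cmod x) * CE"
  unfolding Pw_def
proof (rule norm_diag)
  fix j assume "j < e"
  have "cmod (exp (h * a j * x)) \<le> exp (cmod (h * a j * x))" by (rule norm_exp)
  also have "\<dots> \<le> exp (cmod h * amax * cmod x)"
    using amax(1)[OF \<open>j < e\<close>] by (auto simp: norm_mult intro!: mult_right_mono mult_left_mono)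
  finally show "cmod (exp (h * a j * x)) \<le> exp (cmod h * amax * cmod x)" .
qed

section \<open>The connection on a disc transverse to \<open>H\<close>\<close>

definition f :: "complex \<Rightarrow> complex ^ 'n" where
  "f z = q + z *s n"

lemma form_f: "K \<in> \<A> \<Longrightarrow> \<alpha> K (f z) = \<alpha> K q + z * \<alpha> K n"
  unfolding f_def by (simp add: linear_form_add[OF form] linear_form_scale[OF form])

lemma form_f_H: "\<alpha> H (f z) = z"
  using kernel_iff[OF H] qH by (simp add: form_f[OF H] an)

lemma q_off: "K \<in> \<A> - {H} \<Longrightarrow> \<alpha> K q \<noteq> 0"
  using only kernel_iff by blast

text \<open>On the disc of this radius every other form moves by at most half of its value at
  \<open>q\<close>, hence stays away from 0. The summand 1 keeps the denominator positive.\<close>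

definition r0 :: real where
  "r0 = 1 / (1 + (\<Sum>K\<in>\<A> - {H}. 2 * cmod (\<alpha> K n) / cmod (\<alpha> K q)))"

lemma r0_pos: "r0 > 0"
  unfolding r0_def by (intro divide_pos_pos add_pos_nonneg sum_nonneg) auto

lemma form_off:
  assumes K: "K \<in> \<A> - {H}" and z: "cmod z \<le> r0"
  shows "cmod (z * \<alpha> K n) \<le> cmod (\<alpha> K q) / 2" "cmod (\<alpha> K (f z)) \<ge> cmod (\<alpha> K q) / 2"
proof -
  let ?S = "\<Sum>K\<in>\<A> - {H}. 2 * cmod (\<alpha> K n) / cmod (\<alpha> K q)"
  have "2 * cmod (\<alpha> K n) / cmod (\<alpha> K q) \<le> ?S" using K finite_A by (intro member_le_sum) auto
  then have "2 * cmod (\<alpha> K n) / cmod (\<alpha> K q) \<le> 1 + ?S" by simp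
  moreover have "?S \<ge> 0" by (intro sum_nonneg) auto
  moreover have "1 / (1 + S) * u \<le> 1" if "u \<le> 1 + S" "S \<ge> 0" for u S :: real
    using that by (simp add: field_simps)
  ultimately have "r0 * (2 * cmod (\<alpha> K n) / cmod (\<alpha> K q)) \<le> 1"
    unfolding r0_def by blast
  then have "r0 * (2 * cmod (\<alpha> K n)) \<le> cmod (\<alpha> K q)" using q_off[OF K] by (simp add: field_simps)
  moreover have "cmod z * (2 * cmod (\<alpha> K n)) \<le> r0 * (2 * cmod (\<alpha> K n))" using z by (intro mult_right_mono) auto
  ultimately show 1: "cmod (z * \<alpha> K n) \<le> cmod (\<alpha> K q) / 2" by (simp add: norm_mult)
  have "cmod (\<alpha> K q) \<le> cmod (\<alpha> K q + z * \<alpha> K n) + cmod (z * \<alpha> K n)"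
    using norm_triangle_ineq4[of "\<alpha> K q + z * \<alpha> K n" "z * \<alpha> K n"] by simp
  then show "cmod (\<alpha> K (f z)) \<ge> cmod (\<alpha> K q) / 2" using 1 form_f K by auto
qed

text \<open>A convex subset of \<open>X\<close> containing the half disc in direction
  \<open>w\<close>: the form of \<open>H\<close> is confined to a half plane, the others to discs
  around their values at \<open>q\<close> that avoid 0.\<close>

definition HB :: "complex \<Rightarrow> (complex ^ 'n) set" where
  "HB w = {x. Re (cnj w * \<alpha> H x) > 0} \<inter> (\<Inter>K\<in>\<A> - {H}. \<alpha> K -` ball (\<alpha> K q) (cmod (\<alpha> K q)))"

lemma HB_cvx: "cvx (HB w)"
  unfolding cvx_def
proof (intro conjI)
  have lin: "linear (\<lambda>x. Re (cnj w * \<alpha> H x))"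
    by (rule linearI) (simp_all add: linear_form_add[OF form[OF H]] linear_form_scaleR[OF form[OF H]] algebra_simps)
  have "continuous_on UNIV (\<lambda>x. Re (cnj w * \<alpha> H x))"
    using lin linear_conv_bounded_linear linear_continuous_on by blast
  then have "open {x. Re (cnj w * \<alpha> H x) > 0}" by (intro open_Collect_less) auto
  moreover have "open (\<alpha> K -` ball (\<alpha> K q) (cmod (\<alpha> K q)))" if "K \<in> \<A> - {H}" for K
    using that by (intro open_vimage cont_form) auto
  ultimately show "open (HB w)" unfolding HB_def using finite_A by (intro open_Int open_INT) auto
  have "convex ((\<lambda>x. Re (cnj w * \<alpha> H x)) -` {0<..})" by (rule convex_linear_vimage[OF lin]) simp
  moreover have "(\<lambda>x. Re (cnj w * \<alpha> H x)) -` {0<..} = {x. Re (cnj w * \<alpha> H x) > 0}" by auto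
  moreover have "convex (\<alpha> K -` ball (\<alpha> K q) (cmod (\<alpha> K q)))" if "K \<in> \<A> - {H}" for K
    using that by (intro convex_linear_vimage linear_form_linear form) auto
  ultimately show "convex (HB w)" unfolding HB_def by (intro convex_Int convex_INT) auto
  show "HB w \<subseteq> X"
  proof
    fix x assume x: "x \<in> HB w"
    show "x \<in> X" unfolding X_iff
    proof
      fix K assume K: "K \<in> \<A>"
      show "\<alpha> K x \<noteq> 0"
      proof (cases "K = H")
        case True then show ?thesis using x by (auto simp: HB_def)
      next
        case False
        then have "dist (\<alpha> K q) (\<alpha> K x) < cmod (\<alpha> K q)" using x K by (auto simp: HB_def)
        then show ?thesis by auto
      qed
    qed
  qed
qed

lemma f_in_HB:
  assumes "cmod z \<le> r0" "Re (cnj w * z) > 0" shows "f z \<in> HB w"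
proof -
  have "dist (\<alpha> K q) (\<alpha> K (f z)) < cmod (\<alpha> K q)" if K: "K \<in> \<A> - {H}" for K
  proof -
    have "dist (\<alpha> K q) (\<alpha> K (f z)) = cmod (z * \<alpha> K n)" using K form_f by (simp add: dist_norm)
    also have "\<dots> \<le> cmod (\<alpha> K q) / 2" by (rule form_off(1)[OF K assms(1)])
    also have "\<dots> < cmod (\<alpha> K q)" using q_off[OF K] by simp
    finally show ?thesis .
  qed
  then show ?thesis using assms(2) by (auto simp: HB_def form_f_H)
qed

lemma Re_cnj_self: "w \<noteq> 0 \<Longrightarrow> Re \<kappa> > 0 \<Longrightarrow> Re (cnj w * (\<kappa> * w)) > 0"
proof -
  assume "w \<noteq> 0" "Re \<kappa> > 0"
  have "cnj w * w = complex_of_real ((cmod w)\<^sup>2)"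
    by (simp add: complex_norm_square mult.commute del: of_real_power)
  then have "cnj w * (\<kappa> * w) = \<kappa> * complex_of_real ((cmod w)\<^sup>2)"
    by (simp add: mult.left_commute del: of_real_power)
  then have "Re (cnj w * (\<kappa> * w)) = Re (\<kappa> * complex_of_real ((cmod w)\<^sup>2))" by (rule arg_cong)
  also have "\<dots> = Re \<kappa> * (cmod w)\<^sup>2" by (simp del: of_real_power)
  finally have "Re (cnj w * (\<kappa> * w)) = Re \<kappa> * (cmod w)\<^sup>2" .
  then show ?thesis using \<open>w \<noteq> 0\<close> \<open>Re \<kappa> > 0\<close> by (simp only: zero_less_mult_iff) simp
qed

definition Rest :: "complex \<Rightarrow> complex \<Rightarrow> complex ^ 'm ^ 'm" where
  "Rest y v = (\<Sum>K\<in>\<A> - {H}. mat (v * \<alpha> K n / \<alpha> K (f y)) ** A K)"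

definition CR :: real where
  "CR = (\<Sum>K\<in>\<A> - {H}. cmod (\<alpha> K n) / (cmod (\<alpha> K q) / 2) * norm (A K))"

lemma CR_nonneg: "CR \<ge> 0"
  unfolding CR_def by (intro sum_nonneg) auto

lemma lform_f: "lform A (f y) (v *s n) = mat (v / y) ** A H + Rest y v"
proof -
  have "lform A (f y) (v *s n) = (\<Sum>K\<in>\<A>. mat (v * \<alpha> K n / \<alpha> K (f y)) ** A K)"
    unfolding lform_def by (intro sum.cong refl) (simp add: linear_form_scale[OF form])
  also have "\<dots> = mat (v * \<alpha> H n / \<alpha> H (f y)) ** A H + Rest y v"
    unfolding Rest_def using finite_A H by (rule sum.remove)
  finally show ?thesis by (simp add: an form_f_H)
qed

lemma Rest_bound:
  assumes "cmod y \<le> r0" shows "norm (Rest y v) \<le> cmod v * CR"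
  unfolding Rest_def CR_def sum_distrib_left
proof (rule sum_norm_le)
  fix K assume K: "K \<in> \<A> - {H}"
  have p: "cmod (\<alpha> K q) / 2 > 0" using q_off[OF K] by simp
  have "cmod (\<alpha> K n) / cmod (\<alpha> K (f y)) \<le> cmod (\<alpha> K n) / (cmod (\<alpha> K q) / 2)"
    using form_off(2)[OF K assms] p by (intro divide_left_mono mult_pos_pos) auto
  then have "cmod v * (cmod (\<alpha> K n) / cmod (\<alpha> K (f y))) * norm (A K) \<le> cmod v * (cmod (\<alpha> K n) / (cmod (\<alpha> K q) / 2)) * norm (A K)"
    by (intro mult_right_mono mult_left_mono) auto
  then show "norm (mat (v * \<alpha> K n / \<alpha> K (f y)) ** A K) \<le> cmod v * (cmod (\<alpha> K n) / (cmod (\<alpha> K q) / 2) * norm (A K))"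
    by (simp add: norm_mat_mult norm_mult norm_divide mult.assoc)
qed

lemma radial_segment: "f z + t *\<^sub>R (f (\<kappa> * z) - f z) = f (z * (1 + complex_of_real t * (\<kappa> - 1)))"
  unfolding f_def by (simp add: vec_eq_iff scaleR_conv_of_real[where 'a = complex] algebra_simps)

lemma k_props:
  assumes "t \<in> {0..1}" "\<mu> \<le> 1" "\<mu> \<le> Re \<kappa>" "cmod z \<le> r0" "cmod (\<kappa> * z) \<le> r0"
  shows "Re (1 + complex_of_real t * (\<kappa> - 1)) \<ge> \<mu>"
    and "cmod (z * (1 + complex_of_real t * (\<kappa> - 1))) \<le> r0"
proof -
  have "(1 - t) * \<mu> + t * \<mu> \<le> (1 - t) * 1 + t * Re \<kappa>"
    using assms by (intro add_mono mult_left_mono) auto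
  then show "Re (1 + complex_of_real t * (\<kappa> - 1)) \<ge> \<mu>" by (simp add: algebra_simps)
  have "z * (1 + complex_of_real t * (\<kappa> - 1)) = (1 - t) *\<^sub>R z + t *\<^sub>R (\<kappa> * z)"
    by (simp add: scaleR_conv_of_real algebra_simps)
  also have "\<dots> \<in> cball 0 r0" using assms by (intro convexD[OF convex_cball]) auto
  finally show "cmod (z * (1 + complex_of_real t * (\<kappa> - 1))) \<le> r0" by simp
qed

text \<open>The singular part dz / z is invariant under scaling and the rest is bounded, so the
  bound does not deteriorate as z tends to 0. It is the a priori estimate for the comparison with
  the model.\<close>

lemma T_radial_bound:
  assumes "0 < \<mu>" "\<mu> \<le> 1" "\<mu> \<le> Re \<kappa>" "cmod \<kappa> \<le> B" "z \<noteq> 0" "cmod z \<le> r0" "cmod (\<kappa> * z) \<le> r0" "cmod h \<le> 1"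
  shows "norm (T h (f z) (f (\<kappa> * z))) \<le> norm (mat 1 :: complex ^ 'm ^ 'm) * exp ((B + 1) / \<mu> * norm (A H) + r0 * (B + 1) * CR)"
proof -
  let ?L = "(B + 1) / \<mu> * norm (A H) + r0 * (B + 1) * CR"
  let ?c = "norm (mat 1 :: complex ^ 'm ^ 'm)"
  have B: "B \<ge> 0" using assms(4) norm_ge_zero order_trans by blast
  have L0: "?L \<ge> 0" using B assms r0_pos CR_nonneg by (intro add_nonneg_nonneg mult_nonneg_nonneg) auto
  have k1: "cmod (\<kappa> - 1) \<le> B + 1" using norm_triangle_ineq4[of \<kappa> 1] assms(4) by simp
  have in1: "f z \<in> HB z" using f_in_HB[of z z] Re_cnj_self[of z 1] assms by simp
  have in2: "f (\<kappa> * z) \<in> HB z" using f_in_HB[of "\<kappa> * z" z] Re_cnj_self[of z \<kappa>] assms by simp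
  have "norm (T h (f z) (f (\<kappa> * z)) - mat 1) \<le> ?c * (exp ?L - 1)"
  proof (rule T_bound[OF HB_cvx in1 in2 L0])
    fix t :: real assume t: "t \<in> {0..1}"
    let ?k = "1 + complex_of_real t * (\<kappa> - 1)"
    note kp = k_props[OF t assms(2,3,6,7)]
    have "\<mu> \<le> cmod ?k" using kp(1) complex_Re_le_cmod[of ?k] by linarith
    then have nk: "?k \<noteq> 0" using assms(1) by auto
    have "f (\<kappa> * z) - f z = (z * (\<kappa> - 1)) *s n"
      unfolding f_def by (simp add: vec_eq_iff algebra_simps)
    then have "norm (lform A (f z + t *\<^sub>R (f (\<kappa> * z) - f z)) (f (\<kappa> * z) - f z)) =
        norm (mat ((\<kappa> - 1) / ?k) ** A H + Rest (z * ?k) (z * (\<kappa> - 1)))"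
      unfolding radial_segment using assms(5) nk by (simp add: lform_f)
    also have "\<dots> \<le> cmod ((\<kappa> - 1) / ?k) * norm (A H) + cmod (z * (\<kappa> - 1)) * CR"
      using norm_triangle_le[OF add_mono[OF eq_refl[OF norm_mat_mult] Rest_bound[OF kp(2)]]] .
    also have "\<dots> \<le> (B + 1) / \<mu> * norm (A H) + r0 * (B + 1) * CR"
    proof (intro add_mono mult_right_mono)
      show "cmod ((\<kappa> - 1) / ?k) \<le> (B + 1) / \<mu>"
        unfolding norm_divide using k1 \<open>\<mu> \<le> cmod ?k\<close> assms(1) B by (intro frac_le) auto
      show "cmod (z * (\<kappa> - 1)) \<le> r0 * (B + 1)"
        unfolding norm_mult using k1 assms(6) r0_pos by (intro mult_mono) auto
    qed (use CR_nonneg in auto)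
    finally have "norm (lform A (f z + t *\<^sub>R (f (\<kappa> * z) - f z)) (f (\<kappa> * z) - f z)) \<le> ?L" .
    then show "norm (om h (f z + t *\<^sub>R (f (\<kappa> * z) - f z)) (f (\<kappa> * z) - f z)) \<le> ?L"
      unfolding om_def norm_mat_mult using assms(8) L0 mult_mono[of "cmod h" 1] by fastforce
  qed
  moreover have "norm (T h (f z) (f (\<kappa> * z))) \<le> norm (T h (f z) (f (\<kappa> * z)) - mat 1) + ?c"
    by (metis diff_add_cancel norm_triangle_ineq)
  ultimately show ?thesis by (simp add: right_diff_distrib)
qed

text \<open>Near \<open>H\<close> the connection is a bounded perturbation of \<open>h A\<^sub>H dz / z\<close>, whose transport from
  \<open>z\<close> to \<open>\<kappa> z\<close> is \<open>\<kappa>\<close> to the power \<open>h A\<^sub>H\<close>.\<close>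

lemma T_radial_model:
  assumes \<kappa>: "Re \<kappa> > 0"
  shows "\<exists>C\<ge>0. \<forall>h z. cmod h \<le> 1 \<longrightarrow> z \<noteq> 0 \<longrightarrow> cmod z \<le> r0 \<longrightarrow> cmod (\<kappa> * z) \<le> r0 \<longrightarrow>
    (\<exists>\<delta>. T h (f z) (f (\<kappa> * z)) = Pw h (Ln \<kappa>) ** (mat 1 + \<delta>) \<and> norm \<delta> \<le> C * cmod h * cmod z)"
proof -
  define \<mu> where "\<mu> = min 1 (Re \<kappa>)"
  have \<mu>: "0 < \<mu>" "\<mu> \<le> 1" "\<mu> \<le> Re \<kappa>" using \<kappa> by (auto simp: \<mu>_def)
  define k where "k t = 1 + complex_of_real t * (\<kappa> - 1)" for t :: real
  define B where "B = 1 + cmod \<kappa>"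
  have kRe: "Re (k t) \<ge> \<mu>" if "t \<in> {0..1}" for t
    using k_props(1)[OF that \<mu>(2,3), of 0] r0_pos by (simp add: k_def)
  have kB: "cmod (k t) \<le> B" if "t \<in> {0..1}" for t
  proof -
    have "k t = (1 - t) *\<^sub>R 1 + t *\<^sub>R \<kappa>" by (simp add: k_def scaleR_conv_of_real algebra_simps)
    then have "cmod (k t) \<le> (1 - t) * 1 + t * cmod \<kappa>"
      using norm_triangle_ineq[of "(1 - t) *\<^sub>R (1::complex)" "t *\<^sub>R \<kappa>"] that by simp
    also have "\<dots> \<le> 1 * 1 + 1 * cmod \<kappa>" using that by (intro add_mono mult_right_mono) auto
    finally show ?thesis by (simp add: B_def)
  qed
  have "continuous_on {0..1} (\<lambda>t. Ln (k t))"
  proof (intro continuous_intros)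
    show "continuous_on {0..1} k" unfolding k_def by (intro continuous_intros)
    fix t :: real assume "t \<in> {0..1}"
    then have "Re (k t) > 0" using kRe[of t] \<mu>(1) by linarith
    then show "k t \<notin> \<real>\<^sub>\<le>\<^sub>0" by (auto simp: complex_nonpos_Reals_iff)
  qed
  then have "bounded ((\<lambda>t. Ln (k t)) ` {0..1})" by (intro compact_imp_bounded compact_continuous_image) auto
  then obtain Lm where Lm: "\<And>t. t \<in> {0..1} \<Longrightarrow> cmod (Ln (k t)) \<le> Lm" unfolding bounded_iff by blast
  have Lm0: "Lm \<ge> 0" using Lm[of 0] norm_ge_zero[of "Ln (k 0)"] by (meson atLeastAtMost_iff order_refl order_trans zero_le_one)
  define CV where "CV = exp (amax * Lm) * CE"
  define CT where "CT = norm (mat 1 :: complex ^ 'm ^ 'm) * exp ((B + 1) / \<mu> * norm (A H) + r0 * (B + 1) * CR)"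
  define C where "C = CV * (cmod (\<kappa> - 1) * CR) * CT"
  have CV0: "CV \<ge> 0" using CE_nonneg by (simp add: CV_def)
  have CT0: "CT \<ge> 0" by (simp add: CT_def)
  have C0: "C \<ge> 0" unfolding C_def using CV0 CT0 CR_nonneg by simp
  have "\<exists>\<delta>. T h (f z) (f (\<kappa> * z)) = Pw h (Ln \<kappa>) ** (mat 1 + \<delta>) \<and> norm \<delta> \<le> C * cmod h * cmod z"
    if h: "cmod h \<le> 1" and z: "z \<noteq> 0" "cmod z \<le> r0" "cmod (\<kappa> * z) \<le> r0" for h z
  proof -
    \<comment> \<open>The inverse of the model transport. In the derivative of
      \<open>V t ** S t\<close> the terms with the pole cancel, and what remains contains
      \<open>Rest\<close> along a segment of length proportional to \<open>cmod z\<close>; this is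
      the source of the factor \<open>cmod h * cmod z\<close>.\<close>
    define V where "V t = Pw h (- Ln (k t))" for t
    define S where "S t = T h (f z) (f (z * k t))" for t
    note kp = k_props(2)[OF _ \<mu>(2,3) z(2,3), folded k_def]
    have in1: "f z \<in> HB z" using f_in_HB[of z z] Re_cnj_self[of z 1] z by simp
    have inS: "f (z * k t) \<in> HB z" if t: "t \<in> {0..1}" for t
    proof (rule f_in_HB[OF kp[OF t]])
      have "Re (k t) > 0" using kRe[OF t] \<mu>(1) by linarith
      then show "Re (cnj z * (z * k t)) > 0" using Re_cnj_self[OF z(1), of "k t"] by (simp add: mult.commute)
    qed
    have dS: "(S has_vector_derivative mat h ** (mat ((\<kappa> - 1) / k t) ** A H + Rest (z * k t) (z * (\<kappa> - 1))) ** S t) (at t)"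
      if t: "t \<in> {0..1}" for t
    proof -
      have "k t \<noteq> 0" using kRe[OF t] \<mu>(1) by auto
      have g: "(\<lambda>t. f (z * k t)) = (\<lambda>t. f z + t *\<^sub>R ((z * (\<kappa> - 1)) *s n))"
        by (simp add: fun_eq_iff f_def k_def vec_eq_iff scaleR_conv_of_real[where 'a = complex] algebra_simps)
      have dg: "((\<lambda>t. f (z * k t)) has_derivative (\<lambda>r. r *\<^sub>R ((z * (\<kappa> - 1)) *s n))) (at t)"
        unfolding g by (auto intro!: derivative_eq_intros)
      have "(T h (f z) has_derivative (\<lambda>v. om h (f (z * k t)) v ** S t)) (at (f (z * k t)))"
        using T_sol[OF HB_cvx in1, of h] inS[OF t] by (auto simp: sol_def S_def)
      from has_derivative_compose[OF dg this]
      have "(S has_derivative (\<lambda>r. om h (f (z * k t)) (r *\<^sub>R ((z * (\<kappa> - 1)) *s n)) ** S t)) (at t)"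
        by (simp add: S_def[abs_def])
      moreover have "linear (om h (f (z * k t)))"
        by (rule flat_form.lin_om[OF flat_om]) (use inS[OF t] cvx_D(3)[OF HB_cvx] in blast)
      ultimately have "(S has_vector_derivative om h (f (z * k t)) ((z * (\<kappa> - 1)) *s n) ** S t) (at t)"
        by (simp add: has_vector_derivative_def linear_cmul matrix_mult_scaleR_left)
      then show ?thesis using z(1) \<open>k t \<noteq> 0\<close> by (simp add: om_def lform_f)
    qed
    have dV: "(V has_vector_derivative - (mat (h * (\<kappa> - 1) / k t) ** (V t ** A H))) (at t)" if t: "t \<in> {0..1}" for t
    proof -
      have kn: "k t \<notin> \<real>\<^sub>\<le>\<^sub>0" using kRe[OF t] \<mu>(1) by (auto simp: complex_nonpos_Reals_iff)
      have dk: "(k has_vector_derivative (\<kappa> - 1)) (at t)"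
        unfolding k_def by (auto intro!: derivative_eq_intros simp: has_vector_derivative_def scaleR_conv_of_real)
      have dL: "((\<lambda>t. exp (h * a j * (- Ln (k t)))) has_vector_derivative
          (\<kappa> - 1) * (exp (h * a j * (- Ln (k t))) * (h * a j * (- inverse (k t))))) (at t)" for j
      proof -
        have "((\<lambda>x. exp (h * a j * (- Ln x))) has_field_derivative exp (h * a j * (- Ln (k t))) * (h * a j * (- inverse (k t)))) (at (k t))"
          using kn by (auto intro!: derivative_eq_intros)
        from field_vector_diff_chain_at[OF dk this] show ?thesis by (simp add: o_def)
      qed
      have "(V has_vector_derivative (\<Sum>j<e. mat ((\<kappa> - 1) * (exp (h * a j * (- Ln (k t))) * (h * a j * (- inverse (k t))))) ** E j)) (at t)"
        unfolding V_def Pw_def diag_def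
      proof (rule has_vector_derivative_sum)
        fix j
        show "((\<lambda>t. mat (exp (h * a j * - Ln (k t))) ** E j) has_vector_derivative
            mat ((\<kappa> - 1) * (exp (h * a j * (- Ln (k t))) * (h * a j * (- inverse (k t))))) ** E j) (at t)"
          by (rule bounded_linear.has_vector_derivative[OF bounded_linear_mat_mult dL])
      qed
      moreover have "(\<Sum>j<e. mat ((\<kappa> - 1) * (exp (h * a j * (- Ln (k t))) * (h * a j * (- inverse (k t))))) ** E j) =
          - (mat (h * (\<kappa> - 1) / k t) ** (V t ** A H))"
        unfolding V_def Pw_def A_H_diag diag_mult unfolding diag_def matrix_mult_sum_right sum_negf[symmetric]
        by (intro sum.cong refl) (simp add: vec_eq_iff divide_inverse)
      ultimately show ?thesis by simp
    qed
    have dQ: "((\<lambda>t. V t ** S t) has_vector_derivative mat h ** (V t ** Rest (z * k t) (z * (\<kappa> - 1)) ** S t)) (at t)"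
      if t: "t \<in> {0..1}" for t
    proof -
      have "((\<lambda>t. V t ** S t) has_vector_derivative
          V t ** (mat h ** (mat ((\<kappa> - 1) / k t) ** A H + Rest (z * k t) (z * (\<kappa> - 1))) ** S t) +
          (- (mat (h * (\<kappa> - 1) / k t) ** (V t ** A H))) ** S t) (at t)"
        by (rule bounded_bilinear.has_vector_derivative[OF bounded_bilinear_matrix_mult dV[OF t] dS[OF t]])
      moreover have "V t ** (mat h ** (mat ((\<kappa> - 1) / k t) ** A H + Rest (z * k t) (z * (\<kappa> - 1))) ** S t) =
          mat (h * (\<kappa> - 1) / k t) ** (V t ** A H) ** S t + mat h ** (V t ** Rest (z * k t) (z * (\<kappa> - 1)) ** S t)"
      proof -
        have "V t ** (mat h ** (mat ((\<kappa> - 1) / k t) ** A H + Rest (z * k t) (z * (\<kappa> - 1))) ** S t) =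
            (V t ** (mat h ** (mat ((\<kappa> - 1) / k t) ** A H))) ** S t + (V t ** (mat h ** Rest (z * k t) (z * (\<kappa> - 1)))) ** S t"
          by (simp add: matrix_add_ldistrib matrix_add_rdistrib matrix_mul_assoc)
        also have "V t ** (mat h ** (mat ((\<kappa> - 1) / k t) ** A H)) = mat (h * (\<kappa> - 1) / k t) ** (V t ** A H)"
          by (simp only: mat_left_commute[of "V t"] mat_mat_mult times_divide_eq_right)
        also have "V t ** (mat h ** Rest (z * k t) (z * (\<kappa> - 1))) = mat h ** (V t ** Rest (z * k t) (z * (\<kappa> - 1)))"
          by (rule mat_left_commute)
        finally show ?thesis by (simp add: matrix_mul_assoc)
      qed
      ultimately show ?thesis by (simp add: matrix_mult_minus_left)
    qed
    have bQ: "norm (mat h ** (V t ** Rest (z * k t) (z * (\<kappa> - 1)) ** S t)) \<le> C * cmod h * cmod z" if t: "t \<in> {0..1}" for t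
    proof -
      have V: "norm (V t) \<le> CV"
      proof -
        have "norm (V t) \<le> exp (cmod h * amax * cmod (Ln (k t))) * CE" unfolding V_def using Pw_bound[of h "- Ln (k t)"] by simp
        also have "\<dots> \<le> exp (1 * amax * Lm) * CE"
          using h Lm[OF t] amax(2) CE_nonneg Lm0 by (intro mult_right_mono iffD2[OF exp_le_cancel_iff] mult_mono) auto
        finally show ?thesis by (simp add: CV_def)
      qed
      have S: "norm (S t) \<le> CT"
      proof -
        have "norm (T h (f z) (f (k t * z))) \<le> CT" unfolding CT_def
          using kp[OF t] by (intro T_radial_bound[OF \<mu>(1,2) kRe[OF t] kB[OF t] z(1,2) _ h]) (simp add: mult.commute)
        then show ?thesis by (simp add: S_def mult.commute)
      qed
      have R: "norm (Rest (z * k t) (z * (\<kappa> - 1))) \<le> cmod z * (cmod (\<kappa> - 1) * CR)"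
        using Rest_bound[OF kp[OF t], of "z * (\<kappa> - 1)"] by (simp add: norm_mult mult.assoc)
      have "norm (V t ** Rest (z * k t) (z * (\<kappa> - 1)) ** S t) \<le> norm (V t ** Rest (z * k t) (z * (\<kappa> - 1))) * norm (S t)"
        by (rule norm_matrix_mult_le)
      also have "\<dots> \<le> (norm (V t) * norm (Rest (z * k t) (z * (\<kappa> - 1)))) * norm (S t)"
        by (intro mult_right_mono norm_matrix_mult_le) simp
      also have "\<dots> \<le> (CV * (cmod z * (cmod (\<kappa> - 1) * CR))) * CT"
        using V S R CV0 CR_nonneg by (intro mult_mono mult_nonneg_nonneg) auto
      also have "\<dots> = C * cmod z" by (simp add: C_def)
      finally have "cmod h * norm (V t ** Rest (z * k t) (z * (\<kappa> - 1)) ** S t) \<le> cmod h * (C * cmod z)"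
        by (rule mult_left_mono) simp
      then show ?thesis by (simp only: norm_mat_mult mult.commute mult.left_commute)
    qed
    have "norm (V 1 ** S 1 - V 0 ** S 0) \<le> C * cmod h * cmod z * 1 - C * cmod h * cmod z * 0"
    proof (rule differentiable_bound_general[where f = "\<lambda>t. V t ** S t" and \<phi> = "\<lambda>t. C * cmod h * cmod z * t"])
      show "(0::real) < 1" by simp
      show "continuous_on {0..1} (\<lambda>t. C * cmod h * cmod z * t)" by (intro continuous_intros)
      show "continuous_on {0..1} (\<lambda>t. V t ** S t)"
        by (intro continuous_at_imp_continuous_on ballI has_vector_derivative_continuous[OF dQ])
      show "((\<lambda>t. V t ** S t) has_vector_derivative mat h ** (V t ** Rest (z * k t) (z * (\<kappa> - 1)) ** S t)) (at t)"
        if "0 < t" "t < 1" for t using that by (intro dQ) auto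
      show "((\<lambda>t. C * cmod h * cmod z * t) has_vector_derivative C * cmod h * cmod z) (at t)" for t
        unfolding has_real_derivative_iff_has_vector_derivative[symmetric] by (auto intro!: derivative_eq_intros)
      show "norm (mat h ** (V t ** Rest (z * k t) (z * (\<kappa> - 1)) ** S t)) \<le> C * cmod h * cmod z"
        if "0 < t" "t < 1" for t using that by (intro bQ) auto
    qed
    moreover have "V 0 ** S 0 = mat 1"
      using T_refl[of "f z"] in1 cvx_D(3)[OF HB_cvx] by (auto simp: V_def S_def k_def Pw_0)
    moreover have "V 1 ** S 1 = Pw h (- Ln \<kappa>) ** T h (f z) (f (\<kappa> * z))"
      by (simp add: V_def S_def k_def mult.commute)
    ultimately have nd: "norm (Pw h (- Ln \<kappa>) ** T h (f z) (f (\<kappa> * z)) - mat 1) \<le> C * cmod h * cmod z" by simp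
    have "T h (f z) (f (\<kappa> * z)) = (Pw h (Ln \<kappa>) ** Pw h (- Ln \<kappa>)) ** T h (f z) (f (\<kappa> * z))"
      by (simp add: Pw_inverse)
    then have "T h (f z) (f (\<kappa> * z)) = Pw h (Ln \<kappa>) ** (mat 1 + (Pw h (- Ln \<kappa>) ** T h (f z) (f (\<kappa> * z)) - mat 1))"
      by (simp add: matrix_mul_assoc)
    then show ?thesis using nd by blast
  qed
  then show ?thesis using C0 by blast
qed

end

section \<open>The braided reflection and its normal form\<close>

context meridian
begin

text \<open>A quarter of the rotation \<open>zeta e\<close>. The rotation itself may be as large as
  a half turn, when no half plane contains both ends; its quarter has positive real part. Moreover
  \<open>\<kappa> ^ e = \<i>\<close>, so powers of \<open>\<kappa>\<close> also pass through the
  corners of the square required by \<open>c_circle\<close>.\<close>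

definition \<kappa> :: complex where "\<kappa> = exp (\<i> * of_real (pi / (2 * real e)))"

lemma \<kappa>_props: "\<kappa> ^ 4 = zeta e" "Re \<kappa> > 0" "Re (inverse \<kappa>) > 0" "cmod \<kappa> = 1" "\<kappa> \<noteq> 0"
  "Ln (inverse \<kappa>) = - (\<i> * of_real (pi / (2 * real e)))"
proof -
  let ?x = "pi / (2 * real e)"
  have x: "0 < ?x" "?x < pi / 2" using e2 by (auto simp: field_simps)
  have "\<kappa> ^ 4 = exp (of_nat 4 * (\<i> * of_real ?x))" unfolding \<kappa>_def by (rule exp_of_nat_mult[symmetric])
  also have "of_nat 4 * (\<i> * of_real ?x) = 2 * \<i> * of_real pi / of_nat e" using e2 by (simp add: field_simps)
  finally show "\<kappa> ^ 4 = zeta e" by (simp add: zeta_def)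
  have "cos ?x > 0" using x by (intro cos_gt_zero) auto
  then show "Re \<kappa> > 0" unfolding \<kappa>_def by (simp add: Re_exp)
  have inv: "inverse \<kappa> = exp (- (\<i> * of_real ?x))" unfolding \<kappa>_def by (simp add: exp_minus)
  then show "Re (inverse \<kappa>) > 0" using \<open>cos ?x > 0\<close> by (simp add: Re_exp)
  show "cmod \<kappa> = 1" unfolding \<kappa>_def by simp
  show "\<kappa> \<noteq> 0" unfolding \<kappa>_def by simp
  show "Ln (inverse \<kappa>) = - (\<i> * of_real ?x)"
    unfolding inv using x by (intro Ln_exp) (auto simp: field_simps)
qed

text \<open>\<open>B h z\<close> is the transport from \<open>f (\<zeta> z)\<close> back to \<open>f z\<close> along an arc, and \<open>g h z\<close> the
  monodromy, based at \<open>f z\<close>, of the braided reflection.\<close>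

definition arc :: "complex \<Rightarrow> complex \<Rightarrow> complex ^ 'm ^ 'm" where
  "arc h z = T h (f (\<kappa> * z)) (f z)"

definition B :: "complex \<Rightarrow> complex \<Rightarrow> complex ^ 'm ^ 'm" where
  "B h z = arc h z ** arc h (\<kappa> * z) ** (arc h (\<kappa> ^ 2 * z) ** arc h (\<kappa> ^ 3 * z))"

definition g :: "complex \<Rightarrow> complex \<Rightarrow> complex ^ 'm ^ 'm" where
  "g h z = B h z ** \<rho> s"

text \<open>The limit of \<open>g h z\<close> as z tends to 0, namely the power of
  \<open>\<kappa>\<close> with exponent \<open>- 4 h A H\<close>, times \<open>\<rho> s\<close>; the
  factor \<open>2 * of_real pi * \<i>\<close> in the residue cancels against the angle.\<close>

definition u :: "complex \<Rightarrow> complex ^ 'm ^ 'm" where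
  "u h = diag (\<lambda>j. exp (- h * complex_of_real (\<tau> j) / of_nat e) * zeta e ^ j)"

lemma s_f: "s *v f z = f (zeta e * z)"
  unfolding f_def by (simp add: matrix_vector_right_distrib sq vector_scalar_commute sn vec.scale_scale mult.commute)

lemma arc_HB: "z \<noteq> 0 \<Longrightarrow> cmod z \<le> r0 \<Longrightarrow> f z \<in> HB z \<and> f (\<kappa> * z) \<in> HB z \<and> f (z / 2) \<in> HB z \<and> f (\<kappa> * (z / 2)) \<in> HB z"
proof -
  assume z: "z \<noteq> 0" "cmod z \<le> r0"
  have "Re (cnj z * (\<kappa>' * z)) > 0" if "Re \<kappa>' > 0" for \<kappa>' using Re_cnj_self[OF z(1) that] .
  from this[of 1] this[of \<kappa>] this[of "1/2"] this[of "\<kappa> / 2"] show ?thesis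
    using z \<kappa>_props(2,4) r0_pos by (auto intro!: f_in_HB simp: norm_mult norm_divide)
qed

lemma arc_step:
  assumes z: "z \<noteq> 0" "cmod z \<le> r0"
  shows "arc h z ** T h (f (\<kappa> * (z / 2))) (f (\<kappa> * z)) = T h (f (z / 2)) (f z) ** arc h (z / 2)"
  unfolding arc_def using arc_HB[OF z] T_trans[OF HB_cvx] by metis

text \<open>Four commuting squares, one for each arc, glued along their radial sides.\<close>

lemma B_step:
  assumes z: "z \<noteq> 0" "cmod z \<le> r0"
  shows "B h z ** T h (f (\<kappa> ^ 4 * (z / 2))) (f (\<kappa> ^ 4 * z)) = T h (f (z / 2)) (f z) ** B h (z / 2)"
proof -
  have st: "arc h (\<kappa> ^ i * z) ** T h (f (\<kappa> ^ Suc i * (z / 2))) (f (\<kappa> ^ Suc i * z)) =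
      T h (f (\<kappa> ^ i * (z / 2))) (f (\<kappa> ^ i * z)) ** arc h (\<kappa> ^ i * (z / 2))" for i
    using arc_step[of "\<kappa> ^ i * z" h] z \<kappa>_props(4,5) by (simp add: norm_mult norm_power mult.assoc)
  define x where "x i = arc h (\<kappa> ^ i * z)" for i
  define y where "y i = arc h (\<kappa> ^ i * (z / 2))" for i
  define t where "t i = T h (f (\<kappa> ^ i * (z / 2))) (f (\<kappa> ^ i * z))" for i
  have st': "x i ** t (Suc i) = t i ** y i" for i unfolding x_def y_def t_def by (rule st)
  have "x 0 ** x 1 ** (x 2 ** x 3) ** t (Suc 3) = x 0 ** x 1 ** x 2 ** (x 3 ** t (Suc 3))"
    by (simp only: matrix_mul_assoc)
  also have "\<dots> = x 0 ** x 1 ** (x 2 ** t (Suc 2)) ** y 3"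
    unfolding st'[of 3] by (simp add: matrix_mul_assoc eval_nat_numeral)
  also have "\<dots> = x 0 ** (x 1 ** t (Suc 1)) ** y 2 ** y 3"
    unfolding st'[of 2] by (simp add: matrix_mul_assoc eval_nat_numeral)
  also have "\<dots> = (x 0 ** t (Suc 0)) ** y 1 ** y 2 ** y 3"
    unfolding st'[of 1] by (simp add: matrix_mul_assoc eval_nat_numeral)
  also have "\<dots> = t 0 ** (y 0 ** y 1 ** (y 2 ** y 3))"
    unfolding st'[of 0] by (simp only: matrix_mul_assoc)
  finally show ?thesis unfolding x_def y_def t_def B_def by simp
qed

text \<open>Radial transport from z / 2 to z intertwines the two monodromies: at the far end of the
  arcs it is the translate by \<open>s\<close>, which equivariance turns into conjugation by
  \<open>\<rho> s\<close>.\<close>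

lemma g_step:
  assumes z: "z \<noteq> 0" "cmod z \<le> r0"
  shows "g h z ** T h (f (z / 2)) (f z) = T h (f (z / 2)) (f z) ** g h (z / 2)"
proof -
  have "T h (f (\<kappa> ^ 4 * (z / 2))) (f (\<kappa> ^ 4 * z)) = \<rho> s ** T h (f (z / 2)) (f z) ** \<rho> (winv s)"
    unfolding \<kappa>_props(1) s_f[symmetric] using arc_HB[OF z] by (intro T_equivariant[OF s HB_cvx]) auto
  then have "T h (f (z / 2)) (f z) ** g h (z / 2) = B h z ** (\<rho> s ** T h (f (z / 2)) (f z) ** \<rho> (winv s)) ** \<rho> s"
    unfolding g_def using B_step[OF z, of h] by (simp add: matrix_mul_assoc)
  also have "\<dots> = g h z ** T h (f (z / 2)) (f z) ** (\<rho> (winv s) ** \<rho> s)"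
    by (simp add: g_def matrix_mul_assoc)
  finally show ?thesis using rho_winv(1)[OF s] by simp
qed

lemma u_eq: "u h = Pw h (- (\<i> * of_real (pi / (2 * real e)))) ** Pw h (- (\<i> * of_real (pi / (2 * real e)))) **
    (Pw h (- (\<i> * of_real (pi / (2 * real e)))) ** Pw h (- (\<i> * of_real (pi / (2 * real e))))) ** \<rho> s"
proof -
  have "h * a j * (- (\<i> * of_real (pi / (2 * real e))) + - (\<i> * of_real (pi / (2 * real e))) +
      (- (\<i> * of_real (pi / (2 * real e))) + - (\<i> * of_real (pi / (2 * real e))))) = - h * complex_of_real (\<tau> j) / of_nat e" for j
    using e2 by (simp add: a_def field_simps)
  moreover have "\<rho> s = diag (\<lambda>j. zeta e ^ j)" by (simp add: rho_s diag_def)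
  ultimately show ?thesis by (simp only: Pw_add) (simp only: Pw_def diag_mult u_def)
qed

text \<open>Each arc is its model up to an error of order \<open>cmod z\<close>. This linear rate
  will outweigh the growth of the conjugating model powers.\<close>

lemma g_near_u: "\<exists>C\<ge>0. \<forall>h z. cmod h \<le> 1 \<longrightarrow> z \<noteq> 0 \<longrightarrow> cmod z \<le> r0 \<longrightarrow> norm (g h z - u h) \<le> C * cmod z"
proof -
  obtain C where C: "C \<ge> 0" "\<And>h z. cmod h \<le> 1 \<Longrightarrow> z \<noteq> 0 \<Longrightarrow> cmod z \<le> r0 \<Longrightarrow> cmod (inverse \<kappa> * z) \<le> r0 \<Longrightarrow>
    \<exists>\<delta>. T h (f z) (f (inverse \<kappa> * z)) = Pw h (Ln (inverse \<kappa>)) ** (mat 1 + \<delta>) \<and> norm \<delta> \<le> C * cmod h * cmod z"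
    using T_radial_model[OF \<kappa>_props(3)] by blast
  define P where "P h = Pw h (- (\<i> * of_real (pi / (2 * real e))))" for h
  define M where "M = exp (amax * (pi / (2 * real e))) * CE"
  have M0: "M \<ge> 0" using CE_nonneg by (simp add: M_def)
  have PM: "norm (P h) \<le> M" if "cmod h \<le> 1" for h
  proof -
    have "norm (P h) \<le> exp (cmod h * amax * (pi / (2 * real e))) * CE"
    proof -
      have c: "cmod (- (\<i> * of_real (pi / (2 * real e)))) = pi / (2 * real e)"
        by (simp only: norm_minus_cancel norm_mult norm_ii norm_of_real) simp
      show ?thesis unfolding P_def using Pw_bound[of h "- (\<i> * of_real (pi / (2 * real e)))"] by (simp only: c)
    qed
    also have "\<dots> \<le> exp (1 * amax * (pi / (2 * real e))) * CE"
      using that amax(2) CE_nonneg by (intro mult_right_mono iffD2[OF exp_le_cancel_iff]) auto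
    finally show ?thesis by (simp add: M_def)
  qed
  define M1 where "M1 = M + M * (C * r0)"
  have M1: "M1 \<ge> M" "M1 \<ge> 0" using M0 C(1) r0_pos by (simp_all add: M1_def)
  have arcP: "norm (arc h z - P h) \<le> M * C * cmod z" and arcM: "norm (arc h z) \<le> M1"
    if "cmod h \<le> 1" "z \<noteq> 0" "cmod z \<le> r0" for h z
  proof -
    note hz = that
    have 1: "inverse \<kappa> * (\<kappa> * z) = z" using \<kappa>_props(5) by simp
    have 2: "\<kappa> * z \<noteq> 0" "cmod (\<kappa> * z) = cmod z" using that \<kappa>_props(4,5) by (auto simp: norm_mult)
    obtain \<delta> where \<delta>: "arc h z = P h ** (mat 1 + \<delta>)" "norm \<delta> \<le> C * cmod h * cmod z"
      using C(2)[of h "\<kappa> * z", unfolded 1 2(2) \<kappa>_props(6), OF hz(1) 2(1) hz(3,3)] unfolding arc_def P_def by blast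
    have nd: "norm \<delta> \<le> C * cmod z"
    proof -
      have "C * cmod h * cmod z \<le> C * 1 * cmod z" using that(1) C(1) by (intro mult_right_mono mult_left_mono) auto
      then show ?thesis using \<delta>(2) by simp
    qed
    have "arc h z - P h = P h ** \<delta>" by (simp add: \<delta>(1) matrix_add_ldistrib)
    then have "norm (arc h z - P h) \<le> norm (P h) * norm \<delta>" by (simp add: norm_matrix_mult_le)
    also have "\<dots> \<le> M * (C * cmod z)" using PM[OF that(1)] nd M0 by (intro mult_mono) auto
    finally show 1: "norm (arc h z - P h) \<le> M * C * cmod z" by simp
    have "M * C * cmod z \<le> M * (C * r0)" using M0 C(1) that(3) by (simp add: mult_left_mono mult.assoc)
    then show "norm (arc h z) \<le> M1"
      using 1 PM[OF that(1)] norm_triangle_ineq[of "arc h z - P h" "P h"] by (simp add: M1_def)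
  qed
  define C' where "C' = M * C"
  define D where "D = M1 * C' + M1 * C'"
  have norm_u: "norm (P h ** P h) \<le> M1 * M1" if "cmod h \<le> 1" for h
  proof -
    have "norm (P h ** P h) \<le> norm (P h) * norm (P h)" by (rule norm_matrix_mult_le)
    also have "\<dots> \<le> M1 * M1" using PM[OF that] M1 by (intro mult_mono) auto
    finally show ?thesis .
  qed
  have "norm (g h z - u h) \<le> ((M1 * M1) * D + (M1 * M1) * D) * norm (\<rho> s) * cmod z"
    if h: "cmod h \<le> 1" and z: "z \<noteq> 0" "cmod z \<le> r0" for h z
  proof -
    have nz: "\<kappa> ^ i * z \<noteq> 0" "cmod (\<kappa> ^ i * z) = cmod z" for i
      using z \<kappa>_props by (auto simp: norm_mult norm_power)
    have two: "norm (arc h (\<kappa> ^ i * z) ** arc h (\<kappa> ^ j * z) - P h ** P h) \<le> D * cmod z" for i j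
    proof -
      have "norm (arc h (\<kappa> ^ i * z) ** arc h (\<kappa> ^ j * z) - P h ** P h) \<le> M1 * (M * C * cmod z) + M1 * (M * C * cmod z)"
        using arcP[OF h nz(1)] arcM[OF h nz(1)] PM[OF h] M1 z nz(2)
        by (intro norm_matrix_mult_diff) (auto intro: order_trans)
      then show ?thesis by (simp add: D_def C'_def algebra_simps)
    qed
    have prod: "norm (arc h (\<kappa> ^ i * z) ** arc h (\<kappa> ^ j * z)) \<le> M1 * M1" for i j
    proof -
      have "norm (arc h (\<kappa> ^ i * z) ** arc h (\<kappa> ^ j * z)) \<le> norm (arc h (\<kappa> ^ i * z)) * norm (arc h (\<kappa> ^ j * z))"
        by (rule norm_matrix_mult_le)
      also have "\<dots> \<le> M1 * M1" using arcM[OF h nz(1)] z nz(2) M1 by (intro mult_mono) auto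
      finally show ?thesis .
    qed
    have "norm (B h z - P h ** P h ** (P h ** P h)) \<le> (M1 * M1) * (D * cmod z) + (M1 * M1) * (D * cmod z)"
      using norm_matrix_mult_diff[OF two[of 0 1] two[of 2 3] norm_u[OF h] prod[of 2 3]] by (simp add: B_def)
    then have 1: "norm (B h z - P h ** P h ** (P h ** P h)) \<le> ((M1 * M1) * D + (M1 * M1) * D) * cmod z"
      by (simp add: algebra_simps)
    have "g h z - u h = (B h z - P h ** P h ** (P h ** P h)) ** \<rho> s"
      unfolding g_def u_eq P_def by (simp add: matrix_mult_diff_left)
    then have "norm (g h z - u h) \<le> norm (B h z - P h ** P h ** (P h ** P h)) * norm (\<rho> s)"
      by (simp add: norm_matrix_mult_le)
    also have "\<dots> \<le> (((M1 * M1) * D + (M1 * M1) * D) * cmod z) * norm (\<rho> s)" by (rule mult_right_mono[OF 1 norm_ge_zero])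
    finally show ?thesis by (simp add: mult_ac)
  qed
  moreover have "((M1 * M1) * D + (M1 * M1) * D) * norm (\<rho> s) \<ge> 0"
    using M1 M0 C(1) by (simp add: D_def C'_def)
  ultimately show ?thesis by blast
qed

text \<open>The base point is moved towards \<open>H\<close> by successive halving. The transports
  themselves need not converge, but they do after the model powers are removed: the i-th correction
  has size \<open>cmod h / 2 ^ i\<close> and is conjugated by model powers growing at most like
  \<open>(3 / 2) ^ i\<close>. The limit conjugates \<open>g\<close> exactly to its limit
  \<open>u\<close> and differs from the identity by a multiple of \<open>cmod h\<close>.\<close>

lemma normal_form:
  assumes \<epsilon>: "0 < \<epsilon>" "\<epsilon> \<le> r0"
  shows "\<exists>\<eta>>0. \<exists>C. \<forall>h. cmod h < \<eta> \<longrightarrow>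
    (\<exists>G. g h (complex_of_real \<epsilon>) ** G = G ** u h \<and> norm (G - mat 1) \<le> C * cmod h)"
proof -
  let ?c = "norm (mat 1 :: complex ^ 'm ^ 'm)"
  have "Re (2::complex) > 0" by simp
  then obtain C where C: "C \<ge> 0" "\<And>h z. cmod h \<le> 1 \<Longrightarrow> z \<noteq> 0 \<Longrightarrow> cmod z \<le> r0 \<Longrightarrow> cmod (2 * z) \<le> r0 \<Longrightarrow>
    \<exists>\<delta>. T h (f z) (f (2 * z)) = Pw h (Ln 2) ** (mat 1 + \<delta>) \<and> norm \<delta> \<le> C * cmod h * cmod z"
    using T_radial_model by blast
  obtain Cg where Cg: "Cg \<ge> 0" "\<And>h z. cmod h \<le> 1 \<Longrightarrow> z \<noteq> 0 \<Longrightarrow> cmod z \<le> r0 \<Longrightarrow> norm (g h z - u h) \<le> Cg * cmod z"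
    using g_near_u by blast
  have Ln2: "Ln 2 = complex_of_real (ln 2)" using Ln_of_real[of 2] by simp
  define l where "l = ln (2::real)"
  have l0: "l > 0" by (simp add: l_def)
  \<comment> \<open>For small h one halving step costs at most a factor 3/2, strictly below the
    factor 2 gained from the halving of z.\<close>
  have "\<exists>\<eta>>0. \<forall>t. 0 \<le> t \<and> t < \<eta> \<longrightarrow> exp (2 * (t * amax * l)) \<le> 3 / 2"
  proof -
    have "((\<lambda>t. exp (2 * (t * amax * l))) \<longlongrightarrow> exp (2 * (0 * amax * l))) (at 0)" by (intro tendsto_intros)
    then have "\<forall>\<^sub>F t in at 0. exp (2 * (t * amax * l)) < 3 / 2" by (rule order_tendstoD) simp
    then obtain d where d: "d > 0" "\<And>t. t \<noteq> 0 \<Longrightarrow> dist t 0 < d \<Longrightarrow> exp (2 * (t * amax * l)) < 3 / 2"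
      by (auto simp: eventually_at)
    have "exp (2 * (t * amax * l)) \<le> 3 / 2" if "0 \<le> t \<and> t < d" for t
      using d(2)[of t] that by (cases "t = 0") (auto simp: less_imp_le)
    then show ?thesis using d(1) by blast
  qed
  then obtain \<eta>0 where \<eta>0: "\<eta>0 > 0" "\<And>t. 0 \<le> t \<Longrightarrow> t < \<eta>0 \<Longrightarrow> exp (2 * (t * amax * l)) \<le> 3 / 2" by blast
  define \<eta> where "\<eta> = min \<eta>0 1"
  define C1 where "C1 = CE * CE * C * \<epsilon>"
  have C1: "C1 \<ge> 0" using CE_nonneg C(1) \<epsilon> by (simp add: C1_def)
  have main: "\<exists>G. g h (complex_of_real \<epsilon>) ** G = G ** u h \<and> norm (G - mat 1) \<le> ?c * exp (4 * C1) * (4 * C1) * cmod h"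
    if h: "cmod h < \<eta>" for h
  proof -
    have h1: "cmod h \<le> 1" using h by (simp add: \<eta>_def)
    have e32: "exp (2 * (cmod h * amax * l)) \<le> 3 / 2" using h by (intro \<eta>0(2)) (auto simp: \<eta>_def)
    define z where "z i = complex_of_real (\<epsilon> / 2 ^ i)" for i :: nat
    have z: "z i \<noteq> 0" "cmod (z i) = \<epsilon> / 2 ^ i" "cmod (z i) \<le> r0" for i
    proof -
      show "z i \<noteq> 0" using \<epsilon> by (simp add: z_def)
      show "cmod (z i) = \<epsilon> / 2 ^ i" unfolding z_def norm_of_real using \<epsilon> by simp
      have "\<epsilon> / 2 ^ i \<le> \<epsilon> / 1" using \<epsilon> by (intro divide_left_mono) auto
      then show "cmod (z i) \<le> r0" using \<epsilon> \<open>cmod (z i) = \<epsilon> / 2 ^ i\<close> by simp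
    qed
    have zS: "z i / 2 = z (Suc i)" "2 * z (Suc i) = z i" for i by (simp_all add: z_def)
    define D where "D i = T h (f (z (Suc i))) (f (z i))" for i
    have "\<exists>\<delta>. D i = Pw h (of_real l) ** (mat 1 + \<delta>) \<and> norm \<delta> \<le> C * cmod h * cmod (z (Suc i))" for i
      using C(2)[OF h1 z(1) z(3), of "Suc i"] z(3)[of i] unfolding zS D_def Ln2 l_def by simp
    then obtain \<delta> where \<delta>: "\<And>i. D i = Pw h (of_real l) ** (mat 1 + \<delta> i)" "\<And>i. norm (\<delta> i) \<le> C * cmod h * cmod (z (Suc i))"
      by metis
    define Kf where "Kf = rec_nat (mat 1) (\<lambda>i K. K ** D i)"
    have K0: "Kf 0 = mat 1" and KS: "Kf (Suc i) = Kf i ** D i" for i by (simp_all add: Kf_def)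
    have gK: "g h (z 0) ** Kf i = Kf i ** g h (z i)" for i
    proof (induction i)
      case (Suc i)
      have "g h (z 0) ** Kf (Suc i) = Kf i ** (g h (z i) ** D i)" using Suc by (simp add: KS matrix_mul_assoc)
      also have "g h (z i) ** D i = D i ** g h (z (Suc i))"
        using g_step[of "z i" h, OF z(1,3)] by (simp add: D_def zS)
      finally show ?case by (simp add: KS matrix_mul_assoc)
    qed (simp add: K0)
    define m where "m i = Pw h (complex_of_real (real i * l))" for i
    define m' where "m' i = Pw h (- complex_of_real (real i * l))" for i
    have mm: "m i ** m' i = mat 1" "m' i ** m i = mat 1" for i by (simp_all add: m_def m'_def Pw_inverse)
    have mS: "m i ** Pw h (of_real l) = m (Suc i)" for i by (simp add: m_def Pw_add algebra_simps)
    have nm: "norm (m i) * norm (m' i) \<le> CE * CE * (3 / 2) ^ i" for i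
    proof -
      have "norm (m i) \<le> exp (cmod h * amax * (real i * l)) * CE" "norm (m' i) \<le> exp (cmod h * amax * (real i * l)) * CE"
        unfolding m_def m'_def using Pw_bound[of h "of_real (real i * l)"] Pw_bound[of h "- of_real (real i * l)"] l0
        by (simp_all add: norm_mult)
      then have "norm (m i) * norm (m' i) \<le> (exp (cmod h * amax * (real i * l)) * CE) * (exp (cmod h * amax * (real i * l)) * CE)"
        using CE_nonneg by (intro mult_mono) auto
      also have "\<dots> = CE * CE * (exp (cmod h * amax * (real i * l)) * exp (cmod h * amax * (real i * l)))" by (simp add: mult_ac)
      also have "exp (cmod h * amax * (real i * l)) * exp (cmod h * amax * (real i * l)) = exp (2 * (cmod h * amax * l)) ^ i"
        by (simp add: exp_add[symmetric] exp_of_nat_mult[symmetric] algebra_simps)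
      also have "CE * CE * exp (2 * (cmod h * amax * l)) ^ i \<le> CE * CE * (3 / 2) ^ i"
        using e32 CE_nonneg by (intro mult_left_mono power_mono) auto
      finally show ?thesis .
    qed
    \<comment> \<open>The actual transport from \<open>z i\<close> to \<open>z 0\<close> followed
      against the model: \<open>m' i\<close> is the inverse of the model transport
      \<open>m i\<close> over the same distance.\<close>
    define G where "G i = Kf i ** m' i" for i
    define d where "d i = m (Suc i) ** \<delta> i ** m' (Suc i)" for i
    have KG: "Kf i = G i ** m i" for i
      unfolding G_def using mm(2)[of i] by (simp flip: matrix_mul_assoc)
    have GS: "G (Suc i) = G i ** (mat 1 + d i)" for i
    proof -
      have "G (Suc i) = G i ** (m i ** D i ** m' (Suc i))" by (simp add: G_def[of "Suc i"] KS KG[of i] matrix_mul_assoc)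
      also have "m i ** D i ** m' (Suc i) = m (Suc i) ** (mat 1 + \<delta> i) ** m' (Suc i)"
        unfolding \<delta>(1) mS[symmetric] by (simp add: matrix_mul_assoc)
      also have "\<dots> = mat 1 + d i"
        using mm(1)[of "Suc i"] by (simp add: d_def matrix_add_ldistrib matrix_add_rdistrib)
      finally show ?thesis .
    qed
    have G0: "G 0 = mat 1" by (simp add: G_def K0 m'_def Pw_0)
    have nd: "norm (d i) \<le> (C1 * cmod h) * (3 / 4) ^ i" for i
    proof -
      have "norm (d i) \<le> norm (m (Suc i) ** \<delta> i) * norm (m' (Suc i))" unfolding d_def by (rule norm_matrix_mult_le)
      also have "\<dots> \<le> (norm (m (Suc i)) * norm (\<delta> i)) * norm (m' (Suc i))" by (intro mult_right_mono norm_matrix_mult_le) simp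
      also have "\<dots> = (norm (m (Suc i)) * norm (m' (Suc i))) * norm (\<delta> i)" by simp
      also have "\<dots> \<le> (CE * CE * (3 / 2) ^ Suc i) * (C * cmod h * (\<epsilon> / 2 ^ Suc i))"
      proof (rule mult_mono[OF nm])
        show "norm (\<delta> i) \<le> C * cmod h * (\<epsilon> / 2 ^ Suc i)" using \<delta>(2)[of i] by (simp only: z(2))
      qed (use CE_nonneg in auto)
      also have "\<dots> = (C1 * cmod h) * ((3 / 2) ^ Suc i / 2 ^ Suc i)" by (simp add: C1_def)
      also have "(3 / 2 :: real) ^ Suc i / 2 ^ Suc i = (3 / 4) ^ Suc i" by (simp only: power_divide[symmetric]) simp
      also have "(C1 * cmod h) * (3 / 4) ^ Suc i \<le> (C1 * cmod h) * (3 / 4) ^ i"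
        using C1 by (intro mult_left_mono power_decreasing) auto
      finally show ?thesis .
    qed
    have "\<exists>L. G \<longlonglongrightarrow> L \<and> norm (L - mat 1) \<le> ?c * exp (C1 * cmod h / (1 - 3 / 4)) * (C1 * cmod h / (1 - 3 / 4))"
      using C1 by (intro infinite_matrix_product[OF G0 GS nd]) auto
    then obtain L where L: "G \<longlonglongrightarrow> L" "norm (L - mat 1) \<le> ?c * exp (4 * (C1 * cmod h)) * (4 * (C1 * cmod h))"
      by (auto simp: mult.commute)
    \<comment> \<open>The model powers and \<open>u h\<close> are diagonal for the same projections,
      hence commute. Conjugation by \<open>m i\<close> thus affects only the difference of
      \<open>g h (z i)\<close> and \<open>u h\<close>.\<close>
    have um: "m i ** u h ** m' i = u h" for i
      unfolding m_def m'_def u_def Pw_def diag_mult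
      by (intro arg_cong[of _ _ diag]) (simp add: fun_eq_iff exp_minus field_simps)
    have gG: "g h (z 0) ** G i = G i ** (m i ** g h (z i) ** m' i)" for i
    proof -
      have "g h (z 0) ** G i = (g h (z 0) ** Kf i) ** m' i" by (simp add: G_def matrix_mul_assoc)
      also have "g h (z 0) ** Kf i = (G i ** m i) ** g h (z i)" using gK[of i] KG[of i] by metis
      finally show ?thesis by (simp add: matrix_mul_assoc)
    qed
    have "(\<lambda>i. m i ** g h (z i) ** m' i) \<longlonglongrightarrow> u h"
    proof -
      have "norm (m i ** g h (z i) ** m' i - u h) \<le> (CE * CE * Cg * \<epsilon>) * (3 / 4) ^ i" for i
      proof -
        have "m i ** g h (z i) ** m' i - u h = m i ** (g h (z i) - u h) ** m' i"
          using um[of i] by (simp add: matrix_mult_diff_left matrix_mult_diff_right)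
        also have "norm \<dots> \<le> (norm (m i) * norm (g h (z i) - u h)) * norm (m' i)"
          by (rule order_trans[OF norm_matrix_mult_le mult_right_mono[OF norm_matrix_mult_le norm_ge_zero]])
        also have "\<dots> = (norm (m i) * norm (m' i)) * norm (g h (z i) - u h)" by simp
        also have "\<dots> \<le> (CE * CE * (3 / 2) ^ i) * (Cg * (\<epsilon> / 2 ^ i))"
        proof (rule mult_mono[OF nm])
          show "norm (g h (z i) - u h) \<le> Cg * (\<epsilon> / 2 ^ i)" using Cg(2)[OF h1 z(1)[of i] z(3)[of i]] by (simp only: z(2))
        qed (use CE_nonneg in auto)
        also have "\<dots> = (CE * CE * Cg * \<epsilon>) * ((3 / 2) ^ i / 2 ^ i)" by simp
        also have "(3 / 2 :: real) ^ i / 2 ^ i = (3 / 4) ^ i" by (simp only: power_divide[symmetric]) simp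
        finally show ?thesis .
      qed
      moreover have "(\<lambda>i. (CE * CE * Cg * \<epsilon>) * (3 / 4) ^ i) \<longlonglongrightarrow> (CE * CE * Cg * \<epsilon>) * 0"
        by (intro tendsto_intros LIMSEQ_power_zero) simp
      ultimately have "(\<lambda>i. m i ** g h (z i) ** m' i - u h) \<longlonglongrightarrow> 0"
        by (intro Lim_null_comparison[of "\<lambda>i. m i ** g h (z i) ** m' i - u h" "\<lambda>i. (CE * CE * Cg * \<epsilon>) * (3 / 4) ^ i"]) auto
      then show ?thesis by (simp add: LIM_zero_iff)
    qed
    then have "(\<lambda>i. G i ** (m i ** g h (z i) ** m' i)) \<longlonglongrightarrow> L ** u h" using L(1) by (intro tendsto_intros)
    moreover have "(\<lambda>i. g h (z 0) ** G i) \<longlonglongrightarrow> g h (z 0) ** L" using L(1) by (intro tendsto_intros)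
    ultimately have "g h (z 0) ** L = L ** u h" unfolding gG by (rule LIMSEQ_unique[rotated])
    moreover have "norm (L - mat 1) \<le> ?c * exp (4 * C1) * (4 * C1) * cmod h"
    proof -
      have "C1 * cmod h \<le> C1" using h1 C1 mult_left_mono[of "cmod h" 1 C1] by simp
      then have "?c * exp (4 * (C1 * cmod h)) * (4 * (C1 * cmod h)) \<le> ?c * exp (4 * C1) * (4 * (C1 * cmod h))"
        using C1 by (intro mult_right_mono mult_left_mono) auto
      from order_trans[OF L(2) this] show ?thesis by (simp only: mult.assoc)
    qed
    ultimately show ?thesis by (auto simp: z_def)
  qed
  have "\<eta> > 0" using \<eta>0(1) by (simp add: \<eta>_def)
  then show ?thesis using main by blast
qed

end

section \<open>Rigidity\<close>

lemma sandwich_scale: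
  fixes P Q Y :: "complex ^ 'm ^ 'm"
  shows "(mat b ** P) ** Y ** (mat b' ** Q) = mat (b * b') ** (P ** Y ** Q)"
  by (simp only: matrix_mul_assoc[symmetric] mat_left_commute[of Y] mat_left_commute[of P] mat_mat_mult)

lemma transpose_scale: "transpose (mat c ** g) = mat c ** transpose (g :: complex ^ 'm ^ 'n)"
  by (simp add: vec_eq_iff transpose_def)

lemma mcnj_scale: "mcnj (mat c ** g) = mat (cnj c) ** mcnj g"
  by (simp add: vec_eq_iff)

lemma act_scale: "act (mat c ** g) M = mat (c * cnj c) ** act g M"
  unfolding act_def transpose_scale mcnj_scale sandwich_scale ..

lemma zeta_props:
  assumes "n > 0"
  shows "zeta n ^ n = 1" "cmod (zeta n) = 1" "zeta n \<noteq> 0"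
    and "i < n \<Longrightarrow> j < n \<Longrightarrow> zeta n ^ i * cnj (zeta n ^ j) = 1 \<longleftrightarrow> i = j"
proof -
  have pw: "zeta n ^ k = exp (2 * of_real pi * \<i> * of_nat k / of_nat n)" for k
    unfolding zeta_def exp_of_nat_mult[symmetric] by (simp add: mult_ac)
  show c1: "cmod (zeta n) = 1" unfolding zeta_def by simp
  then show "zeta n \<noteq> 0" by auto
  show "zeta n ^ n = 1" using assms pw[of n] exp_two_pi_i by (simp add: mult_ac)
  assume ij: "i < n" "j < n"
  have "zeta n ^ j * cnj (zeta n ^ j) = 1"
    using c1 complex_norm_square[of "zeta n ^ j"] by (simp add: norm_power)
  then have "zeta n ^ i * cnj (zeta n ^ j) = 1 \<longleftrightarrow> zeta n ^ i = zeta n ^ j"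
    by (metis mult_cancel_right mult_zero_right zero_neq_one)
  also have "\<dots> \<longleftrightarrow> i = j"
    unfolding pw using complex_root_unity_eq[of n i j] assms ij by (simp add: mod_less)
  finally show "zeta n ^ i * cnj (zeta n ^ j) = 1 \<longleftrightarrow> i = j" .
qed

text \<open>The matrices \<open>xk k\<close> may be unbounded; only their defects under the
  monodromies converge. The paths \<open>a x\<close> give every point of \<open>X\<close> a fixed
  connection with the base point.\<close>

locale defect = equivariant_connection \<A> \<alpha> A W \<rho>
  for \<A> :: "(complex ^ 'n) set set" and \<alpha> and A :: "(complex ^ 'n) set \<Rightarrow> complex ^ 'm ^ 'm" and W \<rho> +
  fixes x0 :: "complex ^ 'n" and hk :: "nat \<Rightarrow> complex" and xk :: "nat \<Rightarrow> complex ^ 'm ^ 'm"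
    and a :: "complex ^ 'n \<Rightarrow> complex \<Rightarrow> complex ^ 'm ^ 'm"
  assumes x0: "x0 \<in> X" and hk: "hk \<longlonglongrightarrow> 0" and hk_im: "\<And>k. Re (hk k) = 0"
    and conv: "\<And>w \<gamma>. mon x0 w \<gamma> \<Longrightarrow> convergent (\<lambda>k. act (\<gamma> (hk k)) (xk k) - xk k)"
    and a: "\<And>x. x \<in> X \<Longrightarrow> reach x0 x (a x)" and a_x0: "a x0 = (\<lambda>h. mat 1)"
begin

definition cc :: "(complex \<Rightarrow> complex ^ 'm ^ 'm) \<Rightarrow> complex ^ 'm ^ 'm" where
  "cc \<gamma> = lim (\<lambda>k. act (\<gamma> (hk k)) (xk k) - xk k)"

lemma cc_lim: "mon x0 w \<gamma> \<Longrightarrow> (\<lambda>k. act (\<gamma> (hk k)) (xk k) - xk k) \<longlonglongrightarrow> cc \<gamma>"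
  using conv convergent_LIMSEQ_iff unfolding cc_def by blast

text \<open>The defect of a product is the transported defect of the first factor plus the defect of
  the second. Both are convergent, so the limit can be taken although \<open>xk\<close> itself may
  diverge.\<close>

lemma cc_mult:
  assumes "mon x0 w \<gamma>" "mon x0 w' \<gamma>'"
  shows "cc (\<lambda>h. \<gamma> h ** \<gamma>' h) = act (\<rho> w') (cc \<gamma>) + cc \<gamma>'"
proof (rule LIMSEQ_unique[OF cc_lim[OF mon_mult[OF assms]]])
  have "(\<lambda>k. act (\<gamma>' (hk k)) (act (\<gamma> (hk k)) (xk k) - xk k) + (act (\<gamma>' (hk k)) (xk k) - xk k)) \<longlonglongrightarrow>
      act (\<rho> w') (cc \<gamma>) + cc \<gamma>'"
    using assms by (intro tendsto_intros cc_lim mon_tendsto[OF _ hk])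
  then show "(\<lambda>k. act (\<gamma> (hk k) ** \<gamma>' (hk k)) (xk k) - xk k) \<longlonglongrightarrow> act (\<rho> w') (cc \<gamma>) + cc \<gamma>'"
    by (simp add: act_mult linear_diff[OF linear_act])
qed

lemma mon_one: "mon x0 (mat 1) (\<lambda>h. mat 1)"
proof -
  have "matrix_inv (mat 1 :: complex ^ 'm ^ 'm) = mat 1" by (rule matrix_inv_unique) simp_all
  then show ?thesis using mon_pure[OF reach_refl[OF x0]] by simp
qed

lemma cc_one: "cc (\<lambda>h. mat 1) = 0"
  using cc_mult[OF mon_one mon_one] by (simp add: rho_one)

lemma mon_reach: "reach x0 x0 P \<Longrightarrow> mon x0 (mat 1) P"
proof -
  assume P: "reach x0 x0 P"
  have "matrix_inv (matrix_inv (P h)) = P h" for h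
    using reach_matrix_inv(1,2)[OF P] by (intro matrix_inv_unique) auto
  then show ?thesis using mon_pure[OF reach_matrix_inv(3)[OF P]] by simp
qed

text \<open>The transport goes out to \<open>y\<close>, over to \<open>x\<close> and back. With this
  orientation the matrix product of the loops for x, y and y, z is the loop for x, z.\<close>

definition loop :: "complex ^ 'n \<Rightarrow> complex ^ 'n \<Rightarrow> complex \<Rightarrow> complex ^ 'm ^ 'm" where
  "loop x y h = matrix_inv (a x h) ** T h y x ** a y h"

definition c :: "complex ^ 'n \<Rightarrow> complex ^ 'n \<Rightarrow> complex ^ 'm ^ 'm" where
  "c x y = cc (loop x y)"

lemma a_inv: "x \<in> X \<Longrightarrow> a x h ** matrix_inv (a x h) = mat 1"
  by (rule reach_matrix_inv(2)[OF a])

lemma loop_mon: "cvx K \<Longrightarrow> x \<in> K \<Longrightarrow> y \<in> K \<Longrightarrow> mon x0 (mat 1) (loop x y)"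
proof (rule mon_reach)
  assume K: "cvx K" "x \<in> K" "y \<in> K"
  then have xy: "x \<in> X" "y \<in> X" using cvx_D by auto
  have "reach x0 x0 (\<lambda>h. matrix_inv (a x h) ** (T h y x ** a y h))"
    by (rule reach_trans[OF reach_step[OF a[OF xy(2)] K(1,3,2)] reach_matrix_inv(3)[OF a[OF xy(1)]]])
  then show "reach x0 x0 (loop x y)" by (simp add: loop_def[abs_def] matrix_mul_assoc)
qed

lemma c_additive: "cvx K \<Longrightarrow> x \<in> K \<Longrightarrow> y \<in> K \<Longrightarrow> z \<in> K \<Longrightarrow> c x y + c y z = c x z"
proof -
  assume K: "cvx K" "x \<in> K" "y \<in> K" "z \<in> K"
  have "loop x y h ** loop y z h = loop x z h" for h
  proof -
    have "loop x y h ** loop y z h = matrix_inv (a x h) ** T h y x ** (a y h ** matrix_inv (a y h)) ** T h z y ** a z h"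
      by (simp add: loop_def matrix_mul_assoc)
    also have "\<dots> = matrix_inv (a x h) ** (T h y x ** T h z y) ** a z h"
      using a_inv[of y h] K cvx_D(4) by (simp add: matrix_mul_assoc)
    finally show ?thesis using T_trans[OF K(1,4,3,2)] by (simp add: loop_def)
  qed
  then have "loop x z = (\<lambda>h. loop x y h ** loop y z h)" by (simp add: fun_eq_iff)
  then show ?thesis
    unfolding c_def using cc_mult[OF loop_mon[OF K(1-3)] loop_mon[OF K(1,3,4)]] by (simp add: rho_one)
qed

lemma c_sum:
  assumes K: "cvx K" and y: "\<And>i. i \<le> m \<Longrightarrow> y i \<in> K"
  shows "(\<Sum>i<m. c (y i) (y (Suc i))) = c (y 0) (y m)"
  using y
proof (induction m)
  case 0
  then show ?case using c_additive[OF K, of "y 0" "y 0" "y 0"] by simp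
next
  case (Suc m)
  then show ?case using c_additive[OF K, of "y 0" "y m" "y (Suc m)"] by simp
qed

text \<open>Two evaluations of the cocycle on the e-th power of the meridian. Through the normal
  form it is \<open>e\<close> times the sum of the diagonal blocks of the value on the meridian,
  which vanish. As a loop it consists of \<open>4 * e\<close> arcs, which group into four quarter
  turns, the sides of the square.\<close>

lemma circle:
  assumes mer: "meridian \<A> \<alpha> A W \<rho> H q n s e E \<tau>" and \<delta>: "\<delta> > 0"
  shows "\<exists>v. norm v < \<delta> \<and> Im (\<alpha> H v) = 0 \<and> Re (\<alpha> H v) > 0 \<and>
        c (q + v) (q + \<i> *s v) + c (q + \<i> *s v) (q - v) + c (q - v) (q - \<i> *s v) + c (q - \<i> *s v) (q + v) = 0"
proof -
  interpret m: meridian \<A> \<alpha> A W \<rho> H q n s e E \<tau> by (rule mer)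
  \<comment> \<open>The first bound keeps the circle in the disc of the normal form, the second
    keeps the displacement below \<open>\<delta>\<close>.\<close>
  define \<epsilon> where "\<epsilon> = min m.r0 (\<delta> / (2 * (norm n + 1)))"
  have \<epsilon>: "0 < \<epsilon>" "\<epsilon> \<le> m.r0" "\<epsilon> \<le> \<delta> / (2 * (norm n + 1))"
    unfolding \<epsilon>_def using m.r0_pos \<delta> by (auto intro!: divide_pos_pos add_nonneg_pos)
  let ?z = "complex_of_real \<epsilon>"
  have z: "?z \<noteq> 0" "cmod ?z \<le> m.r0" using \<epsilon> by auto
  have e0: "e > 0" using m.e2 by simp
  note \<kappa> = m.\<kappa>_props
  define p where "p j = m.f (m.\<kappa> ^ j * ?z)" for j
  have \<kappa>z: "m.\<kappa> ^ j * ?z \<noteq> 0" "cmod (m.\<kappa> ^ j * ?z) \<le> m.r0" for j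
    using \<kappa>(4,5) z by (auto simp: norm_mult norm_power)
  have pHB: "p j \<in> m.HB (m.\<kappa> ^ j * ?z)" "p (Suc j) \<in> m.HB (m.\<kappa> ^ j * ?z)" for j
    using m.arc_HB[OF \<kappa>z] by (simp_all add: p_def mult.assoc)
  have pX: "p j \<in> X" for j using pHB cvx_D(4)[OF m.HB_cvx] by blast
  have sp: "s *v p j = p (j + 4)" for j
    unfolding p_def m.s_f \<kappa>(1)[symmetric] by (simp add: power_add mult_ac)
  have arc: "m.arc h (m.\<kappa> ^ j * ?z) = T h (p (Suc j)) (p j)" for h j
    by (simp add: m.arc_def p_def mult.assoc)
  define Bz where "Bz h = m.B h ?z" for h
  have Bz: "Bz h = T h (p 1) (p 0) ** T h (p 2) (p 1) ** (T h (p 3) (p 2) ** T h (p 4) (p 3))" for h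
    unfolding Bz_def m.B_def using arc[of h 0] arc[of h 1] arc[of h 2] arc[of h 3] by (simp add: eval_nat_numeral)
  define \<gamma> where "\<gamma> h = matrix_inv (a (p 0) h) ** m.g h ?z ** a (p 0) h" for h
  have \<gamma>_mon: "mon x0 s \<gamma>"
  proof -
    note st = m.HB_cvx pHB(2) pHB(1)
    have "reach (p 4) (p 3) (\<lambda>h. T h (p 4) (p 3))"
      using reach_T[OF st, of 3] by (simp add: eval_nat_numeral)
    from reach_step[OF this m.HB_cvx[of "m.\<kappa> ^ 2 * ?z"], of "p 2"] pHB[of 2]
    have "reach (p 4) (p 2) (\<lambda>h. T h (p 3) (p 2) ** T h (p 4) (p 3))" by (simp add: eval_nat_numeral)
    from reach_step[OF this m.HB_cvx[of "m.\<kappa> ^ 1 * ?z"], of "p 1"] pHB[of 1]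
    have "reach (p 4) (p 1) (\<lambda>h. T h (p 2) (p 1) ** (T h (p 3) (p 2) ** T h (p 4) (p 3)))" by (simp add: eval_nat_numeral)
    from reach_step[OF this m.HB_cvx[of "m.\<kappa> ^ 0 * ?z"], of "p 0"] pHB[of 0]
    have "reach (p 4) (p 0) (\<lambda>h. T h (p 1) (p 0) ** (T h (p 2) (p 1) ** (T h (p 3) (p 2) ** T h (p 4) (p 3))))" by simp
    then have RB: "reach (s *v p 0) (p 0) Bz" by (simp add: Bz[abs_def] sp matrix_mul_assoc)
    have "reach (s *v x0) (s *v p 0) (\<lambda>h. \<rho> s ** a (p 0) h ** \<rho> (winv s))"
      by (rule reach_equivariant[OF m.s a[OF pX]])
    from reach_trans[OF reach_trans[OF this RB] reach_matrix_inv(3)[OF a[OF pX[of 0]]]]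
    have Q: "reach (s *v x0) x0 (\<lambda>h. matrix_inv (a (p 0) h) ** (Bz h ** (\<rho> s ** a (p 0) h ** \<rho> (winv s))))" .
    let ?Q = "\<lambda>h. matrix_inv (a (p 0) h) ** (Bz h ** (\<rho> s ** a (p 0) h ** \<rho> (winv s)))"
    have "matrix_inv (matrix_inv (?Q h)) = ?Q h" for h
      using reach_matrix_inv(1,2)[OF Q, of h] by (intro matrix_inv_unique) auto
    moreover have "?Q h ** \<rho> s = \<gamma> h" for h
    proof -
      have "?Q h ** \<rho> s = matrix_inv (a (p 0) h) ** Bz h ** \<rho> s ** a (p 0) h ** (\<rho> (winv s) ** \<rho> s)"
        by (simp add: matrix_mul_assoc)
      then show ?thesis using rho_winv(1)[OF m.s] by (simp add: \<gamma>_def m.g_def Bz_def matrix_mul_assoc)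
    qed
    ultimately show ?thesis
      unfolding mon_def using m.s reach_matrix_inv(3)[OF Q]
      by (intro conjI exI[of _ "\<lambda>h. matrix_inv (?Q h)"]) (auto simp: fun_eq_iff)
  qed
  define Y where "Y = cc \<gamma>"
  \<comment> \<open>On the range of \<open>E j\<close> the model \<open>u\<close> is a scalar of
    modulus one, because \<open>hk k\<close> is imaginary, and such a scalar does not change a
    pulled back form. So the defect pulled back along \<open>F k ** E j\<close> is exactly 0 for
    every large k, and \<open>F k\<close> tends to the identity.\<close>
  have Y0: "(\<Sum>j<e. act (E j) Y) = 0"
  proof -
    obtain \<eta> C where \<eta>: "\<eta> > 0" and NF: "\<And>h. cmod h < \<eta> \<Longrightarrow>
        \<exists>G. m.g h ?z ** G = G ** m.u h \<and> norm (G - mat 1) \<le> C * cmod h"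
      using m.normal_form[OF \<epsilon>(1,2)] by blast
    then obtain G where G: "\<And>h. cmod h < \<eta> \<Longrightarrow> m.g h ?z ** G h = G h ** m.u h"
      "\<And>h. cmod h < \<eta> \<Longrightarrow> norm (G h - mat 1) \<le> C * cmod h" by metis
    have ev: "\<forall>\<^sub>F k in sequentially. cmod (hk k) < \<eta>"
      using order_tendstoD(2)[OF tendsto_norm_zero[OF hk] \<eta>] .
    have "(\<lambda>k. C * cmod (hk k)) \<longlonglongrightarrow> C * 0" by (intro tendsto_intros tendsto_norm_zero hk)
    then have "(\<lambda>k. G (hk k) - mat 1) \<longlonglongrightarrow> 0"
      by (intro Lim_null_comparison[of "\<lambda>k. G (hk k) - mat 1" "\<lambda>k. C * cmod (hk k)"])
        (use eventually_mono[OF ev G(2)] in auto)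
    then have Glim: "(\<lambda>k. G (hk k)) \<longlonglongrightarrow> mat 1" by (simp add: LIM_zero_iff)
    define F where "F k = matrix_inv (a (p 0) (hk k)) ** G (hk k)" for k
    have "F \<longlonglongrightarrow> mat 1 ** mat 1"
      unfolding F_def[abs_def] by (intro tendsto_intros Glim reach_tendsto[OF reach_matrix_inv(3)[OF a[OF pX]] hk])
    then have Flim: "F \<longlonglongrightarrow> mat 1" by simp
    have zero: "(\<Sum>j<e. act (F k ** E j) (act (\<gamma> (hk k)) (xk k) - xk k)) = 0" if k: "cmod (hk k) < \<eta>" for k
    proof (rule sum.neutral, intro ballI)
      fix j assume "j \<in> {..<e}"
      then have j: "j < e" by simp
      define l where "l = exp (- hk k * complex_of_real (\<tau> j) / of_nat e) * zeta e ^ j"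
      have "Re (- hk k * complex_of_real (\<tau> j) / of_nat e) = 0"
        using hk_im[of k] by (simp add: Re_divide_of_nat)
      then have "cmod l = 1" using zeta_props(2)[OF e0] by (simp add: l_def norm_mult norm_power)
      then have ll: "l * cnj l = 1" using complex_norm_square[of l] by simp
      have "\<gamma> (hk k) ** F k = matrix_inv (a (p 0) (hk k)) ** m.g (hk k) ?z ** (a (p 0) (hk k) ** matrix_inv (a (p 0) (hk k))) ** G (hk k)"
        by (simp add: \<gamma>_def F_def matrix_mul_assoc)
      also have "\<dots> = matrix_inv (a (p 0) (hk k)) ** (m.g (hk k) ?z ** G (hk k))"
        using a_inv[OF pX] by (simp add: matrix_mul_assoc)
      also have "\<dots> = F k ** m.u (hk k)" unfolding G(1)[OF k] by (simp add: F_def matrix_mul_assoc)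
      finally have "\<gamma> (hk k) ** (F k ** E j) = F k ** (m.u (hk k) ** E j)" by (simp add: matrix_mul_assoc)
      also have "m.u (hk k) ** E j = mat l ** E j" unfolding m.u_def l_def using m.diag_E[OF j] by simp
      also have "F k ** (mat l ** E j) = mat l ** (F k ** E j)" by (rule mat_left_commute)
      finally have "act (F k ** E j) (act (\<gamma> (hk k)) (xk k)) = act (mat l ** (F k ** E j)) (xk k)"
        by (simp add: act_mult[symmetric])
      also have "\<dots> = act (F k ** E j) (xk k)" by (simp add: act_scale ll)
      finally show "act (F k ** E j) (act (\<gamma> (hk k)) (xk k) - xk k) = 0" by (simp add: linear_diff[OF linear_act])
    qed
    have "(\<lambda>k. \<Sum>j<e. act (F k ** E j) (act (\<gamma> (hk k)) (xk k) - xk k)) \<longlonglongrightarrow> (\<Sum>j<e. act (mat 1 ** E j) Y)"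
      unfolding Y_def by (intro tendsto_intros Flim cc_lim[OF \<gamma>_mon])
    moreover have "(\<lambda>k. \<Sum>j<e. act (F k ** E j) (act (\<gamma> (hk k)) (xk k) - xk k)) \<longlonglongrightarrow> 0"
      by (rule tendsto_eventually) (use eventually_mono[OF ev zero] in simp)
    ultimately show ?thesis using LIMSEQ_unique by fastforce
  qed
  define \<gamma>p where "\<gamma>p = rec_nat (\<lambda>h. mat 1) (\<lambda>i f h. f h ** \<gamma> h)"
  have \<gamma>p: "\<gamma>p 0 = (\<lambda>h. mat 1)" "\<gamma>p (Suc i) = (\<lambda>h. \<gamma>p i h ** \<gamma> h)" for i by (simp_all add: \<gamma>p_def)
  have \<gamma>p_mon: "\<exists>w. mon x0 w (\<gamma>p i)" for i
  proof (induction i)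
    case (Suc i)
    then show ?case using mon_mult[OF _ \<gamma>_mon] unfolding \<gamma>p(2) by blast
  qed (use mon_one \<gamma>p(1) in auto)
  have ccp: "cc (\<gamma>p i) = (\<Sum>k<i. act (m.diag (\<lambda>j. zeta e ^ (j * k))) Y)" for i
  proof (induction i)
    case 0
    then show ?case by (simp add: \<gamma>p(1) cc_one)
  next
    case (Suc i)
    obtain w where w: "mon x0 w (\<gamma>p i)" using \<gamma>p_mon by blast
    have rs: "\<rho> s = m.diag (\<lambda>j. zeta e ^ j)" using m.rho_s by (simp add: m.diag_def)
    have "cc (\<gamma>p (Suc i)) = act (\<rho> s) (\<Sum>k<i. act (m.diag (\<lambda>j. zeta e ^ (j * k))) Y) + Y"
      unfolding \<gamma>p(2) cc_mult[OF w \<gamma>_mon] Suc Y_def ..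
    also have "act (\<rho> s) (\<Sum>k<i. act (m.diag (\<lambda>j. zeta e ^ (j * k))) Y) = (\<Sum>k<i. act (m.diag (\<lambda>j. zeta e ^ (j * Suc k))) Y)"
      unfolding linear_sum[OF linear_act] act_mult[symmetric] rs m.diag_mult
      by (simp add: power_add[symmetric] add.commute)
    also have "(\<Sum>k<i. act (m.diag (\<lambda>j. zeta e ^ (j * Suc k))) Y) + Y = (\<Sum>k<Suc i. act (m.diag (\<lambda>j. zeta e ^ (j * k))) Y)"
      by (simp add: sum.lessThan_Suc_shift m.diag_one del: sum.lessThan_Suc)
    finally show ?case .
  qed
  \<comment> \<open>Summation over the powers of \<open>\<rho> s\<close> is a geometric sum in
    ratios of e-th roots of unity: it kills the blocks with distinct indices and multiplies the
    diagonal ones by \<open>e\<close>.\<close>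
  have cce: "cc (\<gamma>p e) = 0"
  proof -
    define Yjl where "Yjl j l = transpose (E j) ** Y ** mcnj (E l)" for j l
    have exp: "act (m.diag x) Y = (\<Sum>j<e. \<Sum>l<e. mat (x j * cnj (x l)) ** Yjl j l)" for x
    proof -
      have tr: "transpose (m.diag x) = (\<Sum>j<e. mat (x j) ** transpose (E j))"
        unfolding m.diag_def linear_sum[OF bounded_linear.linear[OF bounded_linear_transpose]]
        by (simp only: transpose_scale)
      have cj: "mcnj (m.diag x) = (\<Sum>j<e. mat (cnj (x j)) ** mcnj (E j))"
        unfolding m.diag_def linear_sum[OF bounded_linear.linear[OF bounded_linear_mcnj]]
        by (simp only: mcnj_scale)
      show ?thesis
        unfolding act_def tr cj Yjl_def
        by (simp only: matrix_mult_sum_left) (simp only: matrix_mult_sum_right sandwich_scale)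
    qed
    have geo: "(\<Sum>k<e. (zeta e ^ (j * k)) * cnj (zeta e ^ (l * k))) = (if j = l then of_nat e else 0)"
      if jl: "j < e" "l < e" for j l
    proof -
      define w where "w = zeta e ^ j * cnj (zeta e ^ l)"
      have w: "(zeta e ^ (j * k)) * cnj (zeta e ^ (l * k)) = w ^ k" for k
        by (simp add: w_def power_mult power_mult_distrib)
      have we: "w ^ e = 1"
      proof -
        have "w ^ e = (zeta e ^ e) ^ j * cnj ((zeta e ^ e) ^ l)"
          by (simp add: w_def power_mult_distrib power_mult[symmetric] mult.commute)
        then show ?thesis using zeta_props(1)[OF e0] by simp
      qed
      have w1: "w = 1 \<longleftrightarrow> j = l" unfolding w_def by (rule zeta_props(4)[OF e0 jl])
      show ?thesis
      proof (cases "j = l")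
        case True
        then have "w = 1" using w1 by simp
        then show ?thesis unfolding w using True by simp
      next
        case False
        then have "w \<noteq> 1" using w1 by simp
        then have "(\<Sum>k<e. w ^ k) = 0" using geometric_sum[of w e] we by simp
        then show ?thesis unfolding w using False by simp
      qed
    qed
    have "cc (\<gamma>p e) = (\<Sum>k<e. \<Sum>j<e. \<Sum>l<e. mat (zeta e ^ (j * k) * cnj (zeta e ^ (l * k))) ** Yjl j l)"
      unfolding ccp exp ..
    also have "\<dots> = (\<Sum>j<e. \<Sum>k<e. \<Sum>l<e. mat (zeta e ^ (j * k) * cnj (zeta e ^ (l * k))) ** Yjl j l)" by (rule sum.swap)
    also have "\<dots> = (\<Sum>j<e. \<Sum>l<e. \<Sum>k<e. mat (zeta e ^ (j * k) * cnj (zeta e ^ (l * k))) ** Yjl j l)"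
      by (rule sum.cong[OF refl]) (rule sum.swap)
    also have "\<dots> = (\<Sum>j<e. \<Sum>l<e. if j = l then mat (of_nat e) ** Yjl j j else 0)"
    proof (intro sum.cong refl)
      fix j l assume jl: "j \<in> {..<e}" "l \<in> {..<e}"
      have "(\<Sum>k<e. mat (zeta e ^ (j * k) * cnj (zeta e ^ (l * k))) ** Yjl j l) =
          mat (\<Sum>k<e. zeta e ^ (j * k) * cnj (zeta e ^ (l * k))) ** Yjl j l"
        by (rule linear_sum[OF bounded_linear.linear[OF bounded_linear_mat_mult], symmetric])
      also have "\<dots> = mat (if j = l then of_nat e else 0) ** Yjl j l" using geo jl by simp
      finally show "(\<Sum>k<e. mat (zeta e ^ (j * k) * cnj (zeta e ^ (l * k))) ** Yjl j l) = (if j = l then mat (of_nat e) ** Yjl j j else 0)"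
        by simp
    qed
    also have "\<dots> = mat (of_nat e) ** (\<Sum>j<e. Yjl j j)" by (simp add: matrix_mult_sum_right)
    also have "(\<Sum>j<e. Yjl j j) = (\<Sum>j<e. act (E j) Y)" by (simp add: Yjl_def act_def)
    finally show ?thesis using Y0 by simp
  qed
  \<comment> \<open>The product of the small loops over consecutive arcs. The paths
    \<open>a (p i)\<close> cancel between neighbours, and \<open>cc\<close> is additive on it
    because pure loops act trivially.\<close>
  define L where "L = rec_nat (\<lambda>h. mat 1) (\<lambda>i f h. f h ** loop (p i) (p (Suc i)) h)"
  have L: "L 0 = (\<lambda>h. mat 1)" "L (Suc i) = (\<lambda>h. L i h ** loop (p i) (p (Suc i)) h)" for i by (simp_all add: L_def)
  have lm: "mon x0 (mat 1) (loop (p i) (p (Suc i)))" for i by (rule loop_mon[OF m.HB_cvx pHB])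
  have Lm: "mon x0 (mat 1) (L i) \<and> cc (L i) = (\<Sum>j<i. c (p j) (p (Suc j)))" for i
  proof (induction i)
    case (Suc i)
    then have m: "mon x0 (mat 1) (L i)" by simp
    have "mon x0 (mat 1) (L (Suc i))" unfolding L(2) using mon_mult[OF m lm] by simp
    moreover have "cc (L (Suc i)) = cc (L i) + c (p i) (p (Suc i))"
      unfolding L(2) cc_mult[OF m lm] by (simp add: rho_one c_def)
    ultimately show ?case using Suc by simp
  qed (simp add: L mon_one cc_one)
  define ar where "ar h = rec_nat (mat 1) (\<lambda>i M. M ** T h (p (Suc i)) (p i))" for h
  have ar: "ar h 0 = mat 1" "ar h (Suc i) = ar h i ** T h (p (Suc i)) (p i)" for h i by (simp_all add: ar_def)
  have Lar: "L i h = matrix_inv (a (p 0) h) ** ar h i ** a (p i) h" for i h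
  proof (induction i)
    case 0
    then show ?case using reach_matrix_inv(1)[OF a[OF pX]] by (simp add: L ar)
  next
    case (Suc i)
    have "L (Suc i) h = matrix_inv (a (p 0) h) ** ar h i ** (a (p i) h ** matrix_inv (a (p i) h)) ** T h (p (Suc i)) (p i) ** a (p (Suc i)) h"
      by (simp add: L Suc loop_def matrix_mul_assoc)
    then show ?case using a_inv[OF pX] by (simp add: ar matrix_mul_assoc)
  qed
  define rs where "rs = rec_nat (mat 1) (\<lambda>i M. M ** \<rho> s)"
  have rs: "rs 0 = mat 1" "rs (Suc i) = rs i ** \<rho> s" for i by (simp_all add: rs_def)
  have rs_comm: "rs i ** \<rho> s = \<rho> s ** rs i" for i
  proof (induction i)
    case (Suc i)
    have "rs (Suc i) ** \<rho> s = (\<rho> s ** rs i) ** \<rho> s" unfolding rs(2) Suc ..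
    then show ?case by (simp add: rs matrix_mul_assoc)
  qed (simp add: rs)
  have rs_diag: "rs i = m.diag (\<lambda>j. zeta e ^ (j * i))" for i
  proof (induction i)
    case (Suc i)
    have "\<rho> s = m.diag (\<lambda>j. zeta e ^ j)" using m.rho_s by (simp add: m.diag_def)
    then show ?case by (simp add: rs Suc m.diag_mult power_add[symmetric] add.commute)
  qed (simp add: rs m.diag_one)
  \<comment> \<open>Four arcs make one rotation by \<open>s\<close>; equivariance moves any arc back
    to one of the first four at the price of powers of \<open>\<rho> s\<close>.\<close>
  have T_shift: "T h (p (Suc j + 4 * i)) (p (j + 4 * i)) ** rs i = rs i ** T h (p (Suc j)) (p j)" for h j i
  proof (induction i)
    case (Suc i)
    have "T h (p (Suc j + 4 * Suc i)) (p (j + 4 * Suc i)) = T h (s *v p (Suc j + 4 * i)) (s *v p (j + 4 * i))"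
    proof -
      have "Suc j + 4 * Suc i = (Suc j + 4 * i) + 4" "j + 4 * Suc i = (j + 4 * i) + 4" by simp_all
      then show ?thesis by (simp only: sp)
    qed
    also have "\<dots> = \<rho> s ** T h (p (Suc j + 4 * i)) (p (j + 4 * i)) ** \<rho> (winv s)"
      using pHB[of "j + 4 * i"] by (intro T_equivariant[OF m.s m.HB_cvx]) auto
    finally have "T h (p (Suc j + 4 * Suc i)) (p (j + 4 * Suc i)) ** rs (Suc i) =
        \<rho> s ** T h (p (Suc j + 4 * i)) (p (j + 4 * i)) ** (\<rho> (winv s) ** \<rho> s) ** rs i"
      unfolding rs(2) rs_comm by (simp add: matrix_mul_assoc)
    also have "\<dots> = \<rho> s ** (T h (p (Suc j + 4 * i)) (p (j + 4 * i)) ** rs i)"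
      using rho_winv(1)[OF m.s] by (simp add: matrix_mul_assoc)
    also have "\<dots> = rs (Suc i) ** T h (p (Suc j)) (p j)" unfolding Suc rs(2) rs_comm by (simp add: matrix_mul_assoc)
    finally show ?case .
  qed (simp add: rs)
  define gp where "gp h = rec_nat (mat 1) (\<lambda>i M. M ** m.g h ?z)" for h
  have gp: "gp h 0 = mat 1" "gp h (Suc i) = gp h i ** m.g h ?z" for h i by (simp_all add: gp_def)
  have ar_gp: "ar h (4 * i) ** rs i = gp h i" for h i
  proof (induction i)
    case (Suc i)
    have ex: "ar h (4 * Suc i) = ar h (4 * i) ** T h (p (Suc 0 + 4 * i)) (p (0 + 4 * i)) ** T h (p (Suc 1 + 4 * i)) (p (1 + 4 * i)) **
       T h (p (Suc 2 + 4 * i)) (p (2 + 4 * i)) ** T h (p (Suc 3 + 4 * i)) (p (3 + 4 * i))"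
      by (simp add: ar eval_nat_numeral)
    have "ar h (4 * Suc i) ** rs (Suc i) = ar h (4 * i) ** T h (p (Suc 0 + 4 * i)) (p (0 + 4 * i)) ** T h (p (Suc 1 + 4 * i)) (p (1 + 4 * i)) **
       T h (p (Suc 2 + 4 * i)) (p (2 + 4 * i)) ** (T h (p (Suc 3 + 4 * i)) (p (3 + 4 * i)) ** rs i) ** \<rho> s"
      unfolding ex rs(2) by (simp only: matrix_mul_assoc)
    also have "\<dots> = ar h (4 * i) ** T h (p (Suc 0 + 4 * i)) (p (0 + 4 * i)) ** T h (p (Suc 1 + 4 * i)) (p (1 + 4 * i)) **
       (T h (p (Suc 2 + 4 * i)) (p (2 + 4 * i)) ** rs i) ** T h (p (Suc 3)) (p 3) ** \<rho> s"
      unfolding T_shift[of _ 3] by (simp only: matrix_mul_assoc)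
    also have "\<dots> = ar h (4 * i) ** T h (p (Suc 0 + 4 * i)) (p (0 + 4 * i)) ** (T h (p (Suc 1 + 4 * i)) (p (1 + 4 * i)) ** rs i) **
       T h (p (Suc 2)) (p 2) ** T h (p (Suc 3)) (p 3) ** \<rho> s"
      unfolding T_shift[of _ 2] by (simp only: matrix_mul_assoc)
    also have "\<dots> = ar h (4 * i) ** (T h (p (Suc 0 + 4 * i)) (p (0 + 4 * i)) ** rs i) ** T h (p (Suc 1)) (p 1) **
       T h (p (Suc 2)) (p 2) ** T h (p (Suc 3)) (p 3) ** \<rho> s"
      unfolding T_shift[of _ 1] by (simp only: matrix_mul_assoc)
    also have "\<dots> = (ar h (4 * i) ** rs i) ** (T h (p (Suc 0)) (p 0) ** T h (p (Suc 1)) (p 1) **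
       (T h (p (Suc 2)) (p 2) ** T h (p (Suc 3)) (p 3)) ** \<rho> s)"
      unfolding T_shift[of _ 0] by (simp only: matrix_mul_assoc)
    also have "T h (p (Suc 0)) (p 0) ** T h (p (Suc 1)) (p 1) ** (T h (p (Suc 2)) (p 2) ** T h (p (Suc 3)) (p 3)) ** \<rho> s = m.g h ?z"
      unfolding m.g_def using Bz[of h] by (simp add: Bz_def eval_nat_numeral)
    finally show ?case unfolding Suc gp .
  qed (simp add: ar rs gp)
  have \<gamma>p_gp: "\<gamma>p i h = matrix_inv (a (p 0) h) ** gp h i ** a (p 0) h" for i h
  proof (induction i)
    case 0
    then show ?case using reach_matrix_inv(1)[OF a[OF pX]] by (simp add: \<gamma>p gp)
  next
    case (Suc i)
    have "\<gamma>p (Suc i) h = matrix_inv (a (p 0) h) ** gp h i ** (a (p 0) h ** matrix_inv (a (p 0) h)) ** m.g h ?z ** a (p 0) h"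
      by (simp add: \<gamma>p Suc \<gamma>_def matrix_mul_assoc)
    then show ?case using a_inv[OF pX] by (simp add: gp matrix_mul_assoc)
  qed
  have rse: "rs e = mat 1"
    unfolding rs_diag using zeta_props(1)[OF e0] m.diag_one by (simp add: power_mult[of _ e] mult.commute[of _ e])
  have pe: "p (4 * e) = p 0"
    unfolding p_def using \<kappa>(1) zeta_props(1)[OF e0] by (simp add: power_mult)
  have "L (4 * e) = \<gamma>p e"
    using ar_gp[of _ e] by (simp add: fun_eq_iff Lar \<gamma>p_gp rse pe)
  then have sum0: "(\<Sum>j<4 * e. c (p j) (p (Suc j))) = 0" using Lm[of "4 * e"] cce by simp
  have \<kappa>e: "m.\<kappa> ^ e = \<i>"
  proof -
    have "m.\<kappa> ^ e = exp (of_nat e * (\<i> * of_real (pi / (2 * real e))))" unfolding m.\<kappa>_def by (rule exp_of_nat_mult[symmetric])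
    also have "of_nat e * (\<i> * of_real (pi / (2 * real e))) = of_real (pi / 2) * \<i>" using e0 by (simp add: field_simps)
    finally show ?thesis by (simp add: exp_eq_polar cis_conv_exp[symmetric] mult.commute)
  qed
  \<comment> \<open>The \<open>e\<close> arcs of a quarter turn lie in the half plane around its
    bisecting direction \<open>\<i> ^ b * (1 + \<i>)\<close>, so their contributions add up to the
    one of the chord.\<close>
  have quarter: "(\<Sum>j<e. c (p (b * e + j)) (p (Suc (b * e + j)))) = c (p (b * e)) (p (Suc b * e))" for b
  proof -
    have in_w: "p (b * e + j) \<in> m.HB (\<i> ^ b * (1 + \<i>))" if j: "j \<le> e" for j
      unfolding p_def
    proof (rule m.f_in_HB[OF \<kappa>z(2)])
      let ?t = "real j * (pi / (2 * real e))"
      have t: "0 \<le> ?t" "?t \<le> pi / 2" using j e0 by (auto simp: field_simps)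
      have kj: "m.\<kappa> ^ j = exp (\<i> * of_real ?t)"
        unfolding m.\<kappa>_def exp_of_nat_mult[symmetric] by (simp add: mult_ac)
      have "m.\<kappa> ^ (b * e + j) = \<i> ^ b * m.\<kappa> ^ j"
        unfolding power_add mult.commute[of b e] power_mult \<kappa>e ..
      moreover have "cnj (\<i> ^ b) * \<i> ^ b = 1"
        using complex_norm_square[of "\<i> ^ b"] by (simp add: norm_power mult.commute)
      ultimately have e1: "cnj (\<i> ^ b * (1 + \<i>)) * (m.\<kappa> ^ (b * e + j) * ?z) = ((1 - \<i>) * m.\<kappa> ^ j) * ?z"
      proof -
        have "cnj (I * (1 + \<i>)) * ((I * K) * x) = (cnj I * I) * (((1 - \<i>) * K) * x)" for I K x :: complex
          by (simp add: algebra_simps)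
        from this[of "\<i> ^ b" "m.\<kappa> ^ j" ?z] show ?thesis
          using \<open>m.\<kappa> ^ (b * e + j) = \<i> ^ b * m.\<kappa> ^ j\<close> \<open>cnj (\<i> ^ b) * \<i> ^ b = 1\<close> by (simp only: mult_1_left)
      qed
      have e2: "Re ((1 - \<i>) * m.\<kappa> ^ j) = cos ?t + sin ?t"
        unfolding kj by (simp add: Re_exp Im_exp)
      have "Re (cnj (\<i> ^ b * (1 + \<i>)) * (m.\<kappa> ^ (b * e + j) * ?z)) = (cos ?t + sin ?t) * \<epsilon>"
      proof -
        have "Re (w * ?z) = Re w * \<epsilon>" for w by simp
        then show ?thesis by (simp only: e1 e2)
      qed
      moreover have "cos ?t + sin ?t > 0"
      proof (cases "?t = 0")
        case False
        then have "sin ?t > 0" using t by (intro sin_gt_zero) (use pi_gt_zero in linarith)+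
        moreover have "cos ?t \<ge> 0" by (rule cos_ge_zero) (use t pi_gt_zero in linarith)+
        ultimately show ?thesis by simp
      qed (use e0 in auto)
      ultimately show "Re (cnj (\<i> ^ b * (1 + \<i>)) * (m.\<kappa> ^ (b * e + j) * ?z)) > 0" using \<epsilon>(1) by simp
    qed
    have "(\<Sum>j<e. c (p (b * e + j)) (p (b * e + Suc j))) = c (p (b * e + 0)) (p (b * e + e))"
      using in_w by (intro c_sum[OF m.HB_cvx]) auto
    then show ?thesis by (simp add: add.commute)
  qed
  have split: "(\<Sum>j<b * e. c (p j) (p (Suc j))) = (\<Sum>i<b. c (p (i * e)) (p (Suc i * e)))" for b
  proof (induction b)
    case (Suc b)
    have "(\<Sum>j<Suc b * e. c (p j) (p (Suc j))) = (\<Sum>j<b * e. c (p j) (p (Suc j))) + (\<Sum>j<e. c (p (b * e + j)) (p (Suc (b * e + j))))"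
      using sum.nat_group[of "\<lambda>j. c (p j) (p (Suc j))" e "Suc b"] sum.nat_group[of "\<lambda>j. c (p j) (p (Suc j))" e b]
        sum.shift_bounds_nat_ivl[of "\<lambda>j. c (p j) (p (Suc j))" 0 "b * e" e] by (simp add: atLeast0LessThan add.commute)
    then show ?case using Suc quarter[of b] by simp
  qed simp
  have pq: "p (b * e) = q + (\<i> ^ b * ?z) *s n" for b
    unfolding p_def m.f_def mult.commute[of b e] power_mult \<kappa>e ..
  have "c (p (0 * e)) (p (1 * e)) + c (p (1 * e)) (p (2 * e)) + c (p (2 * e)) (p (3 * e)) + c (p (3 * e)) (p (4 * e)) = 0"
  proof -
    have "(\<Sum>i<4. F i) = F 0 + F 1 + F 2 + F 3" for F :: "nat \<Rightarrow> complex ^ 'm ^ 'm" by (simp add: eval_nat_numeral)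
    from this[of "\<lambda>i. c (p (i * e)) (p (Suc i * e))"] show ?thesis
      using split[of 4] sum0 by (simp only: Suc_1 Suc_eq_plus1 one_add_one numeral_plus_one add_0 semiring_norm)
  qed
  then have fin: "c (q + ?z *s n) (q + (\<i> * ?z) *s n) + c (q + (\<i> * ?z) *s n) (q + (- ?z) *s n) +
      c (q + (- ?z) *s n) (q + (- (\<i> * ?z)) *s n) + c (q + (- (\<i> * ?z)) *s n) (q + ?z *s n) = 0"
    unfolding pq by (simp add: power3_eq_cube eval_nat_numeral)
  have "norm (?z *s n) = \<epsilon> * norm n" using \<epsilon>(1) by (simp add: scaleR_eq_smult[symmetric])
  also have "\<dots> \<le> \<delta> / (2 * (norm n + 1)) * (norm n + 1)" using \<epsilon> \<delta> by (intro mult_mono) auto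
  also have "\<dots> = \<delta> / 2" by (simp add: field_simps add_nonneg_eq_0_iff)
  also have "\<dots> < \<delta>" using \<delta> by simp
  finally have "norm (?z *s n) < \<delta>" .
  moreover have "\<alpha> H (?z *s n) = ?z" using linear_form_scale[OF form[OF m.H]] m.an by simp
  moreover have "\<i> *s (?z *s n) = (\<i> * ?z) *s n" "q - ?z *s n = q + (- ?z) *s n" "q - \<i> *s (?z *s n) = q + (- (\<i> * ?z)) *s n"
    by (simp_all add: vec_eq_iff)
  ultimately show ?thesis using fin \<epsilon>(1) by (intro exI[of _ "?z *s n"]) simp
qed

end

section \<open>Vanishing of the obstruction\<close>

locale reflection_connection = equivariant_connection \<A> \<alpha> A W \<rho>
  for \<A> :: "(complex ^ 'n) set set" and \<alpha> and A :: "(complex ^ 'n) set \<Rightarrow> complex ^ 'm ^ 'm" and W \<rho> +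
  assumes reflections: "H \<in> \<A> \<Longrightarrow> \<exists>n s e E \<tau>. s \<in> W \<and> e \<ge> 2 \<and> (\<forall>q\<in>H. s *v q = q) \<and> s *v n = zeta e *s n \<and> \<alpha> H n = 1 \<and>
    (\<forall>i<e. \<forall>j<e. E i ** E j = (if i = j then E i else 0)) \<and> (\<Sum>j<e. E j) = mat 1 \<and>
    \<rho> s = (\<Sum>j<e. mat (zeta e ^ j) ** E j) \<and>
    A H = (\<Sum>j<e. mat (complex_of_real (\<tau> j) / (2 * of_real pi * \<i>)) ** E j)"
begin

lemma meridian_exists:
  assumes "H \<in> \<A>" "q \<in> H" "\<And>K. K \<in> \<A> \<Longrightarrow> q \<in> K \<Longrightarrow> K = H"
  shows "\<exists>n s e E \<tau>. meridian \<A> \<alpha> A W \<rho> H q n s e E \<tau>"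
proof -
  obtain n s e E \<tau> where *: "s \<in> W" "e \<ge> 2" "\<forall>q\<in>H. s *v q = q" "s *v n = zeta e *s n" "\<alpha> H n = 1"
    "\<forall>i<e. \<forall>j<e. E i ** E j = (if i = j then E i else 0)" "(\<Sum>j<e. E j) = mat 1"
    "\<rho> s = (\<Sum>j<e. mat (zeta e ^ j) ** E j)"
    "A H = (\<Sum>j<e. mat (complex_of_real (\<tau> j) / (2 * of_real pi * \<i>)) ** E j)"
    using reflections[OF assms(1)] by (elim exE conjE) (rule that; assumption)
  have "meridian \<A> \<alpha> A W \<rho> H q n s e E \<tau>"
    by (intro meridian.intro meridian_axioms.intro equivariant_connection_axioms)
      (fact assms * bspec[OF *(3) assms(2)] *(6)[rule_format])+
  then show ?thesis by (intro exI)
qed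

text \<open>The cocycle vanishes on pure loops, as values of closed chains, so it depends only on
  the element of \<open>W\<close>. The primitive is minus the mean of its values over
  \<open>W\<close>.\<close>

lemma defect_coboundary:
  assumes "defect \<A> \<alpha> A W \<rho> x0 hk xk a"
  shows "\<exists>u. \<forall>w \<gamma>. mon x0 w \<gamma> \<longrightarrow> defect.cc hk xk \<gamma> = act (\<rho> w) u - u"
proof -
  interpret d: defect \<A> \<alpha> A W \<rho> x0 hk xk a by (rule assms)
  interpret lc: local_cocycle \<A> \<alpha> A d.c
  proof
    fix K x y z assume "cvx K" "x \<in> K" "y \<in> K" "z \<in> K"
    then show "d.c x y + d.c y z = d.c x z" by (rule d.c_additive)
  next
    fix H :: "(complex ^ 'n) set" and q and \<delta> :: real
    assume H: "H \<in> \<A>" "q \<in> H" "\<And>K. K \<in> \<A> \<Longrightarrow> q \<in> K \<Longrightarrow> K = H" and "\<delta> > 0"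
    have "\<exists>n s e E \<tau>. meridian \<A> \<alpha> A W \<rho> H q n s e E \<tau>"
      by (rule meridian_exists[OF H]) assumption+
    then obtain n s e E \<tau> where "meridian \<A> \<alpha> A W \<rho> H q n s e E \<tau>" by (elim exE) (rule that)
    from d.circle[OF this \<open>\<delta> > 0\<close>] show "\<exists>v. norm v < \<delta> \<and> Im (\<alpha> H v) = 0 \<and> Re (\<alpha> H v) > 0 \<and>
        d.c (q + v) (q + \<i> *s v) + d.c (q + \<i> *s v) (q - v) + d.c (q - v) (q - \<i> *s v) + d.c (q - \<i> *s v) (q + v) = 0" .
  qed
  \<comment> \<open>A path closed up by the chosen path \<open>a y\<close> gives a loop; extending
    the path by a step multiplies this loop by one small loop and the chain by one term.\<close>
  have chain: "reach x y P \<Longrightarrow> x = x0 \<Longrightarrow> \<exists>\<sigma>. lc.chain x0 y \<sigma> \<and> d.cc (\<lambda>h. matrix_inv (P h) ** a y h) = \<sigma>" for x y P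
  proof (induction rule: reach.induct)
    case (reach_refl x)
    have "matrix_inv (mat 1 :: complex ^ 'm ^ 'm) = mat 1" by (rule matrix_inv_unique) simp_all
    then show ?case using reach_refl lc.chain_refl[OF d.x0] d.cc_one by (simp add: d.a_x0)
  next
    case (reach_step x y P K z)
    then obtain \<sigma> where \<sigma>: "lc.chain x0 y \<sigma>" "d.cc (\<lambda>h. matrix_inv (P h) ** a y h) = \<sigma>" by auto
    have y: "y \<in> X" using reach_in_X[OF reach_step(1)] by simp
    have "reach x0 x0 (\<lambda>h. matrix_inv (P h) ** a y h)"
      using reach_trans[OF d.a[OF y] reach_matrix_inv(3)[OF reach_step(1)]] reach_step by simp
    from d.cc_mult[OF d.mon_reach[OF this] d.loop_mon[OF reach_step(2-4)]]
    have "d.cc (\<lambda>h. matrix_inv (P h) ** a y h ** d.loop y z h) = \<sigma> + d.c y z"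
      by (simp add: \<sigma> rho_one d.c_def)
    moreover have "matrix_inv (P h) ** a y h ** d.loop y z h = matrix_inv (T h y z ** P h) ** a z h" for h
    proof -
      have "matrix_inv (P h) ** T h z y ** (T h y z ** P h) = matrix_inv (P h) ** (T h z y ** T h y z) ** P h"
        by (simp add: matrix_mul_assoc)
      then have "(matrix_inv (P h) ** T h z y) ** (T h y z ** P h) = mat 1"
        using T_inverse[OF reach_step(2-4)] reach_matrix_inv(1)[OF reach_step(1)] by simp
      then have "matrix_inv (T h y z ** P h) = matrix_inv (P h) ** T h z y"
        using matrix_left_right_inverse by (intro matrix_inv_unique) blast+
      moreover have "matrix_inv (P h) ** a y h ** d.loop y z h =
          matrix_inv (P h) ** (a y h ** matrix_inv (a y h)) ** T h z y ** a z h"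
        by (simp add: d.loop_def matrix_mul_assoc)
      ultimately show ?thesis using d.a_inv[OF y] by simp
    qed
    ultimately show ?case using lc.chain_step[OF \<sigma>(1) reach_step(2-4)] by auto
  qed
  have pure: "d.cc \<gamma> = 0" if \<gamma>: "mon x0 (mat 1) \<gamma>" for \<gamma>
  proof -
    obtain P where P: "reach x0 x0 P" "\<gamma> = (\<lambda>h. matrix_inv (P h))" using mon_pureD[OF \<gamma>] by blast
    obtain \<sigma> where "lc.chain x0 x0 \<sigma>" "d.cc (\<lambda>h. matrix_inv (P h) ** a x0 h) = \<sigma>" using chain[OF P(1)] by auto
    then show ?thesis using lc.closed_chain_zero P(2) by (simp add: d.a_x0)
  qed
  obtain D where D: "\<And>w. w \<in> W \<Longrightarrow> mon x0 w (D w)" using mon_exists[OF d.x0] by metis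
  define C where "C w = d.cc (D w)" for w
  have C: "d.cc \<gamma> = C w" if \<gamma>: "mon x0 w \<gamma>" for w \<gamma>
  proof -
    have w: "w \<in> W" using \<gamma> by (simp add: mon_def)
    obtain \<gamma>' where \<gamma>': "mon x0 (winv w) \<gamma>'" "\<forall>h. \<gamma>' h ** D w h = mat 1 \<and> D w h ** \<gamma>' h = mat 1"
      using mon_inverse[OF D[OF w]] by blast
    have m: "mon x0 (mat 1) (\<lambda>h. \<gamma> h ** \<gamma>' h)" using mon_mult[OF \<gamma> \<gamma>'(1)] winv[OF w] by simp
    have "\<gamma> h = (\<gamma> h ** \<gamma>' h) ** D w h" for h
      using \<gamma>'(2) by (simp add: matrix_mul_assoc[symmetric])
    then have "d.cc \<gamma> = d.cc (\<lambda>h. (\<gamma> h ** \<gamma>' h) ** D w h)" by presburger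
    also have "\<dots> = act (\<rho> w) (d.cc (\<lambda>h. \<gamma> h ** \<gamma>' h)) + C w"
      unfolding C_def by (rule d.cc_mult[OF m D[OF w]])
    finally show ?thesis using pure[OF m] linear_0[OF linear_act] by simp
  qed
  define S where "S = (\<Sum>w\<in>W. C w)"
  \<comment> \<open>Right multiplication by \<open>w\<close> permutes \<open>W\<close>; summing the
    cocycle rule over the first factor gives \<open>card W\<close> times \<open>C w\<close> as the
    difference of \<open>S\<close> and its transport.\<close>
  have "C w = act (\<rho> w) ((- 1 / real (card W)) *\<^sub>R S) - (- 1 / real (card W)) *\<^sub>R S" if w: "w \<in> W" for w
  proof -
    have "bij_betw (\<lambda>v. v ** w) W W"
      using winv[OF w] w mult_W
      by (intro bij_betw_byWitness[of _ "\<lambda>v. v ** winv w"]) (auto simp: matrix_mul_assoc[symmetric])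
    then have "S = (\<Sum>v\<in>W. C (v ** w))" unfolding S_def by (rule sum.reindex_bij_betw[symmetric])
    also have "\<dots> = (\<Sum>v\<in>W. act (\<rho> w) (C v) + C w)"
    proof (intro sum.cong refl)
      fix v assume v: "v \<in> W"
      show "C (v ** w) = act (\<rho> w) (C v) + C w"
        using C[OF mon_mult[OF D[OF v] D[OF w]]] d.cc_mult[OF D[OF v] D[OF w]] by (simp add: C_def)
    qed
    also have "\<dots> = act (\<rho> w) S + real (card W) *\<^sub>R C w"
      by (simp only: sum.distrib S_def linear_sum[OF linear_act] sum_constant_scaleR)
    finally have eq: "real (card W) *\<^sub>R C w = S - act (\<rho> w) S" by (simp add: algebra_simps)
    have N: "real (card W) \<noteq> 0" using finite_W one_W by auto
    have "C w = (1 / real (card W)) *\<^sub>R (real (card W) *\<^sub>R C w)" using N by simp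
    then show ?thesis unfolding eq linear_cmul[OF linear_act] by (simp add: scaleR_diff_right)
  qed
  then show ?thesis using C by (intro exI[of _ "(- 1 / real (card W)) *\<^sub>R S"]) (auto simp: mon_def)
qed

text \<open>The rule for products expresses each defect through defects of generators, so
  convergence on the finite generating set is enough.\<close>

lemma words_convergent:
  assumes conv: "\<And>g. g \<in> G \<Longrightarrow> (\<lambda>k. act (g (hk k)) (xk k) - xk k) \<longlonglongrightarrow> c g"
    and lim: "\<And>g. g \<in> G \<Longrightarrow> \<exists>w. mon x0 w g" and hk: "hk \<longlonglongrightarrow> 0"
  shows "\<gamma> \<in> words G \<Longrightarrow> convergent (\<lambda>k. act (\<gamma> (hk k)) (xk k) - xk k)"
proof (induction rule: words.induct)
  case words_Nil
  then show ?case by (simp add: convergent_const)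
next
  case (words_snoc \<gamma> g)
  then obtain l where l: "(\<lambda>k. act (\<gamma> (hk k)) (xk k) - xk k) \<longlonglongrightarrow> l" by (auto simp: convergent_def)
  obtain w where "mon x0 w g" using lim words_snoc by blast
  then have "(\<lambda>k. act (g (hk k)) (act (\<gamma> (hk k)) (xk k) - xk k) + (act (g (hk k)) (xk k) - xk k)) \<longlonglongrightarrow> act (\<rho> w) l + c g"
    by (intro tendsto_intros l conv words_snoc mon_tendsto[OF _ hk])
  then show ?case unfolding convergent_def by (auto simp: act_mult linear_diff[OF linear_act])
qed

text \<open>The obstruction to deforming a form invariant at \<open>h = 0\<close> is a cocycle of the orbifold fundamental
  group. The normal form of the meridians annihilates it on their \<open>e\<close>-th powers, so it comes from
  the finite group \<open>W\<close>, where it is a coboundary.\<close>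

theorem invariant_forms_persist:
  assumes x0: "x0 \<in> X" and hk: "hk \<longlonglongrightarrow> 0" "\<And>k. Re (hk k) = 0" and M0: "\<And>w. w \<in> W \<Longrightarrow> act (\<rho> w) M0 = M0"
  shows "\<exists>f. (\<forall>k w \<gamma>. mon x0 w \<gamma> \<longrightarrow> act (\<gamma> (hk k)) (f k) = f k) \<and> f \<longlonglongrightarrow> M0"
proof -
  obtain G where G: "finite G" "\<And>g. g \<in> G \<Longrightarrow> \<exists>w. mon x0 w g" "\<And>w \<gamma>. mon x0 w \<gamma> \<Longrightarrow> \<gamma> \<in> words G"
    using monodromies_finitely_generated[OF x0] by metis
  have "\<exists>P. reach x0 x P \<and> (x = x0 \<longrightarrow> P = (\<lambda>h. mat 1))" if "x \<in> X" for x
    using reach_exists[OF x0 that] reach_refl[OF x0] by (cases "x = x0") auto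
  then obtain a where a: "\<And>x. x \<in> X \<Longrightarrow> reach x0 x (a x)" "a x0 = (\<lambda>h. mat 1)" using x0 by metis
  define D where "D n g v = act (g (hk n)) v - v" for n and g :: "complex \<Rightarrow> complex ^ 'm ^ 'm" and v
  define D0 where "D0 g v = act (g 0) v - v" for g :: "complex \<Rightarrow> complex ^ 'm ^ 'm" and v
  have "\<exists>f. (\<forall>n. \<forall>i\<in>G. D n i (f n) = 0) \<and> f \<longlonglongrightarrow> M0"
  proof (rule kernels_persist[OF G(1), where ?D0.0 = D0])
    show "linear (D n i)" for n i
      unfolding D_def[abs_def] by (rule linear_compose_sub[OF linear_act linear_id[unfolded id_def]])
  next
    fix g v assume "g \<in> G"
    then obtain w where w: "mon x0 w g" using G(2) by blast
    show "(\<lambda>n. D n g v) \<longlonglongrightarrow> D0 g v"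
      unfolding D_def D0_def mon_at_zero[OF w] by (intro tendsto_intros mon_tendsto[OF w hk(1)])
  next
    fix r x c assume r: "strict_mono (r :: nat \<Rightarrow> nat)" and c: "\<And>g. g \<in> G \<Longrightarrow> (\<lambda>n. D (r n) g (x n)) \<longlonglongrightarrow> c g"
    have hr: "(\<lambda>n. hk (r n)) \<longlonglongrightarrow> 0" using LIMSEQ_subseq_LIMSEQ[OF hk(1) r] by (simp add: o_def)
    \<comment> \<open>This verifies the exactness condition: convergence on generators spreads to
      all monodromies, the limits form a cocycle, and its primitive is the required
      preimage.\<close>
    interpret d: defect \<A> \<alpha> A W \<rho> x0 "\<lambda>n. hk (r n)" x a
    proof
      fix w \<gamma> assume "mon x0 w \<gamma>"
      then show "convergent (\<lambda>k. act (\<gamma> (hk (r k))) (x k) - x k)"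
        using words_convergent[of G "\<lambda>n. hk (r n)" x c x0 \<gamma>] c G(2,3) hr unfolding D_def by blast
    qed (use x0 hr hk(2) a in auto)
    obtain u where u: "\<And>w \<gamma>. mon x0 w \<gamma> \<Longrightarrow> d.cc \<gamma> = act (\<rho> w) u - u"
      using defect_coboundary[OF d.defect_axioms] by blast
    have "c g = D0 g u" if g: "g \<in> G" for g
    proof -
      obtain w where w: "mon x0 w g" using G(2)[OF g] by blast
      have "c g = d.cc g" using LIMSEQ_unique[OF c[OF g, unfolded D_def] d.cc_lim[OF w]] .
      then show ?thesis using u[OF w] by (simp add: D0_def mon_at_zero[OF w])
    qed
    then show "\<exists>u. \<forall>g\<in>G. c g = D0 g u" by blast
  next
    fix g assume "g \<in> G"
    then obtain w where w: "mon x0 w g" using G(2) by blast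
    then show "D0 g M0 = 0" using M0 by (simp add: D0_def mon_at_zero mon_def)
  qed
  then obtain f where f: "\<And>n g. g \<in> G \<Longrightarrow> D n g (f n) = 0" "f \<longlonglongrightarrow> M0" by blast
  have "\<gamma> \<in> words G \<Longrightarrow> act (\<gamma> (hk k)) (f k) = f k" for k \<gamma>
    by (induction rule: words.induct) (use f(1) in \<open>auto simp: act_mult D_def\<close>)
  then show ?thesis using f(2) G(3) by blast
qed

end

section \<open>The orbit space and its loops\<close>

context equivariant_connection
begin

lemma dist_W: "w \<in> W \<Longrightarrow> dist (w *v x) (w *v y) = dist x y"
  using isometric_W[of w "x - y"] by (simp add: dist_norm matrix_vector_mult_diff_distrib)

lemma self_in_orbit: "x \<in> point_orbit W x"
  unfolding point_orbit_def using one_W by (force simp: image_iff)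

lemma orbit_image:
  assumes w: "w \<in> W" shows "point_orbit W (w *v x) = point_orbit W x"
proof (intro equalityI subsetI)
  fix y assume "y \<in> point_orbit W (w *v x)"
  then show "y \<in> point_orbit W x"
    unfolding point_orbit_def using mult_W w by (auto simp: matrix_vector_mul_assoc)
next
  fix y assume "y \<in> point_orbit W x"
  then obtain v where v: "v \<in> W" "y = v *v x" by (auto simp: point_orbit_def)
  then have "y = (v ** winv w) *v (w *v x)"
    using winv[OF w] by (simp add: matrix_vector_mul_assoc matrix_mul_assoc[symmetric])
  then show "y \<in> point_orbit W (w *v x)"
    unfolding point_orbit_def using mult_W[OF v(1)] winv[OF w] by blast
qed

lemma orbit_eqD: "point_orbit W x = point_orbit W y \<Longrightarrow> \<exists>w\<in>W. x = w *v y"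
  using self_in_orbit[of x] by (auto simp: point_orbit_def)

text \<open>The library's covering spaces have a normed base, so the orbit space is realised inside the
  bounded continuous functions.\<close>

definition bump :: "complex ^ 'n \<Rightarrow> (complex ^ 'n) \<Rightarrow>\<^sub>C real" where
  "bump x = Bcontfun (\<lambda>z. min 1 (infdist z (point_orbit W x)))"

lemma bump_apply: "apply_bcontfun (bump x) z = min 1 (infdist z (point_orbit W x))"
proof -
  have "bounded (range (\<lambda>z. min 1 (infdist z (point_orbit W x))))"
    unfolding bounded_iff by (intro exI[of _ 1]) (auto simp: infdist_nonneg)
  then have "(\<lambda>z. min 1 (infdist z (point_orbit W x))) \<in> bcontfun"
    unfolding bcontfun_def by (auto intro!: continuous_intros)
  then show ?thesis unfolding bump_def by (simp add: Bcontfun_inverse)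
qed

lemma infdist_orbit:
  "infdist z (point_orbit W x) \<le> dist z (w *v x)" if "w \<in> W"
  using that by (intro infdist_le) (auto simp: point_orbit_def)

lemma infdist_orbit_attained: "\<exists>w\<in>W. infdist z (point_orbit W x) = dist z (w *v x)"
proof -
  have "compact (point_orbit W x)" unfolding point_orbit_def by (intro finite_imp_compact finite_imageI finite_W)
  then obtain y where "y \<in> point_orbit W x" "infdist z (point_orbit W x) = dist z y"
    using infdist_attains_inf[of "point_orbit W x" z] self_in_orbit compact_imp_closed by blast
  then show ?thesis by (auto simp: point_orbit_def)
qed

lemma bump_less: "\<epsilon> \<le> 1 \<Longrightarrow> apply_bcontfun (bump x) z < \<epsilon> \<Longrightarrow> \<exists>w\<in>W. dist z (w *v x) < \<epsilon>"
  using infdist_orbit_attained[of z x] by (auto simp: bump_apply min_def split: if_splits)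

lemma bump_self: "apply_bcontfun (bump x) x = 0"
  using self_in_orbit[of x] by (simp add: bump_apply)

lemma bump_eq_iff: "bump x = bump y \<longleftrightarrow> point_orbit W x = point_orbit W y"
proof
  assume "bump x = bump y"
  then have "min 1 (infdist y (point_orbit W x)) = 0" using bump_self[of y] bump_apply[of x y] by simp
  then have "infdist y (point_orbit W x) = 0" by (auto simp: min_def split: if_splits)
  then obtain w where "w \<in> W" "y = w *v x" using infdist_orbit_attained[of y x] by auto
  then show "point_orbit W x = point_orbit W y" using orbit_image by simp
qed (simp add: bump_def)

lemma dist_bump: "dist (bump x) (bump y) \<le> dist x y"
proof (rule dist_bound)
  have half: "infdist z (point_orbit W x) \<le> infdist z (point_orbit W y) + dist x y" for z x y
  proof -
    obtain w where w: "w \<in> W" "infdist z (point_orbit W y) = dist z (w *v y)"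
      using infdist_orbit_attained by blast
    have "infdist z (point_orbit W x) \<le> dist z (w *v x)" by (rule infdist_orbit[OF w(1)])
    also have "\<dots> \<le> dist z (w *v y) + dist (w *v x) (w *v y)" by (metis dist_commute dist_triangle)
    finally show ?thesis by (simp add: w dist_W)
  qed
  fix z
  show "dist (apply_bcontfun (bump x) z) (apply_bcontfun (bump y) z) \<le> dist x y"
    using half[of z x y] half[of z y x] by (auto simp: bump_apply dist_real_def dist_commute min_def)
qed

text \<open>Uniform closeness of two such functions is tested at the single point \<open>y\<close>:
  there one of them is 0, so the other is small, which places some translate of \<open>z\<close>
  near \<open>y\<close>. The truncation at 1 makes the functions bounded, hence radii below 1 are
  used.\<close>

lemma bump_open_map:
  assumes V: "open V" "V \<subseteq> X" shows "openin (top_of_set (bump ` X)) (bump ` V)"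
  unfolding openin_euclidean_subtopology_iff
proof (intro conjI ballI)
  show "bump ` V \<subseteq> bump ` X" using V by blast
  fix F assume "F \<in> bump ` V"
  then obtain y where y: "y \<in> V" "F = bump y" by blast
  obtain e where e: "e > 0" "ball y e \<subseteq> V" using V(1) y(1) open_contains_ball by blast
  have "F' \<in> bump ` V" if F': "F' \<in> bump ` X" "dist F' F < min 1 e" for F'
  proof -
    obtain z where z: "F' = bump z" using F' by blast
    have "dist (apply_bcontfun F' y) (apply_bcontfun F y) < min 1 e"
      using dist_bounded[of F' y F] F'(2) by linarith
    then have "apply_bcontfun (bump z) y < min 1 e" unfolding z y(2) bump_self dist_real_def by linarith
    then obtain w where w: "w \<in> W" "dist y (w *v z) < min 1 e" using bump_less[of "min 1 e"] by auto
    then have "w *v z \<in> V" using e(2) by auto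
    moreover have "bump (w *v z) = F'" using bump_eq_iff orbit_image[OF w(1)] z by simp
    ultimately show ?thesis by blast
  qed
  then show "\<exists>e>0. \<forall>x'\<in>bump ` X. dist x' F < e \<longrightarrow> x' \<in> bump ` V"
    using e(1) by (intro exI[of _ "min 1 e"]) auto
qed

lemma separated_orbit:
  assumes x: "x \<in> X"
  shows "\<exists>\<epsilon>>0. ball x \<epsilon> \<subseteq> X \<and> (\<forall>v\<in>W. \<forall>w\<in>W. dist (v *v x) (w *v x) < 2 * \<epsilon> \<longrightarrow> v = w)"
proof -
  obtain \<epsilon>1 where \<epsilon>1: "\<epsilon>1 > 0" "ball x \<epsilon>1 \<subseteq> X" using open_X x open_contains_ball by blast
  obtain \<epsilon>2 where \<epsilon>2: "\<epsilon>2 > 0" "\<forall>p\<in>(\<lambda>w. w *v x) ` W. p \<noteq> x \<longrightarrow> \<epsilon>2 \<le> dist x p"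
    using finite_set_avoid[OF finite_imageI[OF finite_W]] by metis
  have "v = w" if "v \<in> W" "w \<in> W" "dist (v *v x) (w *v x) < \<epsilon>2" for v w
  proof -
    let ?u = "winv v ** w"
    have u: "?u \<in> W" using winv[OF that(1)] that(2) mult_W by blast
    have "v *v (?u *v x) = w *v x" using winv[OF that(1)] by (simp add: matrix_vector_mul_assoc matrix_mul_assoc)
    then have "dist x (?u *v x) < \<epsilon>2" using that dist_W[of v x "?u *v x"] by simp
    then have "?u *v x = x" using \<epsilon>2(2) u by force
    then have "?u = mat 1" using free_W[OF u x] by simp
    then have "v ** ?u = v" by simp
    then show ?thesis using winv[OF that(1)] by (simp add: matrix_mul_assoc)
  qed
  then show ?thesis using \<epsilon>1 \<epsilon>2(1) by (intro exI[of _ "min \<epsilon>1 (\<epsilon>2 / 2)"]) auto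
qed

text \<open>Around \<open>x\<close> the radius is so small that translates of the ball are pairwise
  disjoint. They are the sheets: isometry makes each of them a ball about a translate of
  \<open>x\<close>, and freeness makes the projection injective on each.\<close>

lemma bump_covering: "covering_space X bump (bump ` X)"
proof
  have "1-lipschitz_on X bump" by (rule lipschitz_onI) (simp_all add: dist_bump)
  then show cont: "continuous_on X bump" by (rule lipschitz_on_continuous_on)
  fix F assume "F \<in> bump ` X"
  then obtain x where x: "x \<in> X" "F = bump x" by blast
  obtain \<epsilon> where \<epsilon>: "\<epsilon> > 0" "ball x \<epsilon> \<subseteq> X"
    and sep: "\<And>v w. v \<in> W \<Longrightarrow> w \<in> W \<Longrightarrow> dist (v *v x) (w *v x) < 2 * \<epsilon> \<Longrightarrow> v = w"
    using separated_orbit[OF x(1)] by metis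
  let ?T = "bump ` ball x \<epsilon>" and ?b = "\<lambda>w. ball (w *v x) \<epsilon>"
  have image: "(*v) w ` ball x \<epsilon> = ?b w" if w: "w \<in> W" for w
  proof (intro equalityI subsetI)
    fix y assume "y \<in> (*v) w ` ball x \<epsilon>"
    then show "y \<in> ?b w" using dist_W[OF w] by auto
  next
    fix y assume "y \<in> ?b w"
    then have "dist (w *v x) (w *v (winv w *v y)) < \<epsilon>" using winv_vec[OF w] by simp
    then have "winv w *v y \<in> ball x \<epsilon>" by (simp add: dist_W[OF w])
    then show "y \<in> (*v) w ` ball x \<epsilon>" using winv_vec(2)[OF w, of y] by (metis imageI)
  qed
  have subX: "?b w \<subseteq> X" if w: "w \<in> W" for w
    unfolding image[OF w, symmetric] using \<epsilon>(2) W_preserves_X[OF w] by blast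
  have bump_b: "bump ` ?b w = ?T" if w: "w \<in> W" for w
    unfolding image[OF w, symmetric] image_image bump_def orbit_image[OF w] ..
  show "\<exists>T. F \<in> T \<and> openin (top_of_set (bump ` X)) T \<and>
      (\<exists>v. \<Union>v = X \<inter> bump -` T \<and> (\<forall>u\<in>v. openin (top_of_set X) u) \<and> pairwise disjnt v \<and>
        (\<forall>u\<in>v. \<exists>q. homeomorphism u T bump q))"
  proof (intro exI[of _ ?T] exI[of _ "?b ` W"] conjI ballI)
    show "F \<in> ?T" using x \<epsilon> by simp
    show "openin (top_of_set (bump ` X)) ?T" by (rule bump_open_map[OF open_ball \<epsilon>(2)])
    show "\<Union>(?b ` W) = X \<inter> bump -` ?T"
    proof (intro equalityI subsetI)
      fix y assume "y \<in> \<Union>(?b ` W)"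
      then show "y \<in> X \<inter> bump -` ?T" using subX bump_b by blast
    next
      fix y assume "y \<in> X \<inter> bump -` ?T"
      then obtain z where z: "z \<in> ball x \<epsilon>" "bump y = bump z" by auto
      then obtain w where w: "w \<in> W" "y = w *v z" using bump_eq_iff orbit_eqD by metis
      then have "y \<in> ?b w" using image[OF w(1)] z(1) by blast
      then show "y \<in> \<Union>(?b ` W)" using w(1) by blast
    qed
    show "pairwise disjnt (?b ` W)"
      unfolding pairwise_def
    proof (intro ballI impI)
      fix u u' assume u: "u \<in> ?b ` W" "u' \<in> ?b ` W" "u \<noteq> u'"
      then obtain v w where vw: "v \<in> W" "w \<in> W" "u = ?b v" "u' = ?b w" by blast
      then have "\<not> dist (v *v x) (w *v x) < 2 * \<epsilon>" using sep u(3) by metis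
      moreover have "dist (v *v x) (w *v x) < 2 * \<epsilon>" if "y \<in> u" "y \<in> u'" for y
        using that dist_triangle_less_add[of "v *v x" y \<epsilon> "w *v x" \<epsilon>] by (auto simp: vw)
      ultimately show "disjnt u u'" unfolding disjnt_iff by blast
    qed
  next
    fix u assume "u \<in> ?b ` W"
    then obtain w where w: "w \<in> W" "u = ?b w" by blast
    show "openin (top_of_set X) u" unfolding w(2) using subX[OF w(1)] by (simp add: open_X openin_open_eq)
    have inj: "inj_on bump u"
    proof (rule inj_onI)
      fix y z assume yz: "y \<in> u" "z \<in> u" "bump y = bump z"
      then obtain v where v: "v \<in> W" "y = v *v z" using bump_eq_iff orbit_eqD by metis
      have "dist (v *v (w *v x)) (v *v z) < \<epsilon>" "dist (w *v x) y < \<epsilon>"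
        using yz by (simp_all add: w dist_W[OF v(1)])
      then have "dist (v *v (w *v x)) (w *v x) < 2 * \<epsilon>"
        using dist_triangle_less_add[of "v *v (w *v x)" y \<epsilon> "w *v x" \<epsilon>] v(2) by (simp add: dist_commute)
      then have "dist ((v ** w) *v x) (w *v x) < 2 * \<epsilon>" by (simp add: matrix_vector_mul_assoc)
      then have "v ** w = w" by (rule sep[OF mult_W[OF v(1) w(1)] w(1)])
      then have "v *v (w *v x) = w *v x" by (simp add: matrix_vector_mul_assoc)
      then have "v = mat 1" using free_W[OF v(1)] W_preserves_X[OF w(1)] x(1) by blast
      then show "y = z" using v(2) by simp
    qed
    have "openin (top_of_set ?T) (bump ` U)" if U: "openin (top_of_set u) U" for U
    proof -
      have "open U" using U w(2) open_ball openin_open_eq by blast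
      moreover have "U \<subseteq> u" using U openin_imp_subset by blast
      ultimately have "openin (top_of_set (bump ` X)) (bump ` U)"
        using subX[OF w(1)] w(2) by (intro bump_open_map) auto
      then show ?thesis
        using bump_b[OF w(1)] w(2) \<open>U \<subseteq> u\<close> \<epsilon>(2) openin_subset_trans[of "bump ` X" "bump ` U" ?T] by blast
    qed
    then show "\<exists>q. homeomorphism u ?T bump q"
      using homeomorphism_injective_open_map[OF continuous_on_subset[OF cont] bump_b[OF w(1), folded w(2)] inj]
        subX[OF w(1)] w(2) by blast
  qed
qed simp

lemma lift_properties:
  assumes X: "X = regular_points W" and x0: "x0 \<in> X"
  shows lift_exists: "\<gamma> \<in> loops (orbit_space W) (point_orbit W x0) \<Longrightarrow> \<exists>g w. lifts_to W x0 \<gamma> g w"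
    and lift_homotopic: "loop_homotopic (orbit_space W) (point_orbit W x0) \<gamma> \<gamma>' \<Longrightarrow>
      lifts_to W x0 \<gamma> g w \<Longrightarrow> lifts_to W x0 \<gamma>' g' w' \<Longrightarrow> homotopic_paths X g g' \<and> w = w'"
proof -
  let ?b = "point_orbit W x0"
  note qm = quotient_map_orbit_space[of W, folded X]
  \<comment> \<open>Continuity is needed only from the orbit space to the image of
    \<open>bump\<close>, and there it follows from the quotient topology.\<close>
  define \<Psi> where "\<Psi> Q = bump (SOME x. x \<in> X \<and> point_orbit W x = Q)" for Q
  have \<Psi>: "\<Psi> (point_orbit W x) = bump x" if "x \<in> X" for x
    unfolding \<Psi>_def bump_eq_iff using someI_ex[of "\<lambda>y. y \<in> X \<and> point_orbit W y = point_orbit W x"] that by blast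
  have "continuous_map (top_of_set X) (top_of_set (bump ` X)) (\<Psi> \<circ> point_orbit W)"
  proof (rule continuous_map_eq)
    show "continuous_map (top_of_set X) (top_of_set (bump ` X)) bump"
      using covering_space_imp_continuous[OF bump_covering] by simp
  qed (simp add: \<Psi>)
  then have \<Psi>c: "continuous_map (orbit_space W) (top_of_set (bump ` X)) \<Psi>"
    using continuous_compose_quotient_map_eq[OF qm] by blast
  have ts: "topspace (orbit_space W) = point_orbit W ` X"
    using quotient_imp_surjective_map[OF qm] by simp
  show "\<exists>g w. lifts_to W x0 \<gamma> g w" if \<gamma>: "\<gamma> \<in> loops (orbit_space W) ?b"
  proof -
    have p: "pathin (orbit_space W) \<gamma>" "\<gamma> 0 = ?b" "\<gamma> 1 = ?b" using \<gamma> by (auto simp: loops_def)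
    have "pathin (top_of_set (bump ` X)) (\<Psi> \<circ> \<gamma>)" by (rule pathin_compose[OF p(1) \<Psi>c])
    then have "path (\<Psi> \<circ> \<gamma>)" "path_image (\<Psi> \<circ> \<gamma>) \<subseteq> bump ` X"
      unfolding pathin_canon_iff path_image_def image_subset_iff_funcset by auto
    moreover have "pathstart (\<Psi> \<circ> \<gamma>) = bump x0" using \<Psi>[OF x0] p(2) by (simp add: pathstart_def)
    ultimately obtain g where g: "path g" "path_image g \<subseteq> X" "pathstart g = x0"
      "\<And>t. t \<in> {0..1} \<Longrightarrow> bump (g t) = (\<Psi> \<circ> \<gamma>) t"
      using covering_space_lift_path_strong[OF bump_covering x0] by metis
    have orb: "point_orbit W (g t) = \<gamma> t" if t: "t \<in> {0..1}" for t
    proof -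
      have "\<gamma> t \<in> topspace (orbit_space W)"
        using p(1) t unfolding pathin_def continuous_map_def by auto
      then obtain y where "y \<in> X" "\<gamma> t = point_orbit W y" using ts by blast
      then show ?thesis using g(4)[OF t] \<Psi> by (simp add: bump_eq_iff)
    qed
    have "point_orbit W (g 1) = point_orbit W x0" using orb[of 1] p(3) by simp
    then obtain w where "w \<in> W" "g 1 = w *v x0" using orbit_eqD by metis
    then have "lifts_to W x0 \<gamma> g w"
      unfolding lifts_to_def using g orb X by (simp add: pathfinish_def)
    then show ?thesis by blast
  qed
  show "homotopic_paths X g g' \<and> w = w'"
    if hom: "loop_homotopic (orbit_space W) ?b \<gamma> \<gamma>'" and g: "lifts_to W x0 \<gamma> g w" and g': "lifts_to W x0 \<gamma>' g' w'"
  proof -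
    have ends: "\<gamma> 0 = ?b" "\<gamma> 1 = ?b" using homotopic_with_imp_property[OF hom[unfolded loop_homotopic_def]] by auto
    have hp: "homotopic_paths (bump ` X) (\<Psi> \<circ> \<gamma>) (\<Psi> \<circ> \<gamma>')"
      unfolding homotopic_paths_def
      by (rule homotopic_with_compose_continuous_map_left[OF hom[unfolded loop_homotopic_def] \<Psi>c])
        (simp add: pathstart_def pathfinish_def ends)
    note hpD = homotopic_paths_imp_path[OF hp] homotopic_paths_imp_subset[OF hp]
    have lift: "bump (g t) = (\<Psi> \<circ> \<gamma>) t" if "lifts_to W x0 \<gamma> g w" "t \<in> {0..1}" for \<gamma> g w t
    proof -
      have "g t \<in> X" "point_orbit W (g t) = \<gamma> t" using that by (auto simp: lifts_to_def X path_image_def)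
      then show ?thesis using \<Psi>[of "g t"] by simp
    qed
    have "homotopic_paths X g g'"
    proof (rule covering_space_lift_homotopic_paths[OF bump_covering _ _ _ _ hp])
      show "path g" "path_image g \<subseteq> X" "path g'" "path_image g' \<subseteq> X" "pathstart g = pathstart g'"
        using g g' by (auto simp: lifts_to_def X)
    qed (use hpD lift[OF g] lift[OF g'] in auto)
    moreover have "w = w'"
    proof -
      have e: "w \<in> W" "w' \<in> W" "pathfinish g = w *v x0" "pathfinish g' = w' *v x0" using g g' by (auto simp: lifts_to_def)
      have "w *v x0 = w' *v x0" using homotopic_paths_imp_pathfinish[OF \<open>homotopic_paths X g g'\<close>] e by simp
      then show ?thesis using separated_orbit[OF x0] e(1,2) by (metis dist_self mult_pos_pos zero_less_numeral)
    qed
    ultimately show ?thesis by simp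
  qed
qed

end

section \<open>The monodromy representation\<close>

context equivariant_connection
begin

lemma mon_invertible: "mon x0 w \<gamma> \<Longrightarrow> invertible (\<gamma> h)"
  unfolding invertible_def using mon_inverse by blast

context
  fixes \<tau> :: "(complex ^ 'n) set set \<Rightarrow> nat \<Rightarrow> complex" and x0 :: "complex ^ 'n"
  assumes X: "X = regular_points W" and omega: "\<And>h x v. omega W \<rho> \<tau> h x v = om h x v" and x0: "x0 \<in> X"
begin

lemma flat_along_eq: "flat_along W \<rho> \<tau> h g F \<longleftrightarrow> along h g F"
  unfolding flat_along_def flat_on_def along_def sol_def omega X by (simp add: conj_assoc)

lemma transport_eq:
  assumes "path g" "path_image g \<subseteq> X" "trans_is h g M"
  shows "transport W \<rho> \<tau> h g = M"
proof -
  have g: "continuous_on {0..1} g" "g ` {0..1} \<subseteq> X" using assms by (auto simp: path_def path_image_def)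
  have "(\<exists>F. flat_along W \<rho> \<tau> h g F \<and> F 0 = mat 1 \<and> F 1 = M') \<longleftrightarrow> trans_is h g M'" for M'
    unfolding trans_is_def flat_along_eq along_iff[OF g] ..
  then show ?thesis unfolding transport_def using assms(3) trans_is_unique[of h g] by (intro the_equality) auto
qed

lemma lift_transport:
  assumes g: "lifts_to W x0 \<gamma> g w"
  obtains P where "w \<in> W" "reach x0 (w *v x0) P" "\<And>h. trans_is h g (P h)" "\<And>h. transport W \<rho> \<tau> h g = P h"
proof -
  have gX: "path g" "path_image g \<subseteq> X" and ends: "g 0 = x0" "g 1 = w *v x0" and w: "w \<in> W"
    using g by (auto simp: lifts_to_def X pathstart_def pathfinish_def)
  then have "continuous_on {0..1} g" "g ` {0..1} \<subseteq> X" by (auto simp: path_def path_image_def)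
  then obtain P where P: "reach x0 (w *v x0) P" "\<And>h. trans_is h g (P h)"
    using tr_on_exists[of g] unfolding ends trans_is_def by blast
  then show ?thesis using transport_eq[OF gX] w that by blast
qed

lemma lift_mon:
  assumes "lifts_to W x0 \<gamma> g w"
  shows "mon x0 w (\<lambda>h. matrix_inv (transport W \<rho> \<tau> h g) ** \<rho> w)"
proof -
  obtain P where "w \<in> W" "reach x0 (w *v x0) P" "\<And>h. transport W \<rho> \<tau> h g = P h"
    using lift_transport[OF assms] by metis
  then show ?thesis unfolding mon_def by (intro conjI exI[of _ P]) simp_all
qed

lemma lift_monodromy_unique:
  assumes "loop_homotopic (orbit_space W) (point_orbit W x0) \<gamma> \<gamma>'"
    and g: "lifts_to W x0 \<gamma> g w" and g': "lifts_to W x0 \<gamma>' g' w'"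
  shows "matrix_inv (transport W \<rho> \<tau> h g) ** \<rho> w = matrix_inv (transport W \<rho> \<tau> h g') ** \<rho> w'"
proof -
  have hom: "homotopic_paths X g g'" and w: "w = w'"
    using lift_homotopic[OF X x0 assms] by auto
  obtain P where P: "\<And>h. trans_is h g (P h)" "\<And>h. transport W \<rho> \<tau> h g = P h"
    using lift_transport[OF g] by metis
  have "transport W \<rho> \<tau> h g' = P h"
    using transport_eq[OF _ _ trans_is_homotopic[OF hom P(1)]] g' by (auto simp: lifts_to_def X)
  then show ?thesis using P(2) w by simp
qed

text \<open>The lift of the second loop starts at \<open>x0\<close>, while the first lift ends at
  \<open>w *v x0\<close>; it has to be translated by \<open>w\<close> before joining.\<close>

lemma lift_concat:
  assumes g: "lifts_to W x0 p g w" and g': "lifts_to W x0 q g' w'"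
  shows "lifts_to W x0 (loop_concat p q) (g +++ (\<lambda>t. w *v g' t)) (w ** w')"
    and "matrix_inv (transport W \<rho> \<tau> h (g +++ (\<lambda>t. w *v g' t))) ** \<rho> (w ** w') =
      (matrix_inv (transport W \<rho> \<tau> h g) ** \<rho> w) ** (matrix_inv (transport W \<rho> \<tau> h g') ** \<rho> w')"
proof -
  let ?g = "g +++ (\<lambda>t. w *v g' t)"
  have 1: "path g" "path_image g \<subseteq> X" "g 0 = x0" "g 1 = w *v x0" "w \<in> W" "\<And>t. t \<in> {0..1} \<Longrightarrow> point_orbit W (g t) = p t"
    using g by (auto simp: lifts_to_def X pathstart_def pathfinish_def)
  have 2: "path g'" "path_image g' \<subseteq> X" "g' 0 = x0" "g' 1 = w' *v x0" "w' \<in> W" "\<And>t. t \<in> {0..1} \<Longrightarrow> point_orbit W (g' t) = q t"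
    using g' by (auto simp: lifts_to_def X pathstart_def pathfinish_def)
  have wg': "path (\<lambda>t. w *v g' t)" "path_image (\<lambda>t. w *v g' t) \<subseteq> X"
    using 2(1,2) bounded_linear.continuous_on[OF bounded_linear_matrix_vector] W_preserves_X[OF 1(5)]
    by (auto simp: path_def path_image_def)
  have path: "path ?g" "path_image ?g \<subseteq> X"
    using 1 2(3) wg' subset_path_image_join[of g X] by (auto simp: pathstart_def pathfinish_def)
  have "point_orbit W (?g t) = loop_concat p q t" if "t \<in> {0..1}" for t
    using that 1(6)[of "2 * t"] 2(6)[of "2 * t - 1"] orbit_image[OF 1(5)] by (auto simp: joinpaths_def loop_concat_def)
  then show lift: "lifts_to W x0 (loop_concat p q) ?g (w ** w')"
    unfolding lifts_to_def using path 1(3) 2(4) mult_W[OF 1(5) 2(5)]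
    by (auto simp: X pathstart_def pathfinish_def joinpaths_def matrix_vector_mul_assoc)
  obtain P where P: "reach x0 (w *v x0) P" "\<And>h. trans_is h g (P h)" "\<And>h. transport W \<rho> \<tau> h g = P h"
    using lift_transport[OF g] by metis
  obtain Q where Q: "reach x0 (w' *v x0) Q" "\<And>h. trans_is h g' (Q h)" "\<And>h. transport W \<rho> \<tau> h g' = Q h"
    using lift_transport[OF g'] by metis
  have "trans_is h ?g (\<rho> w ** Q h ** \<rho> (winv w) ** P h)"
    using trans_is_join[OF P(2) trans_is_equivariant[OF 1(5) Q(2)]] 1(4) 2(3) by simp
  then show "matrix_inv (transport W \<rho> \<tau> h ?g) ** \<rho> (w ** w') =
      (matrix_inv (transport W \<rho> \<tau> h g) ** \<rho> w) ** (matrix_inv (transport W \<rho> \<tau> h g') ** \<rho> w')"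
    using transport_eq[OF path] twisted_product[OF 1(5) 2(5) P(1) Q(1)] by (simp add: P(3) Q(3))
qed

lemma lift_loop:
  assumes g: "lifts_to W x0 p g w" and p: "p 0 = point_orbit W x0" "p 1 = point_orbit W x0"
  shows "p \<in> loops (orbit_space W) (point_orbit W x0)"
proof -
  have "pathin (top_of_set X) g"
    using g unfolding pathin_canon_iff by (auto simp: lifts_to_def X path_image_def)
  then have "pathin (orbit_space W) (point_orbit W \<circ> g)"
    using quotient_imp_continuous_map[OF quotient_map_orbit_space[of W]] by (auto simp: X intro: pathin_compose)
  then have "pathin (orbit_space W) p"
    unfolding pathin_def by (rule continuous_map_eq) (use g in \<open>auto simp: lifts_to_def\<close>)
  then show ?thesis using p by (simp add: loops_def)
qed

abbreviation (input) loop_hom :: "(real \<Rightarrow> (complex ^ 'n) set) \<Rightarrow> (real \<Rightarrow> (complex ^ 'n) set) \<Rightarrow> bool" where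
  "loop_hom \<equiv> loop_homotopic (orbit_space W) (point_orbit W x0)"

lemma loop_hom_trans: "loop_hom p q \<Longrightarrow> loop_hom q r \<Longrightarrow> loop_hom p r"
  unfolding loop_homotopic_def by (rule homotopic_with_trans)

lemma loop_hom_sym: "loop_hom p q \<Longrightarrow> loop_hom q p"
  unfolding loop_homotopic_def by (rule homotopic_with_symD)

lemma loop_hom_refl: "p \<in> loops (orbit_space W) (point_orbit W x0) \<Longrightarrow> loop_hom p p"
  unfolding loop_homotopic_def loops_def pathin_def by simp

lemma braid_class:
  assumes b: "b \<in> carrier (braid_group W x0)"
  shows "\<exists>\<gamma>\<in>b. \<exists>g w. lifts_to W x0 \<gamma> g w"
    and "p \<in> b \<Longrightarrow> q \<in> b \<Longrightarrow> loop_hom p q"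
    and "p \<in> b \<Longrightarrow> p \<in> loops (orbit_space W) (point_orbit W x0)"
proof -
  obtain \<gamma> where \<gamma>: "\<gamma> \<in> loops (orbit_space W) (point_orbit W x0)" "b = {q. loop_hom \<gamma> q}"
    using b by (auto simp: braid_group_def fundamental_group_def quotient_def)
  show "\<exists>\<gamma>\<in>b. \<exists>g w. lifts_to W x0 \<gamma> g w"
    using lift_exists[OF X x0 \<gamma>(1)] loop_hom_refl[OF \<gamma>(1)] \<gamma>(2) by blast
  show "p \<in> b \<Longrightarrow> q \<in> b \<Longrightarrow> loop_hom p q"
    using \<gamma>(2) loop_hom_trans loop_hom_sym by blast
  show "p \<in> b \<Longrightarrow> p \<in> loops (orbit_space W) (point_orbit W x0)"
    using \<gamma>(2) homotopic_with_imp_continuous_maps homotopic_with_imp_property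
    unfolding loop_homotopic_def loops_def pathin_def by blast
qed

lemma monodromy_value:
  assumes b: "b \<in> carrier (braid_group W x0)" and \<gamma>: "\<gamma> \<in> b" "lifts_to W x0 \<gamma> g w"
  shows "monodromy W \<rho> \<tau> h x0 b = matrix_inv (transport W \<rho> \<tau> h g) ** \<rho> w"
  unfolding monodromy_def
proof (rule the_equality)
  fix M assume "\<exists>\<gamma>\<in>b. \<exists>g w. lifts_to W x0 \<gamma> g w \<and> M = matrix_inv (transport W \<rho> \<tau> h g) ** \<rho> w"
  then show "M = matrix_inv (transport W \<rho> \<tau> h g) ** \<rho> w"
    using lift_monodromy_unique[OF braid_class(2)[OF b _ \<gamma>(1)] _ \<gamma>(2)] by blast
qed (use \<gamma> in blast)

lemma monodromy_mon:
  assumes b: "b \<in> carrier (braid_group W x0)"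
  shows "\<exists>w \<gamma>. mon x0 w \<gamma> \<and> (\<forall>h. monodromy W \<rho> \<tau> h x0 b = \<gamma> h)"
  using braid_class(1)[OF b] monodromy_value[OF b] lift_mon by blast

text \<open>The monodromy of the product is read off directly from its definition: every loop in the
  product is homotopic to a concatenation of members of the two classes, so every lift of it yields
  the same matrix.\<close>

lemma monodromy_representation: "is_representation (braid_group W x0) (monodromy W \<rho> \<tau> h x0)"
  unfolding is_representation_def
proof (rule homI)
  fix b assume "b \<in> carrier (braid_group W x0)"
  from monodromy_mon[OF this] show "monodromy W \<rho> \<tau> h x0 b \<in> carrier GL"
    using mon_invertible by (auto simp: GL_def)
next
  fix A B assume A: "A \<in> carrier (braid_group W x0)" and B: "B \<in> carrier (braid_group W x0)"
  let ?AB = "A \<otimes>\<^bsub>braid_group W x0\<^esub> B"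
  have AB: "r \<in> ?AB \<longleftrightarrow> (\<exists>p\<in>A. \<exists>q\<in>B. loop_hom (loop_concat p q) r)" for r
    by (simp add: braid_group_def fundamental_group_def)
  obtain p g w where p: "p \<in> A" "lifts_to W x0 p g w" using braid_class(1)[OF A] by blast
  obtain q g' w' where q: "q \<in> B" "lifts_to W x0 q g' w'" using braid_class(1)[OF B] by blast
  have "loop_concat p q \<in> loops (orbit_space W) (point_orbit W x0)"
    using braid_class(3)[OF A p(1)] braid_class(3)[OF B q(1)]
    by (intro lift_loop[OF lift_concat(1)[OF p(2) q(2)]]) (auto simp: loops_def loop_concat_def)
  then have r: "loop_concat p q \<in> ?AB" using AB loop_hom_refl p(1) q(1) by blast
  have val: "matrix_inv (transport W \<rho> \<tau> h k) ** \<rho> v = monodromy W \<rho> \<tau> h x0 A ** monodromy W \<rho> \<tau> h x0 B"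
    if r: "r \<in> ?AB" and k: "lifts_to W x0 r k v" for r k v
  proof -
    obtain p' q' where p': "p' \<in> A" and q': "q' \<in> B" and hom: "loop_hom (loop_concat p' q') r" using AB r by blast
    obtain g w where g: "lifts_to W x0 p' g w" using lift_exists[OF X x0 braid_class(3)[OF A p']] by blast
    obtain g' w' where g': "lifts_to W x0 q' g' w'" using lift_exists[OF X x0 braid_class(3)[OF B q']] by blast
    show ?thesis
      using lift_monodromy_unique[OF hom lift_concat(1)[OF g g'] k] lift_concat(2)[OF g g']
        monodromy_value[OF A p' g] monodromy_value[OF B q' g'] by simp
  qed
  have "monodromy W \<rho> \<tau> h x0 ?AB = monodromy W \<rho> \<tau> h x0 A ** monodromy W \<rho> \<tau> h x0 B"
    unfolding monodromy_def[of W \<rho> \<tau> h x0 ?AB]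
  proof (rule the_equality)
    show "\<exists>\<gamma>\<in>?AB. \<exists>g w. lifts_to W x0 \<gamma> g w \<and>
        monodromy W \<rho> \<tau> h x0 A ** monodromy W \<rho> \<tau> h x0 B = matrix_inv (transport W \<rho> \<tau> h g) ** \<rho> w"
      using r val[OF r lift_concat(1)[OF p(2) q(2)]] lift_concat(1)[OF p(2) q(2)] by metis
  next
    fix M assume "\<exists>\<gamma>\<in>?AB. \<exists>g w. lifts_to W x0 \<gamma> g w \<and> M = matrix_inv (transport W \<rho> \<tau> h g) ** \<rho> w"
    then show "M = monodromy W \<rho> \<tau> h x0 A ** monodromy W \<rho> \<tau> h x0 B" using val by blast
  qed
  then show "monodromy W \<rho> \<tau> h x0 ?AB = monodromy W \<rho> \<tau> h x0 A \<otimes>\<^bsub>GL\<^esub> monodromy W \<rho> \<tau> h x0 B"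
    by (simp add: GL_def)
qed

end

end

section \<open>Invariant positive definite forms\<close>

definition gram :: "complex ^ 'm ^ 'm \<Rightarrow> complex ^ 'm \<Rightarrow> complex ^ 'm \<Rightarrow> complex" where
  "gram M u v = (\<Sum>i\<in>UNIV. \<Sum>j\<in>UNIV. u $ i * M $ i $ j * cnj (v $ j))"

lemma gram_act:
  fixes g :: "complex ^ 'm ^ 'm"
  shows "gram (act g M) u v = gram M (g *v u) (g *v v)"
proof -
  define cv where "cv v = (\<chi> i. cnj (v $ i))" for v :: "complex ^ 'm"
  have gram: "gram M u v = (\<Sum>i\<in>UNIV. u $ i * (M *v cv v) $ i)" for M and u v :: "complex ^ 'm"
    by (simp add: gram_def cv_def matrix_vector_mult_def sum_distrib_left mult.assoc)
  have cv: "cv (g *v v) = mcnj g *v cv v"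
    by (simp add: cv_def matrix_vector_mult_def vec_eq_iff cnj_sum)
  have "(\<Sum>i\<in>UNIV. u $ i * (transpose g *v y) $ i) = (\<Sum>i\<in>UNIV. \<Sum>k\<in>UNIV. g $ k $ i * u $ i * y $ k)" for y
    by (simp add: matrix_vector_mult_def transpose_def sum_distrib_left mult_ac)
  also have "\<dots> y = (\<Sum>k\<in>UNIV. (g *v u) $ k * y $ k)" for y
    by (subst sum.swap) (simp add: matrix_vector_mult_def sum_distrib_right)
  finally have tr: "(\<Sum>i\<in>UNIV. u $ i * (transpose g *v y) $ i) = (\<Sum>k\<in>UNIV. (g *v u) $ k * y $ k)" for y .
  have "gram (act g M) u v = (\<Sum>i\<in>UNIV. u $ i * (transpose g *v (M *v cv (g *v v))) $ i)"
    by (simp add: gram cv act_def matrix_vector_mul_assoc matrix_mul_assoc)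
  then show ?thesis unfolding tr gram .
qed

lemma gram_add: "gram (M + N) u v = gram M u v + gram N u v"
  by (simp add: gram_def algebra_simps sum.distrib)

lemma gram_sum: "gram (sum M S) u v = (\<Sum>w\<in>S. gram (M w) u v)"
proof (cases "finite S")
  case True
  then show ?thesis by (induction S rule: finite_induct) (simp_all add: gram_add, simp add: gram_def)
qed (simp add: gram_def)

lemma norm_gram_le: "cmod (gram M v v) \<le> (real CARD('m))\<^sup>2 * norm M * (norm v)\<^sup>2" for M :: "complex ^ 'm ^ 'm"
proof -
  have "cmod (v $ i * M $ i $ j * cnj (v $ j)) \<le> norm M * (norm v)\<^sup>2" for i j
  proof -
    have "cmod (M $ i $ j) \<le> norm M" using Finite_Cartesian_Product.norm_nth_le[of M i] Finite_Cartesian_Product.norm_nth_le[of "M $ i" j] by simp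
    then have "cmod (v $ i) * cmod (M $ i $ j) * cmod (v $ j) \<le> norm v * norm M * norm v"
      by (intro mult_mono) (auto intro: Finite_Cartesian_Product.norm_nth_le)
    then show ?thesis by (simp add: norm_mult power2_eq_square mult_ac)
  qed
  then have "cmod (gram M v v) \<le> (\<Sum>i\<in>(UNIV::'m set). \<Sum>j\<in>(UNIV::'m set). norm M * (norm v)\<^sup>2)"
    unfolding gram_def by (intro order_trans[OF norm_sum] sum_mono)
  then show ?thesis by (simp add: power2_eq_square mult_ac)
qed

lemma gram_one: "gram (mat 1) v v = of_real ((norm v)\<^sup>2)"
proof -
  have "gram (mat 1) v v = (\<Sum>i\<in>UNIV. v $ i * cnj (v $ i))"
    by (simp add: gram_def mat_def if_distrib[of "\<lambda>x. _ * x"] if_distrib[of "\<lambda>x. x * _"] cong: if_cong)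
  also have "\<dots> = of_real (\<Sum>i\<in>UNIV. (cmod (v $ i))\<^sup>2)" unfolding of_real_sum complex_norm_square ..
  also have "(\<Sum>i\<in>UNIV. (cmod (v $ i))\<^sup>2) = (norm v)\<^sup>2"
    by (simp add: norm_vec_def L2_set_def sum_nonneg)
  finally show ?thesis .
qed

definition adjoint_matrix :: "complex ^ 'm ^ 'm \<Rightarrow> complex ^ 'm ^ 'm" where
  "adjoint_matrix M = transpose (mcnj M)"

lemma gram_adjoint: "gram (adjoint_matrix M) u v = cnj (gram M v u)"
  unfolding gram_def adjoint_matrix_def
  by (subst sum.swap) (simp add: transpose_def cnj_sum mult_ac)

lemma act_adjoint: "act g (adjoint_matrix M) = adjoint_matrix (act g M)"
proof -
  have "mcnj (mcnj g) = g" "mcnj (transpose g) = transpose (mcnj g)" by (simp_all add: vec_eq_iff transpose_def)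
  then show ?thesis by (simp add: act_def adjoint_matrix_def mcnj_mult matrix_transpose_mul matrix_mul_assoc)
qed

lemma hermitian_form_gram: "hermitian_form (gram (M + adjoint_matrix M))"
  unfolding hermitian_form_def
proof (intro conjI allI)
  let ?M = "M + adjoint_matrix M"
  show "gram ?M (u + v) w = gram ?M u w + gram ?M v w" for u v w
    by (simp add: gram_def algebra_simps sum.distrib)
  show "gram ?M (a *s u) v = a * gram ?M u v" for a u v
    by (simp add: gram_def sum_distrib_left mult_ac)
  show "gram ?M v u = cnj (gram ?M u v)" for u v
    by (simp add: gram_add gram_adjoint)
qed

text \<open>If no radius worked, there would be bad imaginary parameters \<open>hk k\<close> tending
  to 0. The persistent invariant forms along them are positive definite for some k, since they
  converge to a positive definite form.\<close>

theorem (in reflection_connection) unitarizable_near_zero: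
  assumes X: "X = regular_points W" and omega: "\<And>h x v. omega W \<rho> \<tau> h x v = om h x v" and x0: "x0 \<in> X"
  shows "\<exists>\<epsilon>>0. \<forall>h::complex. Re h = 0 \<and> norm h < \<epsilon> \<longrightarrow>
           unitarizable (braid_group W x0) (monodromy W \<rho> \<tau> h x0)"
proof (rule ccontr)
  assume "\<not> ?thesis"
  then have "\<exists>h::complex. Re h = 0 \<and> norm h < inverse (real (Suc k)) \<and> \<not> unitarizable (braid_group W x0) (monodromy W \<rho> \<tau> h x0)" for k
    by (metis inverse_positive_iff_positive of_nat_0_less_iff zero_less_Suc)
  then obtain hk where hk: "\<And>k. Re (hk k) = 0" "\<And>k. norm (hk k) < inverse (real (Suc k))"
    and bad: "\<And>k. \<not> unitarizable (braid_group W x0) (monodromy W \<rho> \<tau> (hk k) x0)" by metis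
  have hk0: "hk \<longlonglongrightarrow> 0"
    by (rule Lim_null_comparison[OF _ LIMSEQ_inverse_real_of_nat]) (intro always_eventually allI less_imp_le hk(2))
  \<comment> \<open>The standard form averaged over \<open>W\<close>. The term of the identity alone
    shows that its value at \<open>v\<close> is at least \<open>(norm v)\<^sup>2\<close>, the margin
    for the perturbation.\<close>
  define M0 where "M0 = (\<Sum>w\<in>W. act (\<rho> w) (mat 1))"
  have M0: "act (\<rho> v) M0 = M0" if v: "v \<in> W" for v
  proof -
    have "bij_betw (\<lambda>w. w ** v) W W"
      using winv[OF v] v mult_W
      by (intro bij_betw_byWitness[of _ "\<lambda>w. w ** winv v"]) (auto simp: matrix_mul_assoc[symmetric])
    then have "M0 = (\<Sum>w\<in>W. act (\<rho> (w ** v)) (mat 1))" unfolding M0_def by (rule sum.reindex_bij_betw[symmetric])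
    also have "\<dots> = (\<Sum>w\<in>W. act (\<rho> v) (act (\<rho> w) (mat 1)))"
      by (intro sum.cong refl) (simp add: rho_mult v act_mult)
    also have "\<dots> = act (\<rho> v) M0" unfolding M0_def by (rule linear_sum[OF linear_act, symmetric])
    finally show ?thesis ..
  qed
  obtain f where f: "\<And>k w \<gamma>. mon x0 w \<gamma> \<Longrightarrow> act (\<gamma> (hk k)) (f k) = f k" and lim: "f \<longlonglongrightarrow> M0"
    using invariant_forms_persist[OF x0 hk0 hk(1) M0] by blast
  let ?C = "(real CARD('m))\<^sup>2"
  have "(\<lambda>k. ?C * norm (f k - M0)) \<longlonglongrightarrow> ?C * 0"
    by (intro tendsto_intros tendsto_norm_zero LIM_zero lim)
  then have "\<forall>\<^sub>F k in sequentially. ?C * norm (f k - M0) < 1" by (rule order_tendstoD) simp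
  then obtain k where k: "?C * norm (f k - M0) < 1" using eventually_happens'[OF sequentially_bot] by blast
  \<comment> \<open>The invariant matrix is not known to be hermitian. Adding its adjoint preserves
    invariance and doubles the real part of the values on the diagonal.\<close>
  let ?F = "f k + adjoint_matrix (f k)"
  have "Re (gram ?F v v) > 0" if v: "v \<noteq> 0" for v
  proof -
    have "(norm v)\<^sup>2 \<le> Re (gram M0 v v)"
    proof -
      have "Re (gram M0 v v) = (\<Sum>w\<in>W. (norm (\<rho> w *v v))\<^sup>2)"
        by (simp add: M0_def gram_sum gram_act gram_one)
      also have "\<dots> \<ge> (norm (\<rho> (mat 1) *v v))\<^sup>2"
        by (rule member_le_sum) (use one_W finite_W in auto)
      finally show ?thesis by (simp add: rho_one)
    qed
    moreover have "cmod (gram (f k - M0) v v) < (norm v)\<^sup>2"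
    proof -
      have "?C * norm (f k - M0) * (norm v)\<^sup>2 < 1 * (norm v)\<^sup>2" using k v by (intro mult_strict_right_mono) auto
      then show ?thesis using norm_gram_le[of "f k - M0" v] by simp
    qed
    moreover have "gram (f k) v v = gram (f k - M0) v v + gram M0 v v" by (simp flip: gram_add)
    ultimately have "Re (gram (f k) v v) > 0" using abs_Re_le_cmod[of "gram (f k - M0) v v"] by auto
    then show ?thesis by (simp add: gram_add gram_adjoint)
  qed
  then have "positive_definite (gram ?F)" by (simp add: positive_definite_def)
  moreover have "gram ?F (monodromy W \<rho> \<tau> (hk k) x0 b *v u) (monodromy W \<rho> \<tau> (hk k) x0 b *v v) = gram ?F u v"
    if b: "b \<in> carrier (braid_group W x0)" for b u v
  proof -
    obtain w \<gamma> where \<gamma>: "mon x0 w \<gamma>" "\<And>h. monodromy W \<rho> \<tau> h x0 b = \<gamma> h"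
      using monodromy_mon[OF X omega x0 b] by blast
    have "act (\<gamma> (hk k)) ?F = ?F" using f[OF \<gamma>(1)] by (simp add: linear_add[OF linear_act] act_adjoint)
    then show ?thesis by (simp add: \<gamma>(2) flip: gram_act)
  qed
  ultimately have "unitarizable (braid_group W x0) (monodromy W \<rho> \<tau> (hk k) x0)"
    unfolding unitarizable_def using monodromy_representation[OF X omega x0] hermitian_form_gram by blast
  then show False using bad by blast
qed

section \<open>Unitary reflection groups\<close>

lemma linear_form_sum: "linear_form f \<Longrightarrow> f (\<Sum>i\<in>S. g i) = (\<Sum>i\<in>S. f (g i))"
  using linear_sum[OF linear_form_linear] by blast

lemma linear_form_coords:
  assumes "linear_form f" shows "f v = (\<Sum>j\<in>UNIV. v $ j * f (axis j 1))"
proof -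
  have "f v = f (\<Sum>j\<in>UNIV. v $ j *s axis j 1)" by (simp add: basis_expansion)
  then show ?thesis by (simp only: linear_form_sum[OF assms] linear_form_scale[OF assms])
qed

lemma linear_form_one:
  assumes f: "linear_form f" and "f v \<noteq> 0" shows "f ((1 / f v) *s v) = 1"
  using assms by (simp add: linear_form_scale)

lemma subspace_kernel: "linear_form f \<Longrightarrow> vec.subspace {v. f v = 0}"
  unfolding vec.subspace_def by (simp add: linear_form_0 linear_form_add linear_form_scale)

lemma dim_kernel:
  fixes f :: "complex ^ 'n \<Rightarrow> complex"
  assumes f: "linear_form f" and u: "f u = 1"
  shows "vec.dim {v. f v = 0} + 1 = CARD('n)"
proof -
  let ?K = "{v. f v = 0}"
  have K: "vec.span ?K = ?K" using subspace_kernel[OF f] by simp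
  have "v \<in> vec.span (insert u ?K)" for v
  proof -
    have "v - f v *s u \<in> vec.span (insert u ?K)"
      by (rule vec.span_base) (simp add: linear_form_diff[OF f] linear_form_scale[OF f] u)
    moreover have "f v *s u \<in> vec.span (insert u ?K)" by (intro vec.span_scale vec.span_base) simp
    ultimately show ?thesis using vec.span_add[of "v - f v *s u" _ "f v *s u"] by simp
  qed
  then have "vec.span (insert u ?K) = UNIV" by blast
  then have "vec.dim (insert u ?K) = CARD('n)" by (metis vec.dim_span vec_dim_card)
  then show ?thesis using vec.dim_insert[of u ?K] K u by simp
qed

lemma subspace_fixed_space: "vec.subspace (fixed_space w)"
  unfolding vec.subspace_def fixed_space_def
  by (simp add: matrix_vector_right_distrib matrix_vector_mult_scaleR vector_scalar_commute)

text \<open>A coordinate of \<open>w - 1\<close> that is not identically zero is a linear form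
  vanishing on the fixed space; equality with its kernel follows by dimension.\<close>

lemma reflection_form:
  fixes w :: "complex ^ 'n ^ 'n"
  assumes w: "reflection w"
  shows "\<exists>f u. linear_form f \<and> f u = 1 \<and> fixed_space w = {v. f v = 0}"
proof -
  have d: "vec.dim (fixed_space w) + 1 = CARD('n)" using w by (simp add: reflection_def)
  have "fixed_space w \<noteq> UNIV"
  proof
    assume "fixed_space w = UNIV"
    then show False using d vec_dim_card[where 'a = complex and 'n = 'n] by simp
  qed
  then obtain v where "w *v v \<noteq> v" by (auto simp: fixed_space_def)
  then obtain i where i: "(w *v v - v) $ i \<noteq> 0" by (auto simp: vec_eq_iff)
  define f where "f x = (w *v x - x) $ i" for x
  have f: "linear_form f"
    unfolding linear_form_iff f_def by (simp add: matrix_vector_right_distrib vector_scalar_commute algebra_simps)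
  have u: "f ((1 / f v) *s v) = 1" using linear_form_one[OF f] i by (simp add: f_def)
  have "fixed_space w \<subseteq> {v. f v = 0}" by (auto simp: fixed_space_def f_def)
  moreover have "vec.dim {v. f v = 0} \<le> vec.dim (fixed_space w)" using dim_kernel[OF f u] d by simp
  ultimately have "fixed_space w = {v. f v = 0}"
    by (intro vec.subspace_dim_equal subspace_fixed_space subspace_kernel[OF f])
  then show ?thesis using f u by blast
qed

text \<open>The determinant is the scalar by which \<open>w\<close> acts on the quotient by the
  hyperplane it fixes. In a basis with all vectors but one in the hyperplane, \<open>w\<close>
  changes a single column, and Cramer's rule gives the determinant.\<close>

lemma det_fixing_hyperplane:
  fixes w :: "complex ^ 'n ^ 'n"
  assumes f: "linear_form f" and u: "f u = 1" and fix_w: "\<And>v. f v = 0 \<Longrightarrow> w *v v = v"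
  shows "f (w *v v) = det w * f v"
proof -
  define a where "a j = f (axis j 1)" for j
  have fc: "f v = (\<Sum>j\<in>UNIV. v $ j * a j)" for v unfolding a_def by (rule linear_form_coords[OF f])
  have "\<exists>k. a k \<noteq> 0"
  proof (rule ccontr)
    assume "\<not> ?thesis"
    then show False using fc[of u] u by simp
  qed
  then obtain k where k: "a k \<noteq> 0" ..
  \<comment> \<open>The standard basis corrected by multiples of \<open>axis k 1\<close> so that all
    vectors except \<open>b k\<close> lie in the kernel of \<open>f\<close>, and
    \<open>f (b k) = 1\<close>.\<close>
  define b where "b j = (if j = k then (1 / a k) *s axis k 1 else axis j 1 - (a j / a k) *s axis k 1)" for j
  have fb: "f (b j) = (if j = k then 1 else 0)" for j
    using k by (simp add: b_def linear_form_diff[OF f] linear_form_scale[OF f] a_def)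
  define B :: "complex ^ 'n ^ 'n" where "B = (\<chi> i j. b j $ i)"
  have Bv: "B *v y = (\<Sum>j\<in>UNIV. y $ j *s b j)" for y
    by (simp add: B_def matrix_vector_mult_def vec_eq_iff mult.commute)
  have fB: "f (B *v y) = y $ k" for y
    unfolding Bv linear_form_sum[OF f] linear_form_scale[OF f] fb by (simp add: if_distrib cong: if_cong)
  have "y = 0" if y: "B *v y = 0" for y
  proof -
    have yk: "y $ k = 0" using fB[of y] y linear_form_0[OF f] by simp
    have "y $ i = 0" for i
    proof (cases "i = k")
      case False
      have "(B *v y) $ i = (\<Sum>j\<in>UNIV. if j = i then y $ i else 0)"
        unfolding Bv sum_component vector_smult_component
        by (intro sum.cong refl) (use False yk in \<open>auto simp: b_def axis_def\<close>)
      then show ?thesis using y by simp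
    qed (simp add: yk)
    then show ?thesis by (simp add: vec_eq_iff)
  qed
  then obtain B' where B': "B' ** B = mat 1" using matrix_left_invertible_ker[of B] by blast
  then have BB': "B ** B' = mat 1" by (simp add: matrix_left_right_inverse)
  have detB: "det B \<noteq> 0" using B' BB' invertible_det_nz[of B] by (auto simp: invertible_def)
  define x where "x = B' *v (w *v b k)"
  have Bx: "B *v x = w *v b k" by (simp add: x_def matrix_vector_mul_assoc matrix_mul_assoc BB')
  \<comment> \<open>Applying \<open>w\<close> replaces column k of \<open>B\<close> by
    \<open>B *v x\<close> and leaves the others, which is the shape of Cramer's rule.\<close>
  have "w ** B = (\<chi> i j. if j = k then (B *v x) $ i else B $ i $ j)"
  proof -
    have "(w ** B) $ i $ j = (w *v b j) $ i" for i j
      by (simp add: matrix_matrix_mult_def matrix_vector_mult_def B_def)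
    moreover have "w *v b j = b j" if "j \<noteq> k" for j using fix_w fb that by simp
    moreover have "B $ i $ j = b j $ i" for i j by (simp add: B_def)
    ultimately show ?thesis unfolding Bx by (simp add: vec_eq_iff)
  qed
  then have "det w * det B = x $ k * det B" using cramer_lemma[of k B x] by (simp flip: det_mul)
  then have d: "det w = f (w *v b k)" using detB fB[of x] by (simp add: Bx)
  have "f (v - f v *s b k) = 0" by (simp add: linear_form_diff[OF f] linear_form_scale[OF f] fb)
  then have "w *v (v - f v *s b k) = v - f v *s b k" by (rule fix_w)
  then have "w *v v = f v *s (w *v b k) + (v - f v *s b k)"
    by (simp add: matrix_vector_mult_diff_distrib vector_scalar_commute algebra_simps)
  then show ?thesis
    by (simp add: linear_form_add[OF f] linear_form_diff[OF f] linear_form_scale[OF f] fb d)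
qed

lemma hyperplane_form:
  assumes "linear_form f" "H = {v. f v = 0}"
  shows "linear_form (hyperplane_form H)" "{v. hyperplane_form H v = 0} = H"
proof -
  have "\<exists>\<alpha>. linear_form \<alpha> \<and> {v. \<alpha> v = 0} = H" using assms by blast
  from someI_ex[OF this] show "linear_form (hyperplane_form H)" "{v. hyperplane_form H v = 0} = H"
    unfolding hyperplane_form_def linear_form_def by blast+
qed

text \<open>Multiplication by an element permutes \<open>D\<close>; comparing the products of all
  elements shows that it is a root of unity of order dividing \<open>card D\<close>. There are no
  more such roots than elements of \<open>D\<close>.\<close>

lemma finite_subgroup_roots_of_unity:
  fixes D :: "complex set"
  assumes D: "finite D" "D \<noteq> {}" "0 \<notin> D" and mult: "\<And>x y. x \<in> D \<Longrightarrow> y \<in> D \<Longrightarrow> x * y \<in> D"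
  shows "D = (\<lambda>k. zeta (card D) ^ k) ` {..<card D}"
proof -
  let ?n = "card D"
  have n: "?n > 0" using D by (simp add: card_gt_0_iff)
  have root: "x ^ ?n = 1" if x: "x \<in> D" for x
  proof -
    have inj: "inj_on (\<lambda>d. x * d) D" using D(3) x by (auto intro: inj_onI)
    moreover have "(\<lambda>d. x * d) ` D \<subseteq> D" using mult x by blast
    ultimately have "(\<lambda>d. x * d) ` D = D" using endo_inj_surj[OF D(1)] by blast
    then have "(\<Prod>d\<in>D. d) = (\<Prod>d\<in>D. x * d)" using prod.reindex[OF inj, of "\<lambda>d. d"] by simp
    also have "\<dots> = x ^ ?n * (\<Prod>d\<in>D. d)" by (simp add: prod.distrib)
    finally show ?thesis using D by (auto simp: prod_zero_iff)
  qed
  have roots: "finite {z::complex. z ^ ?n = 1}" "card {z::complex. z ^ ?n = 1} \<le> ?n"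
    using finite_roots_unity[of ?n] card_roots_unity[of ?n] n by auto
  have "D = {z. z ^ ?n = 1}" using roots root by (intro card_seteq) auto
  moreover have "(\<lambda>k. zeta ?n ^ k) ` {..<?n} = {z. z ^ ?n = 1}"
  proof (rule card_seteq[OF roots(1)])
    have "inj_on (\<lambda>k. zeta ?n ^ k) {..<?n}"
      using zeta_props(4)[OF n] zeta_props(4)[OF n, of _ _] by (intro inj_onI) (metis lessThan_iff)
    then show "card {z::complex. z ^ ?n = 1} \<le> card ((\<lambda>k. zeta ?n ^ k) ` {..<?n})"
      using roots(2) by (simp add: card_image)
    have "(zeta ?n ^ k) ^ ?n = 1" for k
      using zeta_props(1)[OF n] by (metis mult.commute power_mult power_one)
    then show "(\<lambda>k. zeta ?n ^ k) ` {..<?n} \<subseteq> {z. z ^ ?n = 1}" by auto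
  qed
  ultimately show ?thesis by simp
qed

lemma GL_one: "\<one>\<^bsub>GL\<^esub> = (mat 1 :: 'a::field ^ 'n ^ 'n)"
  and GL_mult: "x \<otimes>\<^bsub>GL\<^esub> y = (x ** y :: 'a::field ^ 'n ^ 'n)"
  by (simp_all add: GL_def)

text \<open>\<open>free_W\<close> is the instance of Steinberg's theorem that makes the projection
  to the orbit space a covering; for the monomial groups it is verified by direct
  computation.\<close>

locale unitary_reflection_group =
  fixes W :: "(complex ^ 'n ^ 'n) set"
  assumes finite_W: "finite W"
    and one_W: "mat 1 \<in> W"
    and mult_W: "w \<in> W \<Longrightarrow> w' \<in> W \<Longrightarrow> w ** w' \<in> W"
    and inv_W: "w \<in> W \<Longrightarrow> \<exists>w'\<in>W. w' ** w = mat 1 \<and> w ** w' = mat 1"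
    and isometric_W: "w \<in> W \<Longrightarrow> norm (w *v v) = norm v"
    and free_W: "w \<in> W \<Longrightarrow> x \<in> regular_points W \<Longrightarrow> w *v x = x \<Longrightarrow> w = mat 1"
begin

lemma invertible_W: "w \<in> W \<Longrightarrow> invertible w"
  using inv_W unfolding invertible_def by blast

lemma hyperplane_form_kernel:
  assumes "H \<in> hyperplanes W"
  shows "linear_form (hyperplane_form H)" "{v. hyperplane_form H v = 0} = H" "\<exists>u. hyperplane_form H u = 1"
proof -
  obtain r where "reflection r" "H = fixed_space r" using assms by (auto simp: hyperplanes_def)
  then obtain f u where f: "linear_form f" "f u = 1" "H = {v. f v = 0}" using reflection_form by metis
  show 1: "linear_form (hyperplane_form H)" and 2: "{v. hyperplane_form H v = 0} = H"
    using hyperplane_form[OF f(1,3)] by auto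
  have "u \<notin> H" using f(2,3) by simp
  then have "hyperplane_form H u \<noteq> 0" using 2 by blast
  then show "\<exists>u. hyperplane_form H u = 1" using linear_form_one[OF 1] by blast
qed

lemma image_inverse:
  fixes w w' :: "complex ^ 'n ^ 'n"
  assumes "w' ** w = mat 1" "w ** w' = mat 1"
  shows "(*v) w ` S = {v. w' *v v \<in> S}"
proof (intro equalityI subsetI)
  fix v assume "v \<in> {v. w' *v v \<in> S}"
  moreover have "v = w *v (w' *v v)" using assms by (simp add: matrix_vector_mul_assoc)
  ultimately show "v \<in> (*v) w ` S" by blast
qed (use assms in \<open>auto simp: matrix_vector_mul_assoc\<close>)

lemma hyperplanes_image:
  assumes w: "w \<in> W" and H: "H \<in> hyperplanes W"
  shows "(*v) w ` H \<in> hyperplanes W"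
proof -
  obtain r where r: "r \<in> W" "reflection r" "H = fixed_space r" using H by (auto simp: hyperplanes_def)
  obtain f u where f: "linear_form f" "f u = 1" "fixed_space r = {v. f v = 0}" using reflection_form[OF r(2)] by metis
  obtain w' where w': "w' \<in> W" "w' ** w = mat 1" "w ** w' = mat 1" using inv_W[OF w] by blast
  let ?r = "w ** r ** w'"
  have rW: "?r \<in> W" using mult_W w w'(1) r(1) by blast
  have iff: "w *v x = v \<longleftrightarrow> x = w' *v v" for x v
    using w'(2,3) by (metis matrix_vector_mul_assoc matrix_vector_mul_lid)
  have fixed: "fixed_space ?r = (*v) w ` H"
    unfolding image_inverse[OF w'(2,3)] r(3) fixed_space_def
    by (simp add: matrix_vector_mul_assoc[symmetric] iff)
  have "linear_form (\<lambda>v. f (w' *v v))"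
    using f(1) by (simp add: linear_form_iff matrix_vector_right_distrib vector_scalar_commute)
  moreover have "f (w' *v (w *v u)) = 1" using f(2) w'(2) by (simp add: matrix_vector_mul_assoc)
  ultimately have "vec.dim {v. f (w' *v v) = 0} + 1 = CARD('n)" by (rule dim_kernel)
  moreover have "fixed_space ?r = {v. f (w' *v v) = 0}"
    unfolding fixed image_inverse[OF w'(2,3)] r(3) f(3) by simp
  ultimately have "reflection ?r" using invertible_W[OF rW] by (simp add: reflection_def)
  then show ?thesis unfolding hyperplanes_def using rW fixed by force
qed

text \<open>Such an element is a transvection, sending \<open>u\<close> to \<open>u + m\<close> with
  \<open>m\<close> fixed. Its powers send \<open>u\<close> to \<open>u + k m\<close>, all of the
  same norm, so \<open>m = 0\<close>.\<close>

lemma fixing_det_one: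
  assumes H: "H \<in> hyperplanes W" and w: "w \<in> W" "\<And>v. v \<in> H \<Longrightarrow> w *v v = v" and det: "det w = 1"
  shows "w = mat 1"
proof -
  note f = hyperplane_form_kernel[OF H]
  obtain u where u: "hyperplane_form H u = 1" using f(3) by blast
  have fix_w: "w *v v = v" if "hyperplane_form H v = 0" for v using w(2) f(2) that by blast
  define m where "m = w *v u - u"
  have "hyperplane_form H m = 0"
    using det_fixing_hyperplane[OF f(1) u fix_w, of u] by (simp add: m_def linear_form_diff[OF f(1)] u det)
  then have wm: "w *v m = m" by (rule fix_w)
  have wu: "w *v u = u + m" by (simp add: m_def)
  have step: "norm (u + real k *\<^sub>R m) = norm u" for k
  proof (induction k)
    case (Suc k)
    have "w *v (u + real k *\<^sub>R m) = u + real (Suc k) *\<^sub>R m"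
      by (simp add: matrix_vector_right_distrib matrix_vector_scaleR wm wu algebra_simps)
    then show ?case using isometric_W[OF w(1)] Suc by metis
  qed simp
  have bound: "real k * norm m \<le> 2 * norm u" for k
  proof -
    have "norm (real k *\<^sub>R m) \<le> norm (u + real k *\<^sub>R m) + norm u"
      using norm_triangle_ineq4[of "u + real k *\<^sub>R m" u] by simp
    then show ?thesis using step[of k] by simp
  qed
  have "m = 0"
  proof (rule ccontr)
    assume "m \<noteq> 0"
    then obtain k where "2 * norm u < real k * norm m" using ex_less_of_nat_mult[of "norm m"] by auto
    then show False using bound[of k] by simp
  qed
  then have wu: "w *v u = u" by (simp add: wu)
  have "w *v v = v" for v
  proof -
    have "hyperplane_form H (v - hyperplane_form H v *s u) = 0"
      by (simp add: linear_form_diff[OF f(1)] linear_form_scale[OF f(1)] u)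
    then have "w *v (v - hyperplane_form H v *s u) = v - hyperplane_form H v *s u" by (rule fix_w)
    then show ?thesis using wu by (simp add: matrix_vector_mult_diff_distrib vector_scalar_commute)
  qed
  then show ?thesis by (simp add: matrix_eq)
qed

lemma stabilizer_mult: "w \<in> pointwise_stabilizer W H \<Longrightarrow> w' \<in> pointwise_stabilizer W H \<Longrightarrow> w ** w' \<in> pointwise_stabilizer W H"
  using mult_W by (simp add: pointwise_stabilizer_def matrix_vector_mul_assoc[symmetric])

lemma stabilizer_one: "mat 1 \<in> pointwise_stabilizer W H"
  using one_W by (simp add: pointwise_stabilizer_def)

lemma stabilizer_inverse:
  assumes "w \<in> pointwise_stabilizer W H"
  shows "\<exists>w'\<in>pointwise_stabilizer W H. w' ** w = mat 1 \<and> w ** w' = mat 1"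
proof -
  obtain w' where w': "w' \<in> W" "w' ** w = mat 1" "w ** w' = mat 1"
    using inv_W assms by (auto simp: pointwise_stabilizer_def)
  have "w' *v v = v" if "v \<in> H" for v
  proof -
    have "w' *v v = w' *v (w *v v)" using assms that by (simp add: pointwise_stabilizer_def)
    then show ?thesis using w' by (simp add: matrix_vector_mul_assoc)
  qed
  then have "w' \<in> pointwise_stabilizer W H" using w'(1) by (simp add: pointwise_stabilizer_def)
  then show ?thesis using w' by blast
qed

lemma inj_on_det_stabilizer:
  assumes H: "H \<in> hyperplanes W"
  shows "inj_on det (pointwise_stabilizer W H)"
proof (rule inj_onI)
  fix v w assume v: "v \<in> pointwise_stabilizer W H" and w: "w \<in> pointwise_stabilizer W H" and eq: "det v = det w"
  obtain v' where v': "v' \<in> pointwise_stabilizer W H" "v' ** v = mat 1" "v ** v' = mat 1"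
    using stabilizer_inverse[OF v] by blast
  have "det (v' ** w) = det (v' ** v)" by (simp add: det_mul eq)
  then have "v' ** w = mat 1"
    using stabilizer_mult[OF v'(1) w] v'(2) by (intro fixing_det_one[OF H]) (auto simp: pointwise_stabilizer_def)
  then have "v ** (v' ** w) = v" by simp
  then show "v = w" using v'(3) by (simp add: matrix_mul_assoc)
qed

lemma finite_stabilizer: "finite (pointwise_stabilizer W H)"
  using finite_W by (simp add: pointwise_stabilizer_def)

lemma det_stabilizer:
  assumes H: "H \<in> hyperplanes W"
  shows "det ` pointwise_stabilizer W H = (\<lambda>k. zeta (stab_order W H) ^ k) ` {..<stab_order W H}"
proof -
  let ?D = "det ` pointwise_stabilizer W H"
  have c: "card ?D = stab_order W H" unfolding stab_order_def by (rule card_image[OF inj_on_det_stabilizer[OF H]])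
  have "0 \<notin> ?D"
    using invertible_W invertible_det_nz by (force simp: pointwise_stabilizer_def)
  moreover have "x * y \<in> ?D" if "x \<in> ?D" "y \<in> ?D" for x y
    using that stabilizer_mult by (auto simp: det_mul[symmetric])
  ultimately show ?thesis
    using finite_subgroup_roots_of_unity[of ?D] finite_stabilizer stabilizer_one unfolding c by blast
qed

lemma stab_order_ge: "H \<in> hyperplanes W \<Longrightarrow> stab_order W H \<ge> 2"
proof -
  assume H: "H \<in> hyperplanes W"
  then obtain r where r: "r \<in> W" "reflection r" "H = fixed_space r" by (auto simp: hyperplanes_def)
  have "r \<noteq> mat 1"
  proof
    assume "r = mat 1"
    then have "H = UNIV" using r(3) by (simp add: fixed_space_def)
    then have "hyperplane_form H v = 0" for v using hyperplane_form_kernel(2)[OF H] by blast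
    then show False using hyperplane_form_kernel(3)[OF H] by simp
  qed
  moreover have "{mat 1, r} \<subseteq> pointwise_stabilizer W H"
    using stabilizer_one r by (auto simp: pointwise_stabilizer_def fixed_space_def)
  ultimately show "stab_order W H \<ge> 2"
    using card_mono[OF finite_stabilizer[of H], of "{mat 1, r}"] by (simp add: stab_order_def)
qed

lemma stabilizer_pow: "s \<in> pointwise_stabilizer W H \<Longrightarrow> s [^]\<^bsub>GL\<^esub> (k::nat) \<in> pointwise_stabilizer W H \<and> det (s [^]\<^bsub>GL\<^esub> k) = det s ^ k"
  by (induction k) (simp_all add: GL_one GL_mult stabilizer_one stabilizer_mult det_mul)

lemma stabilizer_generator:
  assumes H: "H \<in> hyperplanes W" and s: "s \<in> pointwise_stabilizer W H" "det s = zeta (stab_order W H)"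
  shows "generate GL {s} = pointwise_stabilizer W H"
proof (intro equalityI subsetI)
  fix w assume "w \<in> generate GL {s}"
  then show "w \<in> pointwise_stabilizer W H"
  proof (induction rule: generate.induct)
    case (inv h)
    obtain w' where w': "w' \<in> pointwise_stabilizer W H" "w' ** s = mat 1" "s ** w' = mat 1"
      using stabilizer_inverse[OF s(1)] by blast
    have "inv\<^bsub>GL\<^esub> s = w'"
      using w'(2,3) by (intro group.inv_equality[OF group_GL]) (auto simp: GL_def invertible_def)
    then show ?case using inv w'(1) by simp
  qed (use stabilizer_one stabilizer_mult s(1) in \<open>auto simp: GL_def\<close>)
next
  fix w assume w: "w \<in> pointwise_stabilizer W H"
  then obtain k where k: "det w = zeta (stab_order W H) ^ k" using det_stabilizer[OF H] by blast
  then have "w = s [^]\<^bsub>GL\<^esub> k"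
    using inj_onD[OF inj_on_det_stabilizer[OF H] _ w, of "s [^]\<^bsub>GL\<^esub> k"] stabilizer_pow[OF s(1), of k] s(2) by simp
  moreover have "s [^]\<^bsub>GL\<^esub> j \<in> generate GL {s}" for j :: nat
  proof (induction j)
    case 0
    show ?case using generate.one[of GL "{s}"] by simp
  next
    case (Suc j)
    then show ?case using generate.eng[OF Suc generate.incl[of s "{s}" GL]] by simp
  qed
  ultimately show "w \<in> generate GL {s}" by simp
qed

lemma distinguished_reflection_eq:
  assumes H: "H \<in> hyperplanes W" and s: "s \<in> pointwise_stabilizer W H" "det s = zeta (stab_order W H)"
  shows "distinguished_reflection W H = s"
  unfolding distinguished_reflection_def
  by (rule the_equality)
    (use s stabilizer_generator[OF H s] inj_onD[OF inj_on_det_stabilizer[OF H]] in auto)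

lemma distinguished_reflection:
  assumes H: "H \<in> hyperplanes W"
  shows "distinguished_reflection W H \<in> pointwise_stabilizer W H"
    and "det (distinguished_reflection W H) = zeta (stab_order W H)"
proof -
  have "zeta (stab_order W H) ^ 1 \<in> det ` pointwise_stabilizer W H"
    unfolding det_stabilizer[OF H] using stab_order_ge[OF H] by (intro imageI) simp
  then obtain s where "s \<in> pointwise_stabilizer W H" "det s = zeta (stab_order W H)" by auto
  then show "distinguished_reflection W H \<in> pointwise_stabilizer W H"
    and "det (distinguished_reflection W H) = zeta (stab_order W H)"
    using distinguished_reflection_eq[OF H] by auto
qed

lemma stabilizer_image:
  assumes w: "w \<in> W" "w' \<in> W" "w' ** w = mat 1" "w ** w' = mat 1" and s: "s \<in> pointwise_stabilizer W H"
  shows "w ** s ** w' \<in> pointwise_stabilizer W ((*v) w ` H)"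
proof -
  have "(w ** s ** w') *v (w *v v) = w *v (s *v ((w' ** w) *v v))" for v
    by (simp add: matrix_vector_mul_assoc matrix_mul_assoc)
  then show ?thesis using s w mult_W by (auto simp: pointwise_stabilizer_def)
qed

lemma stab_order_image:
  assumes w: "w \<in> W"
  shows "stab_order W ((*v) w ` H) = stab_order W H"
proof -
  obtain w' where w': "w' \<in> W" "w' ** w = mat 1" "w ** w' = mat 1" using inv_W[OF w] by blast
  have im: "(*v) w' ` (*v) w ` H = H" using w'(2) by (simp add: image_image matrix_vector_mul_assoc)
  have cancel: "a ** (b ** x ** a) ** b = x" if "a ** b = mat 1" for a b x :: "complex ^ 'n ^ 'n"
    using that by (simp add: matrix_mul_assoc) (simp add: matrix_mul_assoc[symmetric])
  have "bij_betw (\<lambda>s. w ** s ** w') (pointwise_stabilizer W H) (pointwise_stabilizer W ((*v) w ` H))"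
    using stabilizer_image[OF w w'] stabilizer_image[OF w'(1) w w'(3,2), of _ "(*v) w ` H"] cancel w'
    by (intro bij_betw_byWitness[of _ "\<lambda>s. w' ** s ** w"]) (auto simp: im)
  then show ?thesis unfolding stab_order_def by (rule bij_betw_same_card[symmetric])
qed

lemma distinguished_reflection_image:
  assumes w: "w \<in> W" "w' \<in> W" "w' ** w = mat 1" "w ** w' = mat 1" and H: "H \<in> hyperplanes W"
  shows "distinguished_reflection W ((*v) w ` H) = w ** distinguished_reflection W H ** w'"
proof (rule distinguished_reflection_eq[OF hyperplanes_image[OF w(1) H] stabilizer_image[OF w distinguished_reflection(1)[OF H]]])
  have "det w * det w' = 1" using w(4) by (simp flip: det_mul)
  then show "det (w ** distinguished_reflection W H ** w') = zeta (stab_order W ((*v) w ` H))"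
    by (simp add: det_mul distinguished_reflection(2)[OF H] stab_order_image[OF w(1)])
qed

lemma hyperplane_orbit_image:
  assumes w: "w \<in> W"
  shows "hyperplane_orbit W ((*v) w ` H) = hyperplane_orbit W H"
proof -
  obtain w' where w': "w' \<in> W" "w' ** w = mat 1" "w ** w' = mat 1" using inv_W[OF w] by blast
  have im: "(*v) v ` (*v) w ` H = (*v) (v ** w) ` H" for v by (simp add: image_image matrix_vector_mul_assoc)
  have "(\<lambda>v. v ** w) ` W = W"
  proof (intro equalityI subsetI)
    fix v assume "v \<in> W"
    then have "v ** w' \<in> W" "v = (v ** w') ** w" using mult_W w' by (simp_all add: matrix_mul_assoc[symmetric])
    then show "v \<in> (\<lambda>v. v ** w) ` W" by blast
  qed (use mult_W w in auto)
  moreover have "hyperplane_orbit W ((*v) w ` H) = (\<lambda>v. (*v) v ` H) ` (\<lambda>v. v ** w) ` W"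
    unfolding hyperplane_orbit_def im by (simp only: image_image)
  ultimately show ?thesis by (simp add: hyperplane_orbit_def)
qed

end

text \<open>The discrete Fourier transform of the cyclic group generated by \<open>P\<close>.
  Shifting the summation index gives \<open>P ** E j = mat (zeta n ^ j) ** E j\<close>, and the
  remaining claims are orthogonality of characters.\<close>

lemma spectral_projections:
  fixes P :: "complex ^ 'm ^ 'm"
  assumes n: "n > 0" and Pn: "P [^]\<^bsub>GL\<^esub> n = mat 1"
  defines "E \<equiv> \<lambda>j. mat (1 / of_nat n) ** (\<Sum>k<n. mat (inverse (zeta n) ^ (j * k)) ** (P [^]\<^bsub>GL\<^esub> k))"
  shows "i < n \<Longrightarrow> j < n \<Longrightarrow> E i ** E j = (if i = j then E i else 0)"
    and "(\<Sum>j<n. E j) = mat 1"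
    and "P = (\<Sum>j<n. mat (zeta n ^ j) ** E j)"
proof -
  let ?z = "zeta n"
  note z = zeta_props[OF n]
  define R where "R k = P [^]\<^bsub>GL\<^esub> k" for k :: nat
  have R: "R 0 = mat 1" "R (Suc k) = R k ** P" for k by (simp_all add: R_def GL_one GL_mult)
  have R_comm: "R k ** P = P ** R k" for k
  proof (induction k)
    case (Suc k)
    have "R (Suc k) ** P = (P ** R k) ** P" unfolding R(2) Suc ..
    then show ?case by (simp add: R matrix_mul_assoc)
  qed (simp add: R)
  have Rn: "R n = mat 1" using Pn by (simp add: R_def)
  have E: "E j = mat (1 / of_nat n) ** (\<Sum>k<n. mat (inverse ?z ^ (j * k)) ** R k)" for j
    by (simp add: E_def R_def)
  have PE: "P ** E j = mat (?z ^ j) ** E j" for j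
  proof -
    define F where "F k = mat (inverse ?z ^ (j * k)) ** R k" for k
    have PF: "P ** F k = mat (?z ^ j) ** F (Suc k)" for k
    proof -
      have "P ** F k = mat (inverse ?z ^ (j * k)) ** (P ** R k)" unfolding F_def by (rule mat_left_commute)
      moreover have "inverse ?z ^ (j * k) = ?z ^ j * inverse ?z ^ (j * Suc k)"
        using z(3) by (simp add: power_add power_inverse)
      ultimately show ?thesis unfolding F_def R(2) R_comm mat_mat_mult by simp
    qed
    have "inverse ?z ^ (j * n) = 1" using z(1) by (simp add: power_inverse mult.commute[of j] power_mult)
    then have "F n = F 0" by (simp add: F_def Rn R)
    then have "(\<Sum>k<n. F (Suc k)) = (\<Sum>k<n. F k)"
      using sum.lessThan_Suc_shift[of F n] by (simp add: add.commute)
    then have "(\<Sum>k<n. P ** F k) = mat (?z ^ j) ** (\<Sum>k<n. F k)"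
      unfolding PF by (simp flip: matrix_mult_sum_right)
    moreover have "P ** E j = mat (1 / of_nat n) ** (\<Sum>k<n. P ** F k)"
      unfolding E F_def[symmetric] by (subst mat_left_commute) (simp add: matrix_mult_sum_right)
    ultimately show ?thesis unfolding E F_def[symmetric] by (simp add: mat_left_commute[of _ "mat (?z ^ j)"] mat_mat_mult mult.commute)
  qed
  have RE: "R k ** E j = mat (?z ^ (j * k)) ** E j" for k j
  proof (induction k)
    case (Suc k)
    have "R (Suc k) ** E j = P ** (R k ** E j)" by (simp add: R R_comm matrix_mul_assoc)
    also have "\<dots> = mat (?z ^ (j * k)) ** (P ** E j)" unfolding Suc by (rule mat_left_commute)
    finally show ?case by (simp add: PE mat_mat_mult power_add mult.commute)
  qed (simp add: R)
  have geo: "(\<Sum>k<n. inverse ?z ^ (i * k) * ?z ^ (j * k)) = (if i = j then of_nat n else 0)" if ij: "i < n" "j < n" for i j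
  proof -
    define q where "q = inverse ?z ^ i * ?z ^ j"
    have "?z * cnj ?z = 1" using complex_norm_square[of ?z] z(2) by simp
    then have cz: "inverse ?z = cnj ?z" by (rule inverse_unique)
    have q1: "q = 1 \<longleftrightarrow> i = j" using z(4)[OF ij(2,1)] by (auto simp: q_def cz mult.commute)
    have "q ^ n = 1"
    proof -
      have "q ^ n = inverse (?z ^ n) ^ i * (?z ^ n) ^ j"
        by (simp add: q_def power_mult_distrib power_inverse flip: power_mult) (simp add: mult.commute)
      then show ?thesis by (simp add: z(1))
    qed
    have "(\<Sum>k<n. inverse ?z ^ (i * k) * ?z ^ (j * k)) = (\<Sum>k<n. q ^ k)"
      by (simp add: q_def power_mult power_mult_distrib)
    also have "\<dots> = (if i = j then of_nat n else 0)"
      using q1 \<open>q ^ n = 1\<close> by (simp add: sum_gp_strict)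
    finally show ?thesis .
  qed
  show "E i ** E j = (if i = j then E i else 0)" if ij: "i < n" "j < n" for i j
  proof -
    have "E i ** E j = mat (1 / of_nat n) ** (\<Sum>k<n. mat (inverse ?z ^ (i * k)) ** (R k ** E j))"
      unfolding E[of i] by (simp add: matrix_mult_sum_left matrix_mul_assoc[symmetric])
    also have "\<dots> = mat (1 / of_nat n) ** (\<Sum>k<n. mat (inverse ?z ^ (i * k) * ?z ^ (j * k)) ** E j)"
      unfolding RE mat_mat_mult ..
    also have "(\<Sum>k<n. mat (inverse ?z ^ (i * k) * ?z ^ (j * k)) ** E j) = mat (\<Sum>k<n. inverse ?z ^ (i * k) * ?z ^ (j * k)) ** E j"
      by (rule linear_sum[OF bounded_linear.linear[OF bounded_linear_mat_mult], symmetric])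
    finally show ?thesis unfolding geo[OF ij] using n by (simp add: mat_mat_mult)
  qed
  show sum_E: "(\<Sum>j<n. E j) = mat 1"
  proof -
    have "(\<Sum>j<n. E j) = mat (1 / of_nat n) ** (\<Sum>k<n. \<Sum>j<n. mat (inverse ?z ^ (j * k)) ** R k)"
      unfolding E by (subst sum.swap) (simp add: matrix_mult_sum_right)
    also have "(\<Sum>k<n. \<Sum>j<n. mat (inverse ?z ^ (j * k)) ** R k) = (\<Sum>k<n. if k = 0 then mat (of_nat n) else 0)"
    proof (intro sum.cong refl)
      fix k assume k: "k \<in> {..<n}"
      have "(\<Sum>j<n. mat (inverse ?z ^ (j * k)) ** R k) = mat (\<Sum>j<n. inverse ?z ^ (j * k)) ** R k"
        by (rule linear_sum[OF bounded_linear.linear[OF bounded_linear_mat_mult], symmetric])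
      also have "(\<Sum>j<n. inverse ?z ^ (j * k)) = (if k = 0 then of_nat n else 0)"
        using geo[of k 0] k n by (simp add: mult.commute)
      finally show "(\<Sum>j<n. mat (inverse ?z ^ (j * k)) ** R k) = (if k = 0 then mat (of_nat n) else 0)"
        by (simp add: R)
    qed
    finally show ?thesis using n mat_mat_mult[of "1 / of_nat n" "of_nat n :: complex" "mat 1 :: complex ^ 'm ^ 'm"] by simp
  qed
  have "P = P ** (\<Sum>j<n. E j)" by (simp add: sum_E)
  then show "P = (\<Sum>j<n. mat (?z ^ j) ** E j)" by (simp add: matrix_mult_sum_right PE)
qed

section \<open>Residues attached to a representation\<close>

locale unitary_reflection_representation = unitary_reflection_group W
  for W :: "(complex ^ 'n ^ 'n) set" +
  fixes \<rho> :: "complex ^ 'n ^ 'n \<Rightarrow> complex ^ 'm ^ 'm" and \<tau> :: "(complex ^ 'n) set set \<Rightarrow> nat \<Rightarrow> complex"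
  assumes rep: "is_representation (linear_group W) \<rho>"
    and real: "\<And>H j. H \<in> hyperplanes W \<Longrightarrow> j < stab_order W H \<Longrightarrow> \<tau> (hyperplane_orbit W H) j \<in> \<real>"
begin

lemma rho_mult: "w \<in> W \<Longrightarrow> w' \<in> W \<Longrightarrow> \<rho> (w ** w') = \<rho> w ** \<rho> w'"
  using rep unfolding is_representation_def by (auto simp: hom_def GL_def)

lemma rho_one: "\<rho> (mat 1) = mat 1"
proof -
  have "invertible (\<rho> (mat 1))" using rep one_W unfolding is_representation_def by (auto simp: hom_def GL_def)
  then obtain B where "B ** \<rho> (mat 1) = mat 1" by (auto simp: invertible_def)
  moreover have "\<rho> (mat 1) = \<rho> (mat 1) ** \<rho> (mat 1)" using rho_mult[OF one_W one_W] by simp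
  ultimately show ?thesis by (metis matrix_mul_assoc matrix_mul_lid)
qed

lemma rho_pow: "s \<in> pointwise_stabilizer W H \<Longrightarrow> \<rho> s [^]\<^bsub>GL\<^esub> (k::nat) = \<rho> (s [^]\<^bsub>GL\<^esub> k)"
proof (induction k)
  case (Suc k)
  then show ?case using stabilizer_pow[of s H k] rho_mult[of "s [^]\<^bsub>GL\<^esub> k" s]
    by (simp add: GL_mult pointwise_stabilizer_def)
qed (simp add: GL_one rho_one)

text \<open>The factor \<open>1 / (2 * \<i> * of_real pi)\<close> of \<open>log_form\<close> is
  moved into the residue, so that \<open>omega\<close> becomes \<open>om\<close> with plain
  logarithmic forms.\<close>

definition residue :: "(complex ^ 'n) set \<Rightarrow> complex ^ 'm ^ 'm" where
  "residue H = mat (1 / (2 * \<i> * of_real pi)) ** phi_t W \<rho> \<tau> H"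

text \<open>The residue depends on the hyperplane only through its order, its orbit and the powers
  of the distinguished reflection. The one statement serves equivariance, with \<open>C\<close> an
  element of the group, and holonomy, with \<open>C\<close> a sum of residues.\<close>

lemma residue_intertwines:
  assumes "stab_order W H' = stab_order W H" "hyperplane_orbit W H' = hyperplane_orbit W H"
    and C: "\<rho> (distinguished_reflection W H') ** C = C ** \<rho> (distinguished_reflection W H)"
  shows "residue H' ** C = C ** residue H"
proof -
  have "\<rho> (distinguished_reflection W H') [^]\<^bsub>GL\<^esub> (k::nat) ** C = C ** \<rho> (distinguished_reflection W H) [^]\<^bsub>GL\<^esub> k" for k
  proof (induction k)
    case (Suc k)
    let ?s = "\<rho> (distinguished_reflection W H)" and ?s' = "\<rho> (distinguished_reflection W H')"
    have "?s' [^]\<^bsub>GL\<^esub> Suc k ** C = ?s' [^]\<^bsub>GL\<^esub> k ** (C ** ?s)"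
      by (simp add: GL_mult C flip: matrix_mul_assoc)
    also have "\<dots> = C ** ?s [^]\<^bsub>GL\<^esub> k ** ?s" by (simp add: Suc matrix_mul_assoc)
    finally show ?case by (simp add: GL_mult matrix_mul_assoc)
  qed (simp add: GL_one)
  then show ?thesis
    unfolding residue_def phi_t_def Let_def assms(1,2)
    by (simp add: matrix_mult_sum_left matrix_mult_sum_right mat_left_commute[of C] flip: matrix_mul_assoc)
qed

lemma residue_equivariant:
  assumes w: "w \<in> W" and H: "H \<in> hyperplanes W"
  shows "residue ((*v) w ` H) ** \<rho> w = \<rho> w ** residue H"
proof (rule residue_intertwines[OF stab_order_image[OF w] hyperplane_orbit_image[OF w]])
  obtain w' where w': "w' \<in> W" "w' ** w = mat 1" "w ** w' = mat 1" using inv_W[OF w] by blast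
  let ?s = "distinguished_reflection W H"
  have s: "?s \<in> W" using distinguished_reflection(1)[OF H] by (simp add: pointwise_stabilizer_def)
  have "\<rho> (w ** ?s ** w') ** \<rho> w = \<rho> ((w ** ?s ** w') ** w)"
    using w s w' mult_W by (intro rho_mult[symmetric]) auto
  also have "(w ** ?s ** w') ** w = w ** ?s" using w'(2) by (simp flip: matrix_mul_assoc)
  finally show "\<rho> (distinguished_reflection W ((*v) w ` H)) ** \<rho> w = \<rho> w ** \<rho> ?s"
    using distinguished_reflection_image[OF w w' H] rho_mult[OF w s] by simp
qed

text \<open>\<open>s_H\<close> fixes \<open>L \<subseteq> H\<close> pointwise, hence permutes the hyperplanes containing \<open>L\<close>.\<close>

lemma residue_holonomy:
  assumes H: "H \<in> hyperplanes W" "L \<subseteq> H"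
  shows "residue H ** (\<Sum>K\<in>{K\<in>hyperplanes W. L \<subseteq> K}. residue K) = (\<Sum>K\<in>{K\<in>hyperplanes W. L \<subseteq> K}. residue K) ** residue H"
proof (rule residue_intertwines[OF refl refl])
  let ?s = "distinguished_reflection W H" and ?K = "{K\<in>hyperplanes W. L \<subseteq> K}"
  have s: "?s \<in> W" "\<And>v. v \<in> H \<Longrightarrow> ?s *v v = v" using distinguished_reflection(1)[OF H(1)] by (auto simp: pointwise_stabilizer_def)
  obtain s' where s': "s' ** ?s = mat 1" using inv_W[OF s(1)] by blast
  have inj: "inj_on ((`) ((*v) ?s)) ?K"
  proof (rule inj_on_inverseI)
    fix K show "(*v) s' ` (*v) ?s ` K = K" using s' by (simp add: image_image matrix_vector_mul_assoc)
  qed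
  have "(`) ((*v) ?s) ` ?K \<subseteq> ?K"
  proof (intro image_subsetI CollectI conjI)
    fix K assume K: "K \<in> ?K"
    then show "(*v) ?s ` K \<in> hyperplanes W" using hyperplanes_image[OF s(1)] by simp
    show "L \<subseteq> (*v) ?s ` K"
    proof
      fix v assume v: "v \<in> L"
      then have "v = ?s *v v" "v \<in> K" using s(2) H(2) K by auto
      then show "v \<in> (*v) ?s ` K" by (metis imageI)
    qed
  qed
  moreover have "finite ?K" using finite_W by (simp add: hyperplanes_def)
  ultimately have K: "(`) ((*v) ?s) ` ?K = ?K" using endo_inj_surj inj by blast
  have "(\<Sum>K\<in>?K. residue K) = (\<Sum>K\<in>?K. residue ((*v) ?s ` K))"
    using sum.reindex[OF inj, of residue] unfolding K by (simp add: o_def)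
  then have "(\<Sum>K\<in>?K. residue K) ** \<rho> ?s = (\<Sum>K\<in>?K. residue ((*v) ?s ` K) ** \<rho> ?s)"
    by (simp only: matrix_mult_sum_left)
  also have "\<dots> = \<rho> ?s ** (\<Sum>K\<in>?K. residue K)"
    using residue_equivariant[OF s(1)] by (simp add: matrix_mult_sum_right)
  finally show "\<rho> ?s ** (\<Sum>K\<in>?K. residue K) = (\<Sum>K\<in>?K. residue K) ** \<rho> ?s" ..
qed

lemma residue_spectral:
  assumes H: "H \<in> hyperplanes W"
  shows "\<exists>n s e E t. s \<in> W \<and> e \<ge> 2 \<and> (\<forall>q\<in>H. s *v q = q) \<and> s *v n = zeta e *s n \<and> hyperplane_form H n = 1 \<and>
    (\<forall>i<e. \<forall>j<e. E i ** E j = (if i = j then E i else 0)) \<and> (\<Sum>j<e. E j) = mat 1 \<and>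
    \<rho> s = (\<Sum>j<e. mat (zeta e ^ j) ** E j) \<and>
    residue H = (\<Sum>j<e. mat (complex_of_real (t j) / (2 * of_real pi * \<i>)) ** E j)"
proof -
  let ?s = "distinguished_reflection W H" and ?e = "stab_order W H"
  have e: "?e \<ge> 2" "?e > 0" using stab_order_ge[OF H] by auto
  note z = zeta_props[OF e(2)]
  note s = distinguished_reflection[OF H]
  have sW: "?s \<in> W" "\<And>v. v \<in> H \<Longrightarrow> ?s *v v = v" using s(1) by (auto simp: pointwise_stabilizer_def)
  note f = hyperplane_form_kernel[OF H]
  have pow_e: "?s [^]\<^bsub>GL\<^esub> ?e = mat 1"
  proof (rule inj_onD[OF inj_on_det_stabilizer[OF H]])
    show "det (?s [^]\<^bsub>GL\<^esub> ?e) = det (mat 1 :: complex ^ 'n ^ 'n)"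
      using stabilizer_pow[OF s(1), of ?e] s(2) z(1) by simp
  qed (use stabilizer_pow[OF s(1)] stabilizer_one in auto)
  obtain u where u: "hyperplane_form H u = 1" using f(3) by blast
  define S where "S k = (?s [^]\<^bsub>GL\<^esub> k) *v u" for k :: nat
  have fix_s: "?s *v v = v" if "hyperplane_form H v = 0" for v
  proof -
    have "v \<in> H" using f(2) that by blast
    then show ?thesis by (rule sW(2))
  qed
  have fs: "hyperplane_form H (?s *v v) = zeta ?e * hyperplane_form H v" for v
    unfolding s(2)[symmetric] by (rule det_fixing_hyperplane[OF f(1) u fix_s])
  have pow_comm: "?s [^]\<^bsub>GL\<^esub> k ** ?s = ?s ** ?s [^]\<^bsub>GL\<^esub> k" for k :: nat
  proof (induction k)
    case (Suc k)
    have "?s [^]\<^bsub>GL\<^esub> Suc k ** ?s = (?s ** ?s [^]\<^bsub>GL\<^esub> k) ** ?s" by (simp add: GL_mult Suc)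
    then show ?case by (simp add: GL_mult matrix_mul_assoc)
  qed (simp add: GL_one)
  have sS: "?s *v S k = S (Suc k)" for k
    by (simp add: S_def GL_mult pow_comm matrix_vector_mul_assoc)
  have fS: "hyperplane_form H (S k) = zeta ?e ^ k" for k
  proof (induction k)
    case (Suc k)
    then show ?case using fs[of "S k"] by (simp add: sS)
  qed (simp add: S_def GL_one u)
  \<comment> \<open>The component of \<open>u\<close> in the \<open>zeta ?e\<close> eigenspace of
    the reflection. Each term has value \<open>1 / ?e\<close> under the form, so the normalisation
    of \<open>u\<close> is kept.\<close>
  define n where "n = (\<Sum>k<?e. (inverse (zeta ?e) ^ k / of_nat ?e) *s S k)"
  have fn: "hyperplane_form H n = 1"
  proof -
    have "hyperplane_form H n = (\<Sum>k<?e. 1 / of_nat ?e)"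
      unfolding n_def linear_form_sum[OF f(1)] linear_form_scale[OF f(1)] fS
      using z(3) by (intro sum.cong refl) (simp add: power_inverse)
    then show ?thesis using e(2) by simp
  qed
  have sn: "?s *v n = zeta ?e *s n"
  proof -
    define F where "F k = (inverse (zeta ?e) ^ k / of_nat ?e) *s S k" for k
    have "F ?e = F 0" using z(1) by (simp add: F_def S_def pow_e GL_one power_inverse)
    then have sh: "(\<Sum>k<?e. F (Suc k)) = (\<Sum>k<?e. F k)"
      using sum.lessThan_Suc_shift[of F ?e] by (simp add: add.commute)
    have "?s *v F k = zeta ?e *s F (Suc k)" for k
      using z(3) by (simp add: F_def vector_scalar_commute sS)
    then have "?s *v n = (\<Sum>k<?e. zeta ?e *s F (Suc k))"
      unfolding n_def F_def[symmetric] by (simp add: linear_sum[OF linear_matrix_vector])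
    also have "\<dots> = zeta ?e *s (\<Sum>k<?e. F (Suc k))" by (simp add: vec.scale_sum_right)
    finally show ?thesis unfolding sh by (simp add: n_def F_def)
  qed
  define E where "E j = mat (1 / of_nat ?e) ** (\<Sum>k<?e. mat (inverse (zeta ?e) ^ (j * k)) ** (\<rho> ?s [^]\<^bsub>GL\<^esub> k))" for j
  have "\<rho> ?s [^]\<^bsub>GL\<^esub> ?e = mat 1" unfolding rho_pow[OF s(1)] pow_e by (rule rho_one)
  note E = spectral_projections[OF e(2) this, folded E_def]
  \<comment> \<open>The parameters are real by hypothesis, so taking real parts only changes their
    type.\<close>
  define t where "t j = Re (\<tau> (hyperplane_orbit W H) j)" for j
  have "phi_t W \<rho> \<tau> H = (\<Sum>j<?e. mat (complex_of_real (t j)) ** E j)"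
    unfolding phi_t_def Let_def
  proof (intro sum.cong refl)
    fix j assume "j \<in> {..<?e}"
    then have "\<tau> (hyperplane_orbit W H) j = complex_of_real (t j)" using real[OF H] by (simp add: t_def)
    then show "mat (\<tau> (hyperplane_orbit W H) j * (1 / of_nat ?e)) ** (\<Sum>k<?e. mat (inverse (zeta ?e) ^ (j * k)) ** \<rho> ?s [^]\<^bsub>GL\<^esub> k) =
        mat (complex_of_real (t j)) ** E j"
      by (simp add: E_def mat_mat_mult)
  qed
  then have "residue H = (\<Sum>j<?e. mat (complex_of_real (t j) / (2 * of_real pi * \<i>)) ** E j)"
    unfolding residue_def by (simp add: matrix_mult_sum_right mat_mat_mult mult_ac)
  then show ?thesis using sW e(1) sn fn E
    by (intro exI[of _ n] exI[of _ ?s] exI[of _ ?e] exI[of _ E] exI[of _ t]) simp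
qed

end

context unitary_reflection_representation
begin

sublocale conn: arrangement "hyperplanes W" hyperplane_form
proof
  show "finite (hyperplanes W)" using finite_W by (simp add: hyperplanes_def)
  fix H assume H: "H \<in> hyperplanes W"
  note f = hyperplane_form_kernel[OF H]
  show "linear_form (hyperplane_form H)" "{v. hyperplane_form H v = 0} = H" by (fact f)+
  show "H \<noteq> UNIV"
  proof
    assume "H = UNIV"
    then have "hyperplane_form H v = 0" for v using f(2) by blast
    then show False using f(3) by simp
  qed
qed

lemma conn_X: "conn.X = regular_points W"
  by (simp add: conn.X_def regular_points_def)

sublocale conn: reflection_connection "hyperplanes W" hyperplane_form residue W \<rho>
proof
  show "conn.holonomy residue"
    unfolding conn.holonomy_def using residue_holonomy by blast
  show "w *v x = x \<Longrightarrow> w = mat 1" if "w \<in> W" "x \<in> conn.X" for w x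
    using free_W that conn_X by blast
  show "\<exists>n s e E \<tau>. s \<in> W \<and> e \<ge> 2 \<and> (\<forall>q\<in>H. s *v q = q) \<and> s *v n = zeta e *s n \<and> hyperplane_form H n = 1 \<and>
    (\<forall>i<e. \<forall>j<e. E i ** E j = (if i = j then E i else 0)) \<and> (\<Sum>j<e. E j) = mat 1 \<and>
    \<rho> s = (\<Sum>j<e. mat (zeta e ^ j) ** E j) \<and>
    residue H = (\<Sum>j<e. mat (complex_of_real (\<tau> j) / (2 * of_real pi * \<i>)) ** E j)"
    if "H \<in> hyperplanes W" for H by (rule residue_spectral[OF that])
qed (fact finite_W one_W mult_W inv_W isometric_W hyperplanes_image rho_one rho_mult residue_equivariant)+

lemma omega_om: "omega W \<rho> \<tau> h x v = conn.om h x v"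
  unfolding omega_def conn.om_def conn.lform_def log_form_def residue_def
  by (simp add: mat_mat_mult mult_ac)

theorem monodromy_unitarizable:
  assumes "x0 \<in> regular_points W"
  shows "\<exists>\<epsilon>>0. \<forall>h::complex. Re h = 0 \<and> norm h < \<epsilon> \<longrightarrow>
           unitarizable (braid_group W x0) (monodromy W \<rho> \<tau> h x0)"
  using assms by (intro conn.unitarizable_near_zero omega_om) (simp_all add: conn_X)

end

section \<open>The groups \<open>G(de, e, r)\<close>\<close>

definition monomial :: "('n \<Rightarrow> 'n) \<Rightarrow> ('n \<Rightarrow> complex) \<Rightarrow> complex ^ 'n ^ 'n" where
  "monomial p z = (\<chi> i j. if j = p i then z i else 0)"

lemma G_group_monomial:
  "G_group d e = {monomial p z | p z. bij p \<and> (\<forall>i. z i ^ (d * e) = 1) \<and> (\<Prod>i\<in>UNIV. z i) ^ d = 1}"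
  by (simp add: G_group_def monomial_def)

lemma G_groupI: "bij p \<Longrightarrow> (\<And>i. z i ^ (d * e) = 1) \<Longrightarrow> (\<Prod>i\<in>UNIV. z i) ^ d = 1 \<Longrightarrow> monomial p z \<in> G_group d e"
  unfolding G_group_monomial by blast

lemma G_groupE:
  assumes "w \<in> G_group d e"
  obtains p z where "w = monomial p z" "bij p" "\<And>i. z i ^ (d * e) = 1" "(\<Prod>i\<in>UNIV. z i) ^ d = 1"
  using assms unfolding G_group_monomial by blast

lemma monomial_apply: "(monomial p z *v x) $ i = z i * x $ p i"
  by (simp add: monomial_def matrix_vector_mult_def if_distrib[of "\<lambda>y. y * _"] cong: if_cong)

lemma monomial_mult: "monomial p z ** monomial q y = monomial (q \<circ> p) (\<lambda>i. z i * y (p i))"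
proof -
  have "(monomial p z ** monomial q y) *v x = monomial (q \<circ> p) (\<lambda>i. z i * y (p i)) *v x" for x
    by (simp add: vec_eq_iff matrix_vector_mul_assoc[symmetric] monomial_apply)
  then show ?thesis by (simp add: matrix_eq)
qed

lemma monomial_one: "monomial id (\<lambda>i. 1) = mat 1"
  by (simp add: matrix_eq vec_eq_iff monomial_apply)

lemma root_norm: "z ^ n = 1 \<Longrightarrow> n > 0 \<Longrightarrow> cmod z = 1"
  using power_eq_imp_eq_base[of "cmod z" n 1] by (metis norm_ge_zero norm_one norm_power power_one zero_le_one)

lemma reflection_kernel:
  assumes "invertible w" "linear_form f" "f u = 1" "\<And>v. w *v v = v \<longleftrightarrow> f v = 0"
  shows "reflection w"
  using dim_kernel[OF assms(2,3)] assms(1,4) by (simp add: reflection_def fixed_space_def)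

context
  fixes d e :: nat
  assumes d: "d \<ge> 1" and e: "e \<ge> 1"
begin

lemma G_group_inverse:
  assumes "w \<in> G_group d e"
  shows "\<exists>w'\<in>G_group d e. w' ** w = mat 1 \<and> w ** w' = mat (1::complex)"
proof -
  from assms obtain p z where w: "w = monomial p z" "bij p" "\<And>i. z i ^ (d * e) = 1" "(\<Prod>i\<in>UNIV. z i) ^ d = 1"
    by (rule G_groupE) (rule that; assumption)
  let ?q = "inv_into UNIV p"
  let ?y = "\<lambda>i. inverse (z (?q i))"
  have q: "bij ?q" "p (?q i) = i" "?q (p i) = i" for i
    using w(2) by (auto simp: bij_imp_bij_inv bij_is_inj bij_is_surj surj_f_inv_f)
  have z0: "z i \<noteq> 0" for i using w(3)[of i] d e by (auto simp: power_0_left split: if_splits)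
  have "(\<Prod>i\<in>UNIV. ?y i) = inverse (\<Prod>i\<in>UNIV. z i)"
    using prod.reindex_bij_betw[OF q(1), of "\<lambda>i. inverse (z i)"] prod_inversef[of z UNIV] by (simp add: o_def)
  then have "monomial ?q ?y \<in> G_group d e"
    using q w by (intro G_groupI) (auto simp: power_inverse)
  moreover have "monomial p z ** monomial ?q ?y = mat 1"
    by (simp add: matrix_eq vec_eq_iff monomial_apply matrix_vector_mul_assoc[symmetric] q z0)
  ultimately show ?thesis using matrix_left_right_inverse w(1) by blast
qed

lemma finite_G_group: "finite (G_group d e :: (complex ^ 'n ^ 'n) set)"
proof -
  let ?R = "{z :: complex. z ^ (d * e) = 1}"
  have "finite (PiE (UNIV :: 'n set) (\<lambda>_. ?R))"
    using d e by (intro finite_PiE finite_roots_unity) auto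
  then have "finite {z :: 'n \<Rightarrow> complex. \<forall>i. z i ^ (d * e) = 1}"
    by (simp add: PiE_def Pi_def)
  then have "finite ((\<lambda>(p, z). monomial p z) ` ((UNIV :: ('n \<Rightarrow> 'n) set) \<times> {z. \<forall>i. z i ^ (d * e) = 1}))"
    by (intro finite_imageI finite_cartesian_product) simp_all
  then show ?thesis by (rule rev_finite_subset) (auto simp: G_group_monomial)
qed

lemma invertible_G_group: "w \<in> G_group d e \<Longrightarrow> invertible w"
  using G_group_inverse unfolding invertible_def by blast

text \<open>A point fixed by \<open>w \<noteq> 1\<close> satisfies an equation \<open>x i = c * x j\<close>, or \<open>x i = 0\<close> where \<open>w\<close> itself
  multiplies a single coordinate; either way it lies on a reflecting hyperplane.\<close>

lemma G_group_free:
  fixes w :: "complex ^ 'n ^ 'n"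
  assumes w: "w \<in> G_group d e" and x: "x \<in> regular_points (G_group d e)" and wx: "w *v x = x"
  shows "w = mat 1"
proof (rule ccontr)
  assume ne: "w \<noteq> mat 1"
  have regular: "r *v x \<noteq> x" if "r \<in> G_group d e" "reflection r" for r
    using x that by (auto simp: regular_points_def hyperplanes_def fixed_space_def)
  \<comment> \<open>The relation would put \<open>x\<close> on the mirror of the reflection that
    exchanges coordinates i and j up to \<open>c\<close> and \<open>inverse c\<close>; the product
    of its entries is 1, so it belongs to the group.\<close>
  have no_swap: "x $ i \<noteq> c * x $ j" if ij: "i \<noteq> j" and c: "c ^ (d * e) = 1" for i j c
  proof
    assume eq: "x $ i = c * x $ j"
    let ?p = "\<lambda>k. if k = i then j else if k = j then i else k" and ?z = "\<lambda>k. if k = i then c else if k = j then inverse c else 1"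
    have c0: "c \<noteq> 0" using c d e by (auto simp: power_0_left split: if_splits)
    have "?p \<circ> ?p = id" using ij by (auto simp: fun_eq_iff)
    then have p: "bij ?p" using o_bij by blast
    have "(\<Prod>k\<in>UNIV. ?z k) = ?z i * (?z j * (\<Prod>k\<in>UNIV - {i} - {j}. ?z k))"
      using ij by (subst prod.remove[of _ i], simp, simp, subst prod.remove[of _ j], auto)
    also have "(\<Prod>k\<in>UNIV - {i} - {j}. ?z k) = 1" by (intro prod.neutral) auto
    finally have "(\<Prod>k\<in>UNIV. ?z k) = 1" using ij c0 by simp
    then have r: "monomial ?p ?z \<in> G_group d e"
      using p c by (intro G_groupI) (auto simp: power_inverse)
    have fixed: "monomial ?p ?z *v v = v \<longleftrightarrow> v $ i - c * v $ j = 0" for v :: "complex ^ 'n"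
      unfolding vec_eq_iff monomial_apply using ij c0 by (auto simp: field_simps)
    have "reflection (monomial ?p ?z)"
    proof (rule reflection_kernel[OF invertible_G_group[OF r] _ _ fixed])
      show "linear_form (\<lambda>v. v $ i - c * v $ j)" by (simp add: linear_form_iff algebra_simps)
      show "axis i 1 $ i - c * axis i 1 $ j = 1" using ij by (simp add: axis_def)
    qed
    then show False using regular[OF r] fixed eq by simp
  qed
  from w obtain p z where w: "w = monomial p z" "bij p" "\<And>i. z i ^ (d * e) = 1" "(\<Prod>i\<in>UNIV. z i) ^ d = 1"
    by (rule G_groupE) (rule that; assumption)
  have zx: "z i * x $ p i = x $ i" for i using wx by (metis monomial_apply w(1))
  \<comment> \<open>The fixed point equation reads \<open>x $ i = z i * x $ p i\<close>, which
    \<open>no_swap\<close> forbids for \<open>p i\<close> different from \<open>i\<close>.\<close>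
  have "p i = i" for i using no_swap[of i "p i" "z i"] w(3) zx[of i] by metis
  then have p: "p = id" by (simp add: fun_eq_iff)
  obtain i where i: "z i \<noteq> 1"
  proof -
    have "z \<noteq> (\<lambda>i. 1)" using ne w(1) p monomial_one by auto
    then show ?thesis using that by (auto simp: fun_eq_iff)
  qed
  have xi: "x $ i = 0" using zx[of i] i p by simp
  \<comment> \<open>A second vanishing coordinate would satisfy the relation of
    \<open>no_swap\<close> with \<open>c = 1\<close>. The other coordinates are thus nonzero and
    force their entries to be 1, so \<open>w\<close> itself is a reflection whose mirror contains
    \<open>x\<close>.\<close>
  have zj: "z j = 1" if j: "j \<noteq> i" for j
  proof -
    have "x $ j \<noteq> 0" using no_swap[of j i 1] j xi by simp
    then show ?thesis using zx[of j] p by simp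
  qed
  have fixed: "w *v v = v \<longleftrightarrow> v $ i = 0" for v
  proof -
    have "w *v v = v \<longleftrightarrow> (\<forall>j. z j * v $ j = v $ j)" by (simp add: w(1) p vec_eq_iff monomial_apply)
    also have "\<dots> \<longleftrightarrow> z i * v $ i = v $ i" using zj by (metis mult_1)
    finally show ?thesis using i by simp
  qed
  have "reflection w"
  proof (rule reflection_kernel[OF invertible_G_group[OF assms(1)] _ _ fixed])
    show "linear_form (\<lambda>v. v $ i)" by (simp add: linear_form_iff)
    show "axis i 1 $ i = (1 :: complex)" by (simp add: axis_def)
  qed
  then show False using regular[OF assms(1)] wx by simp
qed

lemma G_group_isometric:
  fixes w :: "complex ^ 'n ^ 'n"
  assumes "w \<in> G_group d e" shows "norm (w *v v) = norm v"
proof -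
  from assms obtain p z where w: "w = monomial p z" "bij p" "\<And>i. z i ^ (d * e) = 1"
    by (rule G_groupE) (rule that; assumption)
  have "cmod (z i) = 1" for i using root_norm[OF w(3)] d e by simp
  then have "(\<Sum>i\<in>UNIV. (cmod ((w *v v) $ i))\<^sup>2) = (\<Sum>i\<in>UNIV. (cmod (v $ p i))\<^sup>2)"
    by (simp add: w(1) monomial_apply norm_mult)
  also have "\<dots> = (\<Sum>i\<in>UNIV. (cmod (v $ i))\<^sup>2)" by (rule sum.reindex_bij_betw[OF w(2)])
  finally show ?thesis by (simp add: norm_vec_def L2_set_def)
qed

lemma unitary_reflection_group_G_group: "unitary_reflection_group (G_group d e :: (complex ^ 'n ^ 'n) set)"
proof
  show "mat 1 \<in> (G_group d e :: (complex ^ 'n ^ 'n) set)"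
    unfolding monomial_one[symmetric] by (intro G_groupI) simp_all
  fix w w' :: "complex ^ 'n ^ 'n" assume w: "w \<in> G_group d e" and w': "w' \<in> G_group d e"
  from w obtain p z where 1: "w = monomial p z" "bij p" "\<And>i. z i ^ (d * e) = 1" "(\<Prod>i\<in>UNIV. z i) ^ d = 1"
    by (rule G_groupE) (rule that; assumption)
  from w' obtain q y where 2: "w' = monomial q y" "bij q" "\<And>i. y i ^ (d * e) = 1" "(\<Prod>i\<in>UNIV. y i) ^ d = 1"
    by (rule G_groupE) (rule that; assumption)
  show "w ** w' \<in> G_group d e"
    unfolding 1(1) 2(1) monomial_mult
    using 1 2 prod.reindex_bij_betw[OF 1(2), of y]
    by (intro G_groupI bij_comp) (simp_all add: prod.distrib power_mult_distrib)
qed (use finite_G_group G_group_inverse G_group_isometric G_group_free in blast)+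

end

theorem corollary6p2:
  fixes d e :: nat
    and W :: "(complex ^ 'r ^ 'r) set"
    and \<rho> :: "complex ^ 'r ^ 'r \<Rightarrow> complex ^ 'm ^ 'm"
    and \<tau> :: "(complex ^ 'r) set set \<Rightarrow> nat \<Rightarrow> complex"
    and x0 :: "complex ^ 'r"
  assumes "d \<ge> 1" and "e \<ge> 1"
    and W: "W = G_group d e"
    and "is_representation (linear_group W) \<rho>"
    and "\<And>H j. H \<in> hyperplanes W \<Longrightarrow> j < stab_order W H \<Longrightarrow> \<tau> (hyperplane_orbit W H) j \<in> \<real>"
    and "x0 \<in> regular_points W"
  shows "\<exists>\<epsilon>>0. \<forall>h::complex. Re h = 0 \<and> norm h < \<epsilon> \<longrightarrow>
           unitarizable (braid_group W x0) (monodromy W \<rho> \<tau> h x0)"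
proof -
  interpret unitary_reflection_group W
    unfolding W by (rule unitary_reflection_group_G_group[OF assms(1,2)])
  interpret unitary_reflection_representation W \<rho> \<tau>
    by unfold_locales (fact assms)+
  show ?thesis by (rule monodromy_unitarizable[OF assms(6)])
qed

end
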